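(* Let $d \in \{1,2,3\}$, let $\Omega \subset \mathbb{R}^d$ be a bounded Lipschitz domain, let $T>0$ and $Q = \Omega \times (0,T)$. Let the space $H^1_{0;0,}(Q;\square)$ be equipped with the inner product $\langle \square(\cdot), \square(\cdot)\rangle_{L^2(Q)}$ and the induced norm $\|\square(\cdot)\|_{L^2(Q)}$, and define the bilinear form $a(\cdot,\cdot)\colon H^1_{0;0,}(Q;\square)\times L^2(Q) \to \mathbb{R}$ by $a(v,w) = \langle \square v, w\rangle_{L^2(Q)}$. Then the following three conditions hold true: 1. (continuity) for all $v \in H^1_{0;0,}(Q;\square)$ and all $w \in L^2(Q)$, $$|a(v,w)| \leq \|\square v\|_{L^2(Q)} \, \|w\|_{L^2(Q)};$$ 2. (inf-sup condition) for all $v \in H^1_{0;0,}(Q;\square)$, $$\sup_{0 \neq w \in L^2(Q)} \frac{|a(v,w)|}{\|w\|_{L^2(Q)}} = \|\square v\|_{L^2(Q)};$$ 3. for every $w \in L^2(Q)\setminus\{0\}$ there exists $v \in H^1_{0;0,}(Q;\square)$ such that $a(v,w) \neq 0$. In particular, for each given $f \in L^2(Q)$, the variational formulation to find $u \in H^1_{0;0,}(Q;\square)$ such that $$\forall w \in L^2(Q): \quad a(u,w) = \langle f, w\rangle_{L^2(Q)}$$ has a unique solution $u \in H^1_{0;0,}(Q;\square)$, and this solution fulfills $$\|\square u\|_{L^2(Q)} = \|f\|_{L^2(Q)}.$$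
   Context: All functions are real-valued. $H^1_{0,}(0,T;L^2(\Omega))$ denotes the space of $v \in H^1(0,T;L^2(\Omega))$ with $v(0)=0$. Set $$H^{1,1}_{0;0,}(Q) = H^1_{0,}(0,T;L^2(\Omega)) \cap L^2(0,T;H^1_0(\Omega)) \subset H^1(Q),$$ i.e. functions satisfying the homogeneous Dirichlet condition on $\partial\Omega\times[0,T]$ and the initial condition $v(\cdot,0)=0$, with norm $\|v\|_{H^{1,1}_{0;0,}(Q)} = \left(\|\partial_t v\|_{L^2(Q)}^2 + \|\nabla_x v\|_{L^2(Q)^d}^2\right)^{1/2}$. $\square = \partial_{tt} - \Delta_x$ is the distributional wave operator (wave speed $1$): for $v \in L^2(Q)$ and $g\in L^2(Q)$, $\square v = g$ means $\langle v, \partial_{tt}\varphi\rangle_{L^2(Q)} - \langle v, \Delta_x \varphi\rangle_{L^2(Q)} = \langle g, \varphi\rangle_{L^2(Q)}$ for all $\varphi \in C_0^\infty(Q)$; $\square v \in L^2(Q)$ means that such a $g$ exists. The solution space is $$H^1_{0;0,}(Q;\square) = \{ v \in H^{1,1}_{0;0,}(Q) : \square v \in L^2(Q) \text{ and } \partial_t v(\cdot,0) = 0 \},$$ where the condition $\partial_t v(\cdot,0)=0$ is well-defined because $v \in H^{1,1}_{0;0,}(Q)$ with $\square v \in L^2(Q)$ satisfies $\partial_t v \in C([0,T];[H^1_0(\Omega)]')$, with $[H^1_0(\Omega)]'$ the dual space of $H^1_0(\Omega)$. *)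

theory Defs
  imports "HOL-Analysis.Analysis"
begin

section \<open>Square-integrable functions\<close>

text \<open>
  Elements of \<open>L2 S\<close> are functions, not equivalence classes: equality in the space \<open>L\<^sup>2(S)\<close> is
  equality almost everywhere with respect to \<^term>\<open>lebesgue_on S\<close>.  Membership in the Lebesgue,
  Sobolev and Bochner spaces below is unaffected by changes on null sets.
\<close>

definition L2 :: "'a::euclidean_space set \<Rightarrow> ('a \<Rightarrow> real) set" where
  "L2 S = {f. f \<in> borel_measurable (lebesgue_on S) \<and> integrable (lebesgue_on S) (\<lambda>x. (f x)\<^sup>2)}"

definition L2_inner :: "'a::euclidean_space set \<Rightarrow> ('a \<Rightarrow> real) \<Rightarrow> ('a \<Rightarrow> real) \<Rightarrow> real" where
  "L2_inner S f g = (LINT x|lebesgue_on S. f x * g x)"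

definition L2_norm :: "'a::euclidean_space set \<Rightarrow> ('a \<Rightarrow> real) \<Rightarrow> real" where
  "L2_norm S f = sqrt (L2_inner S f f)"

definition eq_ae :: "'a::euclidean_space set \<Rightarrow> ('a \<Rightarrow> real) \<Rightarrow> ('a \<Rightarrow> real) \<Rightarrow> bool" where
  "eq_ae S f g \<longleftrightarrow> (AE x in lebesgue_on S. f x = g x)"

section \<open>Test functions\<close>

definition pderiv_dir :: "'a::euclidean_space \<Rightarrow> ('a \<Rightarrow> real) \<Rightarrow> 'a \<Rightarrow> real" where
  "pderiv_dir b f x = frechet_derivative f (at x) b"

primrec Ck :: "nat \<Rightarrow> ('a::euclidean_space \<Rightarrow> real) \<Rightarrow> bool" where
  "Ck 0 f \<longleftrightarrow> continuous_on UNIV f"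
| "Ck (Suc k) f \<longleftrightarrow> (\<forall>x. f differentiable (at x)) \<and> (\<forall>b\<in>Basis. Ck k (pderiv_dir b f))"

text \<open>\<open>C\<^sub>0\<^sup>\<infinity>(S)\<close> for open \<open>S\<close>; its elements are extended by zero to the whole space.\<close>

definition test_functions :: "'a::euclidean_space set \<Rightarrow> ('a \<Rightarrow> real) set" where
  "test_functions S =
     {\<phi>. (\<forall>k. Ck k \<phi>) \<and> compact (closure {x. \<phi> x \<noteq> 0}) \<and> closure {x. \<phi> x \<noteq> 0} \<subseteq> S}"

section \<open>The spaces \<open>H\<^sup>1(S)\<close> and \<open>H\<^sup>1\<^sub>0(S)\<close>\<close>

definition has_weak_gradient ::
    "'a::euclidean_space set \<Rightarrow> ('a \<Rightarrow> real) \<Rightarrow> ('a \<Rightarrow> 'a) \<Rightarrow> bool" where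
  "has_weak_gradient S u G \<longleftrightarrow>
     (\<forall>b\<in>Basis. (\<lambda>x. G x \<bullet> b) \<in> L2 S \<and>
        (\<forall>\<phi>\<in>test_functions S. L2_inner S u (pderiv_dir b \<phi>) = - L2_inner S (\<lambda>x. G x \<bullet> b) \<phi>))"

definition H1 :: "'a::euclidean_space set \<Rightarrow> ('a \<Rightarrow> real) set" where
  "H1 S = {u \<in> L2 S. \<exists>G. has_weak_gradient S u G}"

text \<open>For \<open>u \<in> H1 S\<close> with \<open>S\<close> open, the weak gradient is unique up to a null set.\<close>

definition weak_gradient :: "'a::euclidean_space set \<Rightarrow> ('a \<Rightarrow> real) \<Rightarrow> 'a \<Rightarrow> 'a" where
  "weak_gradient S u = (SOME G. has_weak_gradient S u G)"

definition H1_norm :: "'a::euclidean_space set \<Rightarrow> ('a \<Rightarrow> real) \<Rightarrow> real" where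
  "H1_norm S u =
     sqrt ((L2_norm S u)\<^sup>2 + (\<Sum>b\<in>Basis. (L2_norm S (\<lambda>x. weak_gradient S u x \<bullet> b))\<^sup>2))"

definition H10 :: "'a::euclidean_space set \<Rightarrow> ('a \<Rightarrow> real) set" where
  "H10 S = {u \<in> H1 S. \<forall>\<epsilon>>0. \<exists>\<phi>\<in>test_functions S. H1_norm S (\<lambda>x. u x - \<phi> x) < \<epsilon>}"

section \<open>Functions of time with values in a function space\<close>

text \<open>
  In this section \<open>X\<close> is a linear space of functions with seminorm \<open>N\<close>, which becomes a normed space
  after identifying functions at distance zero.
\<close>

definition strongly_measurable_into ::
    "('a \<Rightarrow> real) set \<Rightarrow> (('a \<Rightarrow> real) \<Rightarrow> real) \<Rightarrow> real set \<Rightarrow> (real \<Rightarrow> 'a \<Rightarrow> real) \<Rightarrow> bool" where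
  "strongly_measurable_into X N I V \<longleftrightarrow>
     (AE t in lebesgue_on I. V t \<in> X) \<and>
     (\<exists>s :: nat \<Rightarrow> real \<Rightarrow> 'a \<Rightarrow> real.
        (\<forall>k. finite (s k ` I) \<and> s k ` I \<subseteq> X \<and> (\<forall>g. {t \<in> I. s k t = g} \<in> sets lebesgue)) \<and>
        (AE t in lebesgue_on I. (\<lambda>k. N (\<lambda>x. s k t x - V t x)) \<longlonglongrightarrow> 0))"

definition bochner_L2 ::
    "('a \<Rightarrow> real) set \<Rightarrow> (('a \<Rightarrow> real) \<Rightarrow> real) \<Rightarrow> real set \<Rightarrow> (real \<Rightarrow> 'a \<Rightarrow> real) set" where
  "bochner_L2 X N I =
     {V. strongly_measurable_into X N I V \<and> integrable (lebesgue_on I) (\<lambda>t. (N (V t))\<^sup>2)}"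

definition continuous_into ::
    "('b \<Rightarrow> real) set \<Rightarrow> (('b \<Rightarrow> real) \<Rightarrow> real) \<Rightarrow> real set \<Rightarrow> (real \<Rightarrow> 'b \<Rightarrow> real) \<Rightarrow> bool" where
  "continuous_into X N I C \<longleftrightarrow>
     (\<forall>t\<in>I. C t \<in> X \<and> ((\<lambda>s. N (\<lambda>x. C s x - C t x)) \<longlongrightarrow> 0) (at t within I))"

definition dual_space ::
    "('a \<Rightarrow> real) set \<Rightarrow> (('a \<Rightarrow> real) \<Rightarrow> real) \<Rightarrow> (('a \<Rightarrow> real) \<Rightarrow> real) set" where
  "dual_space X N =
     {F. (\<forall>u\<in>X. \<forall>v\<in>X. F (\<lambda>x. u x + v x) = F u + F v) \<and>
         (\<forall>c. \<forall>u\<in>X. F (\<lambda>x. c * u x) = c * F u) \<and>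
         (\<exists>K. \<forall>u\<in>X. \<bar>F u\<bar> \<le> K * N u)}"

definition dual_norm ::
    "('a \<Rightarrow> real) set \<Rightarrow> (('a \<Rightarrow> real) \<Rightarrow> real) \<Rightarrow> (('a \<Rightarrow> real) \<Rightarrow> real) \<Rightarrow> real" where
  "dual_norm X N F = (SUP u\<in>{u \<in> X. N u \<le> 1}. \<bar>F u\<bar>)"

text \<open>
  Weak derivative \<open>W\<close> of \<open>V\<close> on \<open>(0,T)\<close> with values in \<open>L\<^sup>2(\<Omega>)\<close>: the identity
  \<open>\<integral> \<phi>' V dt = - \<integral> \<phi> W dt\<close> of \<open>L\<^sup>2(\<Omega>)\<close>-valued Bochner integrals, tested against
  every \<open>\<psi> \<in> L\<^sup>2(\<Omega>)\<close>.
\<close>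

definition has_weak_time_deriv ::
    "'a::euclidean_space set \<Rightarrow> real \<Rightarrow> (real \<Rightarrow> 'a \<Rightarrow> real) \<Rightarrow> (real \<Rightarrow> 'a \<Rightarrow> real) \<Rightarrow> bool" where
  "has_weak_time_deriv \<Omega> T V W \<longleftrightarrow>
     W \<in> bochner_L2 (L2 \<Omega>) (L2_norm \<Omega>) {0<..<T} \<and>
     (\<forall>\<phi>\<in>test_functions {0<..<T}. \<forall>\<psi>\<in>L2 \<Omega>.
        (LINT t|lebesgue_on {0<..<T}. deriv \<phi> t * L2_inner \<Omega> (V t) \<psi>) =
        - (LINT t|lebesgue_on {0<..<T}. \<phi> t * L2_inner \<Omega> (W t) \<psi>))"

text \<open>\<open>H\<^sup>1(0,T;L\<^sup>2(\<Omega>))\<close>, and its subspace with \<open>V(0) = 0\<close>, where \<open>V(0)\<close> is the value at \<open>0\<close> of the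
  representative in \<open>C([0,T];L\<^sup>2(\<Omega>))\<close>.\<close>

definition H1_time :: "'a::euclidean_space set \<Rightarrow> real \<Rightarrow> (real \<Rightarrow> 'a \<Rightarrow> real) set" where
  "H1_time \<Omega> T =
     {V \<in> bochner_L2 (L2 \<Omega>) (L2_norm \<Omega>) {0<..<T}. \<exists>W. has_weak_time_deriv \<Omega> T V W}"

definition H1_time_0 :: "'a::euclidean_space set \<Rightarrow> real \<Rightarrow> (real \<Rightarrow> 'a \<Rightarrow> real) set" where
  "H1_time_0 \<Omega> T =
     {V \<in> H1_time \<Omega> T. \<exists>C. continuous_into (L2 \<Omega>) (L2_norm \<Omega>) {0..T} C \<and>
        (AE t in lebesgue_on {0<..<T}. eq_ae \<Omega> (C t) (V t)) \<and> eq_ae \<Omega> (C 0) (\<lambda>x. 0)}"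

section \<open>Functions on the space-time cylinder\<close>

abbreviation cylinder :: "'a::euclidean_space set \<Rightarrow> real \<Rightarrow> ('a \<times> real) set" where
  "cylinder \<Omega> T \<equiv> \<Omega> \<times> {0<..<T}"

definition time_slice :: "('a \<times> real \<Rightarrow> real) \<Rightarrow> real \<Rightarrow> 'a \<Rightarrow> real" where
  "time_slice v t x = v (x, t)"

definition H11_00 :: "'a::euclidean_space set \<Rightarrow> real \<Rightarrow> ('a \<times> real \<Rightarrow> real) set" where
  "H11_00 \<Omega> T =
     {v \<in> L2 (cylinder \<Omega> T).
        time_slice v \<in> H1_time_0 \<Omega> T \<and>
        time_slice v \<in> bochner_L2 (H10 \<Omega>) (H1_norm \<Omega>) {0<..<T}}"

definition dtt :: "('a::euclidean_space \<times> real \<Rightarrow> real) \<Rightarrow> 'a \<times> real \<Rightarrow> real" where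
  "dtt \<phi> = pderiv_dir (0, 1) (pderiv_dir (0, 1) \<phi>)"

definition laplace_x :: "('a::euclidean_space \<times> real \<Rightarrow> real) \<Rightarrow> 'a \<times> real \<Rightarrow> real" where
  "laplace_x \<phi> z = (\<Sum>b\<in>Basis. pderiv_dir (b, 0) (pderiv_dir (b, 0) \<phi>) z)"

definition has_box ::
    "('a::euclidean_space \<times> real) set \<Rightarrow> ('a \<times> real \<Rightarrow> real) \<Rightarrow> ('a \<times> real \<Rightarrow> real) \<Rightarrow> bool" where
  "has_box Q v g \<longleftrightarrow> g \<in> L2 Q \<and>
     (\<forall>\<phi>\<in>test_functions Q. L2_inner Q v (dtt \<phi>) - L2_inner Q v (laplace_x \<phi>) = L2_inner Q g \<phi>)"

text \<open>On an open set \<open>Q\<close>, a function \<open>g\<close> with \<open>has_box Q v g\<close> is unique up to a null set.\<close>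

definition wave_op :: "('a::euclidean_space \<times> real) set \<Rightarrow> ('a \<times> real \<Rightarrow> real) \<Rightarrow> 'a \<times> real \<Rightarrow> real" where
  "wave_op Q v = (SOME g. has_box Q v g)"

text \<open>
  \<open>\<partial>\<^sub>t v(\<cdot>,0) = 0\<close> in \<open>[H\<^sup>1\<^sub>0(\<Omega>)]'\<close>: the weak derivative \<open>\<partial>\<^sub>t v\<close>, viewed as a function with values in
  the dual space by means of the \<open>L\<^sup>2(\<Omega>)\<close> inner product, has a representative in
  \<open>C([0,T];[H\<^sup>1\<^sub>0(\<Omega>)]')\<close> that vanishes at \<open>0\<close>.
\<close>

definition zero_initial_velocity ::
    "'a::euclidean_space set \<Rightarrow> real \<Rightarrow> ('a \<times> real \<Rightarrow> real) \<Rightarrow> bool" where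
  "zero_initial_velocity \<Omega> T v \<longleftrightarrow>
     (\<exists>W F. has_weak_time_deriv \<Omega> T (time_slice v) W \<and>
        continuous_into (dual_space (H10 \<Omega>) (H1_norm \<Omega>)) (dual_norm (H10 \<Omega>) (H1_norm \<Omega>)) {0..T} F \<and>
        (AE t in lebesgue_on {0<..<T}. \<forall>\<psi>\<in>H10 \<Omega>. F t \<psi> = L2_inner \<Omega> (W t) \<psi>) \<and>
        (\<forall>\<psi>\<in>H10 \<Omega>. F 0 \<psi> = 0))"

definition wave_space :: "'a::euclidean_space set \<Rightarrow> real \<Rightarrow> ('a \<times> real \<Rightarrow> real) set" where
  "wave_space \<Omega> T =
     {v \<in> H11_00 \<Omega> T. (\<exists>g. has_box (cylinder \<Omega> T) v g) \<and> zero_initial_velocity \<Omega> T v}"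

definition wave_form ::
    "'a::euclidean_space set \<Rightarrow> real \<Rightarrow> ('a \<times> real \<Rightarrow> real) \<Rightarrow> ('a \<times> real \<Rightarrow> real) \<Rightarrow> real" where
  "wave_form \<Omega> T v w = L2_inner (cylinder \<Omega> T) (wave_op (cylinder \<Omega> T) v) w"

definition wave_solution ::
    "'a::euclidean_space set \<Rightarrow> real \<Rightarrow> ('a \<times> real \<Rightarrow> real) \<Rightarrow> ('a \<times> real \<Rightarrow> real) \<Rightarrow> bool" where
  "wave_solution \<Omega> T f u \<longleftrightarrow> u \<in> wave_space \<Omega> T \<and>
     (\<forall>w\<in>L2 (cylinder \<Omega> T). wave_form \<Omega> T u w = L2_inner (cylinder \<Omega> T) f w)"

section \<open>Lipschitz domains\<close>

text \<open>
  Near each boundary point the domain is the strict epigraph of a Lipschitz function \<open>\<gamma>\<close>, in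
  coordinates where \<open>e\<close> is the vertical unit vector; \<open>\<gamma>\<close> is defined on the hyperplane
  orthogonal to \<open>e\<close>, which plays the role of \<open>\<real>\<^sup>d\<^sup>-\<^sup>1\<close>.
\<close>

definition bounded_lipschitz_domain :: "'a::euclidean_space set \<Rightarrow> bool" where
  "bounded_lipschitz_domain \<Omega> \<longleftrightarrow>
     open \<Omega> \<and> connected \<Omega> \<and> \<Omega> \<noteq> {} \<and> bounded \<Omega> \<and>
     (\<forall>p\<in>frontier \<Omega>. \<exists>(e::'a) (\<gamma>::'a \<Rightarrow> real) L r.
        norm e = 1 \<and> L-lipschitz_on {y. y \<bullet> e = 0} \<gamma> \<and> 0 < r \<and>
        (\<forall>x\<in>ball p r. x \<in> \<Omega> \<longleftrightarrow> \<gamma> (x - (x \<bullet> e) *\<^sub>R e) < x \<bullet> e))"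

end

theory Submission
  imports Defs
begin

text \<open>By definition of the norm, \<open>\<box>\<close> is an isometry from the solution space to
 \<open>L\<^sup>2(Q)\<close>. Continuity is Cauchy-Schwarz in \<open>L\<^sup>2(Q)\<close>, and the inf-sup
 condition says that Cauchy-Schwarz is sharp, with \<open>w = \<box>v\<close>
 (\<open>sup_L2_quotient\<close>). All other claims follow once \<open>\<box>\<close> is bijective, since
 the variational equation just says \<open>\<box>u = f\<close>.

 Injectivity (\<open>wave_space_unique\<close>): a solution is not regular enough to be tested with its
 velocity, so the equation is integrated once in time. Because \<open>\<partial>\<^sub>tu(0) = 0\<close>, it
 becomes \<open>\<partial>\<^sub>tu(t) = \<integral>\<^sub>0\<^sup>t f + div \<integral>\<^sub>0\<^sup>t
 \<nabla>u\<close> in the dual of \<open>H\<^sup>1\<^sub>0(\<Omega>)\<close>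
 (\<open>wave_space_data\<close>), and this may be tested with \<open>u(t)\<close>. For \<open>f = 0\<close>
 the result is an exact derivative, and \<open>\<parallel>u(r)\<parallel>\<^sup>2 +
 \<parallel>\<integral>\<^sub>0\<^sup>r \<nabla>u\<parallel>\<^sup>2 = 0\<close>.

 Surjectivity (\<open>wave_equation_solvable\<close>): regular displacements \<open>v\<close> with
 \<open>v(0) = 0\<close> and \<open>\<partial>\<^sub>tv(T) = 0\<close> are multiplied with the weighted
 velocity \<open>exp (-t) \<partial>\<^sub>tv\<close>. The weight makes the resulting bilinear form coercive
 on these \<open>v\<close> with respect to the norm of \<open>(\<nabla>v, \<partial>\<^sub>tv)\<close>
 (\<open>ansatz_coercive\<close>), although it is unbounded in its second argument. That is the situation of
 the projection theorem of Lions (\<open>Lions_projection\<close>), which yields a limit \<open>(\<nabla>u,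
 \<partial>\<^sub>tu)\<close> of such displacements that solves the weak equation. The displacements
 \<open>v = q(t) \<xi>(x)\<close> turn the weak equation into the same identity for
 \<open>\<partial>\<^sub>tu(t)\<close> as above, for almost every \<open>t\<close>
 (\<open>limit_solution_flux\<close>). Its right-hand side is continuous in time and vanishes at
 \<open>0\<close>, which is the second initial condition; its weak time derivative is the wave equation.

 The spaces of functions of time with values in a function space are linked to functions on \<open>Q\<close>
 by two constructions: a Bochner function has a Borel representative on space-time
 (\<open>joint_representative\<close>), and, conversely, the limit is approximated by functions that are
 step functions in time (\<open>limit_solution_steps\<close>). Time derivatives are handled throughout by
 their primitives \<open>tprim\<close>.\<close>

lemmas integral_cong_space = Bochner_Integration.integral_cong
lemmas integral_cong_pw = Bochner_Integration.integral_cong[OF refl]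

section \<open>Square-integrable functions\<close>

definition sq_int :: "'m measure => ('m => 'b::euclidean_space) => bool" where
 "sq_int M f \<longleftrightarrow> f \<in> borel_measurable M & integrable M (\<lambda>x. (norm (f x))\<^sup>2)"

definition l2n :: "'m measure => ('m => 'b::euclidean_space) => real" where
 "l2n M f = sqrt (\<integral>x. (norm (f x))\<^sup>2 \<partial>M)"

lemma sq_int_measurable [dest]: "sq_int M f ==> f \<in> borel_measurable M"
 by (simp add: sq_int_def)

lemma sq_int_integrable: "sq_int M f ==> integrable M (\<lambda>x. (norm (f x))\<^sup>2)"
 by (simp add: sq_int_def)

lemma l2n_nonneg [simp]: "0 <= l2n M f"
 by (simp add: l2n_def)

lemma l2n_power2: "(l2n M f)\<^sup>2 = (\<integral>x. (norm (f x))\<^sup>2 \<partial>M)"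
 by (simp add: l2n_def)

lemma sq_int_inner:
 assumes "sq_int M f" "sq_int M g"
 shows "integrable M (\<lambda>x. f x \<bullet> g x)"
proof (rule Bochner_Integration.integrable_bound)
 show "integrable M (\<lambda>x. (norm (f x))\<^sup>2 + (norm (g x))\<^sup>2)"
  using assms by (auto simp: sq_int_def)
 show "(\<lambda>x. f x \<bullet> g x) \<in> borel_measurable M"
  using assms by (auto simp: sq_int_def)
 show "AE x in M. norm (f x \<bullet> g x) <= norm ((norm (f x))\<^sup>2 + (norm (g x))\<^sup>2)"
 proof (rule AE_I2)
  fix x
  have "\<bar>f x \<bullet> g x\<bar> <= norm (f x) * norm (g x)" by (rule Cauchy_Schwarz_ineq2)
  also have "\<dots> <= (norm (f x))\<^sup>2 + (norm (g x))\<^sup>2"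
  proof -
   have "2 * (norm (f x) * norm (g x)) <= (norm (f x))\<^sup>2 + (norm (g x))\<^sup>2"
    using sum_squares_bound[of "norm (f x)" "norm (g x)"] by (simp add: mult.assoc)
   moreover have "0 <= norm (f x) * norm (g x)" by simp
   ultimately show ?thesis by linarith
  qed
  finally show "norm (f x \<bullet> g x) <= norm ((norm (f x))\<^sup>2 + (norm (g x))\<^sup>2)" by simp
 qed
qed

lemma sq_int_mult:
 fixes f g :: "'m => real"
 assumes "sq_int M f" "sq_int M g"
 shows "integrable M (\<lambda>x. f x * g x)"
 using sq_int_inner[OF assms] by simp

lemma sq_int_scaleR [intro]: "sq_int M f ==> sq_int M (\<lambda>x. c *\<^sub>R f x)"
 by (auto simp: sq_int_def power_mult_distrib)

lemma sq_int_cmult [intro]: "sq_int M f ==> sq_int M (\<lambda>x. c * f x)" for f :: "_ => real"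
 using sq_int_scaleR[of M f c] by simp

lemma sq_int_add [intro]:
 assumes "sq_int M f" "sq_int M g"
 shows "sq_int M (\<lambda>x. f x + g x)"
 unfolding sq_int_def
proof
 show "(\<lambda>x. f x + g x) \<in> borel_measurable M" using assms by (auto simp: sq_int_def)
 have "integrable M (\<lambda>x. (norm (f x))\<^sup>2 + 2 * (f x \<bullet> g x) + (norm (g x))\<^sup>2)"
  using assms sq_int_inner[OF assms] by (auto simp: sq_int_def)
 then show "integrable M (\<lambda>x. (norm (f x + g x))\<^sup>2)"
  by (simp add: power2_norm_eq_inner inner_simps inner_commute algebra_simps)
qed

lemma sq_int_minus [intro]: "sq_int M f ==> sq_int M (\<lambda>x. - f x)"
 using sq_int_scaleR[of M f "-1"] by simp

lemma sq_int_diff [intro]: "sq_int M f ==> sq_int M g ==> sq_int M (\<lambda>x. f x - g x)"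
 using sq_int_add[of M f "\<lambda>x. - g x"] sq_int_minus[of M g] by simp

lemma sq_int_zero [simp, intro]: "sq_int M (\<lambda>x. 0)"
 by (auto simp: sq_int_def)

lemma sq_int_sum [intro]: "(!!i. i \<in> I ==> sq_int M (f i)) ==> sq_int M (\<lambda>x. \<Sum>i\<in>I. f i x)"
 by (induction I rule: infinite_finite_induct) auto

lemma sq_int_bound:
 assumes "sq_int M g" "f \<in> borel_measurable M" "AE x in M. norm (f x) <= norm (g x)"
 shows "sq_int M f"
 unfolding sq_int_def
proof
 show "integrable M (\<lambda>x. (norm (f x))\<^sup>2)"
  by (rule Bochner_Integration.integrable_bound[OF sq_int_integrable[OF assms(1)]])
    (use assms in "auto intro!: power_mono")
qed (use assms in auto)

lemma sq_int_cong_AE: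
 assumes "sq_int M g" "f \<in> borel_measurable M" "AE x in M. f x = g x"
 shows "sq_int M f"
 by (rule sq_int_bound[OF assms(1,2)]) (use assms(3) in auto)

lemma sq_int_component [intro]: "sq_int M f ==> sq_int M (\<lambda>x. f x \<bullet> b)"
proof -
 assume f: "sq_int M f"
 show ?thesis
 proof (rule sq_int_bound[OF sq_int_scaleR[OF f, of "norm b"]])
  show "AE x in M. norm (f x \<bullet> b) <= norm (norm b *\<^sub>R f x)"
  proof (rule AE_I2)
   fix x show "norm (f x \<bullet> b) <= norm (norm b *\<^sub>R f x)"
    using Cauchy_Schwarz_ineq2[of "f x" b] by (simp add: mult.commute)
  qed
 qed (use f in auto)
qed

lemma (in finite_measure) sq_int_const [intro]: "sq_int M (\<lambda>x. c)"
 by (auto simp: sq_int_def)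

lemma (in finite_measure) sq_int_bounded:
 assumes "f \<in> borel_measurable M" "!!x. x \<in> space M ==> norm (f x) <= c"
 shows "sq_int M f"
proof (rule sq_int_bound[of M "\<lambda>x. c::real"])
 show "AE x in M. norm (f x) <= norm c"
  using assms(2) by (auto intro!: AE_I2 order_trans[OF assms(2)])
qed (use assms in auto)

lemma l2n_eq_0:
 assumes "sq_int M f" "l2n M f = 0" shows "AE x in M. f x = 0"
proof -
 have "(\<integral>x. (norm (f x))\<^sup>2 \<partial>M) = 0" using assms(2) by (simp add: l2n_def)
 then have "AE x in M. (norm (f x))\<^sup>2 = 0"
  using integral_nonneg_eq_0_iff_AE[OF sq_int_integrable[OF assms(1)]] by simp
 then show ?thesis by auto
qed

text \<open>Nonnegativity of \<open>\<integral> |t f - g|\<^sup>2\<close> for the minimising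
 \<open>t\<close>.\<close>

lemma l2_Cauchy_Schwarz:
 assumes f: "sq_int M f" and g: "sq_int M g"
 shows "\<bar>\<integral>x. f x \<bullet> g x \<partial>M\<bar> <= l2n M f * l2n M g"
proof (cases "l2n M f = 0")
 case True
 then have "(\<integral>x. f x \<bullet> g x \<partial>M) = (\<integral>x. 0 \<partial>M)"
  using l2n_eq_0[OF f True] f g by (intro integral_cong_AE) (auto intro!: borel_measurable_inner)
 then show ?thesis by simp
next
 case False
 define A where "A = (l2n M f)\<^sup>2"
 define I where "I = (\<integral>x. f x \<bullet> g x \<partial>M)"
 have A: "A > 0" using False by (simp add: A_def)
 define t where "t = I / A"
 have "0 <= (\<integral>x. (norm (t *\<^sub>R f x - g x))\<^sup>2 \<partial>M)" by simp
 also have "\<dots> = (\<integral>x. t\<^sup>2 * (norm (f x))\<^sup>2 - 2 * t * (f x \<bullet> g x) + (norm (g x))\<^sup>2 \<partial>M)"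
 proof -
  have "(norm (t *\<^sub>R f x - g x))\<^sup>2 = t\<^sup>2 * (norm (f x))\<^sup>2 - 2 * t * (f x \<bullet> g x) + (norm (g x))\<^sup>2" for x
   unfolding power2_norm_eq_inner inner_diff_left inner_diff_right inner_scaleR_left inner_scaleR_right
   by (simp add: inner_commute[of "g x" "f x"] algebra_simps power2_eq_square)
  then show ?thesis by simp
 qed
 also have "\<dots> = t\<^sup>2 * A - 2 * t * I + (l2n M g)\<^sup>2"
  using sq_int_integrable[OF f] sq_int_integrable[OF g] sq_int_inner[OF f g]
  by (simp add: A_def I_def l2n_power2)
 also have "\<dots> = (l2n M g)\<^sup>2 - I\<^sup>2 / A"
  using A by (simp add: t_def field_simps power2_eq_square)
 finally have "I\<^sup>2 <= (l2n M f * l2n M g)\<^sup>2"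
  using A by (simp add: field_simps A_def[symmetric] power_mult_distrib)
 then show ?thesis
  unfolding I_def by (metis abs_le_square_iff abs_of_nonneg l2n_nonneg mult_nonneg_nonneg)
qed

lemma l2n_triangle:
 assumes f: "sq_int M f" and g: "sq_int M g"
 shows "l2n M (\<lambda>x. f x + g x) <= l2n M f + l2n M g"
proof (rule power2_le_imp_le)
 have "(l2n M (\<lambda>x. f x + g x))\<^sup>2 = (\<integral>x. (norm (f x))\<^sup>2 + 2 * (f x \<bullet> g x) + (norm (g x))\<^sup>2 \<partial>M)"
  by (simp add: l2n_power2 power2_norm_eq_inner inner_simps inner_commute algebra_simps)
 also have "\<dots> = (l2n M f)\<^sup>2 + 2 * (\<integral>x. f x \<bullet> g x \<partial>M) + (l2n M g)\<^sup>2"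
  using sq_int_integrable[OF f] sq_int_integrable[OF g] sq_int_inner[OF f g]
  by (simp add: l2n_power2)
 also have "\<dots> <= (l2n M f)\<^sup>2 + 2 * (l2n M f * l2n M g) + (l2n M g)\<^sup>2"
  using l2_Cauchy_Schwarz[OF f g] by linarith
 finally show "(l2n M (\<lambda>x. f x + g x))\<^sup>2 <= (l2n M f + l2n M g)\<^sup>2"
  by (simp add: power2_sum)
qed auto

lemma l2n_scaleR: "l2n M (\<lambda>x. c *\<^sub>R f x) = \<bar>c\<bar> * l2n M f"
 by (simp add: l2n_def power_mult_distrib real_sqrt_mult)

lemma l2n_cmult: "l2n M (\<lambda>x. c * f x) = \<bar>c\<bar> * l2n M f" for f :: "_ => real"
 using l2n_scaleR[of M c f] by simp

lemma l2n_minus_commute: "l2n M (\<lambda>x. f x - g x) = l2n M (\<lambda>x. g x - f x)"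
 by (simp add: l2n_def norm_minus_commute)

lemma l2n_triangle_diff:
 assumes "sq_int M f" "sq_int M g" "sq_int M h"
 shows "l2n M (\<lambda>x. f x - h x) <= l2n M (\<lambda>x. f x - g x) + l2n M (\<lambda>x. g x - h x)"
 using l2n_triangle[of M "\<lambda>x. f x - g x" "\<lambda>x. g x - h x"] assms by auto

lemma l2n_mono:
 assumes "sq_int M g" "f \<in> borel_measurable M" "AE x in M. norm (f x) <= norm (g x)"
 shows "l2n M f <= l2n M g"
 unfolding l2n_def
 using sq_int_integrable[OF sq_int_bound[OF assms]] sq_int_integrable[OF assms(1)] assms(3)
 by (auto intro!: real_sqrt_le_mono integral_mono_AE power_mono)

lemma l2n_cong_AE:
 assumes "f \<in> borel_measurable M" "g \<in> borel_measurable M" "AE x in M. f x = g x"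
 shows "l2n M f = l2n M g"
 unfolding l2n_def using assms by (auto intro!: integral_cong_AE arg_cong[where f=sqrt])

lemma l2_inner_tendsto:
 assumes f: "!!k. sq_int M (f k)" and h: "sq_int M h" and g: "sq_int M g"
  and lim: "(\<lambda>k. l2n M (\<lambda>x. f k x - h x)) \<longlonglongrightarrow> 0"
 shows "(\<lambda>k. \<integral>x. f k x \<bullet> g x \<partial>M) \<longlonglongrightarrow> (\<integral>x. h x \<bullet> g x \<partial>M)"
proof (rule LIM_zero_cancel, rule Lim_null_comparison)
 show "(\<lambda>k. l2n M (\<lambda>x. f k x - h x) * l2n M g) \<longlonglongrightarrow> 0"
  using tendsto_mult_left_zero[OF lim] by simp
 show "\<forall>\<^sub>F k in sequentially. norm ((\<integral>x. f k x \<bullet> g x \<partial>M) - (\<integral>x. h x \<bullet> g x \<partial>M))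
   <= l2n M (\<lambda>x. f k x - h x) * l2n M g"
 proof (rule always_eventually, rule allI)
  fix k
  have "(\<integral>x. f k x \<bullet> g x \<partial>M) - (\<integral>x. h x \<bullet> g x \<partial>M) = (\<integral>x. (f k x - h x) \<bullet> g x \<partial>M)"
   using sq_int_inner[OF f g, of k] sq_int_inner[OF h g]
   by (simp add: inner_diff_left)
  then show "norm ((\<integral>x. f k x \<bullet> g x \<partial>M) - (\<integral>x. h x \<bullet> g x \<partial>M))
   <= l2n M (\<lambda>x. f k x - h x) * l2n M g"
   using l2_Cauchy_Schwarz[of M "\<lambda>x. f k x - h x" g] f g h by auto
 qed
qed

lemma l2_unique_limit:
 assumes "!!k. sq_int M (f k)" "sq_int M g" "sq_int M h"
  and "(\<lambda>k. l2n M (\<lambda>x. f k x - g x)) \<longlonglongrightarrow> 0" "(\<lambda>k. l2n M (\<lambda>x. f k x - h x)) \<longlonglongrightarrow> 0"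
 shows "AE x in M. g x = h x"
proof -
 have "(\<lambda>k. l2n M (\<lambda>x. f k x - g x) + l2n M (\<lambda>x. f k x - h x)) \<longlonglongrightarrow> 0"
  using tendsto_add[OF assms(4,5)] by simp
 then have "l2n M (\<lambda>x. g x - h x) <= 0"
 proof (rule Lim_bounded2[where N=0])
  show "\<forall>n\<ge>0. l2n M (\<lambda>x. g x - h x) <= l2n M (\<lambda>x. f n x - g x) + l2n M (\<lambda>x. f n x - h x)"
   using l2n_triangle_diff[of M g _ h] assms by (auto simp: l2n_minus_commute[of M g])
 qed
 then have "l2n M (\<lambda>x. g x - h x) = 0" using l2n_nonneg[of M] by (meson order_antisym)
 then show ?thesis using l2n_eq_0[of M "\<lambda>x. g x - h x"] assms(2,3) by auto
qed

text \<open>A subsequence with geometrically small increments converges almost everywhere; Fatou then bounds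
 the distance to the limit.\<close>

lemma l2_complete:
 fixes f :: "nat => 'm => 'b::euclidean_space"
 assumes f: "!!k. sq_int M (f k)"
  and Cauchy: "!!e. e > 0 ==> \<exists>N. \<forall>k\<ge>N. \<forall>l\<ge>N. l2n M (\<lambda>x. f k x - f l x) < e"
 shows "\<exists>g. sq_int M g & (\<lambda>k. l2n M (\<lambda>x. f k x - g x)) \<longlonglongrightarrow> 0"
proof -
 have [measurable]: "f k \<in> borel_measurable M" for k using f by auto
 have "\<exists>N. \<forall>k\<ge>N. \<forall>l\<ge>N. l2n M (\<lambda>x. f k x - f l x) < (1/2)^n" for n
  using Cauchy[of "(1/2)^n"] by simp
 then obtain N where N: "!!n k l. k \<ge> N n ==> l \<ge> N n ==> l2n M (\<lambda>x. f k x - f l x) < (1/2)^n"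
  by metis
 define r where "r n = (\<Sum>i\<le>n. N i) + n" for n
 have rN: "r n \<ge> N n" for n
 proof -
  have "N n <= (\<Sum>i\<le>n. N i)" by (rule member_le_sum) auto
  then show ?thesis by (simp add: r_def)
 qed
 have rS: "r (Suc n) \<ge> r n" for n by (simp add: r_def)
 define d where "d n x = f (r (Suc n)) x - f (r n) x" for n x
 have [measurable]: "d n \<in> borel_measurable M" for n unfolding d_def by measurable
 have d: "sq_int M (d n)" for n unfolding d_def using f by auto
 have dn: "(\<integral>x. (norm (d n x))\<^sup>2 \<partial>M) <= (1/4)^n" for n
 proof -
  have "l2n M (d n) <= (1/2)^n"
   unfolding d_def using N[of n "r (Suc n)" "r n"] rN[of n] rS[of n] by simp
  then have "(l2n M (d n))\<^sup>2 <= ((1/2)^n)\<^sup>2" by (intro power_mono) auto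
  also have "((1/2::real)^n)\<^sup>2 = (1/4)^n"
   by (simp add: power2_eq_square flip: power_mult_distrib)
  finally show ?thesis by (simp add: l2n_power2)
 qed
 have "(\<integral>\<^sup>+x. (\<Sum>n. ennreal (2^n * (norm (d n x))\<^sup>2)) \<partial>M) = (\<Sum>n. \<integral>\<^sup>+x. ennreal (2^n * (norm (d n x))\<^sup>2) \<partial>M)"
  by (intro nn_integral_suminf) auto
 also have "\<dots> <= (\<Sum>n. ennreal ((1/2)^n))"
 proof (intro suminf_le summableI)
  fix n
  have "(\<integral>\<^sup>+x. ennreal (2^n * (norm (d n x))\<^sup>2) \<partial>M) = ennreal (2^n * (\<integral>x. (norm (d n x))\<^sup>2 \<partial>M))"
   using sq_int_integrable[OF d, of n] by (subst nn_integral_eq_integral) auto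
  also have "\<dots> <= ennreal (2^n * (1/4)^n)"
   using dn[of n] by (intro ennreal_leI mult_left_mono) auto
  also have "(2::real)^n * (1/4)^n = (1/2)^n"
   by (simp flip: power_mult_distrib)
  finally show "(\<integral>\<^sup>+x. ennreal (2^n * (norm (d n x))\<^sup>2) \<partial>M) <= ennreal ((1/2)^n)" .
 qed
 also have "\<dots> = ennreal (\<Sum>n. (1/2)^n)"
  by (intro suminf_ennreal2) auto
 also have "\<dots> < \<infinity>" by simp
 finally have fin: "(\<integral>\<^sup>+x. (\<Sum>n. ennreal (2^n * (norm (d n x))\<^sup>2)) \<partial>M) \<noteq> \<infinity>" by simp
 have "AE x in M. (\<Sum>n. ennreal (2^n * (norm (d n x))\<^sup>2)) \<noteq> \<infinity>"
  by (rule nn_integral_PInf_AE[OF _ fin]) measurable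
 then have conv: "AE x in M. convergent (\<lambda>n. f (r n) x)"
 proof eventually_elim
  case (elim x)
  define C where "C = enn2real (\<Sum>n. ennreal (2^n * (norm (d n x))\<^sup>2))"
  have C0: "C \<ge> 0" unfolding C_def by (rule enn2real_nonneg)
  have C: "2^n * (norm (d n x))\<^sup>2 <= C" for n
  proof -
   let ?s = "\<lambda>n. ennreal (2^n * (norm (d n x))\<^sup>2)"
   have "sum ?s {n} <= suminf ?s" by (rule sum_le_suminf) simp_all
   then have "?s n <= suminf ?s" by simp
   moreover have "suminf ?s = ennreal C"
    unfolding C_def
   proof (rule ennreal_enn2real[symmetric])
    show "suminf ?s < top" using elim by (metis infinity_ennreal_def top.not_eq_extremum)
   qed
   ultimately have "?s n <= ennreal C" by metis
   then show ?thesis using ennreal_le_iff[OF C0] by blast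
  qed
  define q :: real where "q = sqrt (1/2)"
  have q: "0 <= q" "q < 1" "q\<^sup>2 = 1/2"
   unfolding q_def using real_sqrt_less_mono[of "1/2" 1] by auto
  have "norm (d n x) <= sqrt C * q^n" for n
  proof (rule power2_le_imp_le)
   have "(norm (d n x))\<^sup>2 <= C * (1/2)^n" using C[of n] by (simp add: field_simps)
   also have "\<dots> = (sqrt C * q^n)\<^sup>2"
    using C0 by (simp only: q(3)[symmetric] power_mult_distrib real_sqrt_pow2 power_mult[symmetric] mult.commute)
   finally show "(norm (d n x))\<^sup>2 <= (sqrt C * q^n)\<^sup>2" .
  qed (use C0 q in auto)
  moreover have "summable (\<lambda>n. sqrt C * q^n)"
   using q by (intro summable_mult summable_geometric) auto
  ultimately have "summable (\<lambda>n. d n x)"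
   using summable_comparison_test'[of "\<lambda>n. sqrt C * q^n" 0 "\<lambda>n. d n x"] by blast
  then have "convergent (\<lambda>n. \<Sum>i<n. d i x)" by (simp add: summable_iff_convergent)
  moreover have "(\<Sum>i<n. d i x) = f (r n) x - f (r 0) x" for n
   by (induction n) (auto simp: d_def)
  ultimately have "convergent (\<lambda>n. f (r n) x - f (r 0) x)" by simp
  then show "convergent (\<lambda>n. f (r n) x)"
   using convergent_diff_const_right_iff[of "\<lambda>n. f (r n) x"] by simp
 qed
 define g where "g x = lim (\<lambda>n. f (r n) x)" for x
 have gm[measurable]: "g \<in> borel_measurable M" unfolding g_def by measurable
 have lim: "AE x in M. (\<lambda>n. f (r n) x) \<longlonglongrightarrow> g x"
  using conv unfolding g_def by eventually_elim (simp add: convergent_LIMSEQ_iff)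
 have est: "(\<integral>\<^sup>+x. ennreal ((norm (f k x - g x))\<^sup>2) \<partial>M) <= ennreal (((1/2)^n)\<^sup>2)" if k: "k \<ge> N n" for k n
 proof -
  have "(\<integral>\<^sup>+x. ennreal ((norm (f k x - g x))\<^sup>2) \<partial>M)
    = (\<integral>\<^sup>+x. liminf (\<lambda>m. ennreal ((norm (f k x - f (r m) x))\<^sup>2)) \<partial>M)"
  proof (rule nn_integral_cong_AE)
   show "AE x in M. ennreal ((norm (f k x - g x))\<^sup>2) = liminf (\<lambda>m. ennreal ((norm (f k x - f (r m) x))\<^sup>2))"
    using lim
   proof eventually_elim
    case (elim x)
    have "(\<lambda>m. ennreal ((norm (f k x - f (r m) x))\<^sup>2)) \<longlonglongrightarrow> ennreal ((norm (f k x - g x))\<^sup>2)"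
     by (intro tendsto_intros elim)
    then show ?case by (intro lim_imp_Liminf[symmetric]) simp_all
   qed
  qed
  also have "\<dots> <= liminf (\<lambda>m. \<integral>\<^sup>+x. ennreal ((norm (f k x - f (r m) x))\<^sup>2) \<partial>M)"
   by (intro nn_integral_liminf) auto
  also have "\<dots> <= liminf (\<lambda>m. ennreal (((1/2)^n)\<^sup>2))"
  proof (rule Liminf_mono)
   show "\<forall>\<^sub>F m in sequentially. (\<integral>\<^sup>+x. ennreal ((norm (f k x - f (r m) x))\<^sup>2) \<partial>M) <= ennreal (((1/2)^n)\<^sup>2)"
    using eventually_ge_at_top[of n]
   proof eventually_elim
    case (elim m)
    have "mono r" using rS by (simp add: mono_iff_le_Suc)
    then have "r m \<ge> N n" using rN[of n] elim by (meson monoD order_trans)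
    then have "l2n M (\<lambda>x. f k x - f (r m) x) <= (1/2)^n" using N[of n k "r m"] k by simp
    then have "(l2n M (\<lambda>x. f k x - f (r m) x))\<^sup>2 <= ((1/2)^n)\<^sup>2" by (intro power_mono) auto
    moreover have "sq_int M (\<lambda>x. f k x - f (r m) x)" using f by auto
    ultimately show ?case
     by (subst nn_integral_eq_integral) (auto simp: l2n_power2 sq_int_def simp del: power_one_over intro!: ennreal_leI)
   qed
  qed
  finally show ?thesis by (simp only: Liminf_const[OF sequentially_bot])
 qed
 have fg: "sq_int M (\<lambda>x. f k x - g x)" if k: "k \<ge> N n" for k n
  unfolding sq_int_def
 proof
  show "integrable M (\<lambda>x. (norm (f k x - g x))\<^sup>2)"
   by (rule integrableI_bounded) (use est[OF k] in "auto intro: le_less_trans")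
 qed measurable
 have g: "sq_int M g"
  using sq_int_diff[OF f[of "N 0"] fg[of 0 "N 0"]] by simp
 have "l2n M (\<lambda>x. f k x - g x) <= (1/2)^n" if k: "k \<ge> N n" for k n
 proof -
  have "ennreal ((l2n M (\<lambda>x. f k x - g x))\<^sup>2) <= ennreal (((1/2)^n)\<^sup>2)"
   using est[OF k] unfolding l2n_power2
   by (subst (asm) nn_integral_eq_integral) (use fg[OF k] in "auto simp: sq_int_def")
  then have "(l2n M (\<lambda>x. f k x - g x))\<^sup>2 <= ((1/2)^n)\<^sup>2" by (simp add: ennreal_le_iff)
  then show ?thesis by (rule power2_le_imp_le) auto
 qed
 note bd = this
 have "(\<lambda>k. l2n M (\<lambda>x. f k x - g x)) \<longlonglongrightarrow> 0"
 proof (rule LIMSEQ_I)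
  fix e :: real assume "e > 0"
  then obtain n where n: "(1/2::real)^n < e" using real_arch_pow_inv[of e "1/2"] by auto
  show "\<exists>no. \<forall>k\<ge>no. norm (l2n M (\<lambda>x. f k x - g x) - 0) < e"
   using n by (intro exI[of _ "N n"]) (auto intro: le_less_trans[OF bd])
 qed
 with g show ?thesis by auto
qed

section \<open>Calculus of smooth functions\<close>

definition smooth :: "('a::euclidean_space => real) => bool" where
 "smooth f \<longleftrightarrow> (\<forall>k. Ck k f)"

lemma pderiv_dir_eq: "(f has_derivative D) (at x) ==> pderiv_dir b f x = D b"
 unfolding pderiv_dir_def by (metis frechet_derivative_at)

lemma pderiv_dir_has_derivative:
 "f differentiable (at x) ==> (f has_derivative (\<lambda>b. pderiv_dir b f x)) (at x)"
 unfolding pderiv_dir_def using frechet_derivative_works[of f "at x"] by blast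

lemma Ck_imp_continuous: "Ck k f ==> continuous_on UNIV f"
 by (cases k) (auto simp: continuous_on_eq_continuous_within differentiable_imp_continuous_within)

lemma Ck_SucD: "Ck (Suc k) f ==> Ck k f"
proof (induction k arbitrary: f)
 case 0
 then show ?case using Ck_imp_continuous[of "Suc 0" f] by simp
next
 case (Suc k)
 then show ?case by (metis Ck.simps(2))
qed

lemma Ck_const [intro, simp]: "Ck k (\<lambda>x. c)"
proof (induction k arbitrary: c)
 case (Suc k)
 have "pderiv_dir b (\<lambda>x. c) = (\<lambda>x. 0)" for b :: 'a
  by (rule ext, rule pderiv_dir_eq) simp
 then show ?case using Suc[of 0] by simp
qed simp

lemma Ck_add [intro]: "Ck k f ==> Ck k g ==> Ck k (\<lambda>x. f x + g x)"
proof (induction k arbitrary: f g)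
 case (Suc k)
 have "pderiv_dir b (\<lambda>x. f x + g x) = (\<lambda>x. pderiv_dir b f x + pderiv_dir b g x)" for b
  by (rule ext, rule pderiv_dir_eq)
    (use Suc.prems in "auto intro!: has_derivative_add pderiv_dir_has_derivative")
 then show ?case using Suc by auto
qed (auto intro: continuous_intros)

lemma Ck_mult [intro]: "Ck k f ==> Ck k g ==> Ck k (\<lambda>x. f x * g x)"
proof (induction k arbitrary: f g)
 case (Suc k)
 have "pderiv_dir b (\<lambda>x. f x * g x) = (\<lambda>x. f x * pderiv_dir b g x + pderiv_dir b f x * g x)" for b
  by (rule ext, rule pderiv_dir_eq)
    (use Suc.prems in "auto intro!: has_derivative_mult pderiv_dir_has_derivative")
 moreover have "Ck k f" "Ck k g" using Suc.prems Ck_SucD by auto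
 ultimately show ?case using Suc by (auto intro!: Ck_add)
qed (auto intro: continuous_intros)

lemma Ck_cmult [intro]: "Ck k f ==> Ck k (\<lambda>x. c * f x)"
 by (rule Ck_mult) auto

lemma Ck_sum [intro]: "(!!i. i \<in> I ==> Ck k (f i)) ==> Ck k (\<lambda>x. \<Sum>i\<in>I. f i x)"
 by (induction I rule: infinite_finite_induct) auto

lemma Ck_prod [intro]: "(!!i. i \<in> I ==> Ck k (f i)) ==> Ck k (\<lambda>x. \<Prod>i\<in>I. f i x)"
 by (induction I rule: infinite_finite_induct) auto

lemma pderiv_dir_linear_expand:
 assumes "f differentiable (at x)"
 shows "pderiv_dir v f x = (\<Sum>e\<in>Basis. (v \<bullet> e) * pderiv_dir e f x)"
proof -
 interpret bounded_linear "\<lambda>b. pderiv_dir b f x"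
  using pderiv_dir_has_derivative[OF assms] by (rule has_derivative_bounded_linear)
 have "pderiv_dir (\<Sum>e\<in>Basis. (v \<bullet> e) *\<^sub>R e) f x = (\<Sum>e\<in>Basis. (v \<bullet> e) * pderiv_dir e f x)"
  by (simp add: sum scaleR)
 then show ?thesis by (simp add: euclidean_representation)
qed

lemma has_derivative_comp_affine:
 fixes f :: "'a::euclidean_space => real" and L :: "'b::euclidean_space => 'a"
 assumes L: "bounded_linear L" and f: "f differentiable (at (L x + c))"
 shows "((\<lambda>x. f (L x + c)) has_derivative (\<lambda>h. pderiv_dir (L h) f (L x + c))) (at x)"
proof -
 have "((\<lambda>x. L x + c) has_derivative (\<lambda>h. L h + 0)) (at x)"
  by (intro has_derivative_add has_derivative_const bounded_linear_imp_has_derivative L)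
 from has_derivative_compose[OF this pderiv_dir_has_derivative[OF f]]
 show ?thesis by simp
qed

lemma Ck_comp_affine:
 fixes f :: "'a::euclidean_space => real" and L :: "'b::euclidean_space => 'a"
 assumes L: "bounded_linear L" and f: "Ck k f"
 shows "Ck k (\<lambda>x. f (L x + c))"
 using f
proof (induction k arbitrary: f)
 case 0
 have "continuous_on UNIV (\<lambda>x. L x + c)"
  using L by (intro continuous_intros linear_continuous_on)
 with 0 show ?case
  using continuous_on_compose2[of UNIV f UNIV "\<lambda>x. L x + c"] by simp
next
 case (Suc k)
 have d: "f differentiable (at y)" for y using Suc.prems by simp
 have D: "((\<lambda>x. f (L x + c)) has_derivative (\<lambda>h. pderiv_dir (L h) f (L x + c))) (at x)" for x
  by (rule has_derivative_comp_affine[OF L d])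
 have "pderiv_dir b (\<lambda>x. f (L x + c)) = (\<lambda>x. \<Sum>e\<in>Basis. (L b \<bullet> e) * pderiv_dir e f (L x + c))" for b
  by (rule ext) (simp only: pderiv_dir_eq[OF D] pderiv_dir_linear_expand[OF d, of "L b"])
 moreover have "Ck k (\<lambda>x. \<Sum>e\<in>Basis. (L b \<bullet> e) * pderiv_dir e f (L x + c))" for b
  using Suc by (auto intro!: Ck_sum Ck_cmult)
 ultimately show ?case using D by (auto intro: differentiableI)
qed

lemma smooth_continuous: "smooth f ==> continuous_on UNIV f"
 unfolding smooth_def using Ck_imp_continuous by blast

lemma smooth_differentiable: "smooth f ==> f differentiable (at x)"
 unfolding smooth_def by (metis Ck.simps(2))

lemma smooth_pderiv: "smooth f ==> b \<in> Basis ==> smooth (pderiv_dir b f)"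
 unfolding smooth_def by (metis Ck.simps(2))

lemma smooth_const [simp, intro]: "smooth (\<lambda>x. c)"
 by (simp add: smooth_def)

lemma smooth_add [intro]: "smooth f ==> smooth g ==> smooth (\<lambda>x. f x + g x)"
 by (auto simp: smooth_def)

lemma smooth_mult [intro]: "smooth f ==> smooth g ==> smooth (\<lambda>x. f x * g x)"
 by (auto simp: smooth_def)

lemma smooth_prod [intro]: "(!!i. i \<in> I ==> smooth (f i)) ==> smooth (\<lambda>x. \<Prod>i\<in>I. f i x)"
 by (auto simp: smooth_def)

lemma smooth_comp_affine: "bounded_linear L ==> smooth f ==> smooth (\<lambda>x. f (L x + c))"
 by (auto simp: smooth_def intro: Ck_comp_affine)

lemma smooth_comp_linear: "bounded_linear L ==> smooth f ==> smooth (\<lambda>x. f (L x))"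
 using smooth_comp_affine[of L f 0] by simp

lemma smooth_has_derivative: "smooth f ==> (f has_derivative (\<lambda>b. pderiv_dir b f x)) (at x)"
 by (intro pderiv_dir_has_derivative smooth_differentiable)

lemma pderiv_dir_real:
 fixes f :: "real => real"
 assumes "f differentiable (at x)"
 shows "(f has_real_derivative (pderiv_dir 1 f x)) (at x)"
proof -
 have "(\<lambda>b. pderiv_dir b f x) = (*) (pderiv_dir 1 f x)"
  by (rule ext, subst pderiv_dir_linear_expand[OF assms]) simp
 then show ?thesis
  using pderiv_dir_has_derivative[OF assms] by (simp add: has_field_derivative_def)
qed

lemma pderiv_dir_real_eq: "(f has_real_derivative D) (at x) ==> pderiv_dir 1 f x = D"
 using pderiv_dir_eq[of f "(*) D" x 1] by (simp add: has_field_derivative_def)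

lemma smooth_has_real_derivative:
 "smooth f ==> (f has_real_derivative (pderiv_dir 1 f x)) (at x)"
 by (intro pderiv_dir_real smooth_differentiable)

lemma smooth_deriv: "smooth f ==> deriv f = pderiv_dir 1 f"
 by (rule ext) (metis DERIV_imp_deriv smooth_has_real_derivative)

section \<open>Bump functions\<close>

text \<open>\<open>x\<^sup>-\<^sup>n exp (-1/x)\<close> on the positive axis: this family is closed under differentiation up to
 linear combinations, so induction over the order of differentiability goes through.\<close>

definition flat :: "nat => real => real" where
 "flat n x = (if x > 0 then (1/x)^n * exp (- (1/x)) else 0)"

lemma flat_tendsto_0: "(flat n \<longlongrightarrow> 0) (at 0)"
proof (rule filterlim_split_at)
 have "\<forall>\<^sub>F x in at_left 0. flat n x = 0"
  unfolding eventually_at_left_field by (rule exI[of _ "-1"]) (simp add: flat_def)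
 then show "(flat n \<longlongrightarrow> 0) (at_left 0)" by (rule tendsto_eventually)
 have "((\<lambda>y. y ^ n / exp y) \<longlongrightarrow> (0::real)) at_top" by (rule tendsto_power_div_exp_0)
 moreover have "\<forall>\<^sub>F y in at_top. y ^ n / exp y = flat n (inverse y)"
  using eventually_gt_at_top[of 0]
  by eventually_elim (simp add: flat_def exp_minus field_simps)
 ultimately have "((\<lambda>y. flat n (inverse y)) \<longlongrightarrow> 0) at_top"
  by (rule Lim_transform_eventually)
 then show "(flat n \<longlongrightarrow> 0) (at_right 0)"
  by (simp add: filterlim_at_right_to_top)
qed

lemma flat_has_derivative:
 "(flat n has_real_derivative (flat (n + 2) x - real n * flat (n + 1) x)) (at x)"
proof -
 consider "x > 0" | "x < 0" | "x = 0" by linarith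
 then show ?thesis
 proof cases
  case 1
  have i: "((\<lambda>x. 1/x) has_real_derivative - ((1/x)\<^sup>2)) (at x)"
   using 1 by (auto intro!: derivative_eq_intros simp: field_simps power2_eq_square)
  have "((\<lambda>x. (1/x)^n * exp (- (1/x))) has_real_derivative
    (1/x)^n * (exp (- (1/x)) * (1/x)\<^sup>2) + real n * (- ((1/x)\<^sup>2) * (1/x)^(n - 1)) * exp (- (1/x))) (at x)"
   by (rule DERIV_cong[OF DERIV_mult[OF DERIV_power[OF i] DERIV_fun_exp[OF DERIV_minus[OF i]]]]) simp
  also have "(1/x)^n * (exp (- (1/x)) * (1/x)\<^sup>2) + real n * (- ((1/x)\<^sup>2) * (1/x)^(n - 1)) * exp (- (1/x))
    = flat (n + 2) x - real n * flat (n + 1) x"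
   using 1 by (cases n) (simp_all only: flat_def if_True power_add diff_Suc_1 power_Suc power2_eq_square, simp_all add: algebra_simps)
  finally have "((\<lambda>x. (1/x)^n * exp (- (1/x))) has_real_derivative
    (flat (n + 2) x - real n * flat (n + 1) x)) (at x)" .
  moreover have "open {0::real<..}" "x \<in> {0<..}" using 1 by auto
  ultimately show ?thesis
   by (rule has_field_derivative_transform_within_open) (auto simp: flat_def)
 next
  case 2
  have "((\<lambda>x. 0) has_real_derivative (flat (n + 2) x - real n * flat (n + 1) x)) (at x)"
   using 2 by (auto simp: flat_def)
  moreover have "open {..<0::real}" "x \<in> {..<0}" using 2 by auto
  ultimately show ?thesis
   by (rule has_field_derivative_transform_within_open) (auto simp: flat_def)
 next
  case 3
  have "\<forall>\<^sub>F y in at 0. flat (n + 1) y = (flat n y - flat n 0) / (y - 0)"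
   by (rule eventually_at_topological[THEN iffD2], rule exI[of _ UNIV]) (auto simp: flat_def field_simps)
  from Lim_transform_eventually[OF flat_tendsto_0 this]
  show ?thesis using 3 by (simp add: has_field_derivative_iff flat_def)
 qed
qed

lemma Ck_flat: "Ck k (flat n)"
proof (induction k arbitrary: n)
 case 0
 have "continuous (at x) (flat n)" for x
  using flat_has_derivative[of n x] DERIV_isCont by blast
 then show ?case by (simp add: continuous_on_eq_continuous_within)
next
 case (Suc k)
 have "pderiv_dir 1 (flat n) = (\<lambda>x. flat (n + 2) x + (- real n) * flat (n + 1) x)"
  using pderiv_dir_real_eq[OF flat_has_derivative[of n]] by (auto simp: algebra_simps)
 moreover have "Ck k (\<lambda>x. flat (n + 2) x + (- real n) * flat (n + 1) x)"
  by (intro Ck_add Ck_cmult Suc)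
 ultimately show ?case
  using flat_has_derivative[of n] by (auto simp: real_differentiable_def intro!: field_differentiable_imp_differentiable)
qed

lemma smooth_flat: "smooth (flat n)"
 by (simp add: smooth_def Ck_flat)

lemma flat0_bounds: "0 <= flat 0 x" "flat 0 x <= 1"
 by (auto simp: flat_def)

lemma flat0_tendsto_indicator: "(\<lambda>n. flat 0 (real (Suc n) * x)) \<longlonglongrightarrow> (if x > 0 then 1 else 0)"
proof (cases "x > 0")
 case True
 have "(\<lambda>n. exp (- (inverse (real (Suc n)) * (1 / x)))) \<longlonglongrightarrow> exp (- (0 * (1 / x)))"
  by (intro tendsto_intros LIMSEQ_inverse_real_of_nat)
 moreover have "exp (- (inverse (real (Suc n)) * (1 / x))) = flat 0 (real (Suc n) * x)" for n
  using True by (simp add: flat_def divide_simps del: of_nat_Suc)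
 ultimately show ?thesis using True by simp
next
 case False
 then have "flat 0 (real (Suc n) * x) = 0" for n
  by (auto simp: flat_def zero_less_mult_iff)
 then show ?thesis using False by simp
qed

text \<open>Smooth functions supported in the box from \<open>a\<close> to \<open>c\<close>, increasing to its indicator.\<close>

definition box_bump :: "'a::euclidean_space => 'a => nat => 'a => real" where
 "box_bump a c n x = (\<Prod>e\<in>Basis. flat 0 (real (Suc n) * ((x - a) \<bullet> e)) * flat 0 (real (Suc n) * ((c - x) \<bullet> e)))"

lemma smooth_box_bump: "smooth (box_bump a c n)"
 unfolding box_bump_def
proof (intro smooth_prod smooth_mult)
 fix e :: 'a
 have "bounded_linear (\<lambda>x::'a. real (Suc n) * (x \<bullet> e))"
  by (intro bounded_linear_intros)
 from smooth_comp_affine[OF this smooth_flat, of 0 "- real (Suc n) * (a \<bullet> e)"]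
 show "smooth (\<lambda>x. flat 0 (real (Suc n) * ((x - a) \<bullet> e)))"
  by (simp add: inner_diff_left algebra_simps)
 have "bounded_linear (\<lambda>x::'a. - (real (Suc n) * (x \<bullet> e)))"
  by (intro bounded_linear_minus bounded_linear_intros)
 from smooth_comp_affine[OF this smooth_flat, of 0 "real (Suc n) * (c \<bullet> e)"]
 show "smooth (\<lambda>x. flat 0 (real (Suc n) * ((c - x) \<bullet> e)))"
  by (simp add: inner_diff_left algebra_simps)
qed

lemma box_bump_bounds: "0 <= box_bump a c n x" "box_bump a c n x <= 1"
 unfolding box_bump_def using flat0_bounds
 by (auto intro!: prod_nonneg prod_le_1 mult_le_one)

lemma box_bump_pos_iff: "box_bump a c n x \<noteq> 0 \<longleftrightarrow> x \<in> box a c"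
 unfolding box_bump_def
 by (auto simp: flat_def box_def inner_diff_left zero_less_mult_iff)

lemma box_bump_tendsto: "(\<lambda>n. box_bump a c n x) \<longlonglongrightarrow> indicator (box a c) x"
proof -
 have "(\<lambda>n. box_bump a c n x) \<longlonglongrightarrow>
   (\<Prod>e\<in>Basis. (if (x - a) \<bullet> e > 0 then 1 else 0) * (if (c - x) \<bullet> e > 0 then 1 else 0))"
  unfolding box_bump_def by (intro tendsto_prod tendsto_mult flat0_tendsto_indicator)
 also have "(\<Prod>e\<in>Basis. (if (x - a) \<bullet> e > 0 then 1 else 0) * (if (c - x) \<bullet> e > 0 then 1 else 0)) =
   (indicator (box a c) x :: real)"
 proof (cases "x \<in> box a c")
  case True
  then show ?thesis by (auto simp: box_def inner_diff_left intro!: prod.neutral)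
 next
  case False
  then obtain e where "e \<in> Basis" "\<not> (a \<bullet> e < x \<bullet> e & x \<bullet> e < c \<bullet> e)" by (auto simp: box_def)
  then show ?thesis using False
   by (auto simp: inner_diff_left intro!: prod_zero bexI[of _ e])
 qed
 finally show ?thesis .
qed

section \<open>Test functions\<close>

lemma test_functions_iff:
 "\<phi> \<in> test_functions S \<longleftrightarrow> smooth \<phi> & compact (closure {x. \<phi> x \<noteq> 0}) & closure {x. \<phi> x \<noteq> 0} \<subseteq> S"
 by (auto simp: test_functions_def smooth_def)

lemma test_functionsI:
 assumes "smooth \<phi>" "compact K" "K \<subseteq> S" "!!x. \<phi> x \<noteq> 0 ==> x \<in> K"
 shows "\<phi> \<in> test_functions S"
proof -
 have "closure {x. \<phi> x \<noteq> 0} \<subseteq> K"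
  using assms by (intro closure_minimal compact_imp_closed) auto
 moreover have "compact (closure {x. \<phi> x \<noteq> 0})"
  using calculation assms(2) by (meson bounded_subset closed_closure compact_eq_bounded_closed)
 ultimately show ?thesis using assms by (auto simp: test_functions_iff)
qed

lemma test_functionsD:
 assumes "\<phi> \<in> test_functions S"
 shows "\<exists>K. compact K & K \<subseteq> S & (\<forall>x. x \<notin> K --> \<phi> x = 0) & (\<forall>x. x \<notin> K --> (\<forall>b. pderiv_dir b \<phi> x = 0))"
proof (intro exI conjI allI impI)
 define K where "K = closure {x. \<phi> x \<noteq> 0}"
 show "compact K" "K \<subseteq> S" using assms by (auto simp: test_functions_iff K_def)
 show z: "\<phi> x = 0" if "x \<notin> K" for x
  using that closure_subset[of "{x. \<phi> x \<noteq> 0}"] by (auto simp: K_def)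
 show "pderiv_dir b \<phi> x = 0" if "x \<notin> K" for b x
 proof (rule pderiv_dir_eq)
  have "open (- K)" "x \<in> - K" using that by (auto simp: K_def)
  then show "(\<phi> has_derivative (\<lambda>b. 0)) (at x)"
   by (rule has_derivative_transform_within_open[OF has_derivative_const[of 0]]) (use z in auto)
 qed
qed

lemma test_smooth: "\<phi> \<in> test_functions S ==> smooth \<phi>"
 by (simp add: test_functions_iff)

lemma test_pderiv:
 assumes "\<phi> \<in> test_functions S" "b \<in> Basis"
 shows "pderiv_dir b \<phi> \<in> test_functions S"
proof -
 have sK: "smooth \<phi>" using assms(1) by (rule test_smooth)
 obtain K where K: "compact K" "K \<subseteq> S" "!!b x. x \<notin> K ==> pderiv_dir b \<phi> x = 0"
  using test_functionsD[OF assms(1)] by blast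
 then show ?thesis using assms(2) sK by (intro test_functionsI[of _ K] smooth_pderiv) auto
qed

lemma test_zero [simp]: "(\<lambda>x. 0) \<in> test_functions S"
 by (rule test_functionsI[of _ "{}"]) auto

lemma test_add:
 assumes "f \<in> test_functions S" "g \<in> test_functions S"
 shows "(\<lambda>x. f x + g x) \<in> test_functions S"
proof -
 have sK: "smooth f" using assms(1) by (rule test_smooth)
 obtain K where K: "compact K" "K \<subseteq> S" "!!x. x \<notin> K ==> f x = 0"
  using test_functionsD[OF assms(1)] by blast
 have sL: "smooth g" using assms(2) by (rule test_smooth)
 obtain L where L: "compact L" "L \<subseteq> S" "!!x. x \<notin> L ==> g x = 0"
  using test_functionsD[OF assms(2)] by blast
 show ?thesis
 proof (rule test_functionsI[of _ "K \<union> L"])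
  show "x \<in> K \<union> L" if "f x + g x \<noteq> 0" for x
   using that K(3)[of x] L(3)[of x] by (cases "x \<in> K"; cases "x \<in> L") auto
 qed (use K L sK sL in auto)
qed

lemma test_cmult:
 assumes "f \<in> test_functions S" shows "(\<lambda>x. c * f x) \<in> test_functions S"
proof -
 have sK: "smooth f" using assms by (rule test_smooth)
 obtain K where K: "compact K" "K \<subseteq> S" "!!x. x \<notin> K ==> f x = 0"
  using test_functionsD[OF assms] by blast
 show ?thesis
  by (rule test_functionsI[of _ K]) (use K sK in auto)
qed

lemma test_diff:
 assumes "f \<in> test_functions S" "g \<in> test_functions S"
 shows "(\<lambda>x. f x - g x) \<in> test_functions S"
 using test_add[OF assms(1) test_cmult[OF assms(2), of "-1"]] by simp

lemma pderiv_dir_diff: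
 assumes "smooth f" "smooth g"
 shows "pderiv_dir b (\<lambda>x. f x - g x) x = pderiv_dir b f x - pderiv_dir b g x"
 by (rule pderiv_dir_eq) (intro has_derivative_diff smooth_has_derivative assms)

lemma pderiv_dir_add:
 assumes "smooth f" "smooth g"
 shows "pderiv_dir b (\<lambda>x. f x + g x) x = pderiv_dir b f x + pderiv_dir b g x"
 by (rule pderiv_dir_eq) (intro has_derivative_add smooth_has_derivative assms)

lemma pderiv_dir_cmult:
 assumes "smooth f"
 shows "pderiv_dir b (\<lambda>x. c * f x) x = c * pderiv_dir b f x"
 by (rule pderiv_dir_eq) (intro has_derivative_mult_right smooth_has_derivative assms)

lemma box_bump_test:
 assumes "cbox a c \<subseteq> S" shows "box_bump a c n \<in> test_functions S"
proof (rule test_functionsI[of _ "cbox a c"])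
 show "x \<in> cbox a c" if "box_bump a c n x \<noteq> 0" for x
  using that box_subset_cbox by (auto simp: box_bump_pos_iff)
qed (use assms smooth_box_bump in auto)

lemma continuous_compact_support_bounded:
 fixes f :: "'a::euclidean_space => 'b::euclidean_space"
 assumes "continuous_on UNIV f" "compact K" "!!x. x \<notin> K ==> f x = 0"
 obtains B where "B > 0" "!!x. norm (f x) <= B"
proof -
 have "bounded (f ` K)"
  using assms by (intro compact_imp_bounded compact_continuous_image) (auto intro: continuous_on_subset)
 then obtain B where "B > 0" "!!y. y \<in> f ` K ==> norm y <= B" by (auto simp: bounded_pos)
 then show ?thesis using that[of B] assms(3) by (metis image_eqI less_imp_le norm_zero)
qed

lemma sq_int_continuous_compact_support:
 fixes f :: "'a::euclidean_space => 'b::euclidean_space"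
 assumes "continuous_on UNIV f" "compact K" "!!x. x \<notin> K ==> f x = 0"
 shows "sq_int lborel f" "integrable lborel f"
proof -
 obtain B where B: "B > 0" "!!x. norm (f x) <= B"
  using continuous_compact_support_bounded[OF assms] by blast
 have K: "K \<in> sets lborel" "emeasure lborel K < \<infinity>"
  using assms(2) emeasure_bounded_finite[OF compact_imp_bounded] by (auto simp: compact_imp_closed)
 have fm: "f \<in> borel_measurable lborel"
  using borel_measurable_continuous_onI[OF assms(1)] by simp
 have i1: "integrable lborel (\<lambda>x. c * indicator K x :: real)" for c
  using K by (intro integrable_mult_right integrable_real_indicator) auto
 show "integrable lborel f"
  by (rule Bochner_Integration.integrable_bound[OF i1[of B] fm])
    (use B assms(3) in "auto simp: indicator_def")
 have "integrable lborel (\<lambda>x. (norm (f x))\<^sup>2)"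
  by (rule Bochner_Integration.integrable_bound[OF i1[of "B\<^sup>2"]])
    (use B fm assms(3) in "auto simp: indicator_def intro!: power_mono")
 then show "sq_int lborel f" using fm by (simp add: sq_int_def)
qed

lemma test_sq_int:
 assumes "\<phi> \<in> test_functions S" shows "sq_int lborel \<phi>" "integrable lborel \<phi>"
proof -
 have sK: "smooth \<phi>" using assms by (rule test_smooth)
 obtain K where K: "compact K" "K \<subseteq> S" "!!x. x \<notin> K ==> \<phi> x = 0"
  using test_functionsD[OF assms] by blast
 show "sq_int lborel \<phi>" "integrable lborel \<phi>"
  using sq_int_continuous_compact_support[OF smooth_continuous[OF sK] K(1,3)] by auto
qed

lemma test_outside: "\<phi> \<in> test_functions S ==> x \<notin> S ==> \<phi> x = 0"
 using test_functionsD[of \<phi> S] by blast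

lemma test_borel: "\<phi> \<in> test_functions S ==> \<phi> \<in> borel_measurable borel"
 by (intro borel_measurable_continuous_onI smooth_continuous test_smooth)

subsection \<open>Products and slices\<close>

lemma smooth_slice: "smooth \<phi> ==> smooth (\<lambda>x. \<phi> (x, t))" for \<phi> :: "'a::euclidean_space \<times> real => real"
proof -
 assume "smooth \<phi>"
 then have "smooth (\<lambda>x. \<phi> ((x, 0) + (0, t)))"
  by (intro smooth_comp_affine bounded_linear_Pair bounded_linear_ident bounded_linear_zero)
 then show ?thesis by simp
qed

lemma pderiv_dir_slice:
 fixes \<phi> :: "'a::euclidean_space \<times> real => real"
 assumes "smooth \<phi>"
 shows "pderiv_dir b (\<lambda>x. \<phi> (x, t)) x = pderiv_dir (b, 0) \<phi> (x, t)"
proof (rule pderiv_dir_eq)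
 have "bounded_linear (\<lambda>x::'a. (x, 0::real))"
  by (intro bounded_linear_Pair bounded_linear_ident bounded_linear_zero)
 from has_derivative_comp_affine[OF this smooth_differentiable[OF assms], where x=x and c="(0, t)"]
 show "((\<lambda>x. \<phi> (x, t)) has_derivative (\<lambda>h. pderiv_dir (h, 0) \<phi> (x, t))) (at x)" by simp
qed

lemma time_has_real_derivative:
 fixes \<phi> :: "'a::euclidean_space \<times> real => real"
 assumes "smooth \<phi>"
 shows "((\<lambda>t. \<phi> (x, t)) has_real_derivative pderiv_dir (0, 1) \<phi> (x, t)) (at t)"
proof -
 have "bounded_linear (\<lambda>t::real. (0::'a, t))"
  by (intro bounded_linear_Pair bounded_linear_ident bounded_linear_zero)
 from has_derivative_comp_affine[OF this smooth_differentiable[OF assms], where x=t and c="(x, 0)"]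
 have "((\<lambda>t. \<phi> (x, t)) has_derivative (\<lambda>h. pderiv_dir (0, h) \<phi> (x, t))) (at t)" by simp
 moreover have "(\<lambda>h. pderiv_dir (0, h) \<phi> (x, t)) = (*) (pderiv_dir (0, 1) \<phi> (x, t))"
 proof (rule ext)
  fix h :: real
  interpret bounded_linear "\<lambda>b. pderiv_dir b \<phi> (x, t)"
   using smooth_has_derivative[OF assms] by (rule has_derivative_bounded_linear)
  have "pderiv_dir (h *\<^sub>R (0, 1)) \<phi> (x, t) = h * pderiv_dir (0, 1) \<phi> (x, t)"
   by (subst scaleR) simp
  moreover have "h *\<^sub>R (0::'a, 1::real) = (0, h)" by simp
  ultimately show "pderiv_dir (0, h) \<phi> (x, t) = pderiv_dir (0, 1) \<phi> (x, t) * h" by (metis mult.commute)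
 qed
 ultimately show ?thesis by (simp only: has_field_derivative_def)
qed

lemma test_slice:
 fixes \<phi> :: "'a::euclidean_space \<times> real => real"
 assumes "\<phi> \<in> test_functions (S \<times> I)"
 shows "(\<lambda>x. \<phi> (x, t)) \<in> test_functions S"
proof -
 have sK: "smooth \<phi>" using assms by (rule test_smooth)
 obtain K where K: "compact K" "K \<subseteq> S \<times> I" "!!x. x \<notin> K ==> \<phi> x = 0"
  using test_functionsD[OF assms] by blast
 show ?thesis
 proof (rule test_functionsI[of _ "fst ` K"])
  show "smooth (\<lambda>x. \<phi> (x, t))" by (rule smooth_slice[OF sK])
  show "compact (fst ` K)" using K(1) by (intro compact_continuous_image continuous_intros)
  show "fst ` K \<subseteq> S" using K(2) by auto
  show "x \<in> fst ` K" if "\<phi> (x, t) \<noteq> 0" for x using that K(3) by force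
 qed
qed

lemma test_tensor:
 fixes \<xi> :: "'a::euclidean_space => real" and \<eta> :: "real => real"
 assumes "\<xi> \<in> test_functions S" "\<eta> \<in> test_functions I"
 shows "(\<lambda>z. \<eta> (snd z) * \<xi> (fst z)) \<in> test_functions (S \<times> I)"
proof -
 have sK: "smooth \<xi>" using assms(1) by (rule test_smooth)
 obtain K where K: "compact K" "K \<subseteq> S" "!!x. x \<notin> K ==> \<xi> x = 0"
  using test_functionsD[OF assms(1)] by blast
 have sL: "smooth \<eta>" using assms(2) by (rule test_smooth)
 obtain L where L: "compact L" "L \<subseteq> I" "!!x. x \<notin> L ==> \<eta> x = 0"
  using test_functionsD[OF assms(2)] by blast
 show ?thesis
 proof (rule test_functionsI[of _ "K \<times> L"])
  show "smooth (\<lambda>z. \<eta> (snd z) * \<xi> (fst z))"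
   by (rule smooth_mult[OF smooth_comp_linear[OF bounded_linear_snd sL] smooth_comp_linear[OF bounded_linear_fst sK]])
  show "compact (K \<times> L)" by (rule compact_Times[OF K(1) L(1)])
  show "K \<times> L \<subseteq> S \<times> I" using K L by auto
  show "z \<in> K \<times> L" if "\<eta> (snd z) * \<xi> (fst z) \<noteq> 0" for z
   using that K(3) L(3) by (cases z) auto
 qed
qed

lemma pderiv_dir_tensor:
 fixes \<xi> :: "'a::euclidean_space => real" and \<eta> :: "real => real"
 assumes "smooth \<xi>" "smooth \<eta>"
 shows "pderiv_dir (b, 0) (\<lambda>z. \<eta> (snd z) * \<xi> (fst z)) = (\<lambda>z. \<eta> (snd z) * pderiv_dir b \<xi> (fst z))"
  and "pderiv_dir (0, 1) (\<lambda>z. \<eta> (snd z) * \<xi> (fst z)) = (\<lambda>z. pderiv_dir 1 \<eta> (snd z) * \<xi> (fst z))"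
proof -
 have D: "((\<lambda>z. \<eta> (snd z) * \<xi> (fst z)) has_derivative
   (\<lambda>h. \<eta> (snd z) * pderiv_dir (fst h) \<xi> (fst z) + pderiv_dir (snd h) \<eta> (snd z) * \<xi> (fst z))) (at z)"
  for z :: "'a \<times> real"
  using has_derivative_comp_affine[OF bounded_linear_fst smooth_differentiable[OF assms(1)], where x=z and c=0]
   has_derivative_comp_affine[OF bounded_linear_snd smooth_differentiable[OF assms(2)], where x=z and c=0]
  by (intro has_derivative_mult) auto
 have 0: "pderiv_dir 0 \<xi> x = 0" "pderiv_dir 0 \<eta> y = 0" for x y
  using pderiv_dir_linear_expand[OF smooth_differentiable[OF assms(1)], of 0 x]
   pderiv_dir_linear_expand[OF smooth_differentiable[OF assms(2)], of 0 y] by auto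
 show "pderiv_dir (b, 0) (\<lambda>z. \<eta> (snd z) * \<xi> (fst z)) = (\<lambda>z. \<eta> (snd z) * pderiv_dir b \<xi> (fst z))"
  using pderiv_dir_eq[OF D] 0 by auto
 show "pderiv_dir (0, 1) (\<lambda>z. \<eta> (snd z) * \<xi> (fst z)) = (\<lambda>z. pderiv_dir 1 \<eta> (snd z) * \<xi> (fst z))"
  using pderiv_dir_eq[OF D] 0 by auto
qed

section \<open>Borel representatives\<close>

lemma AE_on_iff:
 assumes "S \<in> sets borel"
 shows "(AE x in lebesgue_on S. P x) \<longleftrightarrow> (AE x in lborel. x \<in> S --> P x)"
 using assms by (subst AE_restrict_space_iff) (auto simp: AE_completion_iff)

lemma borel_on: "h \<in> borel_measurable borel ==> h \<in> borel_measurable (lebesgue_on S)"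
 by (intro measurable_restrict_space1 measurable_completion) simp

lemma lebesgue_on_borel_rep:
 fixes f :: "'a::euclidean_space => real"
 assumes S: "S \<in> sets borel" and f: "f \<in> borel_measurable (lebesgue_on S)"
 obtains h where "h \<in> borel_measurable borel" "!!x. x \<notin> S ==> h x = 0" "AE x in lebesgue_on S. f x = h x"
proof -
 have "S \<in> sets lebesgue" using S by simp
 then have "(\<lambda>x. if x \<in> S then f x else 0) \<in> borel_measurable lebesgue"
  using f by (simp add: borel_measurable_if)
 from completion_ex_borel_measurable_real[OF this]
 obtain g where g: "g \<in> borel_measurable lborel" "AE x in lborel. (if x \<in> S then f x else 0) = g x" by blast
 show ?thesis
 proof
  show "(\<lambda>x. indicator S x * g x) \<in> borel_measurable borel" using g(1) S by simp
  show "AE x in lebesgue_on S. f x = indicator S x * g x"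
   unfolding AE_on_iff[OF S] using g(2) by eventually_elim auto
 qed auto
qed

lemma lebesgue_on_borel:
 fixes h :: "'a::euclidean_space => 'b::{banach, second_countable_topology}"
 assumes S: "S \<in> sets borel" and h: "h \<in> borel_measurable borel"
 shows "integral\<^sup>L (lebesgue_on S) h = (LBINT x. indicator S x *\<^sub>R h x)"
  and "integrable (lebesgue_on S) h \<longleftrightarrow> integrable lborel (\<lambda>x. indicator S x *\<^sub>R h x)"
proof -
 have "(\<lambda>x. indicator S x *\<^sub>R h x) \<in> borel_measurable lborel" using S h by simp
 then show "integral\<^sup>L (lebesgue_on S) h = (LBINT x. indicator S x *\<^sub>R h x)"
  "integrable (lebesgue_on S) h \<longleftrightarrow> integrable lborel (\<lambda>x. indicator S x *\<^sub>R h x)"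
  using S by (simp_all add: integral_restrict_space integrable_restrict_space integral_completion integrable_completion)
qed

lemma L2_iff: "f \<in> L2 S \<longleftrightarrow> sq_int (lebesgue_on S) f"
 by (simp add: L2_def sq_int_def)

lemma L2_norm_eq: "L2_norm S f = l2n (lebesgue_on S) f"
 by (simp add: L2_norm_def L2_inner_def l2n_def power2_eq_square)

lemma L2_inner_eq: "L2_inner S f g = (\<integral>x. f x \<bullet> g x \<partial>lebesgue_on S)"
 by (simp add: L2_inner_def)

lemma L2_inner_commute: "L2_inner S f g = L2_inner S g f"
 by (simp add: L2_inner_def mult.commute)

lemma sq_int_lebesgue_on:
 fixes h :: "'a::euclidean_space => 'b::euclidean_space"
 assumes "sq_int lborel h" "S \<in> sets borel"
 shows "sq_int (lebesgue_on S) h"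
proof -
 have m: "h \<in> borel_measurable borel" using assms(1) by (auto simp: sq_int_def)
 have "integrable lborel (\<lambda>x. indicator S x *\<^sub>R (norm (h x))\<^sup>2)"
  using assms by (intro integrable_mult_indicator) (auto simp: sq_int_def)
 then show ?thesis
  using m assms(2) by (auto simp: sq_int_def lebesgue_on_borel intro: borel_on)
qed

lemma sq_int_lborel_of_lebesgue_on:
 fixes h :: "'a::euclidean_space => real"
 assumes "sq_int (lebesgue_on S) h" "S \<in> sets borel" "h \<in> borel_measurable borel" "!!x. x \<notin> S ==> h x = 0"
 shows "sq_int lborel h"
proof -
 have "integrable lborel (\<lambda>x. indicator S x *\<^sub>R (norm (h x))\<^sup>2)"
  using assms lebesgue_on_borel(2)[OF assms(2), of "\<lambda>x. (norm (h x))\<^sup>2"] by (auto simp: sq_int_def)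
 moreover have "(\<lambda>x. indicator S x *\<^sub>R (norm (h x))\<^sup>2) = (\<lambda>x. (norm (h x))\<^sup>2)"
  using assms(4) by (auto simp: fun_eq_iff indicator_def)
 ultimately show ?thesis using assms(3) by (simp add: sq_int_def)
qed

lemma L2_rep:
 assumes "S \<in> sets borel" "f \<in> L2 S"
 obtains h where "sq_int lborel h" "!!x. x \<notin> S ==> h x = 0" "AE x in lebesgue_on S. f x = h x"
proof -
 have f: "sq_int (lebesgue_on S) f" using assms(2) by (simp add: L2_iff)
 obtain h where h: "h \<in> borel_measurable borel" "!!x. x \<notin> S ==> h x = 0" "AE x in lebesgue_on S. f x = h x"
  using lebesgue_on_borel_rep[OF assms(1) sq_int_measurable[OF f]] by blast
 have "AE x in lebesgue_on S. h x = f x" using h(3) by eventually_elim simp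
 then have "sq_int (lebesgue_on S) h"
  by (rule sq_int_cong_AE[OF f borel_on[OF h(1)]])
 then have "sq_int lborel h" by (rule sq_int_lborel_of_lebesgue_on[OF _ assms(1) h(1,2)])
 with h that show ?thesis by blast
qed

lemma L2_of_sq_int: "sq_int lborel h ==> S \<in> sets borel ==> h \<in> L2 S"
 by (simp add: L2_iff sq_int_lebesgue_on)

lemma L2_inner_lborel:
 assumes "S \<in> sets borel" "h \<in> borel_measurable borel" "k \<in> borel_measurable borel"
  "!!x. x \<notin> S ==> h x = 0 \<or> k x = 0"
 shows "L2_inner S h k = (LBINT x. h x * k x)"
proof -
 have "L2_inner S h k = (LBINT x. indicator S x *\<^sub>R (h x * k x))"
  unfolding L2_inner_def using assms by (intro lebesgue_on_borel) auto
 also have "\<dots> = (LBINT x. h x * k x)"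
  using assms(4) by (intro integral_cong_space) (auto simp: indicator_def)
 finally show ?thesis .
qed

lemma l2n_lborel:
 fixes h :: "'a::euclidean_space => 'b::euclidean_space"
 assumes "S \<in> sets borel" "h \<in> borel_measurable borel" "!!x. x \<notin> S ==> h x = 0"
 shows "l2n (lebesgue_on S) h = l2n lborel h"
proof -
 have "(\<integral>x. (norm (h x))\<^sup>2 \<partial>lebesgue_on S) = (LBINT x. indicator S x *\<^sub>R (norm (h x))\<^sup>2)"
  using assms by (intro lebesgue_on_borel) auto
 also have "\<dots> = (LBINT x. (norm (h x))\<^sup>2)"
  using assms(3) by (intro integral_cong_space) (auto simp: indicator_def)
 finally show ?thesis by (simp add: l2n_def)
qed

lemma L2_inner_cong_AE:
 assumes "f \<in> borel_measurable (lebesgue_on S)" "f' \<in> borel_measurable (lebesgue_on S)"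
  "g \<in> borel_measurable (lebesgue_on S)" "g' \<in> borel_measurable (lebesgue_on S)"
  "AE x in lebesgue_on S. f x = f' x" "AE x in lebesgue_on S. g x = g' x"
 shows "L2_inner S f g = L2_inner S f' g'"
 unfolding L2_inner_def
proof (rule integral_cong_AE)
 show "AE x in lebesgue_on S. f x * g x = f' x * g' x" using assms(5,6) by eventually_elim simp
qed (use assms in auto)

lemma L2_measurable: "f \<in> L2 S ==> f \<in> borel_measurable (lebesgue_on S)"
 by (simp add: L2_def)

lemma L2_add: "f \<in> L2 S ==> g \<in> L2 S ==> (\<lambda>x. f x + g x) \<in> L2 S"
 by (auto simp: L2_iff)

lemma L2_diff: "f \<in> L2 S ==> g \<in> L2 S ==> (\<lambda>x. f x - g x) \<in> L2 S"
 by (auto simp: L2_iff)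

lemma L2_cmult: "f \<in> L2 S ==> (\<lambda>x. c * f x) \<in> L2 S"
 by (auto simp: L2_iff)

lemma L2_inner_integrable: "f \<in> L2 S ==> g \<in> L2 S ==> integrable (lebesgue_on S) (\<lambda>x. f x * g x)"
 by (auto simp: L2_iff intro: sq_int_mult)

lemma L2_inner_add_left: "f \<in> L2 S ==> g \<in> L2 S ==> h \<in> L2 S ==> L2_inner S (\<lambda>x. f x + g x) h = L2_inner S f h + L2_inner S g h"
 by (simp add: L2_inner_def distrib_right L2_inner_integrable)

lemma L2_inner_diff_left: "f \<in> L2 S ==> g \<in> L2 S ==> h \<in> L2 S ==> L2_inner S (\<lambda>x. f x - g x) h = L2_inner S f h - L2_inner S g h"
 by (simp add: L2_inner_def left_diff_distrib L2_inner_integrable)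

lemma L2_inner_cmult_left: "L2_inner S (\<lambda>x. c * f x) h = c * L2_inner S f h"
 by (simp add: L2_inner_def mult.assoc)

lemma L2_Cauchy_Schwarz: "f \<in> L2 S ==> g \<in> L2 S ==> \<bar>L2_inner S f g\<bar> <= L2_norm S f * L2_norm S g"
 using l2_Cauchy_Schwarz[of "lebesgue_on S" f g] by (simp add: L2_iff L2_norm_eq L2_inner_eq)

lemma test_L2: "\<phi> \<in> test_functions S ==> open S ==> \<phi> \<in> L2 S"
 by (intro L2_of_sq_int test_sq_int) auto

section \<open>The fundamental lemma of the calculus of variations\<close>

lemma sq_int_indicator:
 assumes "A \<in> sets borel" "emeasure lborel A < \<infinity>"
 shows "sq_int lborel (indicator A :: 'a::euclidean_space => real)"
proof -
 have "(\<lambda>x. (norm (indicator A x :: real))\<^sup>2) = indicator A" by (auto simp: fun_eq_iff indicator_def)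
 then show ?thesis using assms by (simp add: sq_int_def)
qed

text \<open>The bumps of the box increase to its indicator, and boxes generate the Borel sets: this is how
 the smooth test functions determine a function up to a null set.\<close>

lemma integral_box_eq_0:
 assumes h: "sq_int lborel h" and ac: "cbox a c \<subseteq> S"
  and 0: "!!\<phi>. \<phi> \<in> test_functions S ==> (LBINT x. h x * \<phi> x) = 0"
 shows "(LBINT x. indicator (box a c) x * h x) = 0"
proof -
 have hm[measurable]: "h \<in> borel_measurable borel" using h by (auto simp: sq_int_def)
 have bm[measurable]: "box_bump a c n \<in> borel_measurable borel" for n
  by (rule test_borel[OF box_bump_test[OF ac]])
 have "sq_int lborel (indicator (box a c) :: _ => real)"
  by (intro sq_int_indicator emeasure_bounded_finite) auto
 then have int: "integrable lborel (\<lambda>x. h x * indicator (box a c) x)"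
  by (rule sq_int_mult[OF h])
 have "(\<lambda>n. (LBINT x. h x * box_bump a c n x)) \<longlonglongrightarrow> (LBINT x. h x * indicator (box a c) x)"
 proof (rule integral_dominated_convergence[where w="\<lambda>x. norm (h x * indicator (box a c) x)"])
  show "AE x in lborel. (\<lambda>n. h x * box_bump a c n x) \<longlonglongrightarrow> h x * indicator (box a c) x"
   by (intro AE_I2 tendsto_intros box_bump_tendsto)
  show "AE x in lborel. norm (h x * box_bump a c n x) <= norm (h x * indicator (box a c) x)" for n
  proof (rule AE_I2)
   fix x
   show "norm (h x * box_bump a c n x) <= norm (h x * indicator (box a c) x)"
    using box_bump_bounds[of a c n x] box_bump_pos_iff[of a c n x]
    by (cases "x \<in> box a c") (auto simp: abs_mult intro: mult_left_le)
  qed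
 qed (use int in auto)
 moreover have "(LBINT x. h x * box_bump a c n x) = 0" for n
  by (rule 0[OF box_bump_test[OF ac]])
 ultimately have "(LBINT x. h x * indicator (box a c) x) = 0"
  using LIMSEQ_unique[of "\<lambda>n. 0::real"] by simp
 then show ?thesis by (simp add: mult.commute)
qed

lemma fundamental_lemma_lborel:
 fixes h :: "'a::euclidean_space => real"
 assumes S: "open S" and h: "sq_int lborel h"
  and 0: "!!\<phi>. \<phi> \<in> test_functions S ==> (LBINT x. h x * \<phi> x) = 0"
 shows "AE x in lborel. x \<in> S --> h x = 0"
proof -
 have hm[measurable]: "h \<in> borel_measurable borel" using h by (auto simp: sq_int_def)
 have box: "AE x in lborel. x \<in> box a c --> h x = 0" if ac: "cbox a c \<subseteq> S" for a c
 proof -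
  define f where "f x = indicator (box a c) x * h x" for x
  have "sq_int lborel (indicator (box a c) :: 'a => real)"
   by (intro sq_int_indicator emeasure_bounded_finite) auto
  then have f: "integrable lborel f" unfolding f_def by (rule sq_int_mult[OF _ h])
  have i: "integrable lborel (\<lambda>x. indicator A x * f x)" if "A \<in> sets borel" for A
   using integrable_mult_indicator[OF _ f, of A] that by simp
  have box0: "(LBINT x. indicator (box p q) x * f x) = 0" for p q
  proof -
   obtain p' q' where pq: "box p q \<inter> box a c = box p' q'" using box_Int_box by blast
   have "cbox p' q' \<subseteq> S \<or> box p' q' = {}"
   proof (cases "box p' q' = {}")
    case False
    then have "cbox p' q' = closure (box p' q')" by (simp add: closure_box)
    also have "\<dots> \<subseteq> closure (box a c)" using pq by (intro closure_mono) auto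
    also have "\<dots> \<subseteq> cbox a c" by (intro closure_minimal box_subset_cbox closed_cbox)
    finally show ?thesis using ac by blast
   qed auto
   moreover have "(\<lambda>x. indicator (box p q) x * f x) = (\<lambda>x. indicator (box p' q') x * h x)"
    by (auto simp: f_def pq[symmetric] indicator_def)
   ultimately show ?thesis using integral_box_eq_0[OF h _ 0, of p' q'] by auto
  qed
  have total: "(LBINT x. f x) = 0"
   unfolding f_def by (rule integral_box_eq_0[OF h ac 0])
  have all: "(LBINT x. indicator A x * f x) = 0" if "A \<in> sets borel" for A
  proof -
   let ?G = "range (\<lambda>(a, b). box a b :: 'a set)"
   have A_in: "A \<in> sigma_sets UNIV ?G"
    using that by (simp add: borel_eq_box)
   have G1: "Int_stable ?G"
    by (auto simp: Int_stable_def) (metis (no_types, lifting) box_Int_box case_prod_conv rangeI)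
   have G2: "?G \<subseteq> Pow UNIV" by simp
   show ?thesis using G1 G2 A_in
   proof (induction rule: sigma_sets_induct_disjoint)
    case (basic A)
    then show ?case using box0 by auto
   next
    case empty
    show ?case by simp
   next
    case (compl A)
    then have Ab: "A \<in> sets borel" by (simp add: borel_eq_box)
    have "(LBINT x. indicator (UNIV - A) x * f x) = (LBINT x. f x - indicator A x * f x)"
     by (intro integral_cong_space) (auto simp: indicator_def)
    also have "\<dots> = 0" using f i[OF Ab] compl(2) total by simp
    finally show ?case .
   next
    case (union A)
    then have Ab: "A n \<in> sets borel" for n by (auto simp: borel_eq_box)
    have "set_lebesgue_integral lborel (\<Union>n. A n) f = (\<Sum>n. set_lebesgue_integral lborel (A n) f)"
     using union(1) Ab i[of "\<Union>n. A n"]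
     by (intro lebesgue_integral_countable_add) (auto simp: disjoint_family_on_def set_integrable_def)
    then show ?case
     using union(3) by (simp add: set_lebesgue_integral_def)
   qed
  qed
  have "AE x in lborel. f x = 0"
   by (rule sigma_finite_measure.density_zero[OF sigma_finite_lborel f]) (use all in "auto simp: set_lebesgue_integral_def")
  then show ?thesis by eventually_elim (auto simp: f_def)
 qed
 obtain D where D: "countable D" "D \<subseteq> Pow S" "!!X. X \<in> D ==> \<exists>a b. X = cbox a b" "\<Union>D = S"
  using open_countable_Union_open_cbox[OF S] by metis
 have "\<forall>X\<in>D. AE x in lborel. x \<in> X --> h x = 0"
 proof
  fix X assume X: "X \<in> D"
  then obtain a b where ab: "X = cbox a b" using D(3) by blast
  have "AE x in lborel. x \<notin> cbox a b - box a b"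
  proof (rule AE_not_in)
   have "cbox a b - box a b \<in> null_sets lebesgue"
    using negligible_frontier_interval[of a b] by (simp add: negligible_iff_null_sets)
   then show "cbox a b - box a b \<in> null_sets lborel"
    by (simp add: null_sets_completion_iff)
  qed
  moreover have "AE x in lborel. x \<in> box a b --> h x = 0"
   using X ab D(2) by (intro box) auto
  ultimately show "AE x in lborel. x \<in> X --> h x = 0"
   unfolding ab by eventually_elim auto
 qed
 then have "AE x in lborel. \<forall>X\<in>D. x \<in> X --> h x = 0"
  by (subst AE_ball_countable[OF D(1)])
 then show ?thesis
 proof eventually_elim
  case (elim x)
  then show ?case using D(4) by blast
 qed
qed

lemma fundamental_lemma:
 fixes f :: "'a::euclidean_space => real"
 assumes S: "open S" and f: "f \<in> L2 S"
  and 0: "!!\<phi>. \<phi> \<in> test_functions S ==> L2_inner S f \<phi> = 0"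
 shows "AE x in lebesgue_on S. f x = 0"
proof -
 have Sb: "S \<in> sets borel" using S by simp
 obtain h where h: "sq_int lborel h" "!!x. x \<notin> S ==> h x = 0" "AE x in lebesgue_on S. f x = h x"
  using L2_rep[OF Sb f] by blast
 have hm: "h \<in> borel_measurable borel" using h(1) by (auto simp: sq_int_def)
 have "(LBINT x. h x * \<phi> x) = 0" if \<phi>: "\<phi> \<in> test_functions S" for \<phi>
 proof -
  have "(LBINT x. h x * \<phi> x) = L2_inner S h \<phi>"
   using h(2) by (intro L2_inner_lborel[symmetric] Sb hm test_borel[OF \<phi>]) auto
  also have "\<dots> = L2_inner S f \<phi>"
   by (rule L2_inner_cong_AE)
     (use h(3) hm f test_borel[OF \<phi>] in "auto intro: borel_on L2_measurable")
  finally show ?thesis using 0[OF \<phi>] by simp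
 qed
 then have "AE x in lborel. x \<in> S --> h x = 0"
  by (rule fundamental_lemma_lborel[OF S h(1)])
 then have "AE x in lebesgue_on S. h x = 0" by (simp add: AE_on_iff[OF Sb])
 with h(3) show ?thesis by eventually_elim simp
qed

lemma L2_inner_eq_imp_AE_eq:
 assumes S: "open S" and f: "f \<in> L2 S" "g \<in> L2 S"
  and eq: "!!\<phi>. \<phi> \<in> test_functions S ==> L2_inner S f \<phi> = L2_inner S g \<phi>"
 shows "AE x in lebesgue_on S. f x = g x"
proof -
 have "AE x in lebesgue_on S. f x - g x = 0"
  by (rule fundamental_lemma[OF S L2_diff[OF f]])
    (use eq L2_inner_diff_left[OF f] test_L2[OF _ S] in auto)
 then show ?thesis by eventually_elim simp
qed

section \<open>Integration in one variable\<close>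

lemma primitive_of_continuous:
 fixes f :: "real => real"
 assumes f: "continuous_on UNIV f"
 obtains F where "!!t. (F has_real_derivative f t) (at t)" "F 0 = 0"
proof
 define F where "F t = (LBINT s=ereal 0..ereal t. f s)" for t
 show "(F has_real_derivative f t) (at t)" for t
 proof -
  define a b where "a = min 0 t - 1" and "b = max 0 t + 1"
  have "((\<lambda>u. LBINT y=ereal 0..ereal u. f y) has_vector_derivative f t) (at t within {a..b})"
   by (rule interval_integral_FTC2)
     (auto simp: a_def b_def intro: continuous_on_subset[OF f])
  moreover have "at t within {a..b} = at t"
   by (rule at_within_interior) (auto simp: a_def b_def)
  ultimately show ?thesis unfolding F_def by (simp add: has_real_derivative_iff_has_vector_derivative)
 qed
 show "F 0 = 0" by (simp add: F_def interval_integral_endpoints_same)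
qed

lemma integral_FTC_open:
 fixes F :: "real => real"
 assumes "a <= b" "!!t. (F has_real_derivative f t) (at t)" "continuous_on UNIV f"
 shows "(LBINT t. indicator {a<..<b} t * f t) = F b - F a"
  and "integrable lborel (\<lambda>t. indicator {a<..<b} t * f t)"
proof -
 have c: "(LBINT t. f t * indicator {a..b} t) = F b - F a"
  by (rule integral_FTC_Icc_real) (use assms in "auto simp: continuous_on_eq_continuous_at")
 have m: "f \<in> borel_measurable borel" using assms(3) by (rule borel_measurable_continuous_onI)
 have ae: "AE t in lborel. indicator {a<..<b} t * f t = f t * indicator {a..b} t"
  using AE_lborel_singleton[of a] AE_lborel_singleton[of b] by eventually_elim (auto simp: indicator_def)
 show "(LBINT t. indicator {a<..<b} t * f t) = F b - F a"
  unfolding c[symmetric] using m ae by (intro integral_cong_AE) auto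
 have "integrable lborel (\<lambda>t. f t * indicator {a..b} t)"
  using borel_integrable_atLeastAtMost[of a b f] assms(3)
  by (simp add: continuous_on_eq_continuous_at indicator_def if_distrib cong: if_cong)
 then show "integrable lborel (\<lambda>t. indicator {a<..<b} t * f t)"
 proof (rule integrable_cong_AE_imp)
  show "AE t in lborel. f t * indicator {a..b} t = indicator {a<..<b} t * f t"
   using ae by eventually_elim (simp only:)
 qed (use m in simp)
qed

lemma product_integrable:
 fixes f :: "'a::euclidean_space => real" and g :: "'b::euclidean_space => real"
 assumes f: "integrable lborel f" and g: "integrable lborel g"
 shows "integrable (lborel \<Otimes>\<^sub>M lborel) (\<lambda>z. f (fst z) * g (snd z))"
proof (rule lborel_pair.Fubini_integrable)
 have [measurable]: "f \<in> borel_measurable lborel" "g \<in> borel_measurable lborel" using f g by auto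
 show "(\<lambda>z. f (fst z) * g (snd z)) \<in> borel_measurable (lborel \<Otimes>\<^sub>M lborel)" by measurable
 have "integrable lborel (\<lambda>x. norm (f x) * (LBINT y. norm (g y)))" using f by auto
 then show "integrable lborel (\<lambda>x. (LBINT y. norm (f (fst (x, y)) * g (snd (x, y)))))"
  by (simp add: abs_mult)
 show "AE x in lborel. integrable lborel (\<lambda>y. f (fst (x, y)) * g (snd (x, y)))" using g by simp
qed

definition prim :: "(real => real) => real => real" where
 "prim k t = (LBINT s. indicator {0<..<t} s * k s)"

lemma prim_borel [measurable]:
 assumes [measurable]: "k \<in> borel_measurable borel"
 shows "prim k \<in> borel_measurable borel"
proof -
 have "(\<lambda>(t, s). (if 0 < s & s < t then 1 else 0) * k s) \<in> borel_measurable (borel \<Otimes>\<^sub>M lborel)"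
  by measurable
 then have "(\<lambda>t. (LBINT s. (if 0 < s & s < t then 1 else 0) * k s)) \<in> borel_measurable borel"
  by (intro lborel.borel_measurable_lebesgue_integral) simp
 moreover have "(if 0 < s & s < t then 1 else 0) = (indicator {0<..<t} s :: real)" for s t :: real
  by (auto simp: indicator_def)
 ultimately show ?thesis by (simp add: prim_def[abs_def])
qed

lemma prim_0 [simp]: "prim k 0 = 0"
 by (simp add: prim_def)

lemma prim_abs_le:
 assumes "integrable lborel k" shows "\<bar>prim k t\<bar> <= (LBINT s. \<bar>k s\<bar>)"
proof -
 have i: "integrable lborel (\<lambda>s. indicator {0<..<t} s * k s)"
  using integrable_mult_indicator[OF _ assms, of "{0<..<t}"] by simp
 have "\<bar>prim k t\<bar> <= (LBINT s. \<bar>indicator {0<..<t} s * k s\<bar>)"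
  unfolding prim_def using integral_norm_bound[of lborel "\<lambda>s. indicator {0<..<t} s * k s"] by simp
 also have "\<dots> <= (LBINT s. \<bar>k s\<bar>)"
  using i assms by (intro integral_mono) (auto simp: indicator_def)
 finally show ?thesis .
qed

text \<open>Fubini on the triangle \<open>s < t\<close>; both formulas for primitives below are instances of
 it.\<close>

lemma triangle_swap:
 fixes f k :: "real => real"
 assumes f: "integrable lborel f" and k: "integrable lborel k"
 shows "(LBINT t. f t * (LBINT s. indicator {..<t} s * k s))
    = (LBINT s. k s * (LBINT t. indicator {s<..} t * f t))"
proof -
 have [measurable]: "f \<in> borel_measurable borel" "k \<in> borel_measurable borel" using f k by auto
 define F where "F t s = (if s < t then f t * k s else 0)" for t s
 have "integrable (lborel \<Otimes>\<^sub>M lborel) (case_prod F)"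
 proof (rule Bochner_Integration.integrable_bound[OF product_integrable[OF f k]])
  show "case_prod F \<in> borel_measurable (lborel \<Otimes>\<^sub>M lborel)" unfolding F_def by measurable
 qed (auto simp: F_def)
 from lborel_pair.Fubini_integral[OF this]
 have "(LBINT s. (LBINT t. F t s)) = (LBINT t. (LBINT s. F t s))" .
 moreover have "(LBINT t. F t s) = k s * (LBINT t. indicator {s<..} t * f t)" for s
  unfolding integral_mult_right_zero[symmetric]
  by (rule integral_cong_space) (auto simp: F_def indicator_def)
 moreover have "(LBINT s. F t s) = f t * (LBINT s. indicator {..<t} s * k s)" for t
  unfolding integral_mult_right_zero[symmetric]
  by (rule integral_cong_space) (auto simp: F_def indicator_def)
 ultimately show ?thesis by simp
qed

lemma prim_by_parts:
 fixes \<zeta> \<zeta>' k :: "real => real"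
 assumes k: "integrable lborel k" and T: "0 <= T"
  and \<zeta>: "!!t. (\<zeta> has_real_derivative \<zeta>' t) (at t)" "continuous_on UNIV \<zeta>'"
 shows "(LBINT t. indicator {0<..<T} t * (\<zeta>' t * prim k t))
    = (LBINT s. indicator {0<..<T} s * ((\<zeta> T - \<zeta> s) * k s))"
proof -
 define f where "f t = indicator {0<..<T} t * \<zeta>' t" for t
 define k' where "k' s = indicator {0<..<T} s * k s" for s
 have f: "integrable lborel f" unfolding f_def by (rule integral_FTC_open[OF T \<zeta>])
 have k': "integrable lborel k'"
  unfolding k'_def using integrable_mult_indicator[OF _ k, of "{0<..<T}"] by simp
 have "(LBINT t. indicator {0<..<T} t * (\<zeta>' t * prim k t))
   = (LBINT t. f t * (LBINT s. indicator {..<t} s * k' s))"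
 proof (rule integral_cong_pw)
  fix t
  have "prim k t = (LBINT s. indicator {..<t} s * k' s)" if "t \<in> {0<..<T}"
   unfolding prim_def k'_def
   by (rule integral_cong_space) (use that in "auto simp: indicator_def")
  then show "indicator {0<..<T} t * (\<zeta>' t * prim k t) = f t * (LBINT s. indicator {..<t} s * k' s)"
   by (cases "t \<in> {0<..<T}") (auto simp: f_def)
 qed
 also have "\<dots> = (LBINT s. k' s * (LBINT t. indicator {s<..} t * f t))"
  by (rule triangle_swap[OF f k'])
 also have "\<dots> = (LBINT s. indicator {0<..<T} s * ((\<zeta> T - \<zeta> s) * k s))"
 proof (rule integral_cong_pw)
  fix s
  have "(LBINT t. indicator {s<..} t * f t) = \<zeta> T - \<zeta> s" if s: "s \<in> {0<..<T}"
  proof -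
   have "(LBINT t. indicator {s<..} t * f t) = (LBINT t. indicator {s<..<T} t * \<zeta>' t)"
    by (rule integral_cong_space) (use s in "auto simp: f_def indicator_def")
   also have "\<dots> = \<zeta> T - \<zeta> s" by (rule integral_FTC_open[OF _ \<zeta>]) (use s in auto)
   finally show ?thesis .
  qed
  then show "k' s * (LBINT t. indicator {s<..} t * f t) = indicator {0<..<T} s * ((\<zeta> T - \<zeta> s) * k s)"
   by (cases "s \<in> {0<..<T}") (auto simp: k'_def)
 qed
 finally show ?thesis .
qed

text \<open>The two triangles \<open>s < t\<close> and \<open>t < s\<close> contribute equally to
 \<open>(\<integral> k)\<^sup>2\<close>. This replaces the derivative of \<open>K\<^sup>2\<close> for a
 primitive that is only absolutely continuous, and is the source of all energy identities.\<close>

lemma prim_square: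
 fixes k :: "real => real"
 assumes k: "integrable lborel k"
 shows "(LBINT t. indicator {0<..<r} t * (k t * prim k t)) = (prim k r)\<^sup>2 / 2"
proof -
 define f where "f t = indicator {0<..<r} t * k t" for t
 have f: "integrable lborel f"
  unfolding f_def using integrable_mult_indicator[OF _ k, of "{0<..<r}"] by simp
 have fm[measurable]: "f \<in> borel_measurable borel" using f by auto
 have i: "integrable lborel (\<lambda>s. indicator A s * f s)" if "A \<in> sets borel" for A
  using integrable_mult_indicator[OF _ f, of A] that by simp
 have tot: "prim k r = (LBINT s. f s)" by (simp add: prim_def f_def)
 have lhs: "(LBINT t. indicator {0<..<r} t * (k t * prim k t))
   = (LBINT t. f t * (LBINT s. indicator {..<t} s * f s))"
 proof (rule integral_cong_pw)
  fix t
  have "prim k t = (LBINT s. indicator {..<t} s * f s)" if "t \<in> {0<..<r}"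
   unfolding prim_def f_def
   by (rule integral_cong_space) (use that in "auto simp: indicator_def")
  then show "indicator {0<..<r} t * (k t * prim k t) = f t * (LBINT s. indicator {..<t} s * f s)"
   by (cases "t \<in> {0<..<r}") (auto simp: f_def)
 qed
 have split: "(LBINT s. indicator {..<t} s * f s) + (LBINT s. indicator {t<..} s * f s) = prim k r" for t
 proof -
  have "(LBINT s. indicator {..<t} s * f s) + (LBINT s. indicator {t<..} s * f s)
    = (LBINT s. indicator {..<t} s * f s + indicator {t<..} s * f s)"
   by (rule Bochner_Integration.integral_add[symmetric]) (auto intro: i)
  also have "\<dots> = (LBINT s. f s)"
  proof (rule integral_cong_AE)
   show "AE s in lborel. indicator {..<t} s * f s + indicator {t<..} s * f s = f s"
    using AE_lborel_singleton[of t] by eventually_elim (auto simp: indicator_def)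
  qed auto
  finally show ?thesis using tot by simp
 qed
 define A where "A t = (LBINT s. indicator {..<t} s * f s)" for t
 define B where "B t = (LBINT s. indicator {t<..} s * f s)" for t
 have "(LBINT t. f t * A t) = (LBINT t. f t * B t)"
  unfolding A_def B_def by (rule triangle_swap[OF f f])
 also have "\<dots> = (LBINT t. f t * prim k r - f t * A t)"
 proof (rule integral_cong_pw)
  fix t
  have "B t = prim k r - A t" using split[of t] by (simp add: A_def B_def)
  then show "f t * B t = f t * prim k r - f t * A t" by (simp add: right_diff_distrib)
 qed
 also have "\<dots> = (LBINT t. f t * prim k r) - (LBINT t. f t * A t)"
 proof (rule Bochner_Integration.integral_diff)
  have "A \<in> borel_measurable borel"
  proof -
   have "(\<lambda>(t, s). (if s < t then 1 else 0) * f s) \<in> borel_measurable (borel \<Otimes>\<^sub>M lborel)"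
    by measurable
   then have "(\<lambda>t. (LBINT s. (if s < t then 1 else 0) * f s)) \<in> borel_measurable borel"
    by (intro lborel.borel_measurable_lebesgue_integral) simp
   moreover have "(if s < t then 1 else 0) = (indicator {..<t} s :: real)" for s t :: real
    by (auto simp: indicator_def)
   ultimately show ?thesis by (simp add: A_def[abs_def])
  qed
  moreover have "\<bar>A t\<bar> <= (LBINT s. \<bar>f s\<bar>)" for t
  proof -
   have "\<bar>A t\<bar> <= (LBINT s. \<bar>indicator {..<t} s * f s\<bar>)"
    unfolding A_def using integral_norm_bound[of lborel "\<lambda>s. indicator {..<t} s * f s"] by simp
   also have "\<dots> <= (LBINT s. \<bar>f s\<bar>)"
    using i[of "{..<t}"] f by (intro integral_mono) (auto simp: indicator_def)
   finally show ?thesis .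
  qed
  ultimately show "integrable lborel (\<lambda>t. f t * A t)"
   by (intro Bochner_Integration.integrable_bound[OF integrable_mult_right[of "(LBINT s. \<bar>f s\<bar>)", OF integrable_abs[OF f]]])
     (auto simp: abs_mult intro!: mult_mono simp: mult.commute[of "\<bar>f _\<bar>"])
 qed (use f in auto)
 also have "(LBINT t. f t * prim k r) = (prim k r)\<^sup>2" using tot by (simp add: power2_eq_square)
 finally have "(LBINT t. f t * A t) = (prim k r)\<^sup>2 / 2" by simp
 then show ?thesis using lhs unfolding A_def by simp
qed

lemma zero_mean_test_primitive:
 fixes T :: real
 assumes \<theta>: "\<theta> \<in> test_functions {0<..<T}" and 0: "(LBINT s. \<theta> s) = 0" and T: "0 < T"
 obtains \<eta> where "\<eta> \<in> test_functions {0<..<T}" "pderiv_dir 1 \<eta> = \<theta>"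
proof -
 have s: "smooth \<theta>" using \<theta> by (rule test_smooth)
 obtain K where K: "compact K" "K \<subseteq> {0<..<T}" "!!x. x \<notin> K ==> \<theta> x = 0"
  using test_functionsD[OF \<theta>] by blast
 obtain a b where ab: "0 < a" "a <= b" "b < T" "K \<subseteq> {a..b}"
 proof (cases "K = {}")
  case True
  then show ?thesis using that[of "T/2" "T/2"] T by auto
 next
  case False
  have "Inf K \<in> K" "Sup K \<in> K" using K(1) False
   by (auto intro!: closed_contains_Inf closed_contains_Sup compact_imp_closed
     bounded_imp_bdd_below bounded_imp_bdd_above compact_imp_bounded)
  moreover have "K \<subseteq> {Inf K..Sup K}" using K(1)
   by (auto intro!: cInf_lower cSup_upper bounded_imp_bdd_below bounded_imp_bdd_above compact_imp_bounded)
  ultimately show ?thesis using that[of "Inf K" "Sup K"] K(2) by fastforce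
 qed
 obtain \<eta> where \<eta>: "!!t. (\<eta> has_real_derivative \<theta> t) (at t)" "\<eta> 0 = 0"
  using primitive_of_continuous[OF smooth_continuous[OF s]] by blast
 have d: "pderiv_dir 1 \<eta> = \<theta>" using pderiv_dir_real_eq[OF \<eta>(1)] by auto
 have diff: "\<eta> differentiable (at x)" for x
  using \<eta>(1)[of x] by (auto simp: real_differentiable_def intro: field_differentiable_imp_differentiable)
 have "Ck k \<eta>" for k
 proof (rule Ck_SucD)
  show "Ck (Suc k) \<eta>" using diff d s by (simp add: smooth_def)
 qed
 then have sm: "smooth \<eta>" by (simp add: smooth_def)
 have FTC: "(LBINT t. indicator {u<..<v} t * \<theta> t) = \<eta> v - \<eta> u" if "u <= v" for u v
  by (rule integral_FTC_open[OF that \<eta>(1) smooth_continuous[OF s]])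
 have out: "\<eta> x = 0" if "x \<notin> {a..b}" for x
 proof -
  have \<theta>0: "\<theta> y = 0" if "y \<notin> {a..b}" for y using K(3) ab(4) that by blast
  have "(x < a & x \<ge> 0) \<or> x < 0 \<or> x > b" using that by auto
  then consider "x < a" "x \<ge> 0" | "x < 0" | "x > b" by blast
  then show ?thesis
  proof cases
   case 1
   have "(LBINT t. indicator {0<..<x} t * \<theta> t) = (\<integral>t. 0 \<partial>(lborel::real measure))"
    by (rule integral_cong_space) (use 1 \<theta>0 ab in "auto simp: indicator_def")
   then show ?thesis using FTC[of 0 x] 1 \<eta>(2) by simp
  next
   case 2
   have "(LBINT t. indicator {x<..<0} t * \<theta> t) = (\<integral>t. 0 \<partial>(lborel::real measure))"
    by (rule integral_cong_space) (use 2 \<theta>0 ab in "auto simp: indicator_def")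
   then show ?thesis using FTC[of x 0] 2 \<eta>(2) by simp
  next
   case 3
   have "(LBINT t. indicator {0<..<x} t * \<theta> t) = (LBINT t. \<theta> t)"
   proof (rule integral_cong_pw)
    fix s show "indicator {0<..<x} s * \<theta> s = \<theta> s"
     using 3 ab \<theta>0[of s] by (cases "s \<in> {a..b}") auto
   qed
   then show ?thesis using FTC[of 0 x] 3 ab \<eta>(2) 0 by simp
  qed
 qed
 have "\<eta> \<in> test_functions {0<..<T}"
  by (rule test_functionsI[OF sm, of "{a..b}"]) (use ab out in auto)
 then show ?thesis using d that by blast
qed

text \<open>A test function is the derivative of a test function as soon as its mean vanishes; a multiple of
 one fixed bump corrects the mean.\<close>

lemma du_Bois_Reymond:
 fixes T :: real
 assumes T: "0 < T" and f: "f \<in> L2 {0<..<T}"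
  and 0: "!!\<eta>. \<eta> \<in> test_functions {0<..<T} ==> L2_inner {0<..<T} f (pderiv_dir 1 \<eta>) = 0"
 obtains c where "AE t in lebesgue_on {0<..<T}. f t = c"
proof -
 let ?I = "{0<..<T}"
 define \<beta> where "\<beta> = box_bump (T/4) (3*T/4) 0"
 have \<beta>: "\<beta> \<in> test_functions ?I"
  unfolding \<beta>_def by (rule box_bump_test) (use T in auto)
 have "(LBINT s. \<beta> s) \<noteq> 0"
 proof
  assume "(LBINT s. \<beta> s) = 0"
  moreover have "AE s in lborel. 0 <= \<beta> s" by (simp add: \<beta>_def box_bump_bounds)
  ultimately have "AE s in lborel. \<beta> s = 0"
   using integral_nonneg_eq_0_iff_AE[OF test_sq_int(2)[OF \<beta>]] by blast
  then have "AE s in lborel. s \<notin> {T/4<..<3*T/4}"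
   by eventually_elim (use box_bump_pos_iff[of "T/4" "3*T/4" 0] in "auto simp: \<beta>_def box_real")
  then have "emeasure lborel {T/4<..<3*T/4} = 0"
   by (subst (asm) AE_iff_measurable[of "{T/4<..<3*T/4}"]) auto
  then show False using T by simp
 qed
 define \<rho> where "\<rho> s = (1 / (LBINT s. \<beta> s)) * \<beta> s" for s
 have \<rho>: "\<rho> \<in> test_functions ?I" unfolding \<rho>_def by (rule test_cmult[OF \<beta>])
 have \<rho>1: "(LBINT s. \<rho> s) = 1"
  unfolding \<rho>_def using \<open>(LBINT s. \<beta> s) \<noteq> 0\<close> by simp
 define c where "c = L2_inner ?I f \<rho>"
 have fin: "finite_measure (lebesgue_on ?I)" by (rule finite_measure_lebesgue_on) simp
 have cL: "(\<lambda>t. c) \<in> L2 ?I" unfolding L2_iff by (rule finite_measure.sq_int_const[OF fin])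
 have "AE t in lebesgue_on ?I. f t = c"
 proof (rule L2_inner_eq_imp_AE_eq[OF _ f cL])
  fix \<psi> assume \<psi>: "\<psi> \<in> test_functions ?I"
  define m where "m = (LBINT s. \<psi> s)"
  have \<theta>: "(\<lambda>s. \<psi> s - m * \<rho> s) \<in> test_functions ?I" by (intro test_diff test_cmult \<psi> \<rho>)
  have "(LBINT s. \<psi> s - m * \<rho> s) = 0"
   using test_sq_int(2)[OF \<psi>] test_sq_int(2)[OF \<rho>] \<rho>1 by (simp add: m_def)
  then obtain \<eta> where \<eta>: "\<eta> \<in> test_functions ?I" "pderiv_dir 1 \<eta> = (\<lambda>s. \<psi> s - m * \<rho> s)"
   using zero_mean_test_primitive[OF \<theta> _ T] by blast
  have "L2_inner ?I f (\<lambda>s. \<psi> s - m * \<rho> s) = L2_inner ?I f \<psi> - m * c"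
   unfolding c_def using f test_L2[OF \<psi>] test_L2[OF \<rho>]
   by (simp add: L2_inner_commute[of _ f] L2_inner_diff_left L2_inner_cmult_left L2_cmult)
  then have "L2_inner ?I f \<psi> = m * c" using 0[OF \<eta>(1)] \<eta>(2) by simp
  also have "\<dots> = L2_inner ?I (\<lambda>t. c) \<psi>"
  proof -
   have "L2_inner ?I (\<lambda>t. c) \<psi> = (LBINT x. c * \<psi> x)"
    by (rule L2_inner_lborel) (use test_borel[OF \<psi>] test_outside[OF \<psi>] in auto)
   then show ?thesis by (simp add: m_def)
  qed
  finally show "L2_inner ?I f \<psi> = L2_inner ?I (\<lambda>t. c) \<psi>" .
 qed simp
 then show ?thesis by (rule that)
qed

section \<open>Fubini on space-time\<close>

lemma Fubini_xt:
 fixes h :: "'a::euclidean_space \<times> real => real"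
 assumes h: "integrable lborel h"
 shows "AE x in lborel. integrable lborel (\<lambda>t. h (x, t))"
  and "AE t in lborel. integrable lborel (\<lambda>x. h (x, t))"
  and "integrable lborel (\<lambda>x. (LBINT t. h (x, t)))"
  and "integrable lborel (\<lambda>t. (LBINT x. h (x, t)))"
  and "(LBINT x. (LBINT t. h (x, t))) = (LBINT z. h z)"
  and "(LBINT t. (LBINT x. h (x, t))) = (LBINT z. h z)"
proof -
 have h1: "integrable (lborel \<Otimes>\<^sub>M lborel) h" using h by (simp add: lborel_prod)
 have h2: "integrable (lborel \<Otimes>\<^sub>M lborel) (\<lambda>z. h (snd z, fst z))"
  using lborel_pair.integrable_product_swap[OF h1] by (simp add: case_prod_beta')
 show "AE x in lborel. integrable lborel (\<lambda>t. h (x, t))"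
  using lborel_pair.AE_integrable_fst'[OF h1] .
 show "AE t in lborel. integrable lborel (\<lambda>x. h (x, t))"
  using lborel_pair.AE_integrable_fst'[OF h2] by simp
 show "integrable lborel (\<lambda>x. (LBINT t. h (x, t)))"
  using lborel_pair.integrable_fst'[OF h1] .
 show "integrable lborel (\<lambda>t. (LBINT x. h (x, t)))"
  using lborel_pair.integrable_fst'[OF h2] by simp
 show e: "(LBINT x. (LBINT t. h (x, t))) = (LBINT z. h z)"
  using lborel_pair.integral_fst'[OF h1] by (simp add: lborel_prod)
 show "(LBINT t. (LBINT x. h (x, t))) = (LBINT z. h z)"
  using lborel_pair.Fubini_integral[of "\<lambda>x t. h (x, t)"] h1 e by simp
qed

lemma AE_spacetime_slices:
 fixes P :: "'a::euclidean_space \<times> real => bool"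
 assumes "AE z in lborel. P z"
 shows "AE x in lborel. AE t in lborel. P (x, t)" and "AE t in lborel. AE x in lborel. P (x, t)"
proof -
 obtain N where N: "{z \<in> space lborel. \<not> P z} \<subseteq> N" "N \<in> null_sets (lborel :: ('a \<times> real) measure)"
  using AE_E[OF assms] by (metis null_setsI)
 have "N \<in> sets lborel" using N(2) by auto
 then have Nm: "N \<in> sets (lborel \<Otimes>\<^sub>M lborel)" by (simp only: lborel_prod)
 have "AE z in (lborel \<Otimes>\<^sub>M lborel). z \<notin> N"
  unfolding lborel_prod by (rule AE_not_in[OF N(2)])
 then have 1: "AE x in lborel. AE t in lborel. (x, t) \<notin> N" by (rule lborel_pair.AE_pair)
 have "{z \<in> space (lborel \<Otimes>\<^sub>M lborel). (fst z, snd z) \<notin> N} = space (lborel \<Otimes>\<^sub>M lborel) - N"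
  by (simp only: prod.collapse set_diff_eq)
 then have "{z \<in> space (lborel \<Otimes>\<^sub>M lborel). (fst z, snd z) \<notin> N} \<in> sets (lborel \<Otimes>\<^sub>M lborel)"
  using Nm by (metis sets.compl_sets)
 from lborel_pair.AE_commute[OF this] 1 have 2: "AE t in lborel. AE x in lborel. (x, t) \<notin> N" by simp
 have imp: "z \<notin> N ==> P z" for z using N(1) by auto
 show "AE x in lborel. AE t in lborel. P (x, t)"
  using 1 by (auto elim!: eventually_mono intro: imp)
 show "AE t in lborel. AE x in lborel. P (x, t)"
  using 2 by (auto elim!: eventually_mono intro: imp)
qed

lemma AE_spacetime_fst:
 assumes "AE x in (lborel :: 'a::euclidean_space measure). P x"
 shows "AE z in (lborel :: ('a \<times> real) measure). P (fst z)"
proof -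
 obtain N where N: "{x \<in> space lborel. \<not> P x} \<subseteq> N" "N \<in> null_sets (lborel :: 'a measure)"
  using AE_E[OF assms] by (metis null_setsI)
 have "N \<times> (UNIV :: real set) \<in> null_sets (lborel \<Otimes>\<^sub>M lborel)"
  using N(2) by (auto simp: null_sets_def lborel.emeasure_pair_measure_Times)
 then have "N \<times> (UNIV :: real set) \<in> null_sets lborel" by (simp add: lborel_prod)
 from AE_not_in[OF this] show ?thesis using N(1) by (auto elim!: eventually_mono)
qed

lemma spacetime_slice_borel:
 fixes h :: "'a::euclidean_space \<times> real => 'b::topological_space"
 assumes "h \<in> borel_measurable borel"
 shows "(\<lambda>x. h (x, t)) \<in> borel_measurable borel" "(\<lambda>t. h (x, t)) \<in> borel_measurable borel"
proof -
 have "(\<lambda>x. (x, t)) \<in> borel_measurable (borel :: 'a measure)"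
  "(\<lambda>t. (x, t)) \<in> borel_measurable (borel :: real measure)"
  by (intro borel_measurable_continuous_onI continuous_intros)+
 then show "(\<lambda>x. h (x, t)) \<in> borel_measurable borel" "(\<lambda>t. h (x, t)) \<in> borel_measurable borel"
  using measurable_compose[OF _ assms] by blast+
qed

lemma sq_int_slices:
 fixes h :: "'a::euclidean_space \<times> real => 'b::euclidean_space"
 assumes h: "sq_int lborel h"
 shows "AE t in lborel. sq_int lborel (\<lambda>x. h (x, t))"
  and "AE x in lborel. sq_int lborel (\<lambda>t. h (x, t))"
  and "integrable lborel (\<lambda>t. (l2n lborel (\<lambda>x. h (x, t)))\<^sup>2)"
  and "(LBINT t. (l2n lborel (\<lambda>x. h (x, t)))\<^sup>2) = (l2n lborel h)\<^sup>2"
  and "integrable lborel (\<lambda>x. (l2n lborel (\<lambda>t. h (x, t)))\<^sup>2)"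
  and "(LBINT x. (l2n lborel (\<lambda>t. h (x, t)))\<^sup>2) = (l2n lborel h)\<^sup>2"
proof -
 note F = Fubini_xt[OF sq_int_integrable[OF h]]
 have m: "h \<in> borel_measurable borel" using h by (auto simp: sq_int_def)
 show "AE t in lborel. sq_int lborel (\<lambda>x. h (x, t))"
  using F(2) by eventually_elim (use spacetime_slice_borel[OF m] in "simp add: sq_int_def")
 show "AE x in lborel. sq_int lborel (\<lambda>t. h (x, t))"
  using F(1) by eventually_elim (use spacetime_slice_borel[OF m] in "simp add: sq_int_def")
 show "integrable lborel (\<lambda>t. (l2n lborel (\<lambda>x. h (x, t)))\<^sup>2)"
  "(LBINT t. (l2n lborel (\<lambda>x. h (x, t)))\<^sup>2) = (l2n lborel h)\<^sup>2"
  "integrable lborel (\<lambda>x. (l2n lborel (\<lambda>t. h (x, t)))\<^sup>2)"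
  "(LBINT x. (l2n lborel (\<lambda>t. h (x, t)))\<^sup>2) = (l2n lborel h)\<^sup>2"
  using F(3-6) by (simp_all add: l2n_power2)
qed

lemma sq_int_tensor:
 fixes f :: "'a::euclidean_space => real" and g :: "real => real"
 assumes f: "sq_int lborel f" and g: "sq_int lborel g"
 shows "sq_int lborel (\<lambda>z. f (fst z) * g (snd z))"
proof -
 have [measurable]: "f \<in> borel_measurable borel" "g \<in> borel_measurable borel"
  using f g by (auto simp: sq_int_def)
 have "(\<lambda>z. f (fst z) * g (snd z)) \<in> borel_measurable (lborel \<Otimes>\<^sub>M lborel)" by measurable
 moreover have "integrable (lborel \<Otimes>\<^sub>M lborel) (\<lambda>z. (norm (f (fst z)))\<^sup>2 * (norm (g (snd z)))\<^sup>2)"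
  using f g by (intro product_integrable) (auto simp: sq_int_def)
 ultimately show ?thesis by (simp add: sq_int_def lborel_prod power_mult_distrib)
qed

lemma sq_int_interval: "sq_int lborel (indicator {a<..<b::real} :: real => real)"
 by (intro sq_int_indicator emeasure_bounded_finite) auto

section \<open>Square-integrable functions on the cylinder and their primitives in time\<close>

text \<open>Representatives that are Borel on all of space-time and vanish off the cylinder. Fubini, slices
 and primitives in time then need no restricted measures and no choice of null sets.\<close>

definition cyl :: "'a::euclidean_space set => real => ('a \<times> real => real) set" where
 "cyl \<Omega> T = {h. sq_int lborel h & (\<forall>z. z \<notin> cylinder \<Omega> T --> h z = 0)}"

definition tprim :: "('a \<times> real => real) => 'a \<times> real => real" where
 "tprim h z = prim (\<lambda>s. h (fst z, s)) (snd z)"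

lemma cylD:
 assumes "h \<in> cyl \<Omega> T"
 shows "sq_int lborel h" "!!z. z \<notin> cylinder \<Omega> T ==> h z = 0" "h \<in> borel_measurable borel"
proof -
 show "sq_int lborel h" "!!z. z \<notin> cylinder \<Omega> T ==> h z = 0" using assms unfolding cyl_def by blast+
 then show "h \<in> borel_measurable borel" by (simp add: sq_int_def)
qed

lemma cyl_diff: "h \<in> cyl \<Omega> T ==> k \<in> cyl \<Omega> T ==> (\<lambda>z. h z - k z) \<in> cyl \<Omega> T"
 by (auto simp: cyl_def)

lemma cyl_restrict:
 assumes "sq_int lborel h" "\<Omega> \<in> sets borel"
 shows "(\<lambda>z. indicator (cylinder \<Omega> T) z * h z) \<in> cyl \<Omega> T"
proof -
 have m: "h \<in> borel_measurable borel" using assms(1) by (auto simp: sq_int_def)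
 have [measurable]: "cylinder \<Omega> T \<in> sets borel"
  using assms(2) borel_prod by (metis greaterThanLessThan_borel pair_measureI)
 have "sq_int lborel (\<lambda>z. indicator (cylinder \<Omega> T) z * h z)"
  by (rule sq_int_bound[OF assms(1)]) (use m in "auto simp: indicator_def")
 then show ?thesis by (auto simp: cyl_def)
qed

lemma cylinder_borel: "open \<Omega> ==> cylinder \<Omega> T \<in> sets borel"
 by (intro borel_open open_Times) auto

lemma sq_int_supported_integrable:
 fixes k :: "real => real"
 assumes "sq_int lborel k" "!!t. t \<notin> {0<..<T} ==> k t = 0"
 shows "integrable lborel k"
proof -
 have "integrable lborel (\<lambda>t. indicator {0<..<T} t * k t)"
  by (rule sq_int_mult[OF sq_int_interval assms(1)])
 moreover have "(\<lambda>t. indicator {0<..<T} t * k t) = k"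
  using assms(2) by (auto simp: fun_eq_iff indicator_def)
 ultimately show ?thesis by simp
qed

lemma cyl_time_slices:
 assumes h: "h \<in> cyl \<Omega> T"
 shows "AE x in lborel. sq_int lborel (\<lambda>t. h (x, t)) & integrable lborel (\<lambda>t. h (x, t))"
 using sq_int_slices(2)[OF cylD(1)[OF h]]
proof eventually_elim
 case (elim x)
 have "integrable lborel (\<lambda>t. h (x, t))"
  by (rule sq_int_supported_integrable[OF elim, of T]) (use cylD(2)[OF h] in auto)
 with elim show ?case by simp
qed

lemma tprim_borel:
 fixes h :: "'a::euclidean_space \<times> real => real"
 assumes "h \<in> borel_measurable borel"
 shows "tprim h \<in> borel_measurable borel"
proof -
 have h[measurable]: "h \<in> borel_measurable (borel \<Otimes>\<^sub>M borel)" using assms by (simp add: borel_prod)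
 have "(\<lambda>(z, s). (if 0 < s & s < snd z then 1 else 0) * h (fst z, s))
   \<in> borel_measurable ((borel \<Otimes>\<^sub>M borel) \<Otimes>\<^sub>M lborel)"
  by measurable
 then have "(\<lambda>z. (LBINT s. (if 0 < s & s < snd z then 1 else 0) * h (fst z, s)))
   \<in> borel_measurable (borel \<Otimes>\<^sub>M borel)"
  by (intro lborel.borel_measurable_lebesgue_integral) simp
 moreover have "(if 0 < s & s < t then 1 else 0) = (indicator {0<..<t} s :: real)" for s t :: real
  by (auto simp: indicator_def)
 ultimately show ?thesis by (simp add: tprim_def[abs_def] prim_def borel_prod)
qed

lemma tprim_outside:
 assumes "h \<in> cyl \<Omega> T" "x \<notin> \<Omega> \<or> t <= 0" shows "tprim h (x, t) = 0"
proof -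
 have "indicator {0<..<t} s * h (x, s) = 0" for s
  using assms(2) cylD(2)[OF assms(1), of "(x, s)"] by (auto simp: indicator_def)
 then show ?thesis
  unfolding tprim_def prim_def by (simp only: fst_conv snd_conv Bochner_Integration.integral_zero)
qed

lemma tprim_0 [simp]: "tprim h (x, 0) = 0"
 by (simp add: tprim_def)

text \<open>Cauchy-Schwarz on the interval between \<open>s\<close> and \<open>t\<close>.\<close>

lemma prim_diff_square:
 assumes k: "sq_int lborel k" and st: "0 <= s" "s <= t"
 shows "(prim k t - prim k s)\<^sup>2 <= (t - s) * (l2n lborel k)\<^sup>2"
proof -
 define u :: "real => real" where "u r = indicator {0<..<t} r - indicator {0<..<s} r" for r
 have i: "integrable lborel (\<lambda>r. indicator {0<..<c} r * k r)" for c
  by (rule sq_int_mult[OF sq_int_interval k])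
 have u: "sq_int lborel u" unfolding u_def by (intro sq_int_diff sq_int_interval)
 have "prim k t - prim k s = (LBINT r. u r \<bullet> k r)"
  using i[of t] i[of s] by (simp add: prim_def u_def left_diff_distrib)
 then have "\<bar>prim k t - prim k s\<bar> <= l2n lborel u * l2n lborel k"
  using l2_Cauchy_Schwarz[OF u k] by simp
 then have "(prim k t - prim k s)\<^sup>2 <= (l2n lborel u * l2n lborel k)\<^sup>2"
  by (metis abs_le_square_iff abs_of_nonneg l2n_nonneg mult_nonneg_nonneg)
 moreover have "(l2n lborel u)\<^sup>2 = t - s"
 proof -
  have "(l2n lborel u)\<^sup>2 = (LBINT r. u r)"
   unfolding l2n_power2 using st by (intro integral_cong_space) (auto simp: u_def indicator_def)
  also have "\<dots> = t - s" using st by (simp add: u_def)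
  finally show ?thesis .
 qed
 ultimately show ?thesis by (simp add: power_mult_distrib)
qed

lemma tprim_L2_diff:
 assumes h: "h \<in> cyl \<Omega> T" and st: "0 <= s" "s <= t"
 shows "sq_int lborel (\<lambda>x. tprim h (x, t) - tprim h (x, s))"
  and "l2n lborel (\<lambda>x. tprim h (x, t) - tprim h (x, s)) <= sqrt (t - s) * l2n lborel h"
proof -
 note S = sq_int_slices[OF cylD(1)[OF h]]
 have m: "(\<lambda>x. tprim h (x, t) - tprim h (x, s)) \<in> borel_measurable lborel"
  using spacetime_slice_borel(1)[OF tprim_borel[OF cylD(3)[OF h]]] by simp
 have i: "integrable lborel (\<lambda>x. (t - s) * (l2n lborel (\<lambda>r. h (x, r)))\<^sup>2)" using S(5) by simp
 have ae: "AE x in lborel. (norm (tprim h (x, t) - tprim h (x, s)))\<^sup>2 <= (t - s) * (l2n lborel (\<lambda>r. h (x, r)))\<^sup>2"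
  using S(2) by eventually_elim (use prim_diff_square[OF _ st] in "simp add: tprim_def")
 have "integrable lborel (\<lambda>x. (norm (tprim h (x, t) - tprim h (x, s)))\<^sup>2)"
  by (rule Bochner_Integration.integrable_bound[OF i])
    (use m in auto, use ae in eventually_elim, use st in simp)
 then show sq: "sq_int lborel (\<lambda>x. tprim h (x, t) - tprim h (x, s))" using m by (simp add: sq_int_def)
 have "(l2n lborel (\<lambda>x. tprim h (x, t) - tprim h (x, s)))\<^sup>2 <= (LBINT x. (t - s) * (l2n lborel (\<lambda>r. h (x, r)))\<^sup>2)"
  unfolding l2n_power2[of lborel "\<lambda>x. tprim h (x, t) - tprim h (x, s)"]
  by (rule integral_mono_AE[OF sq_int_integrable[OF sq] i ae])
 also have "\<dots> = (sqrt (t - s) * l2n lborel h)\<^sup>2" using S(6) st by (simp add: power_mult_distrib)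
 finally show "l2n lborel (\<lambda>x. tprim h (x, t) - tprim h (x, s)) <= sqrt (t - s) * l2n lborel h"
  by (rule power2_le_imp_le) (use st in simp)
qed

lemma tprim_L2:
 assumes h: "h \<in> cyl \<Omega> T" and t: "0 <= t"
 shows "sq_int lborel (\<lambda>x. tprim h (x, t))" "l2n lborel (\<lambda>x. tprim h (x, t)) <= sqrt t * l2n lborel h"
 using tprim_L2_diff[OF h order_refl t] by simp_all

lemma tprim_cyl:
 assumes h: "h \<in> cyl \<Omega> T" and \<Omega>: "\<Omega> \<in> sets borel" and T: "0 <= T"
 shows "(\<lambda>z. indicator (cylinder \<Omega> T) z * tprim h z) \<in> cyl \<Omega> T"
proof -
 note S = sq_int_slices[OF cylD(1)[OF h]]
 have m: "tprim h \<in> borel_measurable borel" by (rule tprim_borel[OF cylD(3)[OF h]])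
 define g where "g z = indicator (cylinder \<Omega> T) z * tprim h z" for z
 have [measurable]: "cylinder \<Omega> T \<in> sets borel"
  using \<Omega> borel_prod by (metis greaterThanLessThan_borel pair_measureI)
 have gm: "g \<in> borel_measurable lborel" using m unfolding g_def by simp
 have "integrable lborel (indicator {0<..<T} :: real => real)" using T by simp
 from product_integrable[OF S(5) this]
 have i: "integrable lborel (\<lambda>z. T * ((l2n lborel (\<lambda>t. h (fst z, t)))\<^sup>2 * indicator {0<..<T} (snd z)))"
  by (simp add: lborel_prod)
 have ae: "AE z in lborel. (norm (g z))\<^sup>2 <= T * ((l2n lborel (\<lambda>t. h (fst z, t)))\<^sup>2 * indicator {0<..<T} (snd z))"
  using AE_spacetime_fst[OF S(2)]
 proof eventually_elim
  case (elim z)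
  have "(norm (g z))\<^sup>2 <= T * (l2n lborel (\<lambda>t. h (fst z, t)))\<^sup>2" if z: "z \<in> cylinder \<Omega> T"
  proof -
   have "(norm (g z))\<^sup>2 <= snd z * (l2n lborel (\<lambda>t. h (fst z, t)))\<^sup>2"
    using prim_diff_square[OF elim, of 0 "snd z"] z by (auto simp: g_def tprim_def)
   also have "\<dots> <= T * (l2n lborel (\<lambda>t. h (fst z, t)))\<^sup>2"
    using z by (intro mult_right_mono) auto
   finally show ?thesis .
  qed
  then show ?case using T
   by (cases "z \<in> cylinder \<Omega> T") (auto simp: g_def indicator_def)
 qed
 have "integrable lborel (\<lambda>z. (norm (g z))\<^sup>2)"
  by (rule Bochner_Integration.integrable_bound[OF i])
    (use gm in auto, use ae in eventually_elim, use T in simp)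
 then have "sq_int lborel g" using gm by (simp add: sq_int_def)
 then show ?thesis unfolding cyl_def by (auto simp: g_def[abs_def])
qed

text \<open>The reduction to one time variable: after testing with a function of space, Fubini turns the
 primitive in time of a space-time function into the primitive of a real function.\<close>

lemma slice_inner:
 fixes h :: "'a::euclidean_space \<times> real => real"
 assumes h: "h \<in> cyl \<Omega> T" and \<xi>: "sq_int lborel \<xi>"
 defines "k \<equiv> \<lambda>t. (LBINT x. h (x, t) * \<xi> x)"
 shows "integrable lborel k" "sq_int lborel k" "!!t. t \<notin> {0<..<T} ==> k t = 0"
  and "!!t. (LBINT x. tprim h (x, t) * \<xi> x) = prim k t"
proof -
 show z: "k t = 0" if "t \<notin> {0<..<T}" for t
  using cylD(2)[OF h] that by (simp add: k_def)
 have I: "integrable lborel (\<lambda>z. h z * (\<xi> (fst z) * indicator {0<..<t} (snd z)))" for t :: real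
  by (rule sq_int_mult[OF cylD(1)[OF h] sq_int_tensor[OF \<xi> sq_int_interval]])
 have e: "h (x, s) * (\<xi> x * indicator {0<..<T} s) = h (x, s) * \<xi> x" for x s
  using cylD(2)[OF h, of "(x, s)"] by (cases "s \<in> {0<..<T}") auto
 show k: "integrable lborel k"
  using Fubini_xt(4)[OF I[of T]] by (simp add: e k_def)
 show "sq_int lborel k"
 proof -
  have b1: "integrable lborel (\<lambda>t. (l2n lborel \<xi>)\<^sup>2 * (l2n lborel (\<lambda>x. h (x, t)))\<^sup>2)"
   using sq_int_slices(3)[OF cylD(1)[OF h]] by simp
  have b2: "AE t in lborel. norm ((norm (k t))\<^sup>2) <= norm ((l2n lborel \<xi>)\<^sup>2 * (l2n lborel (\<lambda>x. h (x, t)))\<^sup>2)"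
   using sq_int_slices(1)[OF cylD(1)[OF h]]
  proof eventually_elim
   case (elim t)
   have "\<bar>k t\<bar> <= l2n lborel (\<lambda>x. h (x, t)) * l2n lborel \<xi>"
    using l2_Cauchy_Schwarz[OF elim \<xi>] by (simp add: k_def)
   then have "\<bar>k t\<bar>\<^sup>2 <= (l2n lborel (\<lambda>x. h (x, t)) * l2n lborel \<xi>)\<^sup>2" by (intro power_mono) auto
   then show ?case by (simp add: power_mult_distrib mult.commute)
  qed
  have b3: "(\<lambda>t. (norm (k t))\<^sup>2) \<in> borel_measurable lborel"
   using borel_measurable_integrable[OF k] by measurable
  have "integrable lborel (\<lambda>t. (norm (k t))\<^sup>2)"
   by (rule Bochner_Integration.integrable_bound[OF b1 b3 b2])
  then show ?thesis using k by (auto simp: sq_int_def)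
 qed
 show "(LBINT x. tprim h (x, t) * \<xi> x) = prim k t" for t
 proof -
  have "(LBINT x. tprim h (x, t) * \<xi> x) = (LBINT x. (LBINT s. h (x, s) * (\<xi> x * indicator {0<..<t} s)))"
  proof (rule integral_cong_pw)
   fix x
   have "(LBINT s. h (x, s) * (\<xi> x * indicator {0<..<t} s)) = (LBINT s. \<xi> x * (indicator {0<..<t} s * h (x, s)))"
    by (rule integral_cong_space) auto
   then show "tprim h (x, t) * \<xi> x = (LBINT s. h (x, s) * (\<xi> x * indicator {0<..<t} s))"
    by (simp add: tprim_def prim_def)
  qed
  also have "\<dots> = (LBINT s. (LBINT x. h (x, s) * (\<xi> x * indicator {0<..<t} s)))"
   using Fubini_xt(5,6)[OF I[of t]] by simp
  also have "\<dots> = prim k t"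
   unfolding prim_def k_def
  proof (rule integral_cong_pw)
   fix s
   have "(LBINT x. h (x, s) * (\<xi> x * indicator {0<..<t} s)) = (LBINT x. indicator {0<..<t} s * (h (x, s) * \<xi> x))"
    by (rule integral_cong_space) auto
   then show "(LBINT x. h (x, s) * (\<xi> x * indicator {0<..<t} s)) = indicator {0<..<t} s * (LBINT x. h (x, s) * \<xi> x)"
    by simp
  qed
  finally show ?thesis .
 qed
qed

text \<open>For almost every \<open>x\<close> this is the formula for \<open>\<integral> k K\<close>; it is
 the energy identity on which uniqueness rests.\<close>

lemma tprim_energy:
 fixes h :: "'a::euclidean_space \<times> real => real"
 assumes h: "h \<in> cyl \<Omega> T" and \<Omega>: "\<Omega> \<in> sets borel" and r: "0 <= r" "r <= T"
 shows "(LBINT t. indicator {0<..<r} t * (LBINT x. h (x, t) * tprim h (x, t)))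
    = (l2n lborel (\<lambda>x. tprim h (x, r)))\<^sup>2 / 2"
  and "integrable lborel (\<lambda>t. indicator {0<..<r} t * (LBINT x. h (x, t) * tprim h (x, t)))"
proof -
 define g where "g z = indicator (cylinder \<Omega> T) z * tprim h z" for z
 have g: "g \<in> cyl \<Omega> T" unfolding g_def using r by (intro tprim_cyl[OF h \<Omega>]) simp
 have hg: "integrable lborel (\<lambda>z. h z * g z)" by (rule sq_int_mult[OF cylD(1)[OF h] cylD(1)[OF g]])
 have hge: "h z * g z = h z * tprim h z" for z
  using cylD(2)[OF h, of z] by (cases "z \<in> cylinder \<Omega> T") (auto simp: g_def)
 have hm: "h \<in> borel_measurable borel" "tprim h \<in> borel_measurable borel"
  using cylD(3)[OF h] tprim_borel by auto
 have I: "integrable lborel (\<lambda>z. indicator {0<..<r} (snd z) * (h z * tprim h z))"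
 proof (rule Bochner_Integration.integrable_bound[OF hg])
  have "snd \<in> borel_measurable (borel :: ('a \<times> real) measure)"
   by (intro borel_measurable_continuous_onI continuous_intros)
  then show "(\<lambda>z. indicator {0<..<r} (snd z) * (h z * tprim h z)) \<in> borel_measurable lborel"
   using hm by (intro borel_measurable_times) (auto intro!: measurable_compose[OF _ borel_measurable_indicator])
  show "AE z in lborel. norm (indicator {0<..<r} (snd z) * (h z * tprim h z)) <= norm (h z * g z)"
   unfolding hge by (auto simp: indicator_def)
 qed
 show "integrable lborel (\<lambda>t. indicator {0<..<r} t * (LBINT x. h (x, t) * tprim h (x, t)))"
  using Fubini_xt(4)[OF I] by simp
 have "(LBINT t. indicator {0<..<r} t * (LBINT x. h (x, t) * tprim h (x, t)))
   = (LBINT x. (LBINT t. indicator {0<..<r} t * (h (x, t) * tprim h (x, t))))"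
  using Fubini_xt(5,6)[OF I] by simp
 also have "\<dots> = (LBINT x. (tprim h (x, r))\<^sup>2 / 2)"
 proof (rule integral_cong_AE)
  show "(\<lambda>x. (LBINT t. indicator {0<..<r} t * (h (x, t) * tprim h (x, t)))) \<in> borel_measurable lborel"
   using Fubini_xt(3)[OF I] by auto
  show "(\<lambda>x. (tprim h (x, r))\<^sup>2 / 2) \<in> borel_measurable lborel"
   using spacetime_slice_borel(1)[OF hm(2)] by simp
  show "AE x in lborel. (LBINT t. indicator {0<..<r} t * (h (x, t) * tprim h (x, t))) = (tprim h (x, r))\<^sup>2 / 2"
   using cyl_time_slices[OF h]
   by eventually_elim (use prim_square in "simp add: tprim_def")
 qed
 also have "\<dots> = (l2n lborel (\<lambda>x. tprim h (x, r)))\<^sup>2 / 2" by (simp add: l2n_power2)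
 finally show "(LBINT t. indicator {0<..<r} t * (LBINT x. h (x, t) * tprim h (x, t)))
    = (l2n lborel (\<lambda>x. tprim h (x, r)))\<^sup>2 / 2" .
qed

lemma tprim_by_parts:
 fixes h \<psi> \<psi>' :: "'a::euclidean_space \<times> real => real"
 assumes h: "h \<in> cyl \<Omega> T" and \<Omega>: "\<Omega> \<in> sets borel" and T: "0 <= T"
  and \<psi>: "!!x t. ((\<lambda>t. \<psi> (x, t)) has_real_derivative \<psi>' (x, t)) (at t)" "!!x. \<psi> (x, T) = 0"
  and \<psi>': "continuous_on UNIV \<psi>'"
  and sq: "sq_int lborel \<psi>" "sq_int lborel \<psi>'"
 shows "(LBINT z. (indicator (cylinder \<Omega> T) z * tprim h z) * \<psi>' z) = - (LBINT z. h z * \<psi> z)"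
proof -
 define g where "g z = indicator (cylinder \<Omega> T) z * tprim h z" for z
 have g: "g \<in> cyl \<Omega> T" unfolding g_def by (rule tprim_cyl[OF h \<Omega> T])
 have I1: "integrable lborel (\<lambda>z. g z * \<psi>' z)" by (rule sq_int_mult[OF cylD(1)[OF g] sq(2)])
 have I2: "integrable lborel (\<lambda>z. h z * \<psi> z)" by (rule sq_int_mult[OF cylD(1)[OF h] sq(1)])
 have ge: "g (x, t) = indicator {0<..<T} t * tprim h (x, t)" for x t
  using tprim_outside[OF h, of x t] by (auto simp: g_def indicator_def)
 have "(LBINT z. g z * \<psi>' z) = (LBINT x. (LBINT t. g (x, t) * \<psi>' (x, t)))"
  using Fubini_xt(5)[OF I1] by simp
 also have "\<dots> = (LBINT x. - (LBINT t. h (x, t) * \<psi> (x, t)))"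
 proof (rule integral_cong_AE)
  show "(\<lambda>x. (LBINT t. g (x, t) * \<psi>' (x, t))) \<in> borel_measurable lborel"
   using Fubini_xt(3)[OF I1] by auto
  show "(\<lambda>x. - (LBINT t. h (x, t) * \<psi> (x, t))) \<in> borel_measurable lborel"
   using Fubini_xt(3)[OF I2] by auto
  show "AE x in lborel. (LBINT t. g (x, t) * \<psi>' (x, t)) = - (LBINT t. h (x, t) * \<psi> (x, t))"
   using cyl_time_slices[OF h]
  proof eventually_elim
   case (elim x)
   have c: "continuous_on UNIV (\<lambda>t. \<psi>' (x, t))"
    by (intro continuous_on_compose2[OF \<psi>'] continuous_intros) auto
   have "(LBINT t. g (x, t) * \<psi>' (x, t)) = (LBINT t. indicator {0<..<T} t * (\<psi>' (x, t) * prim (\<lambda>s. h (x, s)) t))"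
    by (rule integral_cong_space) (auto simp: ge tprim_def)
   also have "\<dots> = (LBINT s. indicator {0<..<T} s * ((\<psi> (x, T) - \<psi> (x, s)) * h (x, s)))"
    by (rule prim_by_parts[OF _ T \<psi>(1) c]) (use elim in blast)
   also have "\<dots> = (LBINT s. - (h (x, s) * \<psi> (x, s)))"
   proof (rule integral_cong_pw)
    fix s
    show "indicator {0<..<T} s * ((\<psi> (x, T) - \<psi> (x, s)) * h (x, s)) = - (h (x, s) * \<psi> (x, s))"
     using \<psi>(2) cylD(2)[OF h, of "(x, s)"] by (cases "s \<in> {0<..<T}") auto
   qed
   finally show ?case by simp
  qed
 qed
 also have "\<dots> = - (LBINT z. h z * \<psi> z)" using Fubini_xt(5)[OF I2] by simp
 finally show ?thesis unfolding g_def .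
qed

lemma tprim_diff_AE:
 assumes h: "h \<in> cyl \<Omega> T" and k: "k \<in> cyl \<Omega> T"
 shows "AE x in lborel. \<forall>t. tprim (\<lambda>z. h z - k z) (x, t) = tprim h (x, t) - tprim k (x, t)"
 using cyl_time_slices[OF h] cyl_time_slices[OF k]
proof eventually_elim
 case (elim x)
 have "integrable lborel (\<lambda>s. indicator {0<..<t} s * h (x, s))" "integrable lborel (\<lambda>s. indicator {0<..<t} s * k (x, s))" for t
  using elim by (auto intro!: sq_int_mult sq_int_interval)
 then show ?case by (simp add: tprim_def prim_def right_diff_distrib)
qed

lemma cyl_slices:
 assumes h: "h \<in> cyl \<Omega> T"
 shows "AE t in lborel. sq_int lborel (\<lambda>x. h (x, t)) & (\<forall>x. x \<notin> \<Omega> --> h (x, t) = 0)"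
 using sq_int_slices(1)[OF cylD(1)[OF h]] by eventually_elim (use cylD(2)[OF h] in auto)

section \<open>Weak gradients and the space \<open>H\<^sup>1\<^sub>0\<close>\<close>

lemma squeeze_0:
 fixes F A :: "nat => real"
 assumes "A \<longlonglongrightarrow> 0" "!!k. F k <= A k" "!!k. 0 <= F k"
 shows "F \<longlonglongrightarrow> 0"
 by (rule tendsto_sandwich[OF _ _ tendsto_const assms(1)]) (use assms in auto)

lemma squeeze_0_add:
 fixes F A B :: "nat => real"
 assumes "A \<longlonglongrightarrow> 0" "B \<longlonglongrightarrow> 0" "!!k. F k <= A k + B k" "!!k. 0 <= F k"
 shows "F \<longlonglongrightarrow> 0"
 by (rule squeeze_0[OF _ assms(3,4)]) (use tendsto_add[OF assms(1,2)] in simp)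

lemma lborel_integral_translation:
 fixes f :: "'a::euclidean_space => real"
 assumes "f \<in> borel_measurable borel"
 shows "(LBINT x. f (c + x)) = (LBINT x. f x)"
proof -
 have "(\<integral>x. f x \<partial>distr lborel borel ((+) c)) = (LBINT x. f (c + x))"
  by (rule integral_distr) (use assms in auto)
 then show ?thesis by (simp add: lborel_distr_plus)
qed

text \<open>Difference quotients have integral zero by translation invariance, and they converge
 boundedly to the directional derivative.\<close>

lemma integral_pderiv_dir_test:
 fixes f :: "'a::euclidean_space => real"
 assumes f: "f \<in> test_functions S" and b: "b \<in> Basis"
 shows "(LBINT x. pderiv_dir b f x) = 0"
proof -
 have s: "smooth f" using f by (rule test_smooth)
 have fi: "integrable lborel f" and fm: "f \<in> borel_measurable borel"
  using test_sq_int(2)[OF f] test_borel[OF f] by auto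
 obtain K where K: "compact K" "!!x. x \<notin> K ==> f x = 0" "!!x. x \<notin> K ==> pderiv_dir b f x = 0"
  using test_functionsD[OF f] by blast
 obtain B where B: "B > 0" "!!x. norm (pderiv_dir b f x) <= B"
  using continuous_compact_support_bounded[OF smooth_continuous[OF smooth_pderiv[OF s b]] K(1,3)] by blast
 obtain R where R: "!!x. x \<in> K ==> norm x <= R" using compact_imp_bounded[OF K(1)] by (auto simp: bounded_iff)
 define h :: "nat => real" where "h n = inverse (real (Suc n))" for n
 have h: "0 < h n" "h n <= 1" for n by (auto simp: h_def field_simps)
 have h0: "h \<longlonglongrightarrow> 0" unfolding h_def by (rule LIMSEQ_inverse_real_of_nat)
 define D where "D n x = (f (h n *\<^sub>R b + x) - f x) / h n" for n x
 have line: "((\<lambda>t. f (t *\<^sub>R b + x)) has_real_derivative pderiv_dir b f (t *\<^sub>R b + x)) (at t)" for t x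
 proof -
  have sm: "smooth (\<lambda>t. f (t *\<^sub>R b + x))"
   by (intro smooth_comp_affine[where L="\<lambda>t. t *\<^sub>R b"] bounded_linear_intros s)
  have D: "((\<lambda>t. f (t *\<^sub>R b + x)) has_derivative (\<lambda>h. pderiv_dir (h *\<^sub>R b) f (t *\<^sub>R b + x))) (at t)"
   by (rule has_derivative_comp_affine[where L="\<lambda>t. t *\<^sub>R b"])
     (auto intro: bounded_linear_intros smooth_differentiable[OF s])
  have "pderiv_dir 1 (\<lambda>t. f (t *\<^sub>R b + x)) t = pderiv_dir b f (t *\<^sub>R b + x)"
   using pderiv_dir_eq[OF D, of 1] by simp
  then show ?thesis using smooth_has_real_derivative[OF sm] by metis
 qed
 have DB: "\<bar>D n x\<bar> <= B" for n x
 proof -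
  obtain z where "0 < z" "z < h n" "f (h n *\<^sub>R b + x) - f (0 *\<^sub>R b + x) = (h n - 0) * pderiv_dir b f (z *\<^sub>R b + x)"
   using MVT2[of 0 "h n" "\<lambda>t. f (t *\<^sub>R b + x)" "\<lambda>t. pderiv_dir b f (t *\<^sub>R b + x)"] h line by blast
  then have "D n x = pderiv_dir b f (z *\<^sub>R b + x)" using h[of n] by (simp add: D_def)
  then show ?thesis using B(2) by simp
 qed
 have Dsupp: "D n x = 0" if "norm x > R + 1" for n x
 proof -
  have "norm x <= norm (h n *\<^sub>R b + x) + norm (h n *\<^sub>R b)"
   using norm_triangle_ineq4[of "h n *\<^sub>R b + x" "h n *\<^sub>R b"] by simp
  then have "norm (h n *\<^sub>R b + x) > R" using that h[of n] b by simp
  then have "h n *\<^sub>R b + x \<notin> K" "x \<notin> K" using R that by fastforce+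
  then show ?thesis using K(2) by (simp add: D_def)
 qed
 have [measurable]: "D n \<in> borel_measurable lborel" for n
 proof -
  have "(\<lambda>x. f (h n *\<^sub>R b + x)) \<in> borel_measurable borel"
   using fm by (rule measurable_compose[rotated]) simp
  then show ?thesis using fm unfolding D_def by simp
 qed
 have Dint: "(LBINT x. D n x) = 0" for n
 proof -
  have "integrable lborel (\<lambda>x. f (h n *\<^sub>R b + x))"
  proof -
   have "integrable (distr lborel borel ((+) (h n *\<^sub>R b))) f" using fi by (simp add: lborel_distr_plus)
   then show ?thesis by (subst (asm) integrable_distr_eq) (use fm in auto)
  qed
  then show ?thesis using fi lborel_integral_translation[OF fm] by (simp add: D_def)
 qed
 have "(\<lambda>n. (LBINT x. D n x)) \<longlonglongrightarrow> (LBINT x. pderiv_dir b f x)"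
 proof (rule integral_dominated_convergence[where w="\<lambda>x. B * indicator (cball 0 (R + 1)) x"])
  show "integrable lborel (\<lambda>x::'a. B * indicator (cball 0 (R + 1)) x)"
   using emeasure_bounded_finite[OF bounded_cball[of "0::'a" "R + 1"]] by (intro integrable_mult_right) simp
  show "AE x in lborel. norm (D n x) <= B * indicator (cball 0 (R + 1)) x" for n
  proof (rule AE_I2)
   fix x
   show "norm (D n x) <= B * indicator (cball 0 (R + 1)) x"
    using DB[of n x] Dsupp[of x n] by (cases "norm x > R + 1") (auto simp: indicator_def)
  qed
  show "AE x in lborel. (\<lambda>n. D n x) \<longlonglongrightarrow> pderiv_dir b f x"
  proof (rule AE_I2)
   fix x
   have "((\<lambda>t. (f (t *\<^sub>R b + x) - f (0 *\<^sub>R b + x)) / (t - 0)) \<longlongrightarrow> pderiv_dir b f (0 *\<^sub>R b + x)) (at 0)"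
    using line[of x 0] by (simp only: has_field_derivative_iff)
   moreover have "filterlim h (at 0) sequentially"
    using h0 h by (auto simp: filterlim_at intro!: always_eventually) (metis less_irrefl)
   ultimately show "(\<lambda>n. D n x) \<longlonglongrightarrow> pderiv_dir b f x"
    using filterlim_compose[of "\<lambda>t. (f (t *\<^sub>R b + x) - f (0 *\<^sub>R b + x)) / (t - 0)"] by (fastforce simp: D_def)
  qed
  show "pderiv_dir b f \<in> borel_measurable lborel" using test_borel[OF test_pderiv[OF f b]] by simp
 qed simp
 then show ?thesis using Dint LIMSEQ_unique[of "\<lambda>n. 0::real"] by simp
qed

lemma pderiv_dir_mult:
 assumes "smooth f" "smooth g"
 shows "pderiv_dir b (\<lambda>x. f x * g x) x = f x * pderiv_dir b g x + pderiv_dir b f x * g x"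
 by (rule pderiv_dir_eq) (intro has_derivative_mult smooth_has_derivative assms)

definition grad :: "('a::euclidean_space => real) => 'a => 'a" where
 "grad f x = (\<Sum>b\<in>Basis. pderiv_dir b f x *\<^sub>R b)"

lemma grad_component: "b \<in> Basis ==> grad f x \<bullet> b = pderiv_dir b f x"
 by (simp add: grad_def inner_sum_left inner_Basis if_distrib cong: if_cong)

lemma test_integration_by_parts:
 assumes S: "open S" and f: "f \<in> test_functions S" and g: "g \<in> test_functions S" and b: "b \<in> Basis"
 shows "L2_inner S f (pderiv_dir b g) = - L2_inner S (pderiv_dir b f) g"
proof -
 note m = test_borel[OF f] test_borel[OF g] test_borel[OF test_pderiv[OF f b]] test_borel[OF test_pderiv[OF g b]]
 note q = test_sq_int(1)[OF f] test_sq_int(1)[OF g] test_sq_int(1)[OF test_pderiv[OF f b]] test_sq_int(1)[OF test_pderiv[OF g b]]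
 have fg: "(\<lambda>x. f x * g x) \<in> test_functions S"
 proof -
  obtain K where K: "compact K" "K \<subseteq> S" "!!x. x \<notin> K ==> f x = 0"
   using test_functionsD[OF f] by blast
  show ?thesis
  proof (rule test_functionsI[OF _ K(1,2)])
   show "smooth (\<lambda>x. f x * g x)" using test_smooth[OF f] test_smooth[OF g] by (rule smooth_mult)
   show "x \<in> K" if "f x * g x \<noteq> 0" for x using that K(3)[of x] by auto
  qed
 qed
 have "L2_inner S f (pderiv_dir b g) + L2_inner S (pderiv_dir b f) g
   = (LBINT x. f x * pderiv_dir b g x) + (LBINT x. pderiv_dir b f x * g x)"
  using S m test_outside[OF f] test_outside[OF g] by (subst (1 2) L2_inner_lborel) auto
 also have "\<dots> = (LBINT x. f x * pderiv_dir b g x + pderiv_dir b f x * g x)"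
  using q by (intro Bochner_Integration.integral_add[symmetric] sq_int_mult)
 also have "\<dots> = (LBINT x. pderiv_dir b (\<lambda>x. f x * g x) x)"
  by (simp only: pderiv_dir_mult[OF test_smooth[OF f] test_smooth[OF g]])
 also have "\<dots> = 0" by (rule integral_pderiv_dir_test[OF fg b])
 finally show ?thesis by simp
qed

lemma gradient_L2: "has_weak_gradient S u G ==> b \<in> Basis ==> (\<lambda>x. G x \<bullet> b) \<in> L2 S"
 by (simp add: has_weak_gradient_def)

lemma weak_gradient_eq: "has_weak_gradient S u G ==> b \<in> Basis ==> \<phi> \<in> test_functions S ==>
  L2_inner S u (pderiv_dir b \<phi>) = - L2_inner S (\<lambda>x. G x \<bullet> b) \<phi>"
 by (simp add: has_weak_gradient_def)

lemma has_weak_gradient_test: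
 assumes S: "open S" and f: "f \<in> test_functions S"
 shows "has_weak_gradient S f (grad f)"
 unfolding has_weak_gradient_def
 using test_integration_by_parts[OF S f] test_L2[OF test_pderiv[OF f] S] by (simp add: grad_component)

lemma has_weak_gradient_weak_gradient: "u \<in> H1 S ==> has_weak_gradient S u (weak_gradient S u)"
 unfolding weak_gradient_def H1_def using someI_ex[of "has_weak_gradient S u"] by blast

lemma weak_gradient_unique:
 assumes S: "open S" and G: "has_weak_gradient S u G" "has_weak_gradient S u G'" and b: "b \<in> Basis"
 shows "AE x in lebesgue_on S. G x \<bullet> b = G' x \<bullet> b"
proof (rule L2_inner_eq_imp_AE_eq[OF S gradient_L2[OF G(1) b] gradient_L2[OF G(2) b]])
 fix \<phi> assume "\<phi> \<in> test_functions S"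
 then show "L2_inner S (\<lambda>x. G x \<bullet> b) \<phi> = L2_inner S (\<lambda>x. G' x \<bullet> b) \<phi>"
  using weak_gradient_eq[OF G(1) b] weak_gradient_eq[OF G(2) b] by force
qed

lemma has_weak_gradient_diff:
 assumes S: "open S" and u: "u \<in> L2 S" "v \<in> L2 S" and G: "has_weak_gradient S u G" "has_weak_gradient S v G'"
 shows "has_weak_gradient S (\<lambda>x. u x - v x) (\<lambda>x. G x - G' x)"
 unfolding has_weak_gradient_def
proof (intro ballI conjI)
 fix b :: 'a assume b: "b \<in> Basis"
 note c = gradient_L2[OF G(1) b] gradient_L2[OF G(2) b]
 show "(\<lambda>x. (G x - G' x) \<bullet> b) \<in> L2 S" using L2_diff[OF c] by (simp add: inner_diff_left)
 fix \<phi> assume \<phi>: "\<phi> \<in> test_functions S"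
 show "L2_inner S (\<lambda>x. u x - v x) (pderiv_dir b \<phi>) = - L2_inner S (\<lambda>x. (G x - G' x) \<bullet> b) \<phi>"
  using weak_gradient_eq[OF G(1) b \<phi>] weak_gradient_eq[OF G(2) b \<phi>]
  by (simp add: inner_diff_left L2_inner_diff_left u c test_L2[OF \<phi> S] test_L2[OF test_pderiv[OF \<phi> b] S])
qed

lemma has_weak_gradient_add:
 assumes S: "open S" and u: "u \<in> L2 S" "v \<in> L2 S" and G: "has_weak_gradient S u G" "has_weak_gradient S v G'"
 shows "has_weak_gradient S (\<lambda>x. u x + v x) (\<lambda>x. G x + G' x)"
 unfolding has_weak_gradient_def
proof (intro ballI conjI)
 fix b :: 'a assume b: "b \<in> Basis"
 note c = gradient_L2[OF G(1) b] gradient_L2[OF G(2) b]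
 show "(\<lambda>x. (G x + G' x) \<bullet> b) \<in> L2 S" using L2_add[OF c] by (simp add: inner_add_left)
 fix \<phi> assume \<phi>: "\<phi> \<in> test_functions S"
 show "L2_inner S (\<lambda>x. u x + v x) (pderiv_dir b \<phi>) = - L2_inner S (\<lambda>x. (G x + G' x) \<bullet> b) \<phi>"
  using weak_gradient_eq[OF G(1) b \<phi>] weak_gradient_eq[OF G(2) b \<phi>]
  by (simp add: inner_add_left L2_inner_add_left u c test_L2[OF \<phi> S] test_L2[OF test_pderiv[OF \<phi> b] S])
qed

lemma has_weak_gradient_cmult:
 assumes G: "has_weak_gradient S u G"
 shows "has_weak_gradient S (\<lambda>x. c * u x) (\<lambda>x. c *\<^sub>R G x)"
 unfolding has_weak_gradient_def
proof (intro ballI conjI)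
 fix b :: 'a assume b: "b \<in> Basis"
 show "(\<lambda>x. (c *\<^sub>R G x) \<bullet> b) \<in> L2 S" using L2_cmult[OF gradient_L2[OF G b]] by simp
 fix \<phi> assume \<phi>: "\<phi> \<in> test_functions S"
 show "L2_inner S (\<lambda>x. c * u x) (pderiv_dir b \<phi>) = - L2_inner S (\<lambda>x. (c *\<^sub>R G x) \<bullet> b) \<phi>"
  using weak_gradient_eq[OF G b \<phi>] by (simp add: L2_inner_cmult_left)
qed

lemma H1I: "u \<in> L2 S ==> has_weak_gradient S u G ==> u \<in> H1 S"
 by (auto simp: H1_def)

lemma H1_norm_eq:
 assumes S: "open S" and G: "has_weak_gradient S u G" and u: "u \<in> L2 S"
 shows "H1_norm S u = sqrt ((L2_norm S u)\<^sup>2 + (\<Sum>b\<in>Basis. (L2_norm S (\<lambda>x. G x \<bullet> b))\<^sup>2))"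
proof -
 have W: "has_weak_gradient S u (weak_gradient S u)"
  by (rule has_weak_gradient_weak_gradient[OF H1I[OF u G]])
 have "L2_norm S (\<lambda>x. weak_gradient S u x \<bullet> b) = L2_norm S (\<lambda>x. G x \<bullet> b)" if b: "b \<in> Basis" for b
  unfolding L2_norm_eq
  by (rule l2n_cong_AE[OF _ _ weak_gradient_unique[OF S W G b]])
    (use gradient_L2[OF W b] gradient_L2[OF G b] in "auto intro: L2_measurable")
 then show ?thesis unfolding H1_norm_def by simp
qed

lemma L2_norm_nonneg [simp]: "0 <= L2_norm S f"
 by (simp add: L2_norm_eq)

lemma H1_norm_nonneg [simp]: "0 <= H1_norm S u"
 by (auto simp: H1_norm_def intro!: real_sqrt_ge_zero add_nonneg_nonneg sum_nonneg)

lemma H1_norm_le: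
 assumes S: "open S" and G: "has_weak_gradient S u G" and u: "u \<in> L2 S"
 shows "H1_norm S u <= L2_norm S u + (\<Sum>b\<in>Basis. L2_norm S (\<lambda>x. G x \<bullet> b))"
proof -
 let ?g = "\<lambda>b. L2_norm S (\<lambda>x. G x \<bullet> b)"
 have "H1_norm S u = sqrt ((L2_norm S u)\<^sup>2 + (\<Sum>b\<in>Basis. (?g b)\<^sup>2))" by (rule H1_norm_eq[OF assms])
 also have "\<dots> <= sqrt ((L2_norm S u)\<^sup>2) + sqrt (\<Sum>b\<in>Basis. (?g b)\<^sup>2)"
  by (rule sqrt_add_le_add_sqrt) (auto intro: sum_nonneg)
 also have "sqrt (\<Sum>b\<in>Basis. (?g b)\<^sup>2) <= (\<Sum>b\<in>Basis. ?g b)"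
  using L2_set_le_sum[of Basis ?g] by (simp add: L2_set_def)
 finally show ?thesis by simp
qed

lemma L2_norm_le_H1_norm:
 "L2_norm S u <= H1_norm S u"
 unfolding H1_norm_def by (rule real_le_rsqrt) (simp add: sum_nonneg)

lemma weak_gradient_norm_le_H1_norm:
 assumes b: "b \<in> Basis"
 shows "L2_norm S (\<lambda>x. weak_gradient S u x \<bullet> b) <= H1_norm S u"
proof -
 have "(L2_norm S (\<lambda>x. weak_gradient S u x \<bullet> b))\<^sup>2 <= (\<Sum>b\<in>Basis. (L2_norm S (\<lambda>x. weak_gradient S u x \<bullet> b))\<^sup>2)"
  by (rule member_le_sum) (use b in auto)
 also have "\<dots> <= (L2_norm S u)\<^sup>2 + (\<Sum>b\<in>Basis. (L2_norm S (\<lambda>x. weak_gradient S u x \<bullet> b))\<^sup>2)" by simp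
 finally show ?thesis unfolding H1_norm_def by (rule real_le_rsqrt)
qed

lemma H10_H1: "u \<in> H10 S ==> u \<in> H1 S"
 by (simp add: H10_def)

lemma H10_L2: "u \<in> H10 S ==> u \<in> L2 S"
 by (simp add: H10_def H1_def)

lemma H10_gradient: "u \<in> H10 S ==> has_weak_gradient S u (weak_gradient S u)"
 by (intro has_weak_gradient_weak_gradient H10_H1)

lemma H10_approx:
 assumes S: "open S" and u: "u \<in> H10 S"
 obtains \<phi> :: "nat => 'a::euclidean_space => real" where "!!k. \<phi> k \<in> test_functions S"
  "(\<lambda>k. L2_norm S (\<lambda>x. \<phi> k x - u x)) \<longlonglongrightarrow> 0"
  "!!b. b \<in> Basis ==> (\<lambda>k. L2_norm S (\<lambda>x. pderiv_dir b (\<phi> k) x - weak_gradient S u x \<bullet> b)) \<longlonglongrightarrow> 0"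
proof -
 have "\<exists>\<phi>\<in>test_functions S. H1_norm S (\<lambda>x. u x - \<phi> x) < inverse (real (Suc k))" for k
  using u by (simp add: H10_def)
 then obtain \<phi> where \<phi>: "!!k. \<phi> k \<in> test_functions S" "!!k. H1_norm S (\<lambda>x. u x - \<phi> k x) < inverse (real (Suc k))"
  by metis
 have lim: "(\<lambda>k. H1_norm S (\<lambda>x. u x - \<phi> k x)) \<longlonglongrightarrow> 0"
  by (rule tendsto_sandwich[OF _ _ tendsto_const LIMSEQ_inverse_real_of_nat])
    (use \<phi>(2) in "auto intro!: always_eventually less_imp_le")
 show ?thesis
 proof
  show "\<phi> k \<in> test_functions S" for k by (rule \<phi>(1))
  have "L2_norm S (\<lambda>x. \<phi> k x - u x) <= H1_norm S (\<lambda>x. u x - \<phi> k x)" for k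
   using L2_norm_le_H1_norm[of S "\<lambda>x. u x - \<phi> k x"] by (simp add: L2_norm_eq l2n_minus_commute[of _ u])
  then show "(\<lambda>k. L2_norm S (\<lambda>x. \<phi> k x - u x)) \<longlonglongrightarrow> 0"
   by (rule squeeze_0[OF lim]) simp
  fix b :: 'a assume b: "b \<in> Basis"
  have "L2_norm S (\<lambda>x. pderiv_dir b (\<phi> k) x - weak_gradient S u x \<bullet> b) <= H1_norm S (\<lambda>x. u x - \<phi> k x)" for k
  proof -
   let ?G = "\<lambda>x. weak_gradient S u x - grad (\<phi> k) x"
   have wg: "has_weak_gradient S (\<lambda>x. u x - \<phi> k x) ?G"
    by (rule has_weak_gradient_diff[OF S H10_L2[OF u] test_L2[OF \<phi>(1) S] H10_gradient[OF u] has_weak_gradient_test[OF S \<phi>(1)]])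
   have "H1_norm S (\<lambda>x. u x - \<phi> k x) = sqrt ((L2_norm S (\<lambda>x. u x - \<phi> k x))\<^sup>2 + (\<Sum>b\<in>Basis. (L2_norm S (\<lambda>x. ?G x \<bullet> b))\<^sup>2))"
    by (rule H1_norm_eq[OF S wg L2_diff[OF H10_L2[OF u] test_L2[OF \<phi>(1) S]]])
   moreover have "(L2_norm S (\<lambda>x. ?G x \<bullet> b))\<^sup>2 <= (\<Sum>b\<in>Basis. (L2_norm S (\<lambda>x. ?G x \<bullet> b))\<^sup>2)"
    by (rule member_le_sum) (use b in auto)
   ultimately have "L2_norm S (\<lambda>x. ?G x \<bullet> b) <= H1_norm S (\<lambda>x. u x - \<phi> k x)"
    by (auto intro!: real_le_rsqrt add_increasing)
   moreover have "L2_norm S (\<lambda>x. ?G x \<bullet> b) = L2_norm S (\<lambda>x. pderiv_dir b (\<phi> k) x - weak_gradient S u x \<bullet> b)"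
    unfolding L2_norm_eq by (subst l2n_minus_commute) (simp add: inner_diff_left grad_component[OF b])
   ultimately show ?thesis by simp
  qed
  then show "(\<lambda>k. L2_norm S (\<lambda>x. pderiv_dir b (\<phi> k) x - weak_gradient S u x \<bullet> b)) \<longlonglongrightarrow> 0"
   by (rule squeeze_0[OF lim]) simp
 qed
qed

lemma L2_inner_tendsto:
 assumes "!!k. f k \<in> L2 S" "h \<in> L2 S" "g \<in> L2 S" "(\<lambda>k. L2_norm S (\<lambda>x. f k x - h x)) \<longlonglongrightarrow> 0"
 shows "(\<lambda>k. L2_inner S (f k) g) \<longlonglongrightarrow> L2_inner S h g"
 using l2_inner_tendsto[of "lebesgue_on S" f h g] assms by (simp add: L2_iff L2_norm_eq L2_inner_eq)

text \<open>The weak gradient is closed under \<open>L\<^sup>2\<close> convergence of functions and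
 gradients, so the limit has gradient \<open>G\<close> and the test functions approximate it in the
 \<open>H\<^sup>1\<close> norm.\<close>

lemma H10_limit:
 assumes S: "open S" and \<phi>: "!!k. \<phi> k \<in> test_functions S" and u: "u \<in> L2 S"
  and G: "!!b. b \<in> Basis ==> (\<lambda>x. G x \<bullet> b) \<in> L2 S"
  and lim: "(\<lambda>k. L2_norm S (\<lambda>x. \<phi> k x - u x)) \<longlonglongrightarrow> 0"
  and limG: "!!b. b \<in> Basis ==> (\<lambda>k. L2_norm S (\<lambda>x. pderiv_dir b (\<phi> k) x - G x \<bullet> b)) \<longlonglongrightarrow> 0"
 shows "u \<in> H10 S" "has_weak_gradient S u G" "(\<lambda>k. H1_norm S (\<lambda>x. \<phi> k x - u x)) \<longlonglongrightarrow> 0"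
proof -
 have \<phi>L: "\<phi> k \<in> L2 S" for k by (rule test_L2[OF \<phi> S])
 show wg: "has_weak_gradient S u G"
  unfolding has_weak_gradient_def
 proof (intro ballI conjI G)
  fix b :: 'a and \<psi> assume b: "b \<in> Basis" and \<psi>: "\<psi> \<in> test_functions S"
  have "(\<lambda>k. L2_inner S (\<phi> k) (pderiv_dir b \<psi>)) \<longlonglongrightarrow> L2_inner S u (pderiv_dir b \<psi>)"
   by (rule L2_inner_tendsto[OF \<phi>L u test_L2[OF test_pderiv[OF \<psi> b] S] lim])
  moreover have "(\<lambda>k. - L2_inner S (pderiv_dir b (\<phi> k)) \<psi>) \<longlonglongrightarrow> - L2_inner S (\<lambda>x. G x \<bullet> b) \<psi>"
   by (intro tendsto_minus L2_inner_tendsto[OF test_L2[OF test_pderiv[OF \<phi> b] S] G[OF b] test_L2[OF \<psi> S] limG[OF b]])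
  moreover have "(\<lambda>k. - L2_inner S (pderiv_dir b (\<phi> k)) \<psi>) = (\<lambda>k. L2_inner S (\<phi> k) (pderiv_dir b \<psi>))"
   by (rule ext) (rule test_integration_by_parts[OF S \<phi> \<psi> b, symmetric])
  ultimately show "L2_inner S u (pderiv_dir b \<psi>) = - L2_inner S (\<lambda>x. G x \<bullet> b) \<psi>"
   using LIMSEQ_unique by metis
 qed
 have wd: "has_weak_gradient S (\<lambda>x. \<phi> k x - u x) (\<lambda>x. grad (\<phi> k) x - G x)" for k
  by (rule has_weak_gradient_diff[OF S \<phi>L u has_weak_gradient_test[OF S \<phi>] wg])
 have le: "H1_norm S (\<lambda>x. \<phi> k x - u x) <= L2_norm S (\<lambda>x. \<phi> k x - u x)
   + (\<Sum>b\<in>Basis. L2_norm S (\<lambda>x. pderiv_dir b (\<phi> k) x - G x \<bullet> b))" for k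
 proof -
  have "(\<Sum>b\<in>Basis. L2_norm S (\<lambda>x. (grad (\<phi> k) x - G x) \<bullet> b)) = (\<Sum>b\<in>Basis. L2_norm S (\<lambda>x. pderiv_dir b (\<phi> k) x - G x \<bullet> b))"
   by (rule sum.cong) (auto simp: inner_diff_left grad_component)
  then show ?thesis using H1_norm_le[OF S wd L2_diff[OF \<phi>L u], of k] by simp
 qed
 have "(\<lambda>k. L2_norm S (\<lambda>x. \<phi> k x - u x)
   + (\<Sum>b\<in>Basis. L2_norm S (\<lambda>x. pderiv_dir b (\<phi> k) x - G x \<bullet> b))) \<longlonglongrightarrow> 0 + (\<Sum>b\<in>(Basis::'a set). 0)"
  by (intro tendsto_add tendsto_sum lim limG)
 then have "(\<lambda>k. L2_norm S (\<lambda>x. \<phi> k x - u x)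
   + (\<Sum>b\<in>Basis. L2_norm S (\<lambda>x. pderiv_dir b (\<phi> k) x - G x \<bullet> b))) \<longlonglongrightarrow> 0" by simp
 then show l: "(\<lambda>k. H1_norm S (\<lambda>x. \<phi> k x - u x)) \<longlonglongrightarrow> 0"
  using le by (rule squeeze_0) simp
 show "u \<in> H10 S"
  unfolding H10_def
 proof (intro CollectI conjI allI impI)
  show "u \<in> H1 S" by (rule H1I[OF u wg])
  fix e :: real assume "e > 0"
  then obtain k where k: "H1_norm S (\<lambda>x. \<phi> k x - u x) < e"
   using eventually_happens'[OF sequentially_bot order_tendstoD(2)[OF l, of e]] by blast
  have wd': "has_weak_gradient S (\<lambda>x. u x - \<phi> k x) (\<lambda>x. G x - grad (\<phi> k) x)"
   by (rule has_weak_gradient_diff[OF S u \<phi>L wg has_weak_gradient_test[OF S \<phi>]])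
  have "L2_norm S (\<lambda>x. (G x - grad (\<phi> k) x) \<bullet> b) = L2_norm S (\<lambda>x. (grad (\<phi> k) x - G x) \<bullet> b)" for b
   unfolding L2_norm_eq inner_diff_left by (rule l2n_minus_commute)
  moreover have "L2_norm S (\<lambda>x. u x - \<phi> k x) = L2_norm S (\<lambda>x. \<phi> k x - u x)"
   unfolding L2_norm_eq by (rule l2n_minus_commute)
  ultimately have "H1_norm S (\<lambda>x. u x - \<phi> k x) = H1_norm S (\<lambda>x. \<phi> k x - u x)"
   by (simp only: H1_norm_eq[OF S wd' L2_diff[OF u \<phi>L]] H1_norm_eq[OF S wd L2_diff[OF \<phi>L u], of k])
  with k have "H1_norm S (\<lambda>x. u x - \<phi> k x) < e" by simp
  then show "\<exists>\<phi>\<in>test_functions S. H1_norm S (\<lambda>x. u x - \<phi> x) < e" using \<phi>[of k] by blast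
 qed
qed

lemma test_H10:
 assumes "open S" "\<phi> \<in> test_functions S" shows "\<phi> \<in> H10 S"
proof (rule H10_limit(1)[OF assms(1), of "\<lambda>k. \<phi>" \<phi> "grad \<phi>"])
 have z: "L2_norm S (\<lambda>x. 0) = 0" by (simp add: L2_norm_def L2_inner_def)
 then show "(\<lambda>k::nat. L2_norm S (\<lambda>x. \<phi> x - \<phi> x)) \<longlonglongrightarrow> 0" by simp
 show "(\<lambda>k::nat. L2_norm S (\<lambda>x. pderiv_dir b \<phi> x - grad \<phi> x \<bullet> b)) \<longlonglongrightarrow> 0" if "b \<in> Basis" for b
  using z by (simp add: grad_component[OF that])
qed (use assms test_L2 has_weak_gradient_test[OF assms] in "auto intro: gradient_L2")

lemma L2_norm_diff_diff:
 assumes "f \<in> L2 S" "g \<in> L2 S" "f' \<in> L2 S" "g' \<in> L2 S"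
 shows "L2_norm S (\<lambda>x. (f x - g x) - (f' x - g' x)) <= L2_norm S (\<lambda>x. f x - f' x) + L2_norm S (\<lambda>x. g x - g' x)"
proof -
 have "L2_norm S (\<lambda>x. (f x - f' x) + (g' x - g x)) <= L2_norm S (\<lambda>x. f x - f' x) + L2_norm S (\<lambda>x. g' x - g x)"
  unfolding L2_norm_eq using assms by (intro l2n_triangle) (auto simp: L2_iff)
 moreover have "L2_norm S (\<lambda>x. g' x - g x) = L2_norm S (\<lambda>x. g x - g' x)"
  unfolding L2_norm_eq by (rule l2n_minus_commute)
 ultimately show ?thesis by (simp add: algebra_simps)
qed

lemma H10_diff:
 assumes S: "open S" and u: "u \<in> H10 S" and v: "v \<in> H10 S"
 shows "(\<lambda>x. u x - v x) \<in> H10 S"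
proof -
 obtain \<phi> where \<phi>: "!!k::nat. \<phi> k \<in> test_functions S"
  "(\<lambda>k. L2_norm S (\<lambda>x. \<phi> k x - u x)) \<longlonglongrightarrow> 0"
  "!!b. b \<in> Basis ==> (\<lambda>k. L2_norm S (\<lambda>x. pderiv_dir b (\<phi> k) x - weak_gradient S u x \<bullet> b)) \<longlonglongrightarrow> 0"
  using H10_approx[OF S u] by blast
 obtain \<psi> where \<psi>: "!!k::nat. \<psi> k \<in> test_functions S"
  "(\<lambda>k. L2_norm S (\<lambda>x. \<psi> k x - v x)) \<longlonglongrightarrow> 0"
  "!!b. b \<in> Basis ==> (\<lambda>k. L2_norm S (\<lambda>x. pderiv_dir b (\<psi> k) x - weak_gradient S v x \<bullet> b)) \<longlonglongrightarrow> 0"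
  using H10_approx[OF S v] by blast
 note cu = gradient_L2[OF H10_gradient[OF u]]
 note cv = gradient_L2[OF H10_gradient[OF v]]
 show ?thesis
 proof (rule H10_limit(1)[OF S, of "\<lambda>k x. \<phi> k x - \<psi> k x" _ "\<lambda>x. weak_gradient S u x - weak_gradient S v x"])
  show "(\<lambda>x. \<phi> k x - \<psi> k x) \<in> test_functions S" for k by (rule test_diff[OF \<phi>(1) \<psi>(1)])
  show "(\<lambda>x. u x - v x) \<in> L2 S" by (intro L2_diff H10_L2 u v)
  show "(\<lambda>k. L2_norm S (\<lambda>x. (\<phi> k x - \<psi> k x) - (u x - v x))) \<longlonglongrightarrow> 0"
   by (rule squeeze_0_add[OF \<phi>(2) \<psi>(2)]) (auto intro: L2_norm_diff_diff test_L2[OF \<phi>(1) S] test_L2[OF \<psi>(1) S] H10_L2 u v)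
  fix b :: 'a assume b: "b \<in> Basis"
  show "(\<lambda>x. (weak_gradient S u x - weak_gradient S v x) \<bullet> b) \<in> L2 S"
   using L2_diff[OF cu[OF b] cv[OF b]] by (simp add: inner_diff_left)
  show "(\<lambda>k. L2_norm S (\<lambda>x. pderiv_dir b (\<lambda>x. \<phi> k x - \<psi> k x) x - (weak_gradient S u x - weak_gradient S v x) \<bullet> b)) \<longlonglongrightarrow> 0"
   unfolding pderiv_dir_diff[OF test_smooth[OF \<phi>(1)] test_smooth[OF \<psi>(1)]] inner_diff_left
   by (rule squeeze_0_add[OF \<phi>(3)[OF b] \<psi>(3)[OF b]])
     (auto intro: L2_norm_diff_diff test_L2[OF test_pderiv[OF \<phi>(1) b] S] test_L2[OF test_pderiv[OF \<psi>(1) b] S] cu[OF b] cv[OF b])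
 qed
qed

section \<open>Bochner spaces and functions on space-time\<close>

lemma l2n_triangle_minus:
 assumes "sq_int M f" "sq_int M g"
 shows "l2n M (\<lambda>x. f x - g x) <= l2n M f + l2n M g"
 using l2n_triangle[OF assms(1) sq_int_minus[OF assms(2)]] l2n_scaleR[of M "-1" g] by simp

text \<open>Fubini turns convergence on space-time into convergence in \<open>L\<^sup>1\<close> of the
 squared norms of the slices, hence almost everywhere along a subsequence.\<close>

lemma slices_subsequence:
 fixes S :: "nat => 'a::euclidean_space \<times> real => 'b::euclidean_space"
 assumes S: "!!k. sq_int lborel (S k)" and w: "sq_int lborel w"
  and lim: "(\<lambda>k. l2n lborel (\<lambda>z. S k z - w z)) \<longlonglongrightarrow> 0"
 obtains r :: "nat => nat" where "strict_mono r"
  "AE t in lborel. (\<lambda>k. l2n lborel (\<lambda>x. S (r k) (x, t) - w (x, t))) \<longlonglongrightarrow> 0"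
proof -
 define f where "f k t = (l2n lborel (\<lambda>x. S k (x, t) - w (x, t)))\<^sup>2" for k t
 have d: "sq_int lborel (\<lambda>z. S k z - w z)" for k using S w by auto
 have i: "integrable lborel (f k)" for k using sq_int_slices(3)[OF d] by (simp add: f_def[abs_def])
 have "(\<lambda>k. (l2n lborel (\<lambda>z. S k z - w z))\<^sup>2) \<longlonglongrightarrow> 0\<^sup>2" by (intro tendsto_power lim)
 moreover have "(LBINT t. norm (f k t)) = (l2n lborel (\<lambda>z. S k z - w z))\<^sup>2" for k
  using sq_int_slices(4)[OF d, of k] by (simp add: f_def)
 ultimately have "(\<lambda>k. (LBINT t. norm (f k t))) \<longlonglongrightarrow> 0" by simp
 from tendsto_L1_AE_subseq[OF i this] obtain r where r: "strict_mono r"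
  "AE t in lborel. (\<lambda>k. f (r k) t) \<longlonglongrightarrow> 0" by blast
 have "AE t in lborel. (\<lambda>k. l2n lborel (\<lambda>x. S (r k) (x, t) - w (x, t))) \<longlonglongrightarrow> 0"
  using r(2)
 proof eventually_elim
  case (elim t)
  from tendsto_real_sqrt[OF this] show ?case by (simp add: f_def)
 qed
 with r(1) that show ?thesis by blast
qed

text \<open>A strongly measurable \<open>V\<close> is a limit of step functions, and step functions are
 visibly functions of \<open>(x, t)\<close>. Cut off so that \<open>n + 1\<close> dominates their norms,
 they form a Cauchy sequence in \<open>L\<^sup>2\<close> of space-time; by completeness there is a limit,
 whose slices are the values of \<open>V\<close>.\<close>

lemma joint_representative:
 fixes \<Omega> :: "'a::euclidean_space set" and V :: "real => 'a => real"
 assumes \<Omega>: "open \<Omega>" and V: "strongly_measurable_into (L2 \<Omega>) (L2_norm \<Omega>) {0<..<T} V"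
  and n: "n \<in> L2 {0<..<T}" "!!t. 0 <= n t"
  and bound: "AE t in lebesgue_on {0<..<T}. L2_norm \<Omega> (V t) <= n t"
 obtains w where "w \<in> cyl \<Omega> T" "AE t in lebesgue_on {0<..<T}. eq_ae \<Omega> (\<lambda>x. w (x, t)) (V t)"
proof -
 define I where "I = {0<..<T}"
 have Ib: "I \<in> sets borel" and \<Omega>b: "\<Omega> \<in> sets borel" using \<Omega> by (auto simp: I_def)
 have fin: "finite_measure (lebesgue_on I)" unfolding I_def by (rule finite_measure_lebesgue_on) simp
 note AEI = AE_on_iff[OF Ib]
 obtain s where s: "!!k. finite (s k ` I)" "!!k. s k ` I \<subseteq> L2 \<Omega>"
  "!!k g. {t \<in> I. s k t = g} \<in> sets lebesgue"
  "AE t in lebesgue_on I. (\<lambda>k. L2_norm \<Omega> (\<lambda>x. s k t x - V t x)) \<longlonglongrightarrow> 0"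
  and VL: "AE t in lebesgue_on I. V t \<in> L2 \<Omega>"
  using V unfolding strongly_measurable_into_def I_def by blast
 have "\<forall>g\<in>L2 \<Omega>. \<exists>h. sq_int lborel h & (\<forall>x. x \<notin> \<Omega> --> h x = 0) & (AE x in lebesgue_on \<Omega>. g x = h x)"
  using L2_rep[OF \<Omega>b] by metis
 then obtain R where R: "!!g. g \<in> L2 \<Omega> ==> sq_int lborel (R g)" "!!g x. g \<in> L2 \<Omega> ==> x \<notin> \<Omega> ==> R g x = 0"
  "!!g. g \<in> L2 \<Omega> ==> AE x in lebesgue_on \<Omega>. g x = R g x" by metis
 have Rnorm: "l2n lborel (R g) = L2_norm \<Omega> g" if g: "g \<in> L2 \<Omega>" for g
 proof -
  have m: "R g \<in> borel_measurable borel" using R(1)[OF g] by (auto simp: sq_int_def)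
  have "l2n lborel (R g) = l2n (lebesgue_on \<Omega>) (R g)"
   by (rule l2n_lborel[OF \<Omega>b m R(2)[OF g], symmetric])
  also have "\<dots> = l2n (lebesgue_on \<Omega>) g"
   using R(3)[OF g] by (intro l2n_cong_AE borel_on m L2_measurable g) (simp add: eq_commute)
  finally show ?thesis by (simp add: L2_norm_eq)
 qed
 have Rdiff: "l2n lborel (\<lambda>x. R g x - R g' x) = L2_norm \<Omega> (\<lambda>x. g x - g' x)" if g: "g \<in> L2 \<Omega>" "g' \<in> L2 \<Omega>" for g g'
 proof -
  have m: "(\<lambda>x. R g x - R g' x) \<in> borel_measurable borel"
   using R(1)[OF g(1)] R(1)[OF g(2)] by (auto simp: sq_int_def)
  have "l2n lborel (\<lambda>x. R g x - R g' x) = l2n (lebesgue_on \<Omega>) (\<lambda>x. R g x - R g' x)"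
   by (rule l2n_lborel[OF \<Omega>b m, symmetric]) (simp add: R(2) g)
  also have "\<dots> = l2n (lebesgue_on \<Omega>) (\<lambda>x. g x - g' x)"
  proof (rule l2n_cong_AE[OF borel_on[OF m] L2_measurable[OF L2_diff[OF g]]])
   show "AE x in lebesgue_on \<Omega>. R g x - R g' x = g x - g' x"
    using R(3)[OF g(1)] R(3)[OF g(2)] by eventually_elim simp
  qed
  finally show ?thesis by (simp add: L2_norm_eq)
 qed
 have n1: "(\<lambda>t. n t + 1) \<in> L2 I"
  using n(1) finite_measure.sq_int_const[OF fin, of "1::real"] unfolding L2_iff I_def by (rule sq_int_add)
 obtain m where m: "sq_int lborel m" "!!t. t \<notin> I ==> m t = 0" "AE t in lebesgue_on I. n t + 1 = m t"
  using L2_rep[OF Ib n1] by blast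
 text \<open>The simple approximations are cut off where they exceed the norm of \<open>V\<close> by more than \<open>1\<close>.\<close>
 define A where "A k g = {t \<in> I. s k t = g & L2_norm \<Omega> g <= n t + 1}" for k g
 have AL: "(indicator (A k g) :: real => real) \<in> L2 I" for k g
  unfolding L2_iff
 proof (rule finite_measure.sq_int_bounded[OF fin])
  have "{t \<in> space (lebesgue_on I). L2_norm \<Omega> g <= n t + 1} \<in> sets (lebesgue_on I)"
   using L2_measurable[OF n1] by measurable
  moreover have "{t \<in> I. s k t = g} \<in> sets (lebesgue_on I)"
   by (subst sets_restrict_space_iff) (use s(3)[of k g] Ib in auto)
  ultimately have "{t \<in> I. s k t = g} \<inter> {t \<in> I. L2_norm \<Omega> g <= n t + 1} \<in> sets (lebesgue_on I)"
   by (auto intro: sets.Int)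
  moreover have "A k g = {t \<in> I. s k t = g} \<inter> {t \<in> I. L2_norm \<Omega> g <= n t + 1}" by (auto simp: A_def)
  ultimately show "(indicator (A k g) :: real => real) \<in> borel_measurable (lebesgue_on I)" by simp
  show "norm (indicator (A k g) t :: real) <= 1" for t by (simp add: indicator_def)
 qed
 have "\<exists>h. sq_int lborel h & (\<forall>x. x \<notin> I --> h x = 0) & (AE x in lebesgue_on I. (indicator (A k g) x :: real) = h x)" for k g
  using L2_rep[OF Ib AL[of k g]] by blast
 then obtain c where c: "!!k g. sq_int lborel (c k g)" "!!k g t. t \<notin> I ==> c k g t = 0"
  "!!k g. AE t in lebesgue_on I. (indicator (A k g) t :: real) = c k g t" by metis
 define S where "S k z = (\<Sum>g\<in>s k ` I. R g (fst z) * c k g (snd z))" for k z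
 have Ssq: "sq_int lborel (S k)" for k
  unfolding S_def using s(2) by (intro sq_int_sum sq_int_tensor R(1) c(1)) auto
 have "AE t in lebesgue_on I. \<forall>k. \<forall>g\<in>s k ` I. (indicator (A k g) t :: real) = c k g t"
  unfolding AE_all_countable using s(1) c(3) by (intro allI AE_finite_allI) auto
 then have good: "AE t in lborel. t \<in> I --> (\<forall>k x. S k (x, t) = (if L2_norm \<Omega> (s k t) <= n t + 1 then R (s k t) x else 0))"
  unfolding AEI
 proof eventually_elim
  case (elim t)
  show ?case
  proof (intro impI allI)
   fix k x assume t: "t \<in> I"
   have "S k (x, t) = (\<Sum>g\<in>s k ` I. if g = s k t then (if L2_norm \<Omega> (s k t) <= n t + 1 then R (s k t) x else 0) else 0)"
    unfolding S_def
   proof (rule sum.cong[OF refl])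
    fix g assume "g \<in> s k ` I"
    then have "(indicator (A k g) t :: real) = c k g t" using elim t by blast
    then have "c k g t = indicator (A k g) t" by simp
    then show "R g (fst (x, t)) * c k g (snd (x, t))
      = (if g = s k t then (if L2_norm \<Omega> (s k t) <= n t + 1 then R (s k t) x else 0) else 0)"
     using t by (auto simp: A_def)
   qed
   also have "\<dots> = (if L2_norm \<Omega> (s k t) <= n t + 1 then R (s k t) x else 0)"
    using s(1)[of k] t by (subst sum.delta) auto
   finally show "S k (x, t) = (if L2_norm \<Omega> (s k t) <= n t + 1 then R (s k t) x else 0)" .
  qed
 qed
 have Sout: "S k (x, t) = 0" if "t \<notin> I" for k x t using c(2)[OF that] by (simp add: S_def)
 have sq_t: "AE t in lborel. \<forall>k. sq_int lborel (\<lambda>x. S k (x, t))"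
  unfolding AE_all_countable using sq_int_slices(1)[OF Ssq] by blast
 have conv: "AE t in lborel. t \<in> I --> V t \<in> L2 \<Omega> & (\<lambda>k. l2n lborel (\<lambda>x. S k (x, t) - R (V t) x)) \<longlonglongrightarrow> 0"
  using good VL[unfolded AEI] s(4)[unfolded AEI] bound[folded I_def, unfolded AEI]
 proof eventually_elim
  case (elim t)
  show ?case
  proof (intro impI conjI)
   assume t: "t \<in> I"
   then show v: "V t \<in> L2 \<Omega>" using elim by blast
   have sv: "s k t \<in> L2 \<Omega>" for k using s(2)[of k] t by auto
   have l: "(\<lambda>k. L2_norm \<Omega> (\<lambda>x. s k t x - V t x)) \<longlonglongrightarrow> 0" using elim t by blast
   have "\<forall>\<^sub>F k in sequentially. L2_norm \<Omega> (\<lambda>x. s k t x - V t x) = l2n lborel (\<lambda>x. S k (x, t) - R (V t) x)"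
    using order_tendstoD(2)[OF l zero_less_one]
   proof eventually_elim
    case (elim k)
    have "L2_norm \<Omega> (\<lambda>x. (s k t x - V t x) + V t x) <= L2_norm \<Omega> (\<lambda>x. s k t x - V t x) + L2_norm \<Omega> (V t)"
     unfolding L2_norm_eq by (rule l2n_triangle) (use L2_diff[OF sv v] v in "auto simp: L2_iff")
    then have "L2_norm \<Omega> (s k t) <= n t + 1" using elim \<open>t \<in> I --> L2_norm \<Omega> (V t) <= n t\<close> t by simp
    then have "(\<lambda>x. S k (x, t) - R (V t) x) = (\<lambda>x. R (s k t) x - R (V t) x)"
     using \<open>t \<in> I --> (\<forall>k x. S k (x, t) = _ k x)\<close> t by simp
    then show ?case using Rdiff[OF sv v] by simp
   qed
   with l show "(\<lambda>k. l2n lborel (\<lambda>x. S k (x, t) - R (V t) x)) \<longlonglongrightarrow> 0"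
    by (rule Lim_transform_eventually)
  qed
 qed
 have Sbound: "AE t in lborel. \<forall>k. l2n lborel (\<lambda>x. S k (x, t)) <= m t"
  using good m(3)[unfolded AEI]
 proof eventually_elim
  case (elim t)
  show ?case
  proof
   fix k
   show "l2n lborel (\<lambda>x. S k (x, t)) <= m t"
   proof (cases "t \<in> I")
    case True
    then have sv: "s k t \<in> L2 \<Omega>" using s(2)[of k] by auto
    have mt: "m t = n t + 1" using elim True by simp
    show ?thesis
    proof (cases "L2_norm \<Omega> (s k t) <= n t + 1")
     case le: True
     then have "(\<lambda>x. S k (x, t)) = R (s k t)" using elim True by auto
     then show ?thesis using Rnorm[OF sv] le mt by simp
    next
     case False
     then have "(\<lambda>x. S k (x, t)) = (\<lambda>x. 0)" using elim True by auto
     then show ?thesis using mt n(2)[of t] by (simp add: l2n_def)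
    qed
   next
    case False
    then show ?thesis using Sout[OF False] m(2)[OF False] by (simp add: l2n_def)
   qed
  qed
 qed
 have Cauchy: "\<exists>N. \<forall>k\<ge>N. \<forall>l\<ge>N. l2n lborel (\<lambda>z. S k z - S l z) < e" if e: "e > 0" for e
 proof (rule ccontr)
  assume "\<not> ?thesis"
  then have "\<forall>N. \<exists>k l. k \<ge> N & l \<ge> N & e <= l2n lborel (\<lambda>z. S k z - S l z)" by (meson not_le)
  then obtain p q where pq: "!!N. p N \<ge> N" "!!N. q N \<ge> N" "!!N. e <= l2n lborel (\<lambda>z. S (p N) z - S (q N) z)"
   by metis
  define D where "D N t = (l2n lborel (\<lambda>x. S (p N) (x, t) - S (q N) (x, t)))\<^sup>2" for N t
  have d: "sq_int lborel (\<lambda>z. S (p N) z - S (q N) z)" for N using Ssq by auto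
  have Dint: "(LBINT t. D N t) = (l2n lborel (\<lambda>z. S (p N) z - S (q N) z))\<^sup>2" for N
   unfolding D_def by (rule sq_int_slices(4)[OF d])
  have "(\<lambda>N. (LBINT t. D N t)) \<longlonglongrightarrow> (\<integral>t. 0 \<partial>(lborel :: real measure))"
  proof (rule integral_dominated_convergence[where w="\<lambda>t. 4 * (norm (m t))\<^sup>2"])
   show "D N \<in> borel_measurable lborel" for N
    using sq_int_slices(3)[OF d, of N] by (auto simp: D_def[abs_def])
   show "integrable lborel (\<lambda>t. 4 * (norm (m t))\<^sup>2)" using sq_int_integrable[OF m(1)] by simp
   show "AE t in lborel. norm (D N t) <= 4 * (norm (m t))\<^sup>2" for N
    using Sbound sq_t
   proof eventually_elim
    case (elim t)
    have "l2n lborel (\<lambda>x. S (p N) (x, t) - S (q N) (x, t)) <= l2n lborel (\<lambda>x. S (p N) (x, t)) + l2n lborel (\<lambda>x. S (q N) (x, t))"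
     by (rule l2n_triangle_minus) (use elim(2) in auto)
    also have "\<dots> <= 2 * m t" using elim(1)[rule_format, of "p N"] elim(1)[rule_format, of "q N"] by simp
    finally have "D N t <= (2 * m t)\<^sup>2" unfolding D_def by (intro power_mono) auto
    then show ?case by (simp add: D_def power_mult_distrib)
   qed
   show "AE t in lborel. (\<lambda>N. D N t) \<longlonglongrightarrow> 0"
    using conv sq_t
   proof eventually_elim
    case (elim t)
    show "(\<lambda>N. D N t) \<longlonglongrightarrow> 0"
    proof (cases "t \<in> I")
     case True
     then have v: "V t \<in> L2 \<Omega>" and l: "(\<lambda>k. l2n lborel (\<lambda>x. S k (x, t) - R (V t) x)) \<longlonglongrightarrow> 0"
      using elim by auto
     have "filterlim p sequentially sequentially" "filterlim q sequentially sequentially"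
      using pq(1,2) by (auto simp: filterlim_at_top eventually_sequentially intro: order_trans)
     then have l2: "(\<lambda>N. l2n lborel (\<lambda>x. S (p N) (x, t) - R (V t) x)) \<longlonglongrightarrow> 0"
      "(\<lambda>N. l2n lborel (\<lambda>x. S (q N) (x, t) - R (V t) x)) \<longlonglongrightarrow> 0"
      using filterlim_compose[OF l] by auto
     have "(\<lambda>N. l2n lborel (\<lambda>x. S (p N) (x, t) - S (q N) (x, t))) \<longlonglongrightarrow> 0"
     proof (rule squeeze_0_add[OF l2])
      show "l2n lborel (\<lambda>x. S (p N) (x, t) - S (q N) (x, t))
        <= l2n lborel (\<lambda>x. S (p N) (x, t) - R (V t) x) + l2n lborel (\<lambda>x. S (q N) (x, t) - R (V t) x)" for N
       using l2n_triangle_diff[of lborel "\<lambda>x. S (p N) (x, t)" "R (V t)" "\<lambda>x. S (q N) (x, t)"] elim(2) R(1)[OF v]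
       by (simp add: l2n_minus_commute[of lborel "R (V t)"])
     qed simp
     from tendsto_power[OF this, of 2] show ?thesis by (simp add: D_def)
    next
     case False
     then show ?thesis by (simp add: D_def Sout l2n_def)
    qed
   qed
  qed simp
  then have "(\<lambda>N. (l2n lborel (\<lambda>z. S (p N) z - S (q N) z))\<^sup>2) \<longlonglongrightarrow> 0" by (simp add: Dint)
  from order_tendstoD(2)[OF this, of "e\<^sup>2"] e
  have "\<forall>\<^sub>F N in sequentially. (l2n lborel (\<lambda>z. S (p N) z - S (q N) z))\<^sup>2 < e\<^sup>2" by simp
  then obtain N where "(l2n lborel (\<lambda>z. S (p N) z - S (q N) z))\<^sup>2 < e\<^sup>2"
   using eventually_happens'[OF sequentially_bot] by blast
  moreover have "e\<^sup>2 <= (l2n lborel (\<lambda>z. S (p N) z - S (q N) z))\<^sup>2"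
   using pq(3)[of N] e by (intro power_mono) auto
  ultimately show False by simp
 qed
 obtain w0 where w0: "sq_int lborel w0" "(\<lambda>k. l2n lborel (\<lambda>z. S k z - w0 z)) \<longlonglongrightarrow> 0"
  using l2_complete[of lborel S, OF Ssq Cauchy] by blast
 obtain r where r: "strict_mono r"
  "AE t in lborel. (\<lambda>k. l2n lborel (\<lambda>x. S (r k) (x, t) - w0 (x, t))) \<longlonglongrightarrow> 0"
  using slices_subsequence[OF Ssq w0] by blast
 have eq: "AE t in lborel. t \<in> I --> V t \<in> L2 \<Omega> & (AE x in lborel. w0 (x, t) = R (V t) x)"
  using r(2) conv sq_t sq_int_slices(1)[OF w0(1)]
 proof eventually_elim
  case (elim t)
  show ?case
  proof
   assume t: "t \<in> I"
   then have v: "V t \<in> L2 \<Omega>" and l: "(\<lambda>k. l2n lborel (\<lambda>x. S k (x, t) - R (V t) x)) \<longlonglongrightarrow> 0"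
    using elim by auto
   have l': "(\<lambda>k. l2n lborel (\<lambda>x. S (r k) (x, t) - R (V t) x)) \<longlonglongrightarrow> 0"
    using LIMSEQ_subseq_LIMSEQ[OF l r(1)] by (simp add: o_def)
   have "AE x in lborel. w0 (x, t) = R (V t) x"
    by (rule l2_unique_limit[of lborel "\<lambda>k x. S (r k) (x, t)" "\<lambda>x. w0 (x, t)" "R (V t)"])
      (use elim R(1)[OF v] l' in auto)
   with v show "V t \<in> L2 \<Omega> & (AE x in lborel. w0 (x, t) = R (V t) x)" by blast
  qed
 qed
 define w where "w z = indicator (cylinder \<Omega> T) z * w0 z" for z
 have "w \<in> cyl \<Omega> T" unfolding w_def by (rule cyl_restrict[OF w0(1) \<Omega>b])
 moreover have "AE t in lebesgue_on I. eq_ae \<Omega> (\<lambda>x. w (x, t)) (V t)"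
  unfolding AEI using eq
 proof eventually_elim
  case (elim t)
  show ?case
  proof
   assume t: "t \<in> I"
   then have v: "V t \<in> L2 \<Omega>" and e: "AE x in lborel. w0 (x, t) = R (V t) x" using elim by auto
   show "eq_ae \<Omega> (\<lambda>x. w (x, t)) (V t)"
    unfolding eq_ae_def AE_on_iff[OF \<Omega>b]
    using e R(3)[OF v, unfolded AE_on_iff[OF \<Omega>b]]
    by eventually_elim (use t in "auto simp: w_def I_def")
  qed
 qed
 ultimately show ?thesis using that unfolding I_def by blast
qed

lemma bochner_norm_L2:
 assumes V: "V \<in> bochner_L2 X N I" and N: "!!u. 0 <= N u"
 shows "(\<lambda>t. N (V t)) \<in> L2 I"
proof -
 have i: "integrable (lebesgue_on I) (\<lambda>t. (N (V t))\<^sup>2)" using V by (simp add: bochner_L2_def)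
 then have "(\<lambda>t. sqrt ((N (V t))\<^sup>2)) \<in> borel_measurable (lebesgue_on I)"
  using borel_measurable_integrable[OF i] by measurable
 then show ?thesis using i N by (simp add: L2_def)
qed

lemma bochner_joint_representative:
 assumes \<Omega>: "open \<Omega>" and V: "V \<in> bochner_L2 (L2 \<Omega>) (L2_norm \<Omega>) {0<..<T}"
 obtains w where "w \<in> cyl \<Omega> T" "AE t in lebesgue_on {0<..<T}. eq_ae \<Omega> (\<lambda>x. w (x, t)) (V t)"
proof (rule joint_representative[OF \<Omega> _ bochner_norm_L2[OF V]])
 show "strongly_measurable_into (L2 \<Omega>) (L2_norm \<Omega>) {0<..<T} V" using V by (simp add: bochner_L2_def)
qed (use that in auto)

lemma weak_gradient_diff_le:
 assumes S: "open S" and u: "u \<in> H10 S" and v: "v \<in> H10 S" and b: "b \<in> Basis"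
 shows "L2_norm S (\<lambda>x. weak_gradient S u x \<bullet> b - weak_gradient S v x \<bullet> b) <= H1_norm S (\<lambda>x. u x - v x)"
proof -
 have G: "has_weak_gradient S (\<lambda>x. u x - v x) (\<lambda>x. weak_gradient S u x - weak_gradient S v x)"
  by (rule has_weak_gradient_diff[OF S H10_L2[OF u] H10_L2[OF v] H10_gradient[OF u] H10_gradient[OF v]])
 have L: "(\<lambda>x. u x - v x) \<in> L2 S" by (intro L2_diff H10_L2 u v)
 have W: "has_weak_gradient S (\<lambda>x. u x - v x) (weak_gradient S (\<lambda>x. u x - v x))"
  by (rule has_weak_gradient_weak_gradient[OF H1I[OF L G]])
 have "L2_norm S (\<lambda>x. (weak_gradient S u x - weak_gradient S v x) \<bullet> b) = L2_norm S (\<lambda>x. weak_gradient S (\<lambda>x. u x - v x) x \<bullet> b)"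
  unfolding L2_norm_eq
  by (rule l2n_cong_AE[OF L2_measurable[OF gradient_L2[OF G b]]
     L2_measurable[OF gradient_L2[OF W b]] weak_gradient_unique[OF S G W b]])
 also have "\<dots> <= H1_norm S (\<lambda>x. u x - v x)" by (rule weak_gradient_norm_le_H1_norm[OF b])
 finally show ?thesis by (simp add: inner_diff_left)
qed

lemma bochner_gradient_representative:
 fixes \<Omega> :: "'a::euclidean_space set"
 assumes \<Omega>: "open \<Omega>" and V: "V \<in> bochner_L2 (H10 \<Omega>) (H1_norm \<Omega>) {0<..<T}" and b: "b \<in> Basis"
 obtains g where "g \<in> cyl \<Omega> T"
  "AE t in lebesgue_on {0<..<T}. eq_ae \<Omega> (\<lambda>x. g (x, t)) (\<lambda>x. weak_gradient \<Omega> (V t) x \<bullet> b)"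
proof (rule joint_representative[OF \<Omega> _ bochner_norm_L2[OF V]])
 let ?I = "{0<..<T}"
 let ?D = "\<lambda>u x. weak_gradient \<Omega> u x \<bullet> b"
 obtain s where s: "!!k. finite (s k ` ?I)" "!!k. s k ` ?I \<subseteq> H10 \<Omega>"
  "!!k g. {t \<in> ?I. s k t = g} \<in> sets lebesgue"
  "AE t in lebesgue_on ?I. (\<lambda>k. H1_norm \<Omega> (\<lambda>x. s k t x - V t x)) \<longlonglongrightarrow> 0"
  and VH: "AE t in lebesgue_on ?I. V t \<in> H10 \<Omega>"
  using V unfolding bochner_L2_def strongly_measurable_into_def by blast
 have DL: "?D u \<in> L2 \<Omega>" if "u \<in> H10 \<Omega>" for u
  by (rule gradient_L2[OF H10_gradient[OF that] b])
 show "strongly_measurable_into (L2 \<Omega>) (L2_norm \<Omega>) ?I (\<lambda>t. ?D (V t))"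
  unfolding strongly_measurable_into_def
 proof (intro conjI exI allI)
  show "AE t in lebesgue_on ?I. ?D (V t) \<in> L2 \<Omega>"
   using VH by eventually_elim (rule DL)
  fix k
  have im: "(\<lambda>t. ?D (s k t)) ` ?I = ?D ` (s k ` ?I)" by (simp only: image_image)
  show "finite ((\<lambda>t. ?D (s k t)) ` ?I)" unfolding im by (rule finite_imageI[OF s(1)])
  show "(\<lambda>t. ?D (s k t)) ` ?I \<subseteq> L2 \<Omega>" unfolding im using s(2)[of k] DL by blast
  fix g
  have "{t \<in> ?I. ?D (s k t) = g} = (\<Union>h\<in>{h \<in> s k ` ?I. ?D h = g}. {t \<in> ?I. s k t = h})" by auto
  moreover have "finite {h \<in> s k ` ?I. ?D h = g}" using s(1)[of k] by simp
  ultimately show "{t \<in> ?I. ?D (s k t) = g} \<in> sets lebesgue"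
   using s(3) by (metis (no_types, lifting) sets.finite_UN)
 next
  have I: "AE t in lebesgue_on ?I. t \<in> ?I" by (rule AE_I2) simp
  show "AE t in lebesgue_on ?I. (\<lambda>k. L2_norm \<Omega> (\<lambda>x. ?D (s k t) x - ?D (V t) x)) \<longlonglongrightarrow> 0"
   using VH s(4) I
  proof eventually_elim
   case (elim t)
   have "s k t \<in> H10 \<Omega>" for k using s(2)[of k] elim(3) by blast
   then show ?case
    by (intro squeeze_0[OF elim(2) weak_gradient_diff_le[OF \<Omega> _ elim(1) b]]) simp_all
  qed
 qed
 show "AE t in lebesgue_on ?I. L2_norm \<Omega> (?D (V t)) <= H1_norm \<Omega> (V t)"
  by (rule AE_I2) (rule weak_gradient_norm_le_H1_norm[OF b])
qed (use that in auto)

text \<open>Sampling at \<open>\<lfloor>m t\<rfloor> / m\<close> produces the step functions that strong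
 measurability asks for.\<close>

lemma step_function_measurable:
 fixes \<Phi> :: "int => 'c" and m T :: real
 shows "finite ((\<lambda>t. \<Phi> \<lfloor>m * t\<rfloor>) ` {0<..<T})" and "{t \<in> {0<..<T}. \<Phi> \<lfloor>m * t\<rfloor> = g} \<in> sets lebesgue"
proof -
 have "(\<lambda>t. \<lfloor>m * t\<rfloor>) ` {0<..<T} \<subseteq> {\<lfloor>- \<bar>m\<bar> * \<bar>T\<bar>\<rfloor>..\<lfloor>\<bar>m\<bar> * \<bar>T\<bar>\<rfloor>}"
 proof (rule image_subsetI)
  fix t assume t: "t \<in> {0<..<T}"
  have "\<bar>m * t\<bar> <= \<bar>m\<bar> * \<bar>T\<bar>" using t by (auto simp: abs_mult intro!: mult_left_mono)
  then have "- \<bar>m\<bar> * \<bar>T\<bar> <= m * t" "m * t <= \<bar>m\<bar> * \<bar>T\<bar>" by linarith+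
  then show "\<lfloor>m * t\<rfloor> \<in> {\<lfloor>- \<bar>m\<bar> * \<bar>T\<bar>\<rfloor>..\<lfloor>\<bar>m\<bar> * \<bar>T\<bar>\<rfloor>}"
   by (simp only: atLeastAtMost_iff floor_mono simp_thms)
 qed
 then have "finite ((\<lambda>t. \<lfloor>m * t\<rfloor>) ` {0<..<T})" by (rule finite_subset) simp
 then have "finite (\<Phi> ` ((\<lambda>t. \<lfloor>m * t\<rfloor>) ` {0<..<T}))" by (rule finite_imageI)
 then show "finite ((\<lambda>t. \<Phi> \<lfloor>m * t\<rfloor>) ` {0<..<T})" by (simp only: image_image)
 have "(\<lambda>t. \<lfloor>m * t\<rfloor>) \<in> measurable borel (count_space UNIV)" by measurable
 then have "(\<lambda>t. \<lfloor>m * t\<rfloor>) -` {j. \<Phi> j = g} \<inter> space borel \<in> sets borel"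
  by (rule measurable_sets) simp
 moreover have "{t \<in> {0<..<T}. \<Phi> \<lfloor>m * t\<rfloor> = g} = {0<..<T} \<inter> ((\<lambda>t. \<lfloor>m * t\<rfloor>) -` {j. \<Phi> j = g} \<inter> space borel)"
  by auto
 ultimately have "{t \<in> {0<..<T}. \<Phi> \<lfloor>m * t\<rfloor> = g} \<in> sets borel" by (metis sets.Int greaterThanLessThan_borel)
 then show "{t \<in> {0<..<T}. \<Phi> \<lfloor>m * t\<rfloor> = g} \<in> sets lebesgue" by simp
qed

section \<open>Weak evolution equations in one time variable\<close>

lemma measurable_lebesgue_on_AE:
 fixes f g :: "'a::euclidean_space => real"
 assumes S: "S \<in> sets borel" and g: "g \<in> borel_measurable (lebesgue_on S)" and ae: "AE x in lebesgue_on S. f x = g x"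
 shows "f \<in> borel_measurable (lebesgue_on S)"
proof -
 have SL: "S \<in> sets lebesgue" using S by simp
 have "(\<lambda>x. if x \<in> S then g x else 0) \<in> borel_measurable lebesgue"
  using g SL by (simp add: borel_measurable_if)
 moreover have "AE x in lebesgue. (if x \<in> S then g x else 0) = (if x \<in> S then f x else 0)"
  unfolding AE_completion_iff using ae[unfolded AE_on_iff[OF S]] by eventually_elim auto
 ultimately have "(\<lambda>x. if x \<in> S then f x else 0) \<in> borel_measurable lebesgue"
  by (rule borel_measurable_AE)
 then show ?thesis using SL by (simp add: borel_measurable_if)
qed

lemma integral_lebesgue_on_AE:
 fixes f g :: "'a::euclidean_space => real"
 assumes S: "S \<in> sets borel" and g: "g \<in> borel_measurable borel" and ae: "AE x in lebesgue_on S. f x = g x"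
 shows "integral\<^sup>L (lebesgue_on S) f = (LBINT x. indicator S x * g x)"
proof -
 have "integral\<^sup>L (lebesgue_on S) f = integral\<^sup>L (lebesgue_on S) g"
  by (rule integral_cong_AE[OF measurable_lebesgue_on_AE[OF S borel_on[OF g] ae] borel_on[OF g] ae])
 also have "\<dots> = (LBINT x. indicator S x * g x)"
  using lebesgue_on_borel(1)[OF S g] by simp
 finally show ?thesis .
qed

lemma L2_inner_rep:
 assumes S: "S \<in> sets borel" and f: "f0 \<in> borel_measurable borel" "eq_ae S f f0"
  and g: "g0 \<in> borel_measurable borel" "eq_ae S g g0" and z: "!!x. x \<notin> S ==> f0 x = 0 \<or> g0 x = 0"
 shows "L2_inner S f g = (LBINT x. f0 x * g0 x)"
proof -
 note f' = f(2)[unfolded eq_ae_def] and g' = g(2)[unfolded eq_ae_def]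
 have "L2_inner S f g = L2_inner S f0 g0"
  by (rule L2_inner_cong_AE[OF measurable_lebesgue_on_AE[OF S borel_on[OF f(1)] f'] borel_on[OF f(1)]
    measurable_lebesgue_on_AE[OF S borel_on[OF g(1)] g'] borel_on[OF g(1)] f' g'])
 also have "\<dots> = (LBINT x. f0 x * g0 x)" by (rule L2_inner_lborel[OF S f(1) g(1) z])
 finally show ?thesis .
qed

lemma eq_ae_refl [simp]: "eq_ae S f f"
 by (simp add: eq_ae_def)

lemma eq_ae_sym: "eq_ae S f g ==> eq_ae S g f"
 by (simp add: eq_ae_def eq_commute)

lemma eq_ae_trans:
 assumes "eq_ae S f g" "eq_ae S g h" shows "eq_ae S f h"
 using assms unfolding eq_ae_def by eventually_elim simp

lemma continuous_AE_const:
 fixes d :: "real => real"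
 assumes T: "0 < T" and d: "continuous_on {0..T} d" and ae: "AE t in lebesgue_on {0<..<T}. d t = c" and t: "t \<in> {0..T}"
 shows "d t = c"
proof -
 have cl: "closure {0<..<T} = {0..T}" using T by simp
 have d': "continuous_on {0<..<T} d" by (rule continuous_on_subset[OF d]) auto
 have op: "open ({0<..<T} \<inter> d -` (- {c}))"
  using d' by (intro continuous_open_preimage) auto
 have "AE t in lborel. t \<in> {0<..<T} --> d t = c" using ae by (subst (asm) AE_on_iff) auto
 then have "AE t in lebesgue. t \<notin> {0<..<T} \<inter> d -` (- {c})"
  unfolding AE_completion_iff by eventually_elim auto
 then have "{0<..<T} \<inter> d -` (- {c}) \<in> null_sets lebesgue"
  using op by (subst (asm) AE_iff_null_sets[symmetric]) auto
 then have "{0<..<T} \<inter> d -` (- {c}) = {}"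
  using open_not_negligible[OF op] by (auto simp: negligible_iff_null_sets)
 then have "d s = c" if "s \<in> {0<..<T}" for s using that by auto
 then show ?thesis using continuous_constant_on_closure[of "{0<..<T}" d c t] d t unfolding cl by blast
qed

lemma prim_continuous:
 assumes k: "sq_int lborel k" shows "continuous_on {0..} (prim k)"
proof -
 have "\<bar>prim k t - prim k s\<bar> <= sqrt \<bar>t - s\<bar> * l2n lborel k" if "0 <= s" "0 <= t" for s t
 proof -
  have *: "\<bar>prim k t - prim k s\<bar> <= sqrt \<bar>t - s\<bar> * l2n lborel k" if "0 <= s" "s <= t" for s t
  proof -
   have "(prim k t - prim k s)\<^sup>2 <= (sqrt \<bar>t - s\<bar> * l2n lborel k)\<^sup>2"
    using prim_diff_square[OF k that] that by (simp add: power_mult_distrib)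
   then show ?thesis by (metis abs_le_square_iff abs_of_nonneg l2n_nonneg mult_nonneg_nonneg real_sqrt_ge_zero abs_ge_zero)
  qed
  show ?thesis
  proof (cases "s <= t")
   case True then show ?thesis using *[OF \<open>0 <= s\<close>] by blast
  next
   case False
   then show ?thesis using *[OF \<open>0 <= t\<close>, of s] by (simp add: abs_minus_commute)
  qed
 qed
 note bd = this
 show ?thesis
  unfolding continuous_on_def
 proof
  fix s :: real assume s: "s \<in> {0..}"
  have "((\<lambda>t. sqrt \<bar>t - s\<bar> * l2n lborel k) \<longlongrightarrow> sqrt \<bar>s - s\<bar> * l2n lborel k) (at s within {0..})"
   by (intro tendsto_intros)
  then have l: "((\<lambda>t. sqrt \<bar>t - s\<bar> * l2n lborel k) \<longlongrightarrow> 0) (at s within {0..})" by simp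
  have "((\<lambda>t. prim k t - prim k s) \<longlongrightarrow> 0) (at s within {0..})"
  proof (rule Lim_null_comparison[OF _ l])
   show "\<forall>\<^sub>F t in at s within {0..}. norm (prim k t - prim k s) <= sqrt \<bar>t - s\<bar> * l2n lborel k"
    unfolding eventually_at_filter by (rule always_eventually) (use bd s in auto)
  qed
  then show "(prim k \<longlongrightarrow> prim k s) (at s within {0..})" by (rule LIM_zero_cancel)
 qed
qed

text \<open>By the lemma of du Bois-Reymond \<open>c - prim k\<close> is constant, and continuity up to time
 \<open>0\<close> identifies the constant.\<close>

lemma weak_primitive:
 fixes c k :: "real => real"
 assumes T: "0 < T" and c: "continuous_on {0..T} c" "c 0 = 0"
  and k: "sq_int lborel k" "!!t. t \<notin> {0<..<T} ==> k t = 0"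
  and weak: "!!\<eta>. \<eta> \<in> test_functions {0<..<T} ==>
   (LINT t|lebesgue_on {0<..<T}. pderiv_dir 1 \<eta> t * c t) = - (LBINT t. \<eta> t * k t)"
  and t: "t \<in> {0..T}"
 shows "c t = prim k t"
proof -
 let ?I = "{0<..<T}"
 have ki: "integrable lborel k" by (rule sq_int_supported_integrable[OF k])
 have fin: "finite_measure (lebesgue_on ?I)" by (rule finite_measure_lebesgue_on) simp
 have cont_L2: "f \<in> L2 ?I" if f: "continuous_on {0..T} f" for f
 proof -
  have "bounded (f ` {0..T})" by (intro compact_imp_bounded compact_continuous_image f) simp
  then obtain B where B: "!!t. t \<in> {0..T} ==> norm (f t) <= B" unfolding bounded_iff by blast
  have "f \<in> borel_measurable (lebesgue_on ?I)"
   by (rule continuous_imp_measurable_on_sets_lebesgue) (auto intro: continuous_on_subset[OF f])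
  then show ?thesis unfolding L2_iff
   by (rule finite_measure.sq_int_bounded[OF fin, where c=B]) (use B in auto)
 qed
 have pc: "continuous_on {0..T} (prim k)"
  by (rule continuous_on_subset[OF prim_continuous[OF k(1)]]) auto
 have L: "c \<in> L2 ?I" "prim k \<in> L2 ?I" by (intro cont_L2 c pc)+
 have "L2_inner ?I (\<lambda>t. c t - prim k t) (pderiv_dir 1 \<eta>) = 0" if \<eta>: "\<eta> \<in> test_functions ?I" for \<eta>
 proof -
  have \<eta>': "pderiv_dir 1 \<eta> \<in> test_functions ?I" using test_pderiv[OF \<eta>, of 1] by simp
  have "L2_inner ?I c (pderiv_dir 1 \<eta>) = - (LBINT t. \<eta> t * k t)"
   using weak[OF \<eta>] by (simp add: L2_inner_def mult.commute)
  moreover have "L2_inner ?I (prim k) (pderiv_dir 1 \<eta>) = - (LBINT t. \<eta> t * k t)"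
  proof -
   have km: "k \<in> borel_measurable borel" using k(1) by (auto simp: sq_int_def)
   have "L2_inner ?I (prim k) (pderiv_dir 1 \<eta>) = (LBINT t. prim k t * pderiv_dir 1 \<eta> t)"
    by (rule L2_inner_lborel) (use prim_borel[OF km] test_borel[OF \<eta>'] test_outside[OF \<eta>'] in auto)
   also have "\<dots> = (LBINT t. indicator ?I t * (pderiv_dir 1 \<eta> t * prim k t))"
   proof (rule integral_cong_pw)
    fix t show "prim k t * pderiv_dir 1 \<eta> t = indicator ?I t * (pderiv_dir 1 \<eta> t * prim k t)"
     using test_outside[OF \<eta>', of t] by (cases "t \<in> ?I") auto
   qed
   also have "\<dots> = (LBINT s. indicator ?I s * ((\<eta> T - \<eta> s) * k s))"
    by (rule prim_by_parts[OF ki less_imp_le[OF T] smooth_has_real_derivative[OF test_smooth[OF \<eta>]] smooth_continuous[OF test_smooth[OF \<eta>']]])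
   also have "\<dots> = (LBINT s. - (\<eta> s * k s))"
   proof (rule integral_cong_pw)
    fix s show "indicator ?I s * ((\<eta> T - \<eta> s) * k s) = - (\<eta> s * k s)"
     using test_outside[OF \<eta>, of T] k(2)[of s] by (cases "s \<in> ?I") auto
   qed
   finally show ?thesis by simp
  qed
  ultimately show ?thesis
   using L test_L2[OF \<eta>'] by (simp add: L2_inner_diff_left)
 qed
 from du_Bois_Reymond[OF T L2_diff[OF L] this]
 obtain a where a: "AE t in lebesgue_on ?I. c t - prim k t = a" by blast
 have cd: "continuous_on {0..T} (\<lambda>t. c t - prim k t)" by (intro continuous_intros c pc)
 have "c t - prim k t = a" by (rule continuous_AE_const[OF T cd a t])
 moreover have "c 0 - prim k 0 = a" by (rule continuous_AE_const[OF T cd a]) (use T in auto)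
 ultimately show ?thesis using c(2) by simp
qed

lemma sum_scaled_prim:
 assumes "!!b. b \<in> B ==> sq_int lborel (k b)" "sq_int lborel h"
 shows "prim (\<lambda>s. h s - (\<Sum>b\<in>B. k b s)) t = prim h t - (\<Sum>b\<in>B. prim (k b) t)"
proof -
 have i: "integrable lborel (\<lambda>s. indicator {0<..<t} s * f s)" if "sq_int lborel f" for f :: "real => real"
  by (rule sq_int_mult[OF sq_int_interval that])
 have "prim (\<lambda>s. h s - (\<Sum>b\<in>B. k b s)) t
   = (LBINT s. indicator {0<..<t} s * h s - (\<Sum>b\<in>B. indicator {0<..<t} s * k b s))"
  by (simp add: prim_def right_diff_distrib sum_distrib_left)
 also have "\<dots> = prim h t - (\<Sum>b\<in>B. prim (k b) t)"
  using i assms by (simp add: prim_def Bochner_Integration.integral_sum)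
 finally show ?thesis .
qed

section \<open>Uniqueness\<close>

lemma H1_norm_cmult_test:
 assumes S: "open S" and \<xi>: "\<xi> \<in> test_functions S"
 shows "H1_norm S (\<lambda>x. c * \<xi> x) = \<bar>c\<bar> * H1_norm S \<xi>"
proof -
 have g: "has_weak_gradient S \<xi> (grad \<xi>)" and L: "\<xi> \<in> L2 S"
  by (rule has_weak_gradient_test[OF S \<xi>], rule test_L2[OF \<xi> S])
 have "L2_norm S (\<lambda>x. (c *\<^sub>R grad \<xi> x) \<bullet> b) = \<bar>c\<bar> * L2_norm S (\<lambda>x. grad \<xi> x \<bullet> b)" for b
  by (simp add: L2_norm_eq l2n_cmult)
 moreover have "L2_norm S (\<lambda>x. c * \<xi> x) = \<bar>c\<bar> * L2_norm S \<xi>" by (simp add: L2_norm_eq l2n_cmult)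
 ultimately have "H1_norm S (\<lambda>x. c * \<xi> x) = sqrt (c\<^sup>2 * ((L2_norm S \<xi>)\<^sup>2 + (\<Sum>b\<in>Basis. (L2_norm S (\<lambda>x. grad \<xi> x \<bullet> b))\<^sup>2)))"
  using H1_norm_eq[OF S has_weak_gradient_cmult[OF g, of c] L2_cmult[OF L]]
  by (simp add: power_mult_distrib distrib_left sum_distrib_left)
 then show ?thesis using H1_norm_eq[OF S g L] by (simp add: real_sqrt_mult)
qed

lemma dual_space_add:
 "F \<in> dual_space X N ==> u \<in> X ==> v \<in> X ==> F (\<lambda>x. u x + v x) = F u + F v"
 by (simp add: dual_space_def)

lemma dual_bound:
 assumes F: "F \<in> dual_space X N" and N: "!!u. 0 <= N u"
 obtains K where "0 <= K" "!!u. u \<in> X ==> \<bar>F u\<bar> <= K * N u"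
proof -
 have "\<exists>K. \<forall>u\<in>X. \<bar>F u\<bar> <= K * N u" using F by (simp add: dual_space_def)
 then obtain K where K: "!!u. u \<in> X ==> \<bar>F u\<bar> <= K * N u" by blast
 have "\<bar>F u\<bar> <= \<bar>K\<bar> * N u" if "u \<in> X" for u
  using K[OF that] mult_right_mono[OF abs_ge_self[of K] N[of u]] by linarith
 then show ?thesis using that[of "\<bar>K\<bar>"] by simp
qed

text \<open>Evaluation at a fixed test function is bounded by the dual norm; rescaling brings the test
 function into the unit ball over which that norm is a supremum.\<close>

lemma dual_continuous_test:
 fixes \<Omega> :: "'a::euclidean_space set"
 assumes \<Omega>: "open \<Omega>" and F: "continuous_into (dual_space (H10 \<Omega>) (H1_norm \<Omega>)) (dual_norm (H10 \<Omega>) (H1_norm \<Omega>)) J F"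
  and \<xi>: "\<xi> \<in> test_functions \<Omega>"
 shows "continuous_on J (\<lambda>t. F t \<xi>)"
 unfolding continuous_on_def
proof
 fix t assume t: "t \<in> J"
 define a where "a = 1 / (H1_norm \<Omega> \<xi> + 1)"
 have H: "H1_norm \<Omega> \<xi> + 1 > 0" using H1_norm_nonneg[of \<Omega> \<xi>] by linarith
 have a: "a > 0" using H by (simp add: a_def)
 define \<xi>' where "\<xi>' x = a * \<xi> x" for x
 have \<xi>'H: "\<xi>' \<in> H10 \<Omega>" unfolding \<xi>'_def by (rule test_H10[OF \<Omega> test_cmult[OF \<xi>]])
 have \<xi>'1: "H1_norm \<Omega> \<xi>' <= 1"
  unfolding \<xi>'_def[abs_def] using H1_norm_cmult_test[OF \<Omega> \<xi>, of a] H a by (simp add: a_def)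
 have D: "F s \<in> dual_space (H10 \<Omega>) (H1_norm \<Omega>)" if "s \<in> J" for s
  using F that by (simp add: continuous_into_def)
 have bound: "\<bar>F s \<xi> - F t \<xi>\<bar> <= dual_norm (H10 \<Omega>) (H1_norm \<Omega>) (\<lambda>u. F s u - F t u) / a" if s: "s \<in> J" for s
 proof -
  obtain K where K: "0 <= K" "!!u. u \<in> H10 \<Omega> ==> \<bar>F s u\<bar> <= K * H1_norm \<Omega> u"
   using dual_bound[OF D[OF s]] by (metis H1_norm_nonneg)
  obtain K' where K': "0 <= K'" "!!u. u \<in> H10 \<Omega> ==> \<bar>F t u\<bar> <= K' * H1_norm \<Omega> u"
   using dual_bound[OF D[OF t]] by (metis H1_norm_nonneg)
  have "bdd_above ((\<lambda>u. \<bar>F s u - F t u\<bar>) ` {u \<in> H10 \<Omega>. H1_norm \<Omega> u <= 1})"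
  proof (rule bdd_aboveI2)
   fix u assume u: "u \<in> {u \<in> H10 \<Omega>. H1_norm \<Omega> u <= 1}"
   then have "\<bar>F s u\<bar> <= K * 1" "\<bar>F t u\<bar> <= K' * 1"
    using K(2)[of u] K'(2)[of u] mult_left_mono[OF _ K(1), of "H1_norm \<Omega> u" 1]
     mult_left_mono[OF _ K'(1), of "H1_norm \<Omega> u" 1] by auto
   then show "\<bar>F s u - F t u\<bar> <= K + K'" by linarith
  qed
  then have "\<bar>F s \<xi>' - F t \<xi>'\<bar> <= dual_norm (H10 \<Omega>) (H1_norm \<Omega>) (\<lambda>u. F s u - F t u)"
   unfolding dual_norm_def using \<xi>'H \<xi>'1 by (intro cSUP_upper) auto
  moreover have "F r \<xi>' = a * F r \<xi>" if "r \<in> J" for r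
   using D[OF that] test_H10[OF \<Omega> \<xi>] unfolding dual_space_def \<xi>'_def[abs_def] by blast
  ultimately have "\<bar>a * (F s \<xi> - F t \<xi>)\<bar> <= dual_norm (H10 \<Omega>) (H1_norm \<Omega>) (\<lambda>u. F s u - F t u)"
   using s t by (simp add: right_diff_distrib)
  then show ?thesis using a by (simp add: abs_mult pos_le_divide_eq mult.commute)
 qed
 have "((\<lambda>s. dual_norm (H10 \<Omega>) (H1_norm \<Omega>) (\<lambda>u. F s u - F t u)) \<longlongrightarrow> 0) (at t within J)"
  using F t by (simp add: continuous_into_def)
 then have l: "((\<lambda>s. dual_norm (H10 \<Omega>) (H1_norm \<Omega>) (\<lambda>u. F s u - F t u) / a) \<longlongrightarrow> 0) (at t within J)"
  using tendsto_divide[OF _ tendsto_const[of a]] a by fastforce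
 have "((\<lambda>s. F s \<xi> - F t \<xi>) \<longlongrightarrow> 0) (at t within J)"
  by (rule Lim_null_comparison[OF _ l]) (use bound in "auto simp: eventually_at_filter")
 then show "((\<lambda>s. F s \<xi>) \<longlongrightarrow> F t \<xi>) (at t within J)" by (rule LIM_zero_cancel)
qed

lemma continuous_L2_inner:
 assumes C: "continuous_into (L2 \<Omega>) (L2_norm \<Omega>) J C" and \<psi>: "\<psi> \<in> L2 \<Omega>"
 shows "continuous_on J (\<lambda>t. L2_inner \<Omega> (C t) \<psi>)"
 unfolding continuous_on_def
proof
 fix t assume t: "t \<in> J"
 have CL: "C s \<in> L2 \<Omega>" if "s \<in> J" for s using C that by (simp add: continuous_into_def)
 have "((\<lambda>s. L2_norm \<Omega> (\<lambda>x. C s x - C t x)) \<longlongrightarrow> 0) (at t within J)"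
  using C t by (simp add: continuous_into_def)
 then have l: "((\<lambda>s. L2_norm \<Omega> (\<lambda>x. C s x - C t x) * L2_norm \<Omega> \<psi>) \<longlongrightarrow> 0) (at t within J)"
  using tendsto_mult_left_zero by blast
 have "((\<lambda>s. L2_inner \<Omega> (C s) \<psi> - L2_inner \<Omega> (C t) \<psi>) \<longlongrightarrow> 0) (at t within J)"
 proof (rule Lim_null_comparison[OF _ l])
  have "norm (L2_inner \<Omega> (C s) \<psi> - L2_inner \<Omega> (C t) \<psi>) <= L2_norm \<Omega> (\<lambda>x. C s x - C t x) * L2_norm \<Omega> \<psi>"
   if s: "s \<in> J" for s
   using L2_Cauchy_Schwarz[OF L2_diff[OF CL[OF s] CL[OF t]] \<psi>]
   by (simp add: L2_inner_diff_left CL s t \<psi>)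
  then show "\<forall>\<^sub>F s in at t within J. norm (L2_inner \<Omega> (C s) \<psi> - L2_inner \<Omega> (C t) \<psi>) <= L2_norm \<Omega> (\<lambda>x. C s x - C t x) * L2_norm \<Omega> \<psi>"
   by (auto simp: eventually_at_filter)
 qed
 then show "((\<lambda>s. L2_inner \<Omega> (C s) \<psi>) \<longlongrightarrow> L2_inner \<Omega> (C t) \<psi>) (at t within J)" by (rule LIM_zero_cancel)
qed

lemma cyl_slice_borel: "h \<in> cyl \<Omega> T ==> (\<lambda>x. h (x, t)) \<in> borel_measurable borel"
 by (intro spacetime_slice_borel cylD(3))

lemma cyl_slice_outside: "h \<in> cyl \<Omega> T ==> x \<notin> \<Omega> ==> h (x, t) = 0"
 using cylD(2)[of h \<Omega> T "(x, t)"] by auto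

lemma tprim_slice_borel: "h \<in> cyl \<Omega> T ==> (\<lambda>x. tprim h (x, t)) \<in> borel_measurable borel"
 by (intro spacetime_slice_borel tprim_borel cylD(3))

text \<open>Tested with a function of space, the continuous representative of \<open>V\<close> becomes a
 continuous real function with known weak derivative and initial value \<open>0\<close>.\<close>

lemma weak_derivative_primitive:
 fixes \<Omega> :: "'a::euclidean_space set"
 assumes \<Omega>: "open \<Omega>" and T: "0 < T" and V: "V \<in> H1_time_0 \<Omega> T" and W: "has_weak_time_deriv \<Omega> T V W"
  and w: "w \<in> cyl \<Omega> T" "AE t in lebesgue_on {0<..<T}. eq_ae \<Omega> (\<lambda>x. w (x, t)) (W t)"
 shows "AE t in lebesgue_on {0<..<T}. eq_ae \<Omega> (V t) (\<lambda>x. tprim w (x, t))"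
proof -
 let ?I = "{0<..<T}"
 have \<Omega>b: "\<Omega> \<in> sets borel" using \<Omega> by simp
 obtain C where C: "continuous_into (L2 \<Omega>) (L2_norm \<Omega>) {0..T} C"
  "AE t in lebesgue_on ?I. eq_ae \<Omega> (C t) (V t)" "eq_ae \<Omega> (C 0) (\<lambda>x. 0)"
  using V by (auto simp: H1_time_0_def)
 have CL: "C t \<in> L2 \<Omega>" if "t \<in> {0..T}" for t using C(1) that by (simp add: continuous_into_def)
 have VL: "AE t in lebesgue_on ?I. V t \<in> L2 \<Omega>"
  using V by (simp add: H1_time_0_def H1_time_def bochner_L2_def strongly_measurable_into_def)
 have key: "L2_inner \<Omega> (C t) \<psi> = L2_inner \<Omega> (\<lambda>x. tprim w (x, t)) \<psi>" if t: "t \<in> {0..T}" and \<psi>: "\<psi> \<in> test_functions \<Omega>" for t \<psi>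
 proof -
  have \<psi>s: "sq_int lborel \<psi>" and \<psi>L: "\<psi> \<in> L2 \<Omega>" and \<psi>b: "\<psi> \<in> borel_measurable borel"
   using test_sq_int[OF \<psi>] test_L2[OF \<psi> \<Omega>] test_borel[OF \<psi>] by auto
  define k where "k t = (LBINT x. w (x, t) * \<psi> x)" for t
  note k = slice_inner[OF w(1) \<psi>s, folded k_def]
  have "L2_inner \<Omega> (C t) \<psi> = prim k t"
  proof (rule weak_primitive[OF T continuous_L2_inner[OF C(1) \<psi>L] _ k(2,3) _ t])
   show "L2_inner \<Omega> (C 0) \<psi> = 0"
    using L2_inner_rep[OF \<Omega>b _ C(3) \<psi>b eq_ae_refl] by simp
   fix \<eta> assume \<eta>: "\<eta> \<in> test_functions ?I"
   have "(LINT t|lebesgue_on ?I. pderiv_dir 1 \<eta> t * L2_inner \<Omega> (C t) \<psi>)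
     = (LINT t|lebesgue_on ?I. deriv \<eta> t * L2_inner \<Omega> (V t) \<psi>)"
   proof (rule integral_cong_AE)
    have \<eta>': "pderiv_dir 1 \<eta> \<in> test_functions ?I" using test_pderiv[OF \<eta>, of 1] by simp
    have cm: "(\<lambda>t. L2_inner \<Omega> (C t) \<psi>) \<in> borel_measurable (lebesgue_on ?I)"
     by (rule continuous_imp_measurable_on_sets_lebesgue)
       (auto intro: continuous_on_subset[OF continuous_L2_inner[OF C(1) \<psi>L]])
    show 1: "(\<lambda>t. pderiv_dir 1 \<eta> t * L2_inner \<Omega> (C t) \<psi>) \<in> borel_measurable (lebesgue_on ?I)"
     using cm borel_on[OF test_borel[OF \<eta>']] by simp
    show ae: "AE t in lebesgue_on ?I. pderiv_dir 1 \<eta> t * L2_inner \<Omega> (C t) \<psi> = deriv \<eta> t * L2_inner \<Omega> (V t) \<psi>"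
     using C(2) VL AE_space
    proof eventually_elim
     case (elim t)
     have "L2_inner \<Omega> (C t) \<psi> = L2_inner \<Omega> (V t) \<psi>"
      by (rule L2_inner_cong_AE) (use elim CL[of t] \<psi>L in "auto simp: eq_ae_def intro: L2_measurable")
     then show ?case by (simp add: smooth_deriv[OF test_smooth[OF \<eta>]])
    qed
    show "(\<lambda>t. deriv \<eta> t * L2_inner \<Omega> (V t) \<psi>) \<in> borel_measurable (lebesgue_on ?I)"
     by (rule measurable_lebesgue_on_AE[OF _ 1]) (use ae in "auto simp: eq_commute")
   qed
   also have "\<dots> = - (LINT t|lebesgue_on ?I. \<eta> t * L2_inner \<Omega> (W t) \<psi>)"
    using W \<eta> \<psi>L by (simp add: has_weak_time_deriv_def)
   also have "(LINT t|lebesgue_on ?I. \<eta> t * L2_inner \<Omega> (W t) \<psi>) = (LBINT t. indicator ?I t * (\<eta> t * k t))"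
   proof (rule integral_lebesgue_on_AE)
    show "(\<lambda>t. \<eta> t * k t) \<in> borel_measurable borel" using test_borel[OF \<eta>] k(1) by auto
    show "AE t in lebesgue_on ?I. \<eta> t * L2_inner \<Omega> (W t) \<psi> = \<eta> t * k t"
     using w(2)
    proof eventually_elim
     case (elim t)
     have "L2_inner \<Omega> (W t) \<psi> = k t"
      unfolding k_def by (rule L2_inner_rep[OF \<Omega>b cyl_slice_borel[OF w(1)] eq_ae_sym[OF elim] \<psi>b eq_ae_refl])
        (use cyl_slice_outside[OF w(1)] in auto)
     then show ?case by simp
    qed
   qed simp
   also have "\<dots> = (LBINT t. \<eta> t * k t)"
   proof (rule integral_cong_pw)
    fix t show "indicator ?I t * (\<eta> t * k t) = \<eta> t * k t" using k(3)[of t] by (cases "t \<in> ?I") auto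
   qed
   finally show "(LINT t|lebesgue_on ?I. pderiv_dir 1 \<eta> t * L2_inner \<Omega> (C t) \<psi>) = - (LBINT t. \<eta> t * k t)" .
  qed
  also have "\<dots> = L2_inner \<Omega> (\<lambda>x. tprim w (x, t)) \<psi>"
   unfolding k(4)[symmetric]
   by (rule L2_inner_lborel[OF \<Omega>b tprim_slice_borel[OF w(1)] \<psi>b, symmetric]) (use tprim_outside[OF w(1)] in auto)
  finally show ?thesis .
 qed
 have Ceq: "eq_ae \<Omega> (C t) (\<lambda>x. tprim w (x, t))" if t: "t \<in> {0..T}" for t
  unfolding eq_ae_def
 proof (rule L2_inner_eq_imp_AE_eq[OF \<Omega> CL[OF t] _ key[OF t]])
  show "(\<lambda>x. tprim w (x, t)) \<in> L2 \<Omega>"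
   using t by (intro L2_of_sq_int[OF tprim_L2(1)[OF w(1)] \<Omega>b]) simp
 qed
 show ?thesis
  using C(2) AE_space
 proof eventually_elim
  case (elim t)
  then have "eq_ae \<Omega> (C t) (\<lambda>x. tprim w (x, t))" by (intro Ceq) auto
  with elim(1) show ?case by (meson eq_ae_sym eq_ae_trans)
 qed
qed

lemma rep_slices:
 assumes \<Omega>: "open \<Omega>" and ae: "AE z in lebesgue_on (cylinder \<Omega> T). u z = u1 z"
 shows "AE t in lebesgue_on {0<..<T}. eq_ae \<Omega> (\<lambda>x. u (x, t)) (\<lambda>x. u1 (x, t))"
proof -
 have \<Omega>b: "\<Omega> \<in> sets borel" and Ib: "{0<..<T} \<in> sets borel" using \<Omega> by auto
 have "AE z in lborel. z \<in> cylinder \<Omega> T --> u z = u1 z"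
  using ae unfolding AE_on_iff[OF cylinder_borel[OF \<Omega>]] .
 from AE_spacetime_slices(2)[OF this] show ?thesis
  unfolding AE_on_iff[OF Ib] eq_ae_def AE_on_iff[OF \<Omega>b]
  by eventually_elim (auto elim!: eventually_mono)
qed

lemma tensor_inner:
 fixes h :: "'a::euclidean_space \<times> real => real"
 assumes h: "h \<in> cyl \<Omega> T" and \<xi>: "sq_int lborel \<xi>" and \<eta>: "sq_int lborel \<eta>"
 shows "(LBINT z. h z * (\<eta> (snd z) * \<xi> (fst z))) = (LBINT t. \<eta> t * (LBINT x. h (x, t) * \<xi> x))"
proof -
 have "integrable lborel (\<lambda>z. h z * (\<xi> (fst z) * \<eta> (snd z)))"
  by (rule sq_int_mult[OF cylD(1)[OF h] sq_int_tensor[OF \<xi> \<eta>]])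
 then have I: "integrable lborel (\<lambda>z. h z * (\<eta> (snd z) * \<xi> (fst z)))" by (simp only: mult.commute)
 have "(LBINT z. h z * (\<eta> (snd z) * \<xi> (fst z))) = (LBINT t. (LBINT x. \<eta> t * (h (x, t) * \<xi> x)))"
  unfolding Fubini_xt(6)[OF I, symmetric] by (simp add: mult.left_commute)
 then show ?thesis by simp
qed

text \<open>Uniqueness tests with products \<open>\<eta>(t) \<xi>(x)\<close>: they turn the wave equation
 into an ordinary differential equation in time for each \<open>\<xi>\<close>.\<close>

lemma has_box_tensor:
 fixes \<Omega> :: "'a::euclidean_space set"
 assumes \<Omega>: "open \<Omega>" and box: "has_box (cylinder \<Omega> T) u f"
  and u1: "u1 \<in> cyl \<Omega> T" "AE z in lebesgue_on (cylinder \<Omega> T). u z = u1 z"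
  and f0: "f0 \<in> cyl \<Omega> T" "AE z in lebesgue_on (cylinder \<Omega> T). f z = f0 z"
  and \<xi>: "\<xi> \<in> test_functions \<Omega>" and \<eta>: "\<eta> \<in> test_functions {0<..<T}"
 shows "(LBINT t. pderiv_dir 1 (pderiv_dir 1 \<eta>) t * (LBINT x. u1 (x, t) * \<xi> x))
   - (\<Sum>b\<in>Basis. (LBINT t. \<eta> t * (LBINT x. u1 (x, t) * pderiv_dir b (pderiv_dir b \<xi>) x)))
   = (LBINT t. \<eta> t * (LBINT x. f0 (x, t) * \<xi> x))"
proof -
 let ?Q = "cylinder \<Omega> T"
 have Qb: "?Q \<in> sets borel" by (rule cylinder_borel[OF \<Omega>])
 have \<eta>': "pderiv_dir 1 \<eta> \<in> test_functions {0<..<T}" "pderiv_dir 1 (pderiv_dir 1 \<eta>) \<in> test_functions {0<..<T}"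
  using test_pderiv[OF \<eta>, of 1] test_pderiv[OF test_pderiv[OF \<eta>, of 1], of 1] by auto
 have \<xi>': "pderiv_dir b \<xi> \<in> test_functions \<Omega>" "pderiv_dir b (pderiv_dir b \<xi>) \<in> test_functions \<Omega>" if "b \<in> Basis" for b
  using test_pderiv[OF \<xi> that] test_pderiv[OF test_pderiv[OF \<xi> that] that] by auto
 note s\<xi> = test_smooth[OF \<xi>] and s\<eta> = test_smooth[OF \<eta>]
 define \<phi> where "\<phi> = (\<lambda>z. \<eta> (snd z) * \<xi> (fst z))"
 have \<phi>: "\<phi> \<in> test_functions ?Q" unfolding \<phi>_def by (rule test_tensor[OF \<xi> \<eta>])
 have tt: "dtt \<phi> = (\<lambda>z. pderiv_dir 1 (pderiv_dir 1 \<eta>) (snd z) * \<xi> (fst z))"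
  unfolding dtt_def \<phi>_def pderiv_dir_tensor(2)[OF s\<xi> s\<eta>] pderiv_dir_tensor(2)[OF s\<xi> test_smooth[OF \<eta>'(1)]] ..
 have xx: "laplace_x \<phi> = (\<lambda>z. \<Sum>b\<in>Basis. \<eta> (snd z) * pderiv_dir b (pderiv_dir b \<xi>) (fst z))"
 proof (rule ext, unfold laplace_x_def, rule sum.cong[OF refl])
  fix z :: "'a \<times> real" and b :: 'a assume b: "b \<in> Basis"
  show "pderiv_dir (b, 0) (pderiv_dir (b, 0) \<phi>) z = \<eta> (snd z) * pderiv_dir b (pderiv_dir b \<xi>) (fst z)"
   unfolding \<phi>_def pderiv_dir_tensor(1)[OF s\<xi> s\<eta>] pderiv_dir_tensor(1)[OF test_smooth[OF \<xi>'(1)[OF b]] s\<eta>] ..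
 qed
 have TQ: "(\<lambda>z. \<zeta> (snd z) * \<theta> (fst z)) \<in> test_functions ?Q"
  if "\<theta> \<in> test_functions \<Omega>" "\<zeta> \<in> test_functions {0<..<T}" for \<theta> \<zeta> by (rule test_tensor[OF that])
 have inner: "L2_inner ?Q h (\<lambda>z. \<zeta> (snd z) * \<theta> (fst z)) = (LBINT t. \<zeta> t * (LBINT x. h0 (x, t) * \<theta> x))"
  if h: "h0 \<in> cyl \<Omega> T" "AE z in lebesgue_on ?Q. h z = h0 z" and \<theta>: "\<theta> \<in> test_functions \<Omega>"
   and \<zeta>: "\<zeta> \<in> test_functions {0<..<T}" for h h0 \<theta> \<zeta>
  unfolding tensor_inner[OF h(1) test_sq_int(1)[OF \<theta>] test_sq_int(1)[OF \<zeta>], symmetric]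
  by (rule L2_inner_rep[OF Qb cylD(3)[OF h(1)] _ test_borel[OF TQ[OF \<theta> \<zeta>]] eq_ae_refl])
    (use h(2) cylD(2)[OF h(1)] in "auto simp: eq_ae_def")
 have uL: "u1 \<in> L2 ?Q" by (rule L2_of_sq_int[OF cylD(1)[OF u1(1)] Qb])
 have "L2_inner ?Q u (laplace_x \<phi>) = L2_inner ?Q u1 (laplace_x \<phi>)"
 proof -
  have xb: "laplace_x \<phi> \<in> borel_measurable borel"
   unfolding xx by (intro borel_measurable_sum test_borel[OF TQ[OF \<xi>'(2) \<eta>]])
  have "eq_ae ?Q u u1" using u1(2) by (simp add: eq_ae_def)
  then show ?thesis
   using L2_inner_rep[OF Qb cylD(3)[OF u1(1)] _ xb eq_ae_refl, of u]
    L2_inner_rep[OF Qb cylD(3)[OF u1(1)] eq_ae_refl xb eq_ae_refl] cylD(2)[OF u1(1)] by simp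
 qed
 also have "\<dots> = (\<Sum>b\<in>Basis. L2_inner ?Q u1 (\<lambda>z. \<eta> (snd z) * pderiv_dir b (pderiv_dir b \<xi>) (fst z)))"
  unfolding xx L2_inner_def sum_distrib_left
  by (rule Bochner_Integration.integral_sum)
    (intro L2_inner_integrable uL test_L2[OF TQ[OF \<xi>'(2) \<eta>]] open_Times \<Omega> open_greaterThanLessThan)
 also have "\<dots> = (\<Sum>b\<in>Basis. (LBINT t. \<eta> t * (LBINT x. u1 (x, t) * pderiv_dir b (pderiv_dir b \<xi>) x)))"
  by (intro sum.cong refl inner u1 \<eta> \<xi>'(2)) simp
 finally have X: "L2_inner ?Q u (laplace_x \<phi>) = \<dots>" .
 have "L2_inner ?Q u (dtt \<phi>) - L2_inner ?Q u (laplace_x \<phi>) = L2_inner ?Q f \<phi>"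
  using box \<phi> by (simp add: has_box_def)
 then show ?thesis
  unfolding X unfolding tt unfolding \<phi>_def inner[OF u1 \<xi> \<eta>'(2)] inner[OF f0 \<xi> \<eta>] .
qed

text \<open>The velocity, tested with \<open>H\<^sup>1\<^sub>0\<close>, is the time integral of the equation.  After this
 integration in time, the gradient of the displacement becomes admissible as a test function.\<close>

definition wave_data :: "'a::euclidean_space set => real => ('a \<times> real => real) => ('a \<times> real => real)
  => ('a \<times> real => real) => ('a => 'a \<times> real => real) => bool" where
 "wave_data \<Omega> T u f w g \<longleftrightarrow> w \<in> cyl \<Omega> T & (\<forall>b\<in>Basis. g b \<in> cyl \<Omega> T) \<and>
  (AE t in lborel. t \<in> {0<..<T} --> eq_ae \<Omega> (time_slice u t) (\<lambda>x. tprim w (x, t)) & time_slice u t \<in> H10 \<Omega> \<and>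
    (\<forall>b\<in>Basis. eq_ae \<Omega> (\<lambda>x. g b (x, t)) (\<lambda>x. weak_gradient \<Omega> (time_slice u t) x \<bullet> b)) \<and>
    (\<forall>\<xi>\<in>H10 \<Omega>. L2_inner \<Omega> (\<lambda>x. w (x, t)) \<xi> = L2_inner \<Omega> (\<lambda>x. tprim f (x, t)) \<xi>
     - (\<Sum>b\<in>Basis. L2_inner \<Omega> (\<lambda>x. tprim (g b) (x, t)) (\<lambda>x. weak_gradient \<Omega> \<xi> x \<bullet> b))))"

text \<open>For a test function \<open>\<xi>\<close> the wave equation says that
 \<open>\<langle>\<partial>\<^sub>tu(t), \<xi>\<rangle>\<close>, which is continuous with value
 \<open>0\<close> at time \<open>0\<close>, has a known weak derivative, so it is a primitive. Both sides
 are bounded in the \<open>H\<^sup>1\<close> norm of \<open>\<xi>\<close>, so the identity extends to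
 \<open>H\<^sup>1\<^sub>0\<close> by density.\<close>

lemma wave_space_data:
 fixes \<Omega> :: "'a::euclidean_space set"
 assumes \<Omega>: "open \<Omega>" and T: "0 < T" and u: "u \<in> wave_space \<Omega> T" and box: "has_box (cylinder \<Omega> T) u f"
  and f0: "f0 \<in> cyl \<Omega> T" "AE z in lebesgue_on (cylinder \<Omega> T). f z = f0 z"
 shows "\<exists>w g. wave_data \<Omega> T u f0 w g"
proof -
 let ?I = "{0<..<T}"
 have \<Omega>b: "\<Omega> \<in> sets borel" and Ib: "?I \<in> sets borel" using \<Omega> by auto
 have uH: "u \<in> L2 (cylinder \<Omega> T)" "time_slice u \<in> H1_time_0 \<Omega> T" "time_slice u \<in> bochner_L2 (H10 \<Omega>) (H1_norm \<Omega>) ?I"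
  using u by (auto simp: wave_space_def H11_00_def)
 obtain W F where W: "has_weak_time_deriv \<Omega> T (time_slice u) W"
  and F: "continuous_into (dual_space (H10 \<Omega>) (H1_norm \<Omega>)) (dual_norm (H10 \<Omega>) (H1_norm \<Omega>)) {0..T} F"
   "AE t in lebesgue_on ?I. \<forall>\<psi>\<in>H10 \<Omega>. F t \<psi> = L2_inner \<Omega> (W t) \<psi>" "!!\<psi>. \<psi> \<in> H10 \<Omega> ==> F 0 \<psi> = 0"
  using u unfolding wave_space_def zero_initial_velocity_def by blast
 have "W \<in> bochner_L2 (L2 \<Omega>) (L2_norm \<Omega>) ?I" using W by (simp add: has_weak_time_deriv_def)
 then obtain w where w: "w \<in> cyl \<Omega> T" "AE t in lebesgue_on ?I. eq_ae \<Omega> (\<lambda>x. w (x, t)) (W t)"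
  using bochner_joint_representative[OF \<Omega>] by blast
 define G where "G b h \<longleftrightarrow> h \<in> cyl \<Omega> T & (AE t in lebesgue_on ?I. eq_ae \<Omega> (\<lambda>x. h (x, t)) (\<lambda>x. weak_gradient \<Omega> (time_slice u t) x \<bullet> b))" for b h
 have "\<exists>h. G b h" if b: "b \<in> Basis" for b
 proof -
  obtain h where "h \<in> cyl \<Omega> T" "AE t in lebesgue_on ?I. eq_ae \<Omega> (\<lambda>x. h (x, t)) (\<lambda>x. weak_gradient \<Omega> (time_slice u t) x \<bullet> b)"
   by (rule bochner_gradient_representative[OF \<Omega> uH(3) b])
  then have "G b h" unfolding G_def by blast
  then show ?thesis by blast
 qed
 then obtain g where gG: "!!b. b \<in> Basis ==> G b (g b)" by metis
 have g1: "g b \<in> cyl \<Omega> T" if "b \<in> Basis" for b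
  using gG[OF that] unfolding G_def by blast
 have g2: "AE t in lebesgue_on ?I. eq_ae \<Omega> (\<lambda>x. g b (x, t)) (\<lambda>x. weak_gradient \<Omega> (time_slice u t) x \<bullet> b)" if "b \<in> Basis" for b
  using gG[OF that] unfolding G_def by blast
 note g = g1 g2
 have g_all: "AE t in lebesgue_on ?I. \<forall>b\<in>Basis. eq_ae \<Omega> (\<lambda>x. g b (x, t)) (\<lambda>x. weak_gradient \<Omega> (time_slice u t) x \<bullet> b)"
  by (intro AE_finite_allI g(2)) auto
 have uH10: "AE t in lebesgue_on ?I. time_slice u t \<in> H10 \<Omega>"
  using uH(3) by (simp add: bochner_L2_def strongly_measurable_into_def)
 obtain u1 where u1s: "sq_int lborel u1" "!!z. z \<notin> cylinder \<Omega> T ==> u1 z = 0"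
  and u1ae: "AE z in lebesgue_on (cylinder \<Omega> T). u z = u1 z"
  using L2_rep[OF cylinder_borel[OF \<Omega>] uH(1)] by blast
 have u1: "u1 \<in> cyl \<Omega> T" using u1s unfolding cyl_def by blast
 have u1t: "AE t in lebesgue_on ?I. eq_ae \<Omega> (time_slice u t) (\<lambda>x. u1 (x, t))"
  using rep_slices[OF \<Omega> u1ae] by (simp add: time_slice_def[abs_def])
 have key: "F t \<xi> = L2_inner \<Omega> (\<lambda>x. tprim f0 (x, t)) \<xi> - (\<Sum>b\<in>Basis. L2_inner \<Omega> (\<lambda>x. tprim (g b) (x, t)) (pderiv_dir b \<xi>))"
  if t: "t \<in> {0..T}" and \<xi>: "\<xi> \<in> test_functions \<Omega>" for t \<xi>
 proof -
  have \<xi>': "pderiv_dir b \<xi> \<in> test_functions \<Omega>" "pderiv_dir b (pderiv_dir b \<xi>) \<in> test_functions \<Omega>" if "b \<in> Basis" for b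
   using test_pderiv[OF \<xi> that] test_pderiv[OF test_pderiv[OF \<xi> that] that] by auto
  define kf where "kf t = (LBINT x. f0 (x, t) * \<xi> x)" for t
  define q where "q b t = (LBINT x. g b (x, t) * pderiv_dir b \<xi> x)" for b t
  define ku where "ku t = (LBINT x. u1 (x, t) * \<xi> x)" for t
  define m where "m b t = (LBINT x. u1 (x, t) * pderiv_dir b (pderiv_dir b \<xi>) x)" for b t
  note kf = slice_inner[OF f0(1) test_sq_int(1)[OF \<xi>], folded kf_def]
  have q: "integrable lborel (q b)" "sq_int lborel (q b)" "!!t. t \<notin> ?I ==> q b t = 0"
   "!!t. (LBINT x. tprim (g b) (x, t) * pderiv_dir b \<xi> x) = prim (q b) t" if b: "b \<in> Basis" for b
   using slice_inner[OF g(1)[OF b] test_sq_int(1)[OF \<xi>'(1)[OF b]]] unfolding q_def[abs_def] by blast+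
  note ku = slice_inner[OF u1 test_sq_int(1)[OF \<xi>], folded ku_def]
  note m = slice_inner[OF u1 test_sq_int(1)[OF \<xi>'(2)], folded m_def]
  have mq: "AE t in lborel. m b t = - q b t" if b: "b \<in> Basis" for b
  proof -
   have "AE t in lebesgue_on ?I. m b t = - q b t"
    using u1t uH10 g(2)[OF b]
   proof eventually_elim
    case (elim t)
    have "m b t = L2_inner \<Omega> (time_slice u t) (pderiv_dir b (pderiv_dir b \<xi>))"
     unfolding m_def
     by (rule L2_inner_rep[OF \<Omega>b cyl_slice_borel[OF u1] elim(1) test_borel[OF \<xi>'(2)[OF b]] eq_ae_refl, symmetric])
       (use cyl_slice_outside[OF u1] in auto)
    also have "\<dots> = - L2_inner \<Omega> (\<lambda>x. weak_gradient \<Omega> (time_slice u t) x \<bullet> b) (pderiv_dir b \<xi>)"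
     by (rule weak_gradient_eq[OF H10_gradient[OF elim(2)] b \<xi>'(1)[OF b]])
    also have "L2_inner \<Omega> (\<lambda>x. weak_gradient \<Omega> (time_slice u t) x \<bullet> b) (pderiv_dir b \<xi>) = q b t"
     unfolding q_def
     by (rule L2_inner_rep[OF \<Omega>b cyl_slice_borel[OF g(1)[OF b]] eq_ae_sym[OF elim(3)] test_borel[OF \<xi>'(1)[OF b]] eq_ae_refl])
       (use cyl_slice_outside[OF g(1)[OF b]] in auto)
    finally show ?case .
   qed
   then show ?thesis unfolding AE_on_iff[OF Ib]
   proof eventually_elim
    case (elim t)
    then show ?case using m(3)[OF b, of t] q(3)[OF b, of t] by (cases "t \<in> ?I") auto
   qed
  qed
  have "F t \<xi> = prim (\<lambda>s. kf s - (\<Sum>b\<in>Basis. q b s)) t"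
  proof (rule weak_primitive[OF T dual_continuous_test[OF \<Omega> F(1) \<xi>] F(3)[OF test_H10[OF \<Omega> \<xi>]] _ _ _ t])
   show "sq_int lborel (\<lambda>s. kf s - (\<Sum>b\<in>Basis. q b s))"
    by (intro sq_int_diff sq_int_sum kf q(2))
   show "kf s - (\<Sum>b\<in>Basis. q b s) = 0" if "s \<notin> ?I" for s
    using kf(3)[OF that] q(3)[OF _ that] by simp
   fix \<eta> assume \<eta>: "\<eta> \<in> test_functions ?I"
   have \<eta>': "pderiv_dir 1 \<eta> \<in> test_functions ?I" "pderiv_dir 1 (pderiv_dir 1 \<eta>) \<in> test_functions ?I"
    using test_pderiv[OF \<eta>, of 1] test_pderiv[OF test_pderiv[OF \<eta>, of 1], of 1] by auto
   have Fm: "(\<lambda>t. F t \<xi>) \<in> borel_measurable (lebesgue_on ?I)"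
    by (rule continuous_imp_measurable_on_sets_lebesgue)
      (auto intro: continuous_on_subset[OF dual_continuous_test[OF \<Omega> F(1) \<xi>]])
   have 1: "(\<lambda>t. pderiv_dir 1 \<eta> t * F t \<xi>) \<in> borel_measurable (lebesgue_on ?I)"
    using Fm borel_on[OF test_borel[OF \<eta>'(1)]] by simp
   have ae: "AE t in lebesgue_on ?I. pderiv_dir 1 \<eta> t * L2_inner \<Omega> (W t) \<xi> = pderiv_dir 1 \<eta> t * F t \<xi>"
    using F(2) by eventually_elim (use test_H10[OF \<Omega> \<xi>] in simp)
   have "(LINT t|lebesgue_on ?I. pderiv_dir 1 \<eta> t * F t \<xi>) = (LINT t|lebesgue_on ?I. pderiv_dir 1 \<eta> t * L2_inner \<Omega> (W t) \<xi>)"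
    by (rule integral_cong_AE[OF measurable_lebesgue_on_AE[OF Ib 1 ae] 1 ae, symmetric])
   also have "\<dots> = - (LINT t|lebesgue_on ?I. deriv (pderiv_dir 1 \<eta>) t * L2_inner \<Omega> (time_slice u t) \<xi>)"
    using W \<eta>'(1) test_L2[OF \<xi> \<Omega>] by (simp add: has_weak_time_deriv_def)
   also have "(LINT t|lebesgue_on ?I. deriv (pderiv_dir 1 \<eta>) t * L2_inner \<Omega> (time_slice u t) \<xi>)
     = (LBINT t. indicator ?I t * (pderiv_dir 1 (pderiv_dir 1 \<eta>) t * ku t))"
   proof (rule integral_lebesgue_on_AE[OF Ib])
    show "(\<lambda>t. pderiv_dir 1 (pderiv_dir 1 \<eta>) t * ku t) \<in> borel_measurable borel"
     using test_borel[OF \<eta>'(2)] ku(1) by auto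
    show "AE t in lebesgue_on ?I. deriv (pderiv_dir 1 \<eta>) t * L2_inner \<Omega> (time_slice u t) \<xi> = pderiv_dir 1 (pderiv_dir 1 \<eta>) t * ku t"
     using u1t
    proof eventually_elim
     case (elim t)
     have "L2_inner \<Omega> (time_slice u t) \<xi> = ku t"
      unfolding ku_def
      by (rule L2_inner_rep[OF \<Omega>b cyl_slice_borel[OF u1] elim test_borel[OF \<xi>] eq_ae_refl])
        (use cyl_slice_outside[OF u1] in auto)
     then show ?case by (simp add: smooth_deriv[OF test_smooth[OF \<eta>'(1)]])
    qed
   qed
   also have "\<dots> = (LBINT t. pderiv_dir 1 (pderiv_dir 1 \<eta>) t * ku t)"
   proof (rule integral_cong_pw)
    fix t show "indicator ?I t * (pderiv_dir 1 (pderiv_dir 1 \<eta>) t * ku t) = pderiv_dir 1 (pderiv_dir 1 \<eta>) t * ku t"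
     using ku(3)[of t] by (cases "t \<in> ?I") auto
   qed
   also have "\<dots> = (LBINT t. \<eta> t * kf t) + (\<Sum>b\<in>Basis. (LBINT t. \<eta> t * m b t))"
    using has_box_tensor[OF \<Omega> box u1 u1ae f0 \<xi> \<eta>] by (simp add: ku_def kf_def m_def)
   also have "(\<Sum>b\<in>Basis. (LBINT t. \<eta> t * m b t)) = (\<Sum>b\<in>Basis. - (LBINT t. \<eta> t * q b t))"
   proof (rule sum.cong[OF refl])
    fix b :: 'a assume b: "b \<in> Basis"
    have "(LBINT t. \<eta> t * m b t) = (LBINT t. - (\<eta> t * q b t))"
    proof (rule integral_cong_AE)
     show "AE t in lborel. \<eta> t * m b t = - (\<eta> t * q b t)" using mq[OF b] by eventually_elim simp
    qed (use m(1)[OF b] q(1)[OF b] test_borel[OF \<eta>] in auto)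
    then show "(LBINT t. \<eta> t * m b t) = - (LBINT t. \<eta> t * q b t)" by simp
   qed
   also have "(LBINT t. \<eta> t * kf t) + (\<Sum>b\<in>Basis. - (LBINT t. \<eta> t * q b t))
     = (LBINT t. \<eta> t * kf t - (\<Sum>b\<in>Basis. \<eta> t * q b t))"
    using sq_int_mult[OF test_sq_int(1)[OF \<eta>] kf(2)] sq_int_mult[OF test_sq_int(1)[OF \<eta>] q(2)]
    by (simp add: Bochner_Integration.integral_sum sum_negf)
   also have "\<dots> = (LBINT t. \<eta> t * (kf t - (\<Sum>b\<in>Basis. q b t)))"
    by (simp add: right_diff_distrib sum_distrib_left)
   finally show "(LINT t|lebesgue_on ?I. pderiv_dir 1 \<eta> t * F t \<xi>) = - (LBINT t. \<eta> t * (kf t - (\<Sum>b\<in>Basis. q b t)))" .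
  qed
  also have "\<dots> = prim kf t - (\<Sum>b\<in>Basis. prim (q b) t)"
   by (rule sum_scaled_prim) (auto intro: q(2) kf(2))
  also have "prim kf t = L2_inner \<Omega> (\<lambda>x. tprim f0 (x, t)) \<xi>"
   unfolding kf(4)[symmetric]
   by (rule L2_inner_lborel[OF \<Omega>b tprim_slice_borel[OF f0(1)] test_borel[OF \<xi>], symmetric]) (use tprim_outside[OF f0(1)] in auto)
  also have "(\<Sum>b\<in>Basis. prim (q b) t) = (\<Sum>b\<in>Basis. L2_inner \<Omega> (\<lambda>x. tprim (g b) (x, t)) (pderiv_dir b \<xi>))"
  proof (rule sum.cong[OF refl])
   fix b :: 'a assume b: "b \<in> Basis"
   show "prim (q b) t = L2_inner \<Omega> (\<lambda>x. tprim (g b) (x, t)) (pderiv_dir b \<xi>)"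
    unfolding q(4)[OF b, symmetric]
    by (rule L2_inner_lborel[OF \<Omega>b tprim_slice_borel[OF g(1)[OF b]] test_borel[OF \<xi>'(1)[OF b]], symmetric])
      (use tprim_outside[OF g(1)[OF b]] in auto)
  qed
  finally show ?thesis .
 qed
 have keyH: "F t \<xi> = L2_inner \<Omega> (\<lambda>x. tprim f0 (x, t)) \<xi> - (\<Sum>b\<in>Basis. L2_inner \<Omega> (\<lambda>x. tprim (g b) (x, t)) (\<lambda>x. weak_gradient \<Omega> \<xi> x \<bullet> b))"
  if t: "t \<in> {0..T}" and \<xi>: "\<xi> \<in> H10 \<Omega>" for t \<xi>
 proof -
  obtain \<phi> where \<phi>: "!!k::nat. \<phi> k \<in> test_functions \<Omega>"
   "(\<lambda>k. L2_norm \<Omega> (\<lambda>x. \<phi> k x - \<xi> x)) \<longlonglongrightarrow> 0"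
   "!!b. b \<in> Basis ==> (\<lambda>k. L2_norm \<Omega> (\<lambda>x. pderiv_dir b (\<phi> k) x - weak_gradient \<Omega> \<xi> x \<bullet> b)) \<longlonglongrightarrow> 0"
   using H10_approx[OF \<Omega> \<xi>] by blast
  have \<phi>H: "(\<lambda>k. H1_norm \<Omega> (\<lambda>x. \<phi> k x - \<xi> x)) \<longlonglongrightarrow> 0"
   by (rule H10_limit(3)[OF \<Omega> \<phi>(1) H10_L2[OF \<xi>] gradient_L2[OF H10_gradient[OF \<xi>]] \<phi>(2,3)])
  have L: "(\<lambda>x. tprim h (x, t)) \<in> L2 \<Omega>" if "h \<in> cyl \<Omega> T" for h
   using t by (intro L2_of_sq_int[OF tprim_L2(1)[OF that] \<Omega>b]) simp
  have r1: "(\<lambda>k. L2_inner \<Omega> (\<lambda>x. tprim f0 (x, t)) (\<phi> k)) \<longlonglongrightarrow> L2_inner \<Omega> (\<lambda>x. tprim f0 (x, t)) \<xi>"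
   unfolding L2_inner_commute[of _ "\<lambda>x. tprim f0 (x, t)"]
   by (rule L2_inner_tendsto[OF test_L2[OF \<phi>(1) \<Omega>] H10_L2[OF \<xi>] L[OF f0(1)] \<phi>(2)])
  have r2: "(\<lambda>k. L2_inner \<Omega> (\<lambda>x. tprim (g b) (x, t)) (pderiv_dir b (\<phi> k)))
    \<longlonglongrightarrow> L2_inner \<Omega> (\<lambda>x. tprim (g b) (x, t)) (\<lambda>x. weak_gradient \<Omega> \<xi> x \<bullet> b)" if b: "b \<in> Basis" for b
   unfolding L2_inner_commute[of _ "\<lambda>x. tprim (g b) (x, t)"]
   by (rule L2_inner_tendsto[OF test_L2[OF test_pderiv[OF \<phi>(1) b] \<Omega>] gradient_L2[OF H10_gradient[OF \<xi>] b] L[OF g(1)[OF b]] \<phi>(3)[OF b]])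
  have "(\<lambda>k. F t (\<phi> k)) \<longlonglongrightarrow> L2_inner \<Omega> (\<lambda>x. tprim f0 (x, t)) \<xi> - (\<Sum>b\<in>Basis. L2_inner \<Omega> (\<lambda>x. tprim (g b) (x, t)) (\<lambda>x. weak_gradient \<Omega> \<xi> x \<bullet> b))"
   unfolding key[OF t \<phi>(1)] by (intro tendsto_diff tendsto_sum r1 r2)
  moreover have "(\<lambda>k. F t (\<phi> k)) \<longlonglongrightarrow> F t \<xi>"
  proof (rule LIM_zero_cancel)
   have D: "F t \<in> dual_space (H10 \<Omega>) (H1_norm \<Omega>)" using F(1) t by (simp add: continuous_into_def)
   obtain K where K: "0 <= K" "!!u. u \<in> H10 \<Omega> ==> \<bar>F t u\<bar> <= K * H1_norm \<Omega> u"
    using dual_bound[OF D] by (metis H1_norm_nonneg)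
   have l: "(\<lambda>k. K * H1_norm \<Omega> (\<lambda>x. \<phi> k x - \<xi> x)) \<longlonglongrightarrow> 0" using tendsto_mult_right_zero[OF \<phi>H] .
   have "norm (F t (\<phi> k) - F t \<xi>) <= K * H1_norm \<Omega> (\<lambda>x. \<phi> k x - \<xi> x)" for k
   proof -
    have d: "(\<lambda>x. \<phi> k x - \<xi> x) \<in> H10 \<Omega>" by (rule H10_diff[OF \<Omega> test_H10[OF \<Omega> \<phi>(1)] \<xi>])
    have "F t (\<lambda>x. (\<phi> k x - \<xi> x) + \<xi> x) = F t (\<lambda>x. \<phi> k x - \<xi> x) + F t \<xi>"
     by (rule dual_space_add[OF D d \<xi>])
    moreover have "(\<lambda>x. (\<phi> k x - \<xi> x) + \<xi> x) = \<phi> k" by simp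
    ultimately show ?thesis using K(2)[OF d] by simp
   qed
   then show "(\<lambda>k. F t (\<phi> k) - F t \<xi>) \<longlonglongrightarrow> 0"
    by (intro Lim_null_comparison[OF _ l] always_eventually allI)
  qed
  ultimately show ?thesis using LIMSEQ_unique by blast
 qed
 have "AE t in lebesgue_on ?I. \<forall>\<xi>\<in>H10 \<Omega>. L2_inner \<Omega> (\<lambda>x. w (x, t)) \<xi> = L2_inner \<Omega> (\<lambda>x. tprim f0 (x, t)) \<xi>
    - (\<Sum>b\<in>Basis. L2_inner \<Omega> (\<lambda>x. tprim (g b) (x, t)) (\<lambda>x. weak_gradient \<Omega> \<xi> x \<bullet> b))"
  using F(2) w(2) AE_space
 proof eventually_elim
  case (elim t)
  show ?case
  proof
   fix \<xi> assume \<xi>: "\<xi> \<in> H10 \<Omega>"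
   have wm: "(\<lambda>x. w (x, t)) \<in> borel_measurable (lebesgue_on \<Omega>)"
    by (rule borel_on[OF cyl_slice_borel[OF w(1)]])
   have e: "AE x in lebesgue_on \<Omega>. W t x = w (x, t)" using eq_ae_sym[OF elim(2)] by (simp add: eq_ae_def)
   have \<xi>m: "\<xi> \<in> borel_measurable (lebesgue_on \<Omega>)" by (rule L2_measurable[OF H10_L2[OF \<xi>]])
   have "L2_inner \<Omega> (W t) \<xi> = L2_inner \<Omega> (\<lambda>x. w (x, t)) \<xi>"
    by (rule L2_inner_cong_AE[OF measurable_lebesgue_on_AE[OF \<Omega>b wm e] wm \<xi>m \<xi>m e]) simp
   moreover have t: "t \<in> {0..T}" using elim(3) by simp
   ultimately have "L2_inner \<Omega> (\<lambda>x. w (x, t)) \<xi> = F t \<xi>" using bspec[OF elim(1) \<xi>] by simp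
   then show "L2_inner \<Omega> (\<lambda>x. w (x, t)) \<xi> = L2_inner \<Omega> (\<lambda>x. tprim f0 (x, t)) \<xi>
    - (\<Sum>b\<in>Basis. L2_inner \<Omega> (\<lambda>x. tprim (g b) (x, t)) (\<lambda>x. weak_gradient \<Omega> \<xi> x \<bullet> b))"
    unfolding keyH[OF t \<xi>] .
  qed
 qed
 note c = this
 have "AE t in lborel. t \<in> ?I --> eq_ae \<Omega> (time_slice u t) (\<lambda>x. tprim w (x, t)) & time_slice u t \<in> H10 \<Omega> \<and>
    (\<forall>b\<in>Basis. eq_ae \<Omega> (\<lambda>x. g b (x, t)) (\<lambda>x. weak_gradient \<Omega> (time_slice u t) x \<bullet> b)) \<and>
    (\<forall>\<xi>\<in>H10 \<Omega>. L2_inner \<Omega> (\<lambda>x. w (x, t)) \<xi> = L2_inner \<Omega> (\<lambda>x. tprim f0 (x, t)) \<xi>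
     - (\<Sum>b\<in>Basis. L2_inner \<Omega> (\<lambda>x. tprim (g b) (x, t)) (\<lambda>x. weak_gradient \<Omega> \<xi> x \<bullet> b)))"
  using weak_derivative_primitive[OF \<Omega> T uH(2) W w, unfolded AE_on_iff[OF Ib]]
   uH10[unfolded AE_on_iff[OF Ib]] g_all[unfolded AE_on_iff[OF Ib]] c[unfolded AE_on_iff[OF Ib]]
 proof eventually_elim
  case (elim t)
  show ?case
  proof
   assume t: "t \<in> ?I"
   show "eq_ae \<Omega> (time_slice u t) (\<lambda>x. tprim w (x, t)) & time_slice u t \<in> H10 \<Omega> \<and>
    (\<forall>b\<in>Basis. eq_ae \<Omega> (\<lambda>x. g b (x, t)) (\<lambda>x. weak_gradient \<Omega> (time_slice u t) x \<bullet> b)) \<and>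
    (\<forall>\<xi>\<in>H10 \<Omega>. L2_inner \<Omega> (\<lambda>x. w (x, t)) \<xi> = L2_inner \<Omega> (\<lambda>x. tprim f0 (x, t)) \<xi>
     - (\<Sum>b\<in>Basis. L2_inner \<Omega> (\<lambda>x. tprim (g b) (x, t)) (\<lambda>x. weak_gradient \<Omega> \<xi> x \<bullet> b)))"
    by (rule conjI[OF mp[OF elim(1) t] conjI[OF mp[OF elim(2) t] conjI[OF mp[OF elim(3) t] mp[OF elim(4) t]]]])
  qed
 qed
 then have "wave_data \<Omega> T u f0 w g" unfolding wave_data_def using w(1) g(1) by blast
 then show ?thesis by blast
qed

lemma tprim_diff_eq_ae:
 assumes "\<Omega> \<in> sets borel" "h \<in> cyl \<Omega> T" "k \<in> cyl \<Omega> T"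
 shows "eq_ae \<Omega> (\<lambda>x. tprim h (x, t) - tprim k (x, t)) (\<lambda>x. tprim (\<lambda>z. h z - k z) (x, t))"
 unfolding eq_ae_def AE_on_iff[OF assms(1)]
 using tprim_diff_AE[OF assms(2,3)] by eventually_elim simp

lemma eq_ae_diff:
 assumes "eq_ae S f f'" "eq_ae S g g'" shows "eq_ae S (\<lambda>x. f x - g x) (\<lambda>x. f' x - g' x)"
 using assms unfolding eq_ae_def by eventually_elim simp

lemma diff_diff_common: "(a - b) - (a - c) = - (b - c)" for a b c :: real
 by simp

text \<open>For the difference of two solutions the identity of \<open>wave_space_data\<close> has no load.
 With \<open>\<xi> = u(t)\<close>, whose gradient \<open>\<nabla>u(t)\<close> is the derivative of
 \<open>\<integral>\<^sub>0\<^sup>t \<nabla>u\<close> as \<open>\<partial>\<^sub>tu\<close> is that of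
 \<open>u\<close>, it reads \<open>\<langle>\<partial>\<^sub>tu, u\<rangle> +
 \<langle>\<integral>\<^sub>0\<^sup>t \<nabla>u, \<nabla>u\<rangle> = 0\<close>. Integration up to
 \<open>r\<close> yields \<open>\<parallel>u(r)\<parallel>\<^sup>2 + \<parallel>\<integral>\<^sub>0\<^sup>r
 \<nabla>u\<parallel>\<^sup>2 = 0\<close>.\<close>

theorem wave_space_unique:
 fixes \<Omega> :: "'a::euclidean_space set"
 assumes \<Omega>: "open \<Omega>" and T: "0 < T"
  and u: "u \<in> wave_space \<Omega> T" "has_box (cylinder \<Omega> T) u f"
  and v: "v \<in> wave_space \<Omega> T" "has_box (cylinder \<Omega> T) v f'"
  and ff: "eq_ae (cylinder \<Omega> T) f f'"
 shows "eq_ae (cylinder \<Omega> T) u v"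
proof -
 let ?I = "{0<..<T}" and ?Q = "cylinder \<Omega> T"
 have \<Omega>b: "\<Omega> \<in> sets borel" and Ib: "?I \<in> sets borel" and Qb: "?Q \<in> sets borel"
  using \<Omega> cylinder_borel[OF \<Omega>] by auto
 have "f \<in> L2 ?Q" using u(2) by (simp add: has_box_def)
 then obtain f0 where f0s: "sq_int lborel f0" "!!z. z \<notin> ?Q ==> f0 z = 0" and f0u: "AE z in lebesgue_on ?Q. f z = f0 z"
  using L2_rep[OF Qb] by blast
 have f0: "f0 \<in> cyl \<Omega> T" using f0s unfolding cyl_def by blast
 have f0v: "AE z in lebesgue_on ?Q. f' z = f0 z"
  using ff[unfolded eq_ae_def] f0u by eventually_elim simp
 obtain w g where wg: "wave_data \<Omega> T u f0 w g" using wave_space_data[OF \<Omega> T u f0 f0u] by blast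
 obtain w' g' where wg': "wave_data \<Omega> T v f0 w' g'" using wave_space_data[OF \<Omega> T v f0 f0v] by blast
 have w: "w \<in> cyl \<Omega> T" "w' \<in> cyl \<Omega> T" using wg wg' by (simp_all add: wave_data_def)
 have g: "g b \<in> cyl \<Omega> T" "g' b \<in> cyl \<Omega> T" if "b \<in> Basis" for b
  using wg wg' that by (simp_all add: wave_data_def)
 have ud: "AE t in lborel. t \<in> ?I --> eq_ae \<Omega> (time_slice u t) (\<lambda>x. tprim w (x, t)) & time_slice u t \<in> H10 \<Omega> \<and>
    (\<forall>b\<in>Basis. eq_ae \<Omega> (\<lambda>x. g b (x, t)) (\<lambda>x. weak_gradient \<Omega> (time_slice u t) x \<bullet> b)) \<and>
    (\<forall>\<xi>\<in>H10 \<Omega>. L2_inner \<Omega> (\<lambda>x. w (x, t)) \<xi> = L2_inner \<Omega> (\<lambda>x. tprim f0 (x, t)) \<xi>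
     - (\<Sum>b\<in>Basis. L2_inner \<Omega> (\<lambda>x. tprim (g b) (x, t)) (\<lambda>x. weak_gradient \<Omega> \<xi> x \<bullet> b)))"
  using conjunct2[OF conjunct2[OF wg[unfolded wave_data_def]]] .
 have vd: "AE t in lborel. t \<in> ?I --> eq_ae \<Omega> (time_slice v t) (\<lambda>x. tprim w' (x, t)) & time_slice v t \<in> H10 \<Omega> \<and>
    (\<forall>b\<in>Basis. eq_ae \<Omega> (\<lambda>x. g' b (x, t)) (\<lambda>x. weak_gradient \<Omega> (time_slice v t) x \<bullet> b)) \<and>
    (\<forall>\<xi>\<in>H10 \<Omega>. L2_inner \<Omega> (\<lambda>x. w' (x, t)) \<xi> = L2_inner \<Omega> (\<lambda>x. tprim f0 (x, t)) \<xi>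
     - (\<Sum>b\<in>Basis. L2_inner \<Omega> (\<lambda>x. tprim (g' b) (x, t)) (\<lambda>x. weak_gradient \<Omega> \<xi> x \<bullet> b)))"
  using conjunct2[OF conjunct2[OF wg'[unfolded wave_data_def]]] .
 define W where "W z = w z - w' z" for z
 define G where "G b z = g b z - g' b z" for b z
 have Wc: "W \<in> cyl \<Omega> T" unfolding W_def[abs_def] by (rule cyl_diff[OF w])
 have Gc: "G b \<in> cyl \<Omega> T" if "b \<in> Basis" for b unfolding G_def[abs_def] by (rule cyl_diff[OF g[OF that]])
 have sl: "AE t in lborel. sq_int lborel (\<lambda>x. h (x, t))" if "h \<in> cyl \<Omega> T" for h
  by (rule sq_int_slices(1)[OF cylD(1)[OF that]])
 have energy: "AE t in lborel. t \<in> ?I --> (LBINT x. W (x, t) * tprim W (x, t))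
   = - (\<Sum>b\<in>Basis. (LBINT x. G b (x, t) * tprim (G b) (x, t)))"
  using ud vd sl[OF w(1)] sl[OF w(2)]
 proof eventually_elim
  case (elim t)
  show ?case
  proof
   assume t: "t \<in> ?I"
   define \<xi> where "\<xi> x = time_slice u t x - time_slice v t x" for x
   note eu = mp[OF elim(1) t] and ev = mp[OF elim(2) t]
   note uW = conjunct1[OF eu] and uH = conjunct1[OF conjunct2[OF eu]]
    and uG = conjunct1[OF conjunct2[OF conjunct2[OF eu]]] and uE = conjunct2[OF conjunct2[OF conjunct2[OF eu]]]
   note vW = conjunct1[OF ev] and vH = conjunct1[OF conjunct2[OF ev]]
    and vG = conjunct1[OF conjunct2[OF conjunct2[OF ev]]] and vE = conjunct2[OF conjunct2[OF conjunct2[OF ev]]]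
   have \<xi>H: "\<xi> \<in> H10 \<Omega>" unfolding \<xi>_def[abs_def] by (rule H10_diff[OF \<Omega> uH vH])
   have \<xi>e: "eq_ae \<Omega> \<xi> (\<lambda>x. tprim W (x, t))"
   proof -
    have "eq_ae \<Omega> \<xi> (\<lambda>x. tprim w (x, t) - tprim w' (x, t))"
     unfolding \<xi>_def[abs_def] by (rule eq_ae_diff[OF uW vW])
    then show ?thesis unfolding W_def[abs_def] using tprim_diff_eq_ae[OF \<Omega>b w] by (rule eq_ae_trans)
   qed
   have \<xi>G: "eq_ae \<Omega> (\<lambda>x. weak_gradient \<Omega> \<xi> x \<bullet> b) (\<lambda>x. G b (x, t))" if b: "b \<in> Basis" for b
   proof -
    have wd: "has_weak_gradient \<Omega> \<xi> (\<lambda>x. weak_gradient \<Omega> (time_slice u t) x - weak_gradient \<Omega> (time_slice v t) x)"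
     unfolding \<xi>_def[abs_def]
     by (rule has_weak_gradient_diff[OF \<Omega> H10_L2[OF uH] H10_L2[OF vH] H10_gradient[OF uH] H10_gradient[OF vH]])
    have "eq_ae \<Omega> (\<lambda>x. weak_gradient \<Omega> \<xi> x \<bullet> b) (\<lambda>x. weak_gradient \<Omega> (time_slice u t) x \<bullet> b - weak_gradient \<Omega> (time_slice v t) x \<bullet> b)"
     using weak_gradient_unique[OF \<Omega> H10_gradient[OF \<xi>H] wd b] by (simp add: eq_ae_def inner_diff_left)
    moreover have "eq_ae \<Omega> (\<lambda>x. weak_gradient \<Omega> (time_slice u t) x \<bullet> b - weak_gradient \<Omega> (time_slice v t) x \<bullet> b) (\<lambda>x. G b (x, t))"
     unfolding G_def by (rule eq_ae_diff[OF eq_ae_sym[OF bspec[OF uG b]] eq_ae_sym[OF bspec[OF vG b]]])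
    ultimately show ?thesis by (rule eq_ae_trans)
   qed
   have \<xi>L: "\<xi> \<in> L2 \<Omega>" by (rule H10_L2[OF \<xi>H])
   have wL: "(\<lambda>x. w (x, t)) \<in> L2 \<Omega>" "(\<lambda>x. w' (x, t)) \<in> L2 \<Omega>"
    by (rule L2_of_sq_int[OF elim(3) \<Omega>b], rule L2_of_sq_int[OF elim(4) \<Omega>b])
   have tL: "(\<lambda>x. tprim h (x, t)) \<in> L2 \<Omega>" if "h \<in> cyl \<Omega> T" for h
    using t by (intro L2_of_sq_int[OF tprim_L2(1)[OF that] \<Omega>b]) simp
   have "(LBINT x. W (x, t) * tprim W (x, t)) = L2_inner \<Omega> (\<lambda>x. w (x, t) - w' (x, t)) \<xi>"
    by (rule L2_inner_rep[OF \<Omega>b cyl_slice_borel[OF Wc] _ tprim_slice_borel[OF Wc] \<xi>e, symmetric])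
      (use cyl_slice_outside[OF Wc] in "auto simp: W_def")
   also have "\<dots> = L2_inner \<Omega> (\<lambda>x. w (x, t)) \<xi> - L2_inner \<Omega> (\<lambda>x. w' (x, t)) \<xi>"
    by (rule L2_inner_diff_left[OF wL \<xi>L])
   also have "\<dots> = - (\<Sum>b\<in>Basis. L2_inner \<Omega> (\<lambda>x. tprim (g b) (x, t)) (\<lambda>x. weak_gradient \<Omega> \<xi> x \<bullet> b)
      - L2_inner \<Omega> (\<lambda>x. tprim (g' b) (x, t)) (\<lambda>x. weak_gradient \<Omega> \<xi> x \<bullet> b))"
   proof -
    show ?thesis unfolding bspec[OF uE \<xi>H] bspec[OF vE \<xi>H] sum_subtractf by (rule diff_diff_common)
   qed
   also have "\<dots> = - (\<Sum>b\<in>Basis. (LBINT x. G b (x, t) * tprim (G b) (x, t)))"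
   proof (rule arg_cong[where f=uminus], rule sum.cong[OF refl])
    fix b :: 'a assume b: "b \<in> Basis"
    have "L2_inner \<Omega> (\<lambda>x. tprim (g b) (x, t)) (\<lambda>x. weak_gradient \<Omega> \<xi> x \<bullet> b)
      - L2_inner \<Omega> (\<lambda>x. tprim (g' b) (x, t)) (\<lambda>x. weak_gradient \<Omega> \<xi> x \<bullet> b)
      = L2_inner \<Omega> (\<lambda>x. tprim (g b) (x, t) - tprim (g' b) (x, t)) (\<lambda>x. weak_gradient \<Omega> \<xi> x \<bullet> b)"
     by (rule L2_inner_diff_left[OF tL[OF g(1)[OF b]] tL[OF g(2)[OF b]] gradient_L2[OF H10_gradient[OF \<xi>H] b], symmetric])
    also have "\<dots> = (LBINT x. tprim (G b) (x, t) * G b (x, t))"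
    proof (rule L2_inner_rep[OF \<Omega>b tprim_slice_borel[OF Gc[OF b]] _ cyl_slice_borel[OF Gc[OF b]] \<xi>G[OF b]])
     show "eq_ae \<Omega> (\<lambda>x. tprim (g b) (x, t) - tprim (g' b) (x, t)) (\<lambda>x. tprim (G b) (x, t))"
      unfolding G_def[abs_def] by (rule tprim_diff_eq_ae[OF \<Omega>b g[OF b]])
    qed (use cyl_slice_outside[OF Gc[OF b]] in auto)
    finally show "L2_inner \<Omega> (\<lambda>x. tprim (g b) (x, t)) (\<lambda>x. weak_gradient \<Omega> \<xi> x \<bullet> b)
      - L2_inner \<Omega> (\<lambda>x. tprim (g' b) (x, t)) (\<lambda>x. weak_gradient \<Omega> \<xi> x \<bullet> b)
      = (LBINT x. G b (x, t) * tprim (G b) (x, t))" by (simp add: mult.commute)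
   qed
   finally show "(LBINT x. W (x, t) * tprim W (x, t)) = - (\<Sum>b\<in>Basis. (LBINT x. G b (x, t) * tprim (G b) (x, t)))" .
  qed
 qed
 have zero: "l2n lborel (\<lambda>x. tprim W (x, r)) = 0" if r: "0 <= r" "r <= T" for r
 proof -
  note EW = tprim_energy[OF Wc \<Omega>b r]
  note EG = tprim_energy[OF Gc \<Omega>b r]
  have "(l2n lborel (\<lambda>x. tprim W (x, r)))\<^sup>2 / 2 = (LBINT t. indicator {0<..<r} t * (LBINT x. W (x, t) * tprim W (x, t)))"
   using EW(1) by simp
  also have "\<dots> = (LBINT t. - (\<Sum>b\<in>Basis. indicator {0<..<r} t * (LBINT x. G b (x, t) * tprim (G b) (x, t))))"
  proof (rule integral_cong_AE)
   show "AE t in lborel. indicator {0<..<r} t * (LBINT x. W (x, t) * tprim W (x, t))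
     = - (\<Sum>b\<in>Basis. indicator {0<..<r} t * (LBINT x. G b (x, t) * tprim (G b) (x, t)))"
    using energy by eventually_elim (use r in "auto simp: indicator_def")
   show "(\<lambda>t. indicator {0<..<r} t * (LBINT x. W (x, t) * tprim W (x, t))) \<in> borel_measurable lborel"
    by (rule borel_measurable_integrable[OF EW(2)])
   show "(\<lambda>t. - (\<Sum>b\<in>Basis. indicator {0<..<r} t * (LBINT x. G b (x, t) * tprim (G b) (x, t)))) \<in> borel_measurable lborel"
    by (intro borel_measurable_uminus borel_measurable_sum borel_measurable_integrable[OF EG(2)])
  qed
  also have "\<dots> = - (\<Sum>b\<in>Basis. (l2n lborel (\<lambda>x. tprim (G b) (x, r)))\<^sup>2 / 2)"
  proof -
   have "(LBINT t. (\<Sum>b\<in>Basis. indicator {0<..<r} t * (LBINT x. G b (x, t) * tprim (G b) (x, t))))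
     = (\<Sum>b\<in>Basis. (LBINT t. indicator {0<..<r} t * (LBINT x. G b (x, t) * tprim (G b) (x, t))))"
    by (rule Bochner_Integration.integral_sum) (rule EG(2))
   also have "\<dots> = (\<Sum>b\<in>Basis. (l2n lborel (\<lambda>x. tprim (G b) (x, r)))\<^sup>2 / 2)"
    by (rule sum.cong[OF refl]) (rule EG(1))
   finally show ?thesis by simp
  qed
  finally have e: "(l2n lborel (\<lambda>x. tprim W (x, r)))\<^sup>2 / 2 = - (\<Sum>b\<in>Basis. (l2n lborel (\<lambda>x. tprim (G b) (x, r)))\<^sup>2 / 2)" .
  have "0 <= (\<Sum>b\<in>(Basis::'a set). (l2n lborel (\<lambda>x. tprim (G b) (x, r)))\<^sup>2 / 2)" by (intro sum_nonneg) simp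
  then have "(l2n lborel (\<lambda>x. tprim W (x, r)))\<^sup>2 <= 0" using e by linarith
  then show ?thesis by simp
 qed
 have slices: "AE t in lborel. t \<in> ?I --> eq_ae \<Omega> (time_slice u t) (time_slice v t)"
  using ud vd
 proof eventually_elim
  case (elim t)
  show ?case
  proof
   assume t: "t \<in> ?I"
   have "AE x in lborel. tprim W (x, t) = 0"
    by (rule l2n_eq_0[OF tprim_L2(1)[OF Wc] zero]) (use t in auto)
   then have "eq_ae \<Omega> (\<lambda>x. tprim w (x, t)) (\<lambda>x. tprim w' (x, t))"
    unfolding eq_ae_def AE_on_iff[OF \<Omega>b] using tprim_diff_AE[OF w]
    by eventually_elim (simp add: W_def[abs_def])
   then show "eq_ae \<Omega> (time_slice u t) (time_slice v t)"
    using eq_ae_trans[OF eq_ae_trans[OF conjunct1[OF mp[OF elim(1) t]]] eq_ae_sym[OF conjunct1[OF mp[OF elim(2) t]]]] by blast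
  qed
 qed
 have uL: "u \<in> L2 ?Q" "v \<in> L2 ?Q" using u(1) v(1) by (auto simp: wave_space_def H11_00_def)
 obtain u1 where u1s: "sq_int lborel u1" "!!z. z \<notin> ?Q ==> u1 z = 0" and u1: "AE z in lebesgue_on ?Q. u z = u1 z"
  using L2_rep[OF Qb uL(1)] by blast
 obtain v1 where v1s: "sq_int lborel v1" "!!z. z \<notin> ?Q ==> v1 z = 0" and v1: "AE z in lebesgue_on ?Q. v z = v1 z"
  using L2_rep[OF Qb uL(2)] by blast
 have d: "sq_int lborel (\<lambda>z. u1 z - v1 z)" using u1s(1) v1s(1) by auto
 have "AE t in lborel. (l2n lborel (\<lambda>x. u1 (x, t) - v1 (x, t)))\<^sup>2 = 0"
  using slices rep_slices[OF \<Omega> u1, unfolded AE_on_iff[OF Ib]] rep_slices[OF \<Omega> v1, unfolded AE_on_iff[OF Ib]]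
 proof eventually_elim
  case (elim t)
  have "AE x in lborel. u1 (x, t) - v1 (x, t) = 0"
  proof (cases "t \<in> ?I")
   case True
   have "eq_ae \<Omega> (\<lambda>x. u1 (x, t)) (\<lambda>x. v1 (x, t))"
    using elim True by (simp add: time_slice_def[abs_def]) (meson eq_ae_sym eq_ae_trans)
   then show ?thesis unfolding eq_ae_def AE_on_iff[OF \<Omega>b]
   proof eventually_elim
    case (elim x)
    then show ?case using u1s(2)[of "(x, t)"] v1s(2)[of "(x, t)"] by (cases "x \<in> \<Omega>") auto
   qed
  next
   case False
   then have "u1 (x, t) - v1 (x, t) = 0" for x using u1s(2)[of "(x, t)"] v1s(2)[of "(x, t)"] by auto
   then show ?thesis by simp
  qed
  moreover have "(\<lambda>x. u1 (x, t)) \<in> borel_measurable borel" "(\<lambda>x. v1 (x, t)) \<in> borel_measurable borel"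
   using u1s(1) v1s(1) by (auto simp: sq_int_def intro: spacetime_slice_borel)
  ultimately have "l2n lborel (\<lambda>x. u1 (x, t) - v1 (x, t)) = l2n lborel (\<lambda>x::'a. 0::real)"
   by (intro l2n_cong_AE) auto
  then show ?case by (simp add: l2n_def)
 qed
 then have "(LBINT t. (l2n lborel (\<lambda>x. u1 (x, t) - v1 (x, t)))\<^sup>2) = 0"
  by (rule integral_eq_zero_AE)
 then have "l2n lborel (\<lambda>z. u1 z - v1 z) = 0" using sq_int_slices(4)[OF d] by simp
 from l2n_eq_0[OF d this] have "AE z in lborel. z \<in> ?Q --> u1 z = v1 z" by eventually_elim simp
 then have "eq_ae ?Q u1 v1" unfolding eq_ae_def AE_on_iff[OF Qb] .
 moreover have "eq_ae ?Q u u1" "eq_ae ?Q v v1" using u1 v1 by (simp_all add: eq_ae_def)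
 ultimately show ?thesis by (meson eq_ae_sym eq_ae_trans)
qed

section \<open>Orthogonal projection and a theorem of Lions\<close>

text \<open>By the parallelogram law a minimising sequence is Cauchy, and the limit is orthogonal by the
 usual variation argument.\<close>

lemma closed_subspace_projection:
 fixes A :: "'h::{real_inner, complete_space} set"
 assumes A: "subspace A" and cl: "closed A"
 obtains p where "p \<in> A" "!!a. a \<in> A ==> inner (x - p) a = 0"
proof -
 have ne: "A \<noteq> {}" using subspace_0[OF A] by auto
 define d where "d = (INF a\<in>A. (norm (x - a))\<^sup>2)"
 have bdd: "bdd_below ((\<lambda>a. (norm (x - a))\<^sup>2) ` A)" by (rule bdd_belowI2[of _ 0]) simp
 have d_le: "d <= (norm (x - a))\<^sup>2" if "a \<in> A" for a
  unfolding d_def by (rule cINF_lower[OF bdd that])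
 have "\<exists>a\<in>A. (norm (x - a))\<^sup>2 < d + inverse (real (Suc n))" for n
 proof -
  have "d < d + inverse (real (Suc n))" by simp
  then show ?thesis unfolding d_def using cINF_less_iff[OF ne bdd] by blast
 qed
 then obtain s where s: "!!n. s n \<in> A" "!!n. (norm (x - s n))\<^sup>2 < d + inverse (real (Suc n))" by metis
 have par: "(norm (s n - s m))\<^sup>2 <= 2 * (inverse (real (Suc n)) + inverse (real (Suc m)))" for n m
 proof -
  have "(norm (s n - s m))\<^sup>2 + 4 * (norm (x - (1/2) *\<^sub>R (s n + s m)))\<^sup>2 = 2 * (norm (x - s n))\<^sup>2 + 2 * (norm (x - s m))\<^sup>2"
   unfolding power2_norm_eq_inner by (simp add: inner_simps inner_commute algebra_simps)
  moreover have "d <= (norm (x - (1/2) *\<^sub>R (s n + s m)))\<^sup>2"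
   by (intro d_le subspace_scale[OF A] subspace_add[OF A] s)
  moreover have "X <= 2 * i + 2 * j" if "X + 4 * P = 2 * a + 2 * b" "d <= P" "a < d + i" "b < d + j" for X P a b i j :: real
   using that by linarith
  ultimately show ?thesis using s(2)[of n] s(2)[of m] unfolding distrib_left by blast
 qed
 have "Cauchy s"
 proof (rule metric_CauchyI)
  fix e :: real assume e: "e > 0"
  obtain N where N: "inverse (real (Suc N)) < e\<^sup>2 / 4" using reals_Archimedean[of "e\<^sup>2 / 4"] e by auto
  have "dist (s m) (s n) < e" if mn: "m \<ge> N" "n \<ge> N" for m n
  proof -
   have "inverse (real (Suc m)) <= inverse (real (Suc N))" "inverse (real (Suc n)) <= inverse (real (Suc N))"
    using mn by (auto intro!: le_imp_inverse_le)
   moreover have "X < y" if "i <= k" "j <= k" "X <= 2 * i + 2 * j" "k < y / 4" for X y i j k :: real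
    using that by linarith
   ultimately have "(norm (s m - s n))\<^sup>2 < e\<^sup>2" using par[of m n, unfolded distrib_left] N by blast
   then show ?thesis using e by (simp add: dist_norm power2_less_imp_less)
  qed
  then show "\<exists>M. \<forall>m\<ge>M. \<forall>n\<ge>M. dist (s m) (s n) < e" by blast
 qed
 then obtain p where p: "s \<longlonglongrightarrow> p" using Cauchy_convergent convergent_def by blast
 have pA: "p \<in> A" using closed_sequentially[OF cl] s(1) p by blast
 have "(norm (x - p))\<^sup>2 <= d"
 proof (rule LIMSEQ_le)
  show "(\<lambda>n. (norm (x - s n))\<^sup>2) \<longlonglongrightarrow> (norm (x - p))\<^sup>2" by (intro tendsto_intros p)
  show "(\<lambda>n. d + inverse (real (Suc n))) \<longlonglongrightarrow> d"
   using tendsto_add[OF tendsto_const LIMSEQ_inverse_real_of_nat] by fastforce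
  show "\<exists>N. \<forall>n\<ge>N. (norm (x - s n))\<^sup>2 <= d + inverse (real (Suc n))" using s(2) by (auto intro: less_imp_le)
 qed
 then have min: "(norm (x - p))\<^sup>2 <= (norm (x - a))\<^sup>2" if "a \<in> A" for a using d_le[OF that] by linarith
 have "inner (x - p) a = 0" if a: "a \<in> A" for a
 proof (cases "a = 0")
  case False
  define t where "t = inner (x - p) a / inner a a"
  have "p + t *\<^sub>R a \<in> A" by (intro subspace_add[OF A] subspace_scale[OF A] pA a)
  then have "(norm (x - p))\<^sup>2 <= (norm ((x - p) - t *\<^sub>R a))\<^sup>2" using min[of "p + t *\<^sub>R a"] by (simp add: diff_diff_eq)
  also have "\<dots> = (norm (x - p))\<^sup>2 - 2 * t * inner (x - p) a + t\<^sup>2 * inner a a"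
  proof -
   have "inner (y - t *\<^sub>R a) (y - t *\<^sub>R a) = inner y y - 2 * t * inner y a + t\<^sup>2 * inner a a" for y
    by (simp add: inner_diff_left inner_diff_right inner_commute[of a y] power2_eq_square algebra_simps)
   then show ?thesis unfolding power2_norm_eq_inner by blast
  qed
  also have "\<dots> = (norm (x - p))\<^sup>2 - (inner (x - p) a)\<^sup>2 / inner a a"
   using False by (simp add: t_def power2_eq_square field_simps)
  finally have "(inner (x - p) a)\<^sup>2 / inner a a <= 0" by simp
  moreover have "inner a a > 0" using False by simp
  ultimately have "(inner (x - p) a)\<^sup>2 <= 0" using pos_divide_le_eq[of "inner a a" "(inner (x - p) a)\<^sup>2" 0] by simp
  then show ?thesis by simp
 qed simp
 with pA that show ?thesis by blast
qed

lemma subspace_closure: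
 fixes S :: "'h::real_normed_vector set"
 assumes S: "subspace S" shows "subspace (closure S)"
proof (rule subspaceI)
 show "0 \<in> closure S" using subspace_0[OF S] closure_subset by blast
 show "x + y \<in> closure S" if xy: "x \<in> closure S" "y \<in> closure S" for x y
 proof -
  obtain a b where ab: "!!n. a n \<in> S" "a \<longlonglongrightarrow> x" "!!n. b n \<in> S" "b \<longlonglongrightarrow> y"
   using xy unfolding closure_sequential by blast
  have "(\<lambda>n. a n + b n) \<longlonglongrightarrow> x + y" by (intro tendsto_add ab)
  moreover have "\<forall>n. a n + b n \<in> S" by (intro allI subspace_add[OF S] ab)
  ultimately show ?thesis unfolding closure_sequential by (intro exI[of _ "\<lambda>n. a n + b n"] conjI)
 qed
 show "c *\<^sub>R x \<in> closure S" if x: "x \<in> closure S" for c x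
 proof -
  obtain a where a: "!!n. a n \<in> S" "a \<longlonglongrightarrow> x" using x unfolding closure_sequential by blast
  have "(\<lambda>n. c *\<^sub>R a n) \<longlonglongrightarrow> c *\<^sub>R x" by (intro tendsto_scaleR tendsto_const a)
  moreover have "\<forall>n. c *\<^sub>R a n \<in> S" by (intro allI subspace_scale[OF S] a)
  ultimately show ?thesis unfolding closure_sequential by (intro exI[of _ "\<lambda>n. c *\<^sub>R a n"] conjI)
 qed
qed

text \<open>The linear maps \<open>D\<close>, \<open>M\<close> and the load \<open>L\<close> are given by
 their joint graph \<open>G\<close>, with elements \<open>(D \<phi>, M \<phi>, L \<phi>)\<close>. Coercivity
 bounds \<open>D \<phi>\<close>, hence also \<open>L \<phi>\<close>, by the projection of \<open>M
 \<phi>\<close> onto the closure of the range of \<open>D\<close>; so the load is a bounded functional of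
 that projection, and a Riesz representative of it is \<open>U\<close>.\<close>

theorem Lions_projection:
 fixes G :: "('h::{real_inner, complete_space} \<times> 'h \<times> real) set"
 assumes G: "subspace G" and \<alpha>: "0 < \<alpha>"
  and coercive: "!!a m l. (a, m, l) \<in> G ==> \<alpha> * (norm a)\<^sup>2 <= inner a m"
  and bounded: "!!a m l. (a, m, l) \<in> G ==> \<bar>l\<bar> <= C * norm a"
 obtains U where "U \<in> closure (fst ` G)" "!!a m l. (a, m, l) \<in> G ==> inner U m = l"
proof -
 define A where "A = closure (fst ` G)"
 have "subspace (fst ` G)" by (rule linear_subspace_image[OF linear_fst G])
 then have A: "subspace A" "closed A" unfolding A_def by (auto intro: subspace_closure)
 have GA: "a \<in> A" if "(a, m, l) \<in> G" for a m l
  using that closure_subset[of "fst ` G"] unfolding A_def by force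
 \<comment> \<open>The load as a functional of the projection \<open>k\<close> of \<open>M \<phi>\<close> onto \<open>A\<close>, again as a graph.\<close>
 define K where "K = {(k, l). k \<in> A & (\<exists>a m. (a, m, l) \<in> G & (\<forall>a'\<in>A. inner (m - k) a' = 0))}"
 have Ksub: "subspace K"
 proof (rule subspaceI)
  have "(0, 0, 0) \<in> G" using subspace_0[OF G] by (simp add: zero_prod_def)
  then show "0 \<in> K" unfolding K_def zero_prod_def using subspace_0[OF A(1)] by force
  show "x + y \<in> K" if xy: "x \<in> K" "y \<in> K" for x y
  proof -
   obtain k l a m k' l' a' m' where *: "x = (k, l)" "k \<in> A" "(a, m, l) \<in> G" "\<forall>b\<in>A. inner (m - k) b = 0"
    "y = (k', l')" "k' \<in> A" "(a', m', l') \<in> G" "\<forall>b\<in>A. inner (m' - k') b = 0"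
    using xy unfolding K_def by blast
   have "(a + a', m + m', l + l') \<in> G" using subspace_add[OF G *(3,7)] by simp
   moreover have "\<forall>b\<in>A. inner (m + m' - (k + k')) b = 0"
    using *(4,8) by (auto simp: inner_diff_left inner_add_left)
   ultimately show ?thesis unfolding K_def using * subspace_add[OF A(1) *(2,6)] by auto
  qed
  show "c *\<^sub>R x \<in> K" if x: "x \<in> K" for c x
  proof -
   obtain k l a m where *: "x = (k, l)" "k \<in> A" "(a, m, l) \<in> G" "\<forall>b\<in>A. inner (m - k) b = 0"
    using x unfolding K_def by blast
   have "(c *\<^sub>R a, c *\<^sub>R m, c * l) \<in> G" using subspace_scale[OF G *(3), of c] by simp
   moreover have "\<forall>b\<in>A. inner (c *\<^sub>R m - c *\<^sub>R k) b = 0"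
    using *(4) by (auto simp: inner_diff_left)
   ultimately show ?thesis unfolding K_def using * subspace_scale[OF A(1) *(2), of c] by auto
  qed
 qed
 define B where "B = closure K"
 have B: "subspace B" "closed B" unfolding B_def using subspace_closure[OF Ksub] by auto
 have Kbound: "\<bar>l\<bar> <= (\<bar>C\<bar> / \<alpha>) * norm k" if kl: "(k, l) \<in> K" for k l
 proof -
  obtain a m where am: "(a, m, l) \<in> G" "\<forall>b\<in>A. inner (m - k) b = 0" using kl unfolding K_def by blast
  have "inner m a = inner k a" using bspec[OF am(2) GA[OF am(1)]] by (simp add: inner_diff_left)
  then have "inner a m = inner a k" by (simp only: inner_commute[of a])
  then have "\<alpha> * (norm a)\<^sup>2 <= norm a * norm k"
   using coercive[OF am(1)] norm_cauchy_schwarz[of a k] by linarith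
  then have "\<alpha> * norm a <= norm k"
   by (cases "norm a = 0") (auto simp: power2_eq_square mult.left_commute[of \<alpha>])
  then have "norm a <= norm k / \<alpha>" using \<alpha> by (simp add: field_simps)
  then have "\<bar>C\<bar> * norm a <= \<bar>C\<bar> * (norm k / \<alpha>)" by (intro mult_left_mono) auto
  moreover have "\<bar>l\<bar> <= \<bar>C\<bar> * norm a"
   using bounded[OF am(1)] mult_right_mono[OF abs_ge_self[of C], of "norm a"] by simp
  ultimately show ?thesis by simp
 qed
 have Bbound: "\<bar>snd z\<bar> <= (\<bar>C\<bar> / \<alpha>) * norm (fst z)" and BA: "fst z \<in> A" if "z \<in> B" for z
 proof -
  have "closed {z :: 'h \<times> real. \<bar>snd z\<bar> <= (\<bar>C\<bar> / \<alpha>) * norm (fst z)}"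
   by (intro closed_Collect_le continuous_intros)
  moreover have "K \<subseteq> {z. \<bar>snd z\<bar> <= (\<bar>C\<bar> / \<alpha>) * norm (fst z)}" using Kbound by auto
  ultimately have "B \<subseteq> {z. \<bar>snd z\<bar> <= (\<bar>C\<bar> / \<alpha>) * norm (fst z)}" unfolding B_def by (rule closure_minimal[rotated])
  then show "\<bar>snd z\<bar> <= (\<bar>C\<bar> / \<alpha>) * norm (fst z)" using that by blast
  have "closed (A \<times> (UNIV :: real set))" by (intro closed_Times A) simp
  moreover have "K \<subseteq> A \<times> UNIV" unfolding K_def by auto
  ultimately have "B \<subseteq> A \<times> UNIV" unfolding B_def by (rule closure_minimal[rotated])
  then show "fst z \<in> A" using that by auto
 qed
 \<comment> \<open>The normal to a graph that contains no vertical vector represents the functional.\<close>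
 obtain q where q: "q \<in> B" "!!z. z \<in> B ==> inner ((0, 1) - q) z = 0"
  using closed_subspace_projection[OF B, of "(0, 1)"] by blast
 obtain k0 l0 where k0: "q = (k0, l0)" by (cases q)
 have orth: "(1 - l0) * snd z = inner k0 (fst z)" if "z \<in> B" for z
  using q(2)[OF that] by (simp add: k0 inner_prod_def)
 have l0: "l0 \<noteq> 1"
 proof
  assume "l0 = 1"
  then have "inner k0 k0 = 0" using orth[OF q(1)] by (simp add: k0)
  then have "\<bar>l0\<bar> <= 0" using Bbound[OF q(1)] by (simp add: k0)
  then show False using \<open>l0 = 1\<close> by simp
 qed
 define U where "U = (1 / (1 - l0)) *\<^sub>R k0"
 have UA: "U \<in> A" unfolding U_def using BA[OF q(1)] by (intro subspace_scale[OF A(1)]) (simp add: k0)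
 have "inner U m = l" if aml: "(a, m, l) \<in> G" for a m l
 proof -
  obtain k where k: "k \<in> A" "!!b. b \<in> A ==> inner (m - k) b = 0"
   using closed_subspace_projection[OF A, of m] by blast
  then have "(k, l) \<in> K" unfolding K_def using aml by blast
  then have "(k, l) \<in> B" unfolding B_def using closure_subset by blast
  then have "(1 - l0) * l = inner k0 k" using orth[of "(k, l)"] by simp
  then have "inner U k = l" using l0 by (simp add: U_def field_simps)
  moreover have "inner m U = inner k U" using k(2)[OF UA] by (simp add: inner_diff_left)
  then have "inner U m = inner U k" by (simp only: inner_commute[of U])
  ultimately show ?thesis by simp
 qed
 with UA that show ?thesis unfolding A_def by blast
qed

section \<open>The Hilbert space of square-integrable functions\<close>

text \<open>The theorem of Lions needs a Hilbert space, hence classes of functions modulo null functions.\<close>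

definition l2_rel :: "('q::euclidean_space => 'b::euclidean_space) => ('q => 'b) => bool" where
 "l2_rel f g \<longleftrightarrow> sq_int lborel f & sq_int lborel g & (AE x in lborel. f x = g x)"

quotient_type (overloaded) ('q, 'b) l2 = "'q::euclidean_space => 'b::euclidean_space" / partial: l2_rel
 morphisms rep_l2 abs_l2
proof (rule part_equivpI)
 show "\<exists>f. l2_rel f f" by (rule exI[of _ "\<lambda>x. 0"]) (simp add: l2_rel_def)
 show "symp l2_rel" by (auto simp: symp_def l2_rel_def eq_commute)
 show "transp l2_rel"
 proof (rule transpI)
  fix f g h assume fg: "l2_rel f g" and gh: "l2_rel g h"
  have "AE x in lborel. f x = g x" "AE x in lborel. g x = h x" using fg gh by (auto simp: l2_rel_def)
  then have "AE x in lborel. f x = h x" by eventually_elim simp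
  then show "l2_rel f h" using fg gh by (auto simp: l2_rel_def)
 qed
qed

instantiation l2 :: (euclidean_space, euclidean_space) real_vector
begin

lift_definition zero_l2 :: "('a, 'b) l2" is "\<lambda>x. 0"
 unfolding l2_rel_def by simp

lift_definition plus_l2 :: "('a, 'b) l2 => ('a, 'b) l2 => ('a, 'b) l2" is "\<lambda>f g x. f x + g x"
proof -
 fix f f' g g' :: "'a => 'b" assume r: "l2_rel f f'" "l2_rel g g'"
 then have "AE x in lborel. f x = f' x" "AE x in lborel. g x = g' x" by (auto simp: l2_rel_def)
 then have "AE x in lborel. f x + g x = f' x + g' x" by eventually_elim simp
 then show "l2_rel (\<lambda>x. f x + g x) (\<lambda>x. f' x + g' x)" using r by (auto simp: l2_rel_def)
qed

lift_definition uminus_l2 :: "('a, 'b) l2 => ('a, 'b) l2" is "\<lambda>f x. - f x"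
 by (auto simp: l2_rel_def)

lift_definition minus_l2 :: "('a, 'b) l2 => ('a, 'b) l2 => ('a, 'b) l2" is "\<lambda>f g x. f x - g x"
proof -
 fix f f' g g' :: "'a => 'b" assume r: "l2_rel f f'" "l2_rel g g'"
 then have "AE x in lborel. f x = f' x" "AE x in lborel. g x = g' x" by (auto simp: l2_rel_def)
 then have "AE x in lborel. f x - g x = f' x - g' x" by eventually_elim simp
 then show "l2_rel (\<lambda>x. f x - g x) (\<lambda>x. f' x - g' x)" using r by (auto simp: l2_rel_def)
qed

lift_definition scaleR_l2 :: "real => ('a, 'b) l2 => ('a, 'b) l2" is "\<lambda>c f x. c *\<^sub>R f x"
proof -
 fix c and f f' :: "'a => 'b" assume r: "l2_rel f f'"
 then have "AE x in lborel. f x = f' x" by (auto simp: l2_rel_def)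
 then have "AE x in lborel. c *\<^sub>R f x = c *\<^sub>R f' x" by eventually_elim simp
 then show "l2_rel (\<lambda>x. c *\<^sub>R f x) (\<lambda>x. c *\<^sub>R f' x)" using r by (auto simp: l2_rel_def)
qed

instance
 by standard (transfer, auto simp: l2_rel_def algebra_simps)+

end

instantiation l2 :: (euclidean_space, euclidean_space) real_inner
begin

lift_definition inner_l2 :: "('a, 'b) l2 => ('a, 'b) l2 => real" is "\<lambda>f g. (LBINT x. f x \<bullet> g x)"
proof (rule integral_cong_AE)
 fix f f' g g' :: "'a => 'b" assume r: "l2_rel f f'" "l2_rel g g'"
 then have "AE x in lborel. f x = f' x" "AE x in lborel. g x = g' x" by (auto simp: l2_rel_def)
 then show "AE x in lborel. f x \<bullet> g x = f' x \<bullet> g' x" by eventually_elim simp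
 show "(\<lambda>x. f x \<bullet> g x) \<in> borel_measurable lborel" "(\<lambda>x. f' x \<bullet> g' x) \<in> borel_measurable lborel"
  using r by (auto simp: l2_rel_def intro!: borel_measurable_inner)
qed

definition norm_l2 :: "('a, 'b) l2 => real" where "norm_l2 x = sqrt (inner x x)"
definition sgn_l2 :: "('a, 'b) l2 => ('a, 'b) l2" where "sgn_l2 x = x /\<^sub>R norm x"
definition dist_l2 :: "('a, 'b) l2 => ('a, 'b) l2 => real" where "dist_l2 x y = norm (x - y)"
definition uniformity_l2 :: "(('a, 'b) l2 \<times> ('a, 'b) l2) filter" where
 "uniformity_l2 = (INF e\<in>{0 <..}. principal {(x, y). dist x y < e})"
definition open_l2 :: "('a, 'b) l2 set => bool" where
 "open_l2 U \<longleftrightarrow> (\<forall>x\<in>U. \<forall>\<^sub>F (x', y) in uniformity. x' = x --> y \<in> U)"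

instance
proof
 fix x y z :: "('a, 'b) l2" and c :: real
 show "inner x y = inner y x" by transfer (simp add: inner_commute)
 show "inner (x + y) z = inner x z + inner y z"
  by transfer (auto simp: l2_rel_def inner_add_left sq_int_inner)
 show "inner (c *\<^sub>R x) y = c * inner x y" by transfer simp
 show "0 <= inner x x" by transfer simp
 show "inner x x = 0 \<longleftrightarrow> x = 0"
 proof transfer
  fix f :: "'a => 'b" assume "l2_rel f f"
  then have f: "sq_int lborel f" by (simp add: l2_rel_def)
  have "(LBINT x. f x \<bullet> f x) = 0 \<longleftrightarrow> l2n lborel f = 0" by (simp add: l2n_def power2_norm_eq_inner)
  also have "\<dots> \<longleftrightarrow> (AE x in lborel. f x = 0)"
  proof
   assume "AE x in lborel. f x = 0"
   then have "l2n lborel f = l2n lborel (\<lambda>x::'a. 0::'b)" using f by (intro l2n_cong_AE) auto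
   then show "l2n lborel f = 0" by (simp add: l2n_def)
  qed (rule l2n_eq_0[OF f])
  finally show "(LBINT x. f x \<bullet> f x) = 0 \<longleftrightarrow> l2_rel f (\<lambda>x. 0)" using f by (simp add: l2_rel_def)
 qed
 show "norm x = sqrt (inner x x)" by (rule norm_l2_def)
qed (rule dist_l2_def sgn_l2_def uniformity_l2_def open_l2_def)+

end

lemma l2_rel_refl: "sq_int lborel f ==> l2_rel f f"
 by (simp add: l2_rel_def)

lemma l2_cases:
 obtains f where "x = abs_l2 f" "sq_int lborel f"
proof -
 have "x = abs_l2 (rep_l2 x)" "l2_rel (rep_l2 x) (rep_l2 x)"
  by (simp_all only: Quotient_abs_rep[OF Quotient_l2] Quotient_rep_reflp[OF Quotient_l2])
 then show ?thesis using that by (auto simp: l2_rel_def)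
qed

lemma abs_l2_add: "sq_int lborel f ==> sq_int lborel g ==> abs_l2 f + abs_l2 g = abs_l2 (\<lambda>x. f x + g x)"
 by (intro plus_l2.abs_eq l2_rel_refl)

lemma abs_l2_diff: "sq_int lborel f ==> sq_int lborel g ==> abs_l2 f - abs_l2 g = abs_l2 (\<lambda>x. f x - g x)"
 by (intro minus_l2.abs_eq l2_rel_refl)

lemma abs_l2_scaleR: "sq_int lborel f ==> c *\<^sub>R abs_l2 f = abs_l2 (\<lambda>x. c *\<^sub>R f x)"
 by (intro scaleR_l2.abs_eq l2_rel_refl)

lemma inner_abs_l2: "sq_int lborel f ==> sq_int lborel g ==> inner (abs_l2 f) (abs_l2 g) = (LBINT x. f x \<bullet> g x)"
 by (intro inner_l2.abs_eq l2_rel_refl)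

lemma norm_abs_l2: "sq_int lborel f ==> norm (abs_l2 f) = l2n lborel f"
 by (simp add: norm_l2_def inner_abs_l2 l2n_def power2_norm_eq_inner)

lemma dist_abs_l2: "sq_int lborel f ==> sq_int lborel g ==> dist (abs_l2 f) (abs_l2 g) = l2n lborel (\<lambda>x. f x - g x)"
 by (simp add: dist_norm abs_l2_diff norm_abs_l2 sq_int_diff)

instance l2 :: (euclidean_space, euclidean_space) complete_space
proof
 fix X :: "nat => ('a, 'b) l2" assume X: "Cauchy X"
 have "\<exists>f. X n = abs_l2 f & sq_int lborel f" for n using l2_cases[of "X n"] by blast
 then obtain f where f: "!!n. X n = abs_l2 (f n)" "!!n. sq_int lborel (f n)" by metis
 have "\<exists>N. \<forall>k\<ge>N. \<forall>l\<ge>N. l2n lborel (\<lambda>x. f k x - f l x) < e" if "e > 0" for e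
  using metric_CauchyD[OF X that] by (simp add: f dist_abs_l2)
 from l2_complete[OF f(2) this] obtain g where g: "sq_int lborel g" "(\<lambda>k. l2n lborel (\<lambda>x. f k x - g x)) \<longlonglongrightarrow> 0" by blast
 have "(\<lambda>n. dist (X n) (abs_l2 g)) \<longlonglongrightarrow> 0" using g by (simp add: f dist_abs_l2)
 then have "X \<longlonglongrightarrow> abs_l2 g" using tendsto_dist_iff by blast
 then show "convergent X" by (auto simp: convergent_def)
qed

section \<open>Two tools: symmetry of second derivatives, separability of test functions\<close>

lemma line_derivative:
 fixes f :: "'a::euclidean_space => real"
 assumes s: "smooth f"
 shows "((\<lambda>t. f (x + t *\<^sub>R b)) has_real_derivative pderiv_dir b f (x + t *\<^sub>R b)) (at t)"
proof -
 have sm: "smooth (\<lambda>t. f (t *\<^sub>R b + x))"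
  by (intro smooth_comp_affine[where L="\<lambda>t. t *\<^sub>R b"] bounded_linear_intros s)
 have D: "((\<lambda>t. f (t *\<^sub>R b + x)) has_derivative (\<lambda>h. pderiv_dir (h *\<^sub>R b) f (t *\<^sub>R b + x))) (at t)"
  by (rule has_derivative_comp_affine[where L="\<lambda>t. t *\<^sub>R b"])
    (auto intro: bounded_linear_intros smooth_differentiable[OF s])
 have "pderiv_dir 1 (\<lambda>t. f (t *\<^sub>R b + x)) t = pderiv_dir b f (t *\<^sub>R b + x)"
  using pderiv_dir_eq[OF D, of 1] by simp
 then show ?thesis using smooth_has_real_derivative[OF sm, of t] by (simp add: add.commute)
qed

text \<open>The mean value theorem, applied once in each direction.\<close>

lemma second_difference:
 fixes f :: "'a::euclidean_space => real"
 assumes s: "smooth f" and b: "b \<in> Basis" and h: "0 < h"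
 obtains p where "f (x + h *\<^sub>R b + h *\<^sub>R c) - f (x + h *\<^sub>R b) - f (x + h *\<^sub>R c) + f x = h * h * pderiv_dir c (pderiv_dir b f) p"
  "dist p x <= h * (norm b + norm c)"
proof -
 let ?F = "\<lambda>t. f (x + h *\<^sub>R c + t *\<^sub>R b) - f (x + t *\<^sub>R b)"
 let ?F' = "\<lambda>t. pderiv_dir b f (x + h *\<^sub>R c + t *\<^sub>R b) - pderiv_dir b f (x + t *\<^sub>R b)"
 have "(?F has_real_derivative ?F' t) (at t)" for t by (intro DERIV_diff line_derivative s)
 then obtain s1 where s1: "0 < s1" "s1 < h" "?F h - ?F 0 = (h - 0) * ?F' s1"
  using MVT2[OF h, of ?F ?F'] by blast
 let ?H = "\<lambda>r. pderiv_dir b f (x + s1 *\<^sub>R b + r *\<^sub>R c)"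
 have "(?H has_real_derivative pderiv_dir c (pderiv_dir b f) (x + s1 *\<^sub>R b + r *\<^sub>R c)) (at r)" for r
  by (intro line_derivative smooth_pderiv s b)
 then obtain r1 where r1: "0 < r1" "r1 < h"
  "?H h - ?H 0 = (h - 0) * pderiv_dir c (pderiv_dir b f) (x + s1 *\<^sub>R b + r1 *\<^sub>R c)"
  using MVT2[OF h, of ?H "\<lambda>r. pderiv_dir c (pderiv_dir b f) (x + s1 *\<^sub>R b + r *\<^sub>R c)"] by blast
 have e: "?F' s1 = ?H h - ?H 0" by (simp add: algebra_simps)
 show ?thesis
 proof
  show "f (x + h *\<^sub>R b + h *\<^sub>R c) - f (x + h *\<^sub>R b) - f (x + h *\<^sub>R c) + f x
    = h * h * pderiv_dir c (pderiv_dir b f) (x + s1 *\<^sub>R b + r1 *\<^sub>R c)"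
   using s1(3) unfolding e r1(3) by (simp add: algebra_simps)
  have "dist (x + s1 *\<^sub>R b + r1 *\<^sub>R c) x <= norm (s1 *\<^sub>R b) + norm (r1 *\<^sub>R c)"
   using norm_triangle_ineq[of "s1 *\<^sub>R b" "r1 *\<^sub>R c"] by (simp add: dist_norm algebra_simps)
  also have "\<dots> <= h * norm b + h * norm c" using s1 r1 by (auto intro!: add_mono mult_right_mono)
  finally show "dist (x + s1 *\<^sub>R b + r1 *\<^sub>R c) x <= h * (norm b + norm c)" by (simp add: distrib_left)
 qed
qed

text \<open>The second difference is symmetric in the two directions, and divided by
 \<open>h\<^sup>2\<close> it converges to either mixed derivative.\<close>

lemma pderiv_dir_commute:
 fixes f :: "'a::euclidean_space => real"
 assumes s: "smooth f" and b: "b \<in> Basis" and c: "c \<in> Basis"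
 shows "pderiv_dir c (pderiv_dir b f) x = pderiv_dir b (pderiv_dir c f) x"
proof -
 define h where "h n = inverse (real (Suc n))" for n
 have h: "h n > 0" for n by (simp add: h_def)
 have "\<exists>p q. pderiv_dir c (pderiv_dir b f) p = pderiv_dir b (pderiv_dir c f) q & dist p x <= h n * 2 & dist q x <= h n * 2" for n
 proof -
  obtain p where p: "f (x + h n *\<^sub>R b + h n *\<^sub>R c) - f (x + h n *\<^sub>R b) - f (x + h n *\<^sub>R c) + f x = h n * h n * pderiv_dir c (pderiv_dir b f) p"
   "dist p x <= h n * (norm b + norm c)" using second_difference[OF s b h] by blast
  obtain q where q: "f (x + h n *\<^sub>R c + h n *\<^sub>R b) - f (x + h n *\<^sub>R c) - f (x + h n *\<^sub>R b) + f x = h n * h n * pderiv_dir b (pderiv_dir c f) q"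
   "dist q x <= h n * (norm c + norm b)" using second_difference[OF s c h] by blast
  have "x + h n *\<^sub>R c + h n *\<^sub>R b = x + h n *\<^sub>R b + h n *\<^sub>R c" by (simp add: algebra_simps)
  then have "f (x + h n *\<^sub>R c + h n *\<^sub>R b) = f (x + h n *\<^sub>R b + h n *\<^sub>R c)"
   by (rule arg_cong[where f=f])
  then have "h n * h n * pderiv_dir c (pderiv_dir b f) p = h n * h n * pderiv_dir b (pderiv_dir c f) q"
   using p(1) q(1) by linarith
  then have "pderiv_dir c (pderiv_dir b f) p = pderiv_dir b (pderiv_dir c f) q" using h[of n] by simp
  then show ?thesis using p(2) q(2) b c by auto
 qed
 then obtain p q where pq: "!!n. pderiv_dir c (pderiv_dir b f) (p n) = pderiv_dir b (pderiv_dir c f) (q n)"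
  "!!n. dist (p n) x <= h n * 2" "!!n. dist (q n) x <= h n * 2" by metis
 have h0: "(\<lambda>n. h n * 2) \<longlonglongrightarrow> 0" unfolding h_def using tendsto_mult_left_zero[OF LIMSEQ_inverse_real_of_nat] .
 have "(\<lambda>n. dist (p n) x) \<longlonglongrightarrow> 0" "(\<lambda>n. dist (q n) x) \<longlonglongrightarrow> 0"
  by (rule squeeze_0[OF h0 pq(2)], simp, rule squeeze_0[OF h0 pq(3)], simp)
 then have l: "p \<longlonglongrightarrow> x" "q \<longlonglongrightarrow> x" by (simp_all only: tendsto_dist_iff[symmetric])
 have cont: "isCont (pderiv_dir c (pderiv_dir b f)) x" "isCont (pderiv_dir b (pderiv_dir c f)) x"
  using smooth_continuous[OF smooth_pderiv[OF smooth_pderiv[OF s b] c]] smooth_continuous[OF smooth_pderiv[OF smooth_pderiv[OF s c] b]]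
  by (simp_all add: continuous_on_eq_continuous_at)
 have "(\<lambda>n. pderiv_dir c (pderiv_dir b f) (p n)) \<longlonglongrightarrow> pderiv_dir c (pderiv_dir b f) x"
  by (rule isCont_tendsto_compose[OF cont(1) l(1)])
 moreover have "(\<lambda>n. pderiv_dir c (pderiv_dir b f) (p n)) \<longlonglongrightarrow> pderiv_dir b (pderiv_dir c f) x"
  unfolding pq(1) by (rule isCont_tendsto_compose[OF cont(2) l(2)])
 ultimately show ?thesis by (rule LIMSEQ_unique)
qed

text \<open>Up to a given error, a continuous function on a compact set is determined by finitely many of
 its values, rounded to a countable dense set.\<close>

lemma separable_sup_norm:
 fixes F :: "('a::euclidean_space => 'b::euclidean_space) set" and S :: "'a set"
 assumes S: "compact S" and cont: "!!f. f \<in> F ==> continuous_on S f"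
 obtains C where "countable C" "C \<subseteq> F" "!!f e. f \<in> F ==> 0 < e ==> \<exists>g\<in>C. \<forall>x\<in>S. norm (f x - g x) < e"
proof -
 obtain D :: "'a set" where D: "countable D" "D \<subseteq> S" "S \<subseteq> closure D" using separable[of S] by blast
 obtain E :: "'b set" where E: "countable E" "!!U. open U ==> U \<noteq> {} ==> \<exists>d\<in>E. d \<in> U"
  using countable_dense_exists[where 'a='b] by blast
 define Q where "Q m n l f \<longleftrightarrow> f \<in> F & (\<forall>(d, y)\<in>set l. \<forall>x\<in>S. dist d x < inverse (real (Suc n)) --> norm (f x - y) < inverse (real (Suc m)))"
  for m n :: nat and l :: "('a \<times> 'b) list" and f
 define cover where "cover n l \<longleftrightarrow> (\<forall>x\<in>S. \<exists>(d, y)\<in>set l. dist d x < inverse (real (Suc n)))" for n :: nat and l :: "('a \<times> 'b) list"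
 define code where "code = {(m, n, l). l \<in> lists (D \<times> E) & cover n l & (\<exists>f. Q m n l f)}"
 define pick where "pick z = (case z of (m, n, l) => SOME f. Q m n l f)" for z :: "nat \<times> nat \<times> ('a \<times> 'b) list"
 have pick: "Q m n l (pick (m, n, l))" if "Q m n l f" for m n l f
  unfolding pick_def using someI[of "Q m n l" f] that by simp
 have "countable (UNIV \<times> (UNIV \<times> lists (D \<times> E)) :: (nat \<times> nat \<times> ('a \<times> 'b) list) set)"
  by (intro countable_SIGMA countable_lists D(1) E(1)) auto
 moreover have "code \<subseteq> UNIV \<times> (UNIV \<times> lists (D \<times> E))" unfolding code_def by auto
 ultimately have "countable code" by (rule countable_subset[rotated])
 then have 1: "countable (pick ` code)" by (rule countable_image)
 have 2: "pick ` code \<subseteq> F"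
 proof
  fix g assume "g \<in> pick ` code"
  then obtain m n l f where "g = pick (m, n, l)" "Q m n l f" unfolding code_def by auto
  then show "g \<in> F" using pick unfolding Q_def by blast
 qed
 have 3: "\<exists>g\<in>pick ` code. \<forall>x\<in>S. norm (f x - g x) < e" if f: "f \<in> F" and e: "0 < e" for f e
 proof -
  obtain m where m: "inverse (real (Suc m)) < e / 2" using reals_Archimedean[of "e/2"] e by auto
  define \<epsilon> where "\<epsilon> = inverse (real (Suc m))"
  have \<epsilon>: "\<epsilon> > 0" by (simp add: \<epsilon>_def)
  have "uniformly_continuous_on S f" by (rule compact_uniformly_continuous[OF cont[OF f] S])
  then obtain d where d: "d > 0" "!!x y. x \<in> S ==> y \<in> S ==> dist y x < d ==> dist (f y) (f x) < \<epsilon> / 2"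
   unfolding uniformly_continuous_on_def using half_gt_zero[OF \<epsilon>] by metis
  obtain n where n: "inverse (real (Suc n)) < d" using reals_Archimedean[OF d(1)] by auto
  define \<delta> where "\<delta> = inverse (real (Suc n))"
  have \<delta>: "\<delta> > 0" "\<delta> < d" using n by (auto simp: \<delta>_def)
  have "S \<subseteq> (\<Union>c\<in>D. ball c \<delta>)"
  proof
   fix x assume "x \<in> S"
   then have "x \<in> closure D" using D(3) by blast
   then obtain c where "c \<in> D" "dist c x < \<delta>" using \<delta>(1) unfolding closure_approachable by blast
   then show "x \<in> (\<Union>c\<in>D. ball c \<delta>)" by auto
  qed
  then obtain D' where D': "D' \<subseteq> D" "finite D'" "S \<subseteq> (\<Union>c\<in>D'. ball c \<delta>)"
   by (rule compactE_image[OF S, rotated]) auto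
  have "\<exists>y\<in>E. norm (f c - y) < \<epsilon> / 2" for c
   using E(2)[of "ball (f c) (\<epsilon>/2)"] \<epsilon> by (auto simp: dist_norm)
  then obtain Y where Y: "!!c. Y c \<in> E" "!!c. norm (f c - Y c) < \<epsilon> / 2" by metis
  obtain cs where cs: "set cs = D'" using finite_list[OF D'(2)] by blast
  define l where "l = map (\<lambda>c. (c, Y c)) cs"
  have lE: "l \<in> lists (D \<times> E)" using cs D'(1) Y(1) by (auto simp: l_def)
  have cov: "cover n l"
   unfolding cover_def
  proof
   fix x assume "x \<in> S"
   then obtain c where "c \<in> D'" "dist c x < \<delta>" using D'(3) by fastforce
   then show "\<exists>(d, y)\<in>set l. dist d x < inverse (real (Suc n))"
    unfolding l_def \<delta>_def[symmetric] using cs by force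
  qed
  have Qf: "Q m n l f"
   unfolding Q_def
  proof (intro conjI f ballI, clarify)
   fix c y x assume cy: "(c, y) \<in> set l" and x: "x \<in> S" and "dist c x < inverse (real (Suc n))"
   then have "dist c x < d" using n by linarith
   moreover have "c \<in> S" using cy cs D'(1) D(2) by (auto simp: l_def)
   ultimately have "norm (f x - f c) < \<epsilon> / 2" using d(2)[OF x] by (simp add: dist_norm norm_minus_commute)
   moreover have "y = Y c" using cy by (auto simp: l_def)
   ultimately have "norm ((f x - f c) + (f c - y)) < \<epsilon> / 2 + \<epsilon> / 2"
    using Y(2)[of c] by (intro norm_triangle_lt) simp
   then show "norm (f x - y) < inverse (real (Suc m))" by (simp add: \<epsilon>_def)
  qed
  have g: "Q m n l (pick (m, n, l))" by (rule pick[OF Qf])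
  have "(m, n, l) \<in> code" unfolding code_def using lE cov Qf by auto
  moreover have "norm (f x - pick (m, n, l) x) < e" if x: "x \<in> S" for x
  proof -
   obtain c y where cy: "(c, y) \<in> set l" "dist c x < inverse (real (Suc n))" using cov x unfolding cover_def by blast
   have a: "norm (f x - y) < \<epsilon>" "norm (pick (m, n, l) x - y) < \<epsilon>"
    using Qf g cy x unfolding Q_def \<epsilon>_def by blast+
   have "f x - pick (m, n, l) x = (f x - y) + (y - pick (m, n, l) x)" by simp
   also have "norm \<dots> <= norm (f x - y) + norm (y - pick (m, n, l) x)" by (rule norm_triangle_ineq)
   finally show ?thesis using a m by (simp add: norm_minus_commute \<epsilon>_def)
  qed
  ultimately show ?thesis by blast
 qed
 show ?thesis by (rule that[OF 1 2 3])
qed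

lemma L2_norm_le_sup:
 fixes h :: "'a::euclidean_space => real"
 assumes \<Omega>: "open \<Omega>" "bounded \<Omega>" and h: "h \<in> borel_measurable borel" and c: "0 <= c" "!!x. x \<in> \<Omega> ==> \<bar>h x\<bar> <= c"
 shows "L2_norm \<Omega> h <= c * sqrt (measure lebesgue \<Omega>)"
proof -
 have lm: "\<Omega> \<in> lmeasurable" using \<Omega> by (rule lmeasurable_open[rotated])
 interpret finite_measure "lebesgue_on \<Omega>" by (rule finite_measure_lebesgue_on[OF lm])
 have "l2n (lebesgue_on \<Omega>) h <= l2n (lebesgue_on \<Omega>) (\<lambda>x. c)"
  by (rule l2n_mono[OF sq_int_const borel_on[OF h] AE_I2]) (use c in auto)
 also have "\<dots> = c * sqrt (measure lebesgue \<Omega>)"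
  using c(1) lm by (simp add: l2n_def measure_restrict_space real_sqrt_mult fmeasurableD mult.commute)
 finally show ?thesis by (simp add: L2_norm_eq)
qed

lemma grad_continuous:
 fixes \<xi> :: "'a::euclidean_space => real"
 shows "smooth \<xi> ==> continuous_on UNIV (grad \<xi>)"
 unfolding grad_def[abs_def] by (intro continuous_on_sum continuous_on_scaleR continuous_on_const smooth_continuous smooth_pderiv)

text \<open>Pairs of a test function and its gradient are separable in the supremum norm, which dominates
 the \<open>H\<^sup>1\<close> norm because \<open>\<Omega>\<close> is bounded; test functions are dense in
 \<open>H\<^sup>1\<^sub>0\<close>.\<close>

lemma H10_separable:
 fixes \<Omega> :: "'a::euclidean_space set"
 assumes \<Omega>: "open \<Omega>" "bounded \<Omega>"
 obtains C where "countable C" "C \<subseteq> test_functions \<Omega>"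
  "!!\<xi>. \<xi> \<in> H10 \<Omega> ==> \<exists>\<phi> :: nat => 'a => real. (\<forall>k. \<phi> k \<in> C) & (\<lambda>k. L2_norm \<Omega> (\<lambda>x. \<phi> k x - \<xi> x)) \<longlonglongrightarrow> 0 \<and>
    (\<forall>b\<in>Basis. (\<lambda>k. L2_norm \<Omega> (\<lambda>x. pderiv_dir b (\<phi> k) x - weak_gradient \<Omega> \<xi> x \<bullet> b)) \<longlonglongrightarrow> 0)"
proof -
 define J where "J \<xi> x = (\<xi> x, grad \<xi> x)" for \<xi> :: "'a => real" and x
 have cl: "compact (closure \<Omega>)" using \<Omega>(2) by (simp add: compact_closure)
 have "continuous_on (closure \<Omega>) f" if f: "f \<in> J ` test_functions \<Omega>" for f
 proof -
  obtain \<xi> where \<xi>: "f = J \<xi>" "\<xi> \<in> test_functions \<Omega>" using f by blast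
  have "continuous_on UNIV (\<lambda>x. (\<xi> x, grad \<xi> x))"
   by (intro continuous_on_Pair smooth_continuous grad_continuous test_smooth[OF \<xi>(2)])
  then show ?thesis unfolding \<xi>(1) J_def[abs_def] by (rule continuous_on_subset) simp
 qed
 from separable_sup_norm[OF cl this] obtain C0 where C0: "countable C0" "C0 \<subseteq> J ` test_functions \<Omega>"
  "!!f e. f \<in> J ` test_functions \<Omega> ==> 0 < e ==> \<exists>g\<in>C0. \<forall>x\<in>closure \<Omega>. norm (f x - g x) < e" by metis
 define C where "C = (\<lambda>f x. fst (f x)) ` C0"
 have CJ: "\<xi> \<in> C \<longleftrightarrow> J \<xi> \<in> C0" for \<xi>
 proof
  assume "\<xi> \<in> C"
  then obtain f where f: "f \<in> C0" "\<xi> = (\<lambda>x. fst (f x))" unfolding C_def by blast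
  then obtain \<xi>' where "f = J \<xi>'" using C0(2) by blast
  then have "\<xi> = \<xi>'" using f(2) by (simp add: J_def)
  then show "J \<xi> \<in> C0" using \<open>f = J \<xi>'\<close> f(1) by simp
 next
  assume "J \<xi> \<in> C0"
  moreover have "\<xi> = (\<lambda>x. fst (J \<xi> x))" by (simp add: J_def)
  ultimately show "\<xi> \<in> C" unfolding C_def by blast
 qed
 have Ct: "C \<subseteq> test_functions \<Omega>"
 proof
  fix \<xi> assume "\<xi> \<in> C"
  then obtain \<xi>' where \<xi>': "J \<xi> = J \<xi>'" "\<xi>' \<in> test_functions \<Omega>" using CJ C0(2) by blast
  have "\<xi> x = \<xi>' x" for x using fun_cong[OF \<xi>'(1), of x] by (simp add: J_def)
  then have "\<xi> = \<xi>'" by blast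
  then show "\<xi> \<in> test_functions \<Omega>" using \<xi>'(2) by simp
 qed
 define M where "M = sqrt (measure lebesgue \<Omega>)"
 have M: "0 <= M" by (simp add: M_def)
 have approx: "\<exists>\<phi>\<in>C. L2_norm \<Omega> (\<lambda>x. \<phi> x - \<xi> x) <= e * M & (\<forall>b\<in>Basis. L2_norm \<Omega> (\<lambda>x. pderiv_dir b \<phi> x - pderiv_dir b \<xi> x) <= e * M)"
  if \<xi>: "\<xi> \<in> test_functions \<Omega>" and e: "0 < e" for \<xi> e
 proof -
  obtain g where g: "g \<in> C0" "!!x. x \<in> closure \<Omega> ==> norm (J \<xi> x - g x) < e"
   using C0(3)[of "J \<xi>" e] \<xi> e by blast
  obtain \<phi> where \<phi>: "g = J \<phi>" "\<phi> \<in> test_functions \<Omega>" using g(1) C0(2) by blast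
  have \<phi>C: "\<phi> \<in> C" using g(1) \<phi>(1) CJ by simp
  have close: "\<bar>\<phi> x - \<xi> x\<bar> <= e" "b \<in> Basis ==> \<bar>pderiv_dir b \<phi> x - pderiv_dir b \<xi> x\<bar> <= e" if x: "x \<in> \<Omega>" for x b
  proof -
   have n: "norm (\<xi> x - \<phi> x, grad \<xi> x - grad \<phi> x) < e"
    using g(2)[of x] x closure_subset by (auto simp: \<phi>(1) J_def)
   have "norm (\<xi> x - \<phi> x) <= norm (\<xi> x - \<phi> x, grad \<xi> x - grad \<phi> x)"
    using norm_fst_le[of "(\<xi> x - \<phi> x)" "grad \<xi> x - grad \<phi> x"] by simp
   then show "\<bar>\<phi> x - \<xi> x\<bar> <= e" using n by (simp add: abs_minus_commute)
   assume b: "b \<in> Basis"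
   have "\<bar>(grad \<xi> x - grad \<phi> x) \<bullet> b\<bar> <= norm (grad \<xi> x - grad \<phi> x)" by (rule Basis_le_norm[OF b])
   also have "\<dots> <= norm (\<xi> x - \<phi> x, grad \<xi> x - grad \<phi> x)"
    using norm_snd_le[of "grad \<xi> x - grad \<phi> x" "\<xi> x - \<phi> x"] by simp
   finally show "\<bar>pderiv_dir b \<phi> x - pderiv_dir b \<xi> x\<bar> <= e"
    using n by (simp add: inner_diff_left grad_component[OF b] abs_minus_commute)
  qed
  show ?thesis
  proof (intro bexI[OF _ \<phi>C] conjI ballI)
   show "L2_norm \<Omega> (\<lambda>x. \<phi> x - \<xi> x) <= e * M"
    unfolding M_def
    by (rule L2_norm_le_sup[OF \<Omega>]) (use close(1) e test_borel[OF \<phi>(2)] test_borel[OF \<xi>] in auto)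
   fix b :: 'a assume b: "b \<in> Basis"
   show "L2_norm \<Omega> (\<lambda>x. pderiv_dir b \<phi> x - pderiv_dir b \<xi> x) <= e * M"
    unfolding M_def
    by (rule L2_norm_le_sup[OF \<Omega>])
      (use close(2)[OF _ b] e test_borel[OF test_pderiv[OF \<phi>(2) b]] test_borel[OF test_pderiv[OF \<xi> b]] in auto)
  qed
 qed
 have "\<exists>\<phi> :: nat => 'a => real. (\<forall>k. \<phi> k \<in> C) & (\<lambda>k. L2_norm \<Omega> (\<lambda>x. \<phi> k x - \<xi> x)) \<longlonglongrightarrow> 0 \<and>
    (\<forall>b\<in>Basis. (\<lambda>k. L2_norm \<Omega> (\<lambda>x. pderiv_dir b (\<phi> k) x - weak_gradient \<Omega> \<xi> x \<bullet> b)) \<longlonglongrightarrow> 0)"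
  if \<xi>: "\<xi> \<in> H10 \<Omega>" for \<xi>
 proof -
  obtain \<psi> where \<psi>: "!!k::nat. \<psi> k \<in> test_functions \<Omega>"
   "(\<lambda>k. L2_norm \<Omega> (\<lambda>x. \<psi> k x - \<xi> x)) \<longlonglongrightarrow> 0"
   "!!b. b \<in> Basis ==> (\<lambda>k. L2_norm \<Omega> (\<lambda>x. pderiv_dir b (\<psi> k) x - weak_gradient \<Omega> \<xi> x \<bullet> b)) \<longlonglongrightarrow> 0"
   using H10_approx[OF \<Omega>(1) \<xi>] by blast
  define e where "e k = inverse (real (Suc k))" for k
  have e: "e k > 0" for k by (simp add: e_def)
  have eM: "(\<lambda>k. e k * M) \<longlonglongrightarrow> 0" unfolding e_def using tendsto_mult_left_zero[OF LIMSEQ_inverse_real_of_nat] .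
  have "\<exists>\<phi>. \<phi> \<in> C & L2_norm \<Omega> (\<lambda>x. \<phi> x - \<psi> k x) <= e k * M & (\<forall>b\<in>Basis. L2_norm \<Omega> (\<lambda>x. pderiv_dir b \<phi> x - pderiv_dir b (\<psi> k) x) <= e k * M)" for k
   using approx[OF \<psi>(1) e] by blast
  then obtain \<phi> where \<phi>: "!!k. \<phi> k \<in> C" "!!k. L2_norm \<Omega> (\<lambda>x. \<phi> k x - \<psi> k x) <= e k * M"
   "!!k b. b \<in> Basis ==> L2_norm \<Omega> (\<lambda>x. pderiv_dir b (\<phi> k) x - pderiv_dir b (\<psi> k) x) <= e k * M" by metis
  have \<phi>t: "\<phi> k \<in> test_functions \<Omega>" for k using \<phi>(1) Ct by blast
  have L: "sq_int (lebesgue_on \<Omega>) f" if "f \<in> L2 \<Omega>" for f using that by (simp add: L2_iff)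
  show ?thesis
  proof (intro exI[of _ \<phi>] conjI allI \<phi>(1) ballI)
   show "(\<lambda>k. L2_norm \<Omega> (\<lambda>x. \<phi> k x - \<xi> x)) \<longlonglongrightarrow> 0"
   proof (rule squeeze_0_add[OF eM \<psi>(2)])
    fix k
    have "L2_norm \<Omega> (\<lambda>x. \<phi> k x - \<xi> x) <= L2_norm \<Omega> (\<lambda>x. \<phi> k x - \<psi> k x) + L2_norm \<Omega> (\<lambda>x. \<psi> k x - \<xi> x)"
     unfolding L2_norm_eq by (intro l2n_triangle_diff L test_L2[OF \<phi>t \<Omega>(1)] test_L2[OF \<psi>(1) \<Omega>(1)] H10_L2[OF \<xi>])
    then show "L2_norm \<Omega> (\<lambda>x. \<phi> k x - \<xi> x) <= e k * M + L2_norm \<Omega> (\<lambda>x. \<psi> k x - \<xi> x)" using \<phi>(2)[of k] by linarith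
   qed simp
   fix b :: 'a assume b: "b \<in> Basis"
   show "(\<lambda>k. L2_norm \<Omega> (\<lambda>x. pderiv_dir b (\<phi> k) x - weak_gradient \<Omega> \<xi> x \<bullet> b)) \<longlonglongrightarrow> 0"
   proof (rule squeeze_0_add[OF eM \<psi>(3)[OF b]])
    fix k
    have "L2_norm \<Omega> (\<lambda>x. pderiv_dir b (\<phi> k) x - weak_gradient \<Omega> \<xi> x \<bullet> b)
      <= L2_norm \<Omega> (\<lambda>x. pderiv_dir b (\<phi> k) x - pderiv_dir b (\<psi> k) x) + L2_norm \<Omega> (\<lambda>x. pderiv_dir b (\<psi> k) x - weak_gradient \<Omega> \<xi> x \<bullet> b)"
     unfolding L2_norm_eq
     by (rule l2n_triangle_diff[OF L[OF test_L2[OF test_pderiv[OF \<phi>t b] \<Omega>(1)]] L[OF test_L2[OF test_pderiv[OF \<psi>(1) b] \<Omega>(1)]]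
       L[OF gradient_L2[OF H10_gradient[OF \<xi>] b]]])
    then show "L2_norm \<Omega> (\<lambda>x. pderiv_dir b (\<phi> k) x - weak_gradient \<Omega> \<xi> x \<bullet> b)
      <= e k * M + L2_norm \<Omega> (\<lambda>x. pderiv_dir b (\<psi> k) x - weak_gradient \<Omega> \<xi> x \<bullet> b)" using \<phi>(3)[OF b, of k] by linarith
   qed simp
  qed
 qed
 moreover have "countable C" unfolding C_def using C0(1) by (rule countable_image)
 ultimately show ?thesis using that Ct by blast
qed

section \<open>The variational problem\<close>

text \<open>A displacement \<open>v\<close> with its velocity, acceleration, gradient, and the time
 derivative of the gradient. The initial condition \<open>v = 0\<close> survives the passage to the limit;
 velocity zero at time \<open>T\<close> makes the boundary term of the weighted energy at \<open>T\<close>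
 nonnegative.\<close>

definition ansatz :: "'a::euclidean_space set => real => ('a \<times> real => real) => ('a \<times> real => real) => ('a \<times> real => real)
  => ('a \<times> real => 'a) => ('a \<times> real => 'a) => bool" where
 "ansatz \<Omega> T v vt vtt g gt \<longleftrightarrow>
   continuous_on UNIV v & continuous_on UNIV vt & continuous_on UNIV vtt & continuous_on UNIV g & continuous_on UNIV gt \<and>
   (\<exists>K. compact K & K \<subseteq> \<Omega> & (\<forall>x t. x \<notin> K --> v (x, t) = 0 & vt (x, t) = 0 & vtt (x, t) = 0 & g (x, t) = 0 & gt (x, t) = 0)) \<and>
   (\<forall>x t. ((\<lambda>t. v (x, t)) has_vector_derivative vt (x, t)) (at t) & ((\<lambda>t. vt (x, t)) has_vector_derivative vtt (x, t)) (at t) \<and>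
    ((\<lambda>t. g (x, t)) has_vector_derivative gt (x, t)) (at t)) \<and>
   (\<forall>x. v (x, 0) = 0 & g (x, 0) = 0 & vt (x, T) = 0) \<and>
   (\<forall>t. (\<lambda>x. v (x, t)) \<in> test_functions \<Omega> & (\<forall>b\<in>Basis. \<forall>x. pderiv_dir b (\<lambda>x. v (x, t)) x = g (x, t) \<bullet> b))"

lemma ansatz_add:
 assumes "ansatz \<Omega> T v vt vtt g gt" "ansatz \<Omega> T v' vt' vtt' g' gt'"
 shows "ansatz \<Omega> T (\<lambda>z. v z + v' z) (\<lambda>z. vt z + vt' z) (\<lambda>z. vtt z + vtt' z) (\<lambda>z. g z + g' z) (\<lambda>z. gt z + gt' z)"
proof -
 obtain K where K: "compact K" "K \<subseteq> \<Omega>" "!!x t. x \<notin> K ==> v (x, t) = 0 & vt (x, t) = 0 & vtt (x, t) = 0 & g (x, t) = 0 & gt (x, t) = 0"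
  using assms(1) unfolding ansatz_def by blast
 obtain L where L: "compact L" "L \<subseteq> \<Omega>" "!!x t. x \<notin> L ==> v' (x, t) = 0 & vt' (x, t) = 0 & vtt' (x, t) = 0 & g' (x, t) = 0 & gt' (x, t) = 0"
  using assms(2) unfolding ansatz_def by blast
 show ?thesis
  unfolding ansatz_def
 proof (intro conjI allI ballI)
  show "\<exists>K. compact K & K \<subseteq> \<Omega> & (\<forall>x t. x \<notin> K --> v (x, t) + v' (x, t) = 0 & vt (x, t) + vt' (x, t) = 0 \<and>
    vtt (x, t) + vtt' (x, t) = 0 & g (x, t) + g' (x, t) = 0 & gt (x, t) + gt' (x, t) = 0)"
   by (rule exI[of _ "K \<union> L"]) (use K L in auto)
  show "(\<lambda>x. v (x, t) + v' (x, t)) \<in> test_functions \<Omega>" for t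
   using assms by (intro test_add) (auto simp: ansatz_def)
  show "pderiv_dir b (\<lambda>x. v (x, t) + v' (x, t)) x = (g (x, t) + g' (x, t)) \<bullet> b" if "b \<in> Basis" for t b x
   using assms that by (subst pderiv_dir_add) (auto simp: ansatz_def inner_add_left intro: test_smooth)
 qed (use assms in "auto simp: ansatz_def intro!: continuous_intros has_vector_derivative_add")
qed

lemma ansatz_scale:
 assumes "ansatz \<Omega> T v vt vtt g gt"
 shows "ansatz \<Omega> T (\<lambda>z. c * v z) (\<lambda>z. c * vt z) (\<lambda>z. c * vtt z) (\<lambda>z. c *\<^sub>R g z) (\<lambda>z. c *\<^sub>R gt z)"
proof -
 obtain K where K: "compact K" "K \<subseteq> \<Omega>" "!!x t. x \<notin> K ==> v (x, t) = 0 & vt (x, t) = 0 & vtt (x, t) = 0 & g (x, t) = 0 & gt (x, t) = 0"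
  using assms(1) unfolding ansatz_def by blast
 show ?thesis
  unfolding ansatz_def
 proof (intro conjI allI ballI)
  show "\<exists>K. compact K & K \<subseteq> \<Omega> & (\<forall>x t. x \<notin> K --> c * v (x, t) = 0 & c * vt (x, t) = 0 \<and>
    c * vtt (x, t) = 0 & c *\<^sub>R g (x, t) = 0 & c *\<^sub>R gt (x, t) = 0)"
   by (rule exI[of _ K]) (use K in auto)
  show "(\<lambda>x. c * v (x, t)) \<in> test_functions \<Omega>" for t
   using assms by (intro test_cmult) (auto simp: ansatz_def)
  show "pderiv_dir b (\<lambda>x. c * v (x, t)) x = (c *\<^sub>R g (x, t)) \<bullet> b" if "b \<in> Basis" for t b x
   using assms that by (subst pderiv_dir_cmult) (auto simp: ansatz_def intro: test_smooth)
  show "((\<lambda>t. c * v (x, t)) has_vector_derivative c * vt (x, t)) (at t)"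
   "((\<lambda>t. c * vt (x, t)) has_vector_derivative c * vtt (x, t)) (at t)"
   "((\<lambda>t. c *\<^sub>R g (x, t)) has_vector_derivative c *\<^sub>R gt (x, t)) (at t)" for x t
   using assms by (auto simp: ansatz_def intro!: has_vector_derivative_mult_right bounded_linear.has_vector_derivative[OF bounded_linear_scaleR_right])
 qed (use assms in "auto simp: ansatz_def intro!: continuous_intros")
qed

lemma restricted_continuous_sq_int:
 fixes F :: "'a::euclidean_space \<times> real => 'b::euclidean_space"
 assumes \<Omega>: "open \<Omega>" and F: "continuous_on UNIV F" and K: "compact K" "K \<subseteq> \<Omega>" "!!x t. x \<notin> K ==> F (x, t) = 0"
 shows "sq_int lborel (\<lambda>z. indicator (cylinder \<Omega> T) z *\<^sub>R F z)"
proof -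
 have c: "compact (K \<times> {0..T})" by (intro compact_Times K) simp
 have "bounded (F ` (K \<times> {0..T}))"
  by (intro compact_imp_bounded compact_continuous_image c continuous_on_subset[OF F]) simp
 then obtain B where B: "!!z. z \<in> K \<times> {0..T} ==> norm (F z) <= B" unfolding bounded_iff by blast
 have fin: "emeasure lborel (K \<times> {0..T}) < \<infinity>" by (rule emeasure_bounded_finite[OF compact_imp_bounded[OF c]])
 have Kb: "K \<times> {0..T} \<in> sets borel" using compact_imp_closed[OF c] by simp
 have m: "F \<in> borel_measurable borel" by (rule borel_measurable_continuous_onI[OF F])
 show ?thesis
 proof (rule sq_int_bound[OF sq_int_scaleR[OF sq_int_indicator[OF Kb fin], of "\<bar>B\<bar>"]])
  show "(\<lambda>z. indicator (cylinder \<Omega> T) z *\<^sub>R F z) \<in> borel_measurable lborel"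
   using m cylinder_borel[OF \<Omega>, of T] by simp
  show "AE z in lborel. norm (indicator (cylinder \<Omega> T) z *\<^sub>R F z) <= norm (\<bar>B\<bar> *\<^sub>R (indicator (K \<times> {0..T}) z :: real))"
  proof (rule AE_I2)
   fix z :: "'a \<times> real"
   obtain x t where z: "z = (x, t)" by (cases z)
   show "norm (indicator (cylinder \<Omega> T) z *\<^sub>R F z) <= norm (\<bar>B\<bar> *\<^sub>R (indicator (K \<times> {0..T}) z :: real))"
    using B[of z] K(3)[of x t] by (cases "x \<in> K"; cases "t \<in> {0<..<T}") (auto simp: z indicator_def)
  qed
 qed
qed

lemma interval_continuous_integrable:
 fixes f :: "real => real"
 assumes f: "continuous_on UNIV f" and ab: "a <= b"
 shows "integrable lborel (\<lambda>t. indicator {a<..<b} t * f t)"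
proof -
 obtain F where F: "!!t. (F has_real_derivative f t) (at t)" using primitive_of_continuous[OF f] by blast
 show ?thesis by (rule integral_FTC_open(2)[OF ab F f])
qed

lemma interval_continuous_sq_int:
 fixes f :: "real => real"
 assumes f: "continuous_on UNIV f"
 shows "sq_int lborel (\<lambda>t. indicator {a<..<b} t * f t)"
proof -
 have "bounded (f ` {a..b})" by (intro compact_imp_bounded compact_continuous_image continuous_on_subset[OF f]) auto
 then obtain B where B: "!!t. t \<in> {a..b} ==> norm (f t) <= B" unfolding bounded_iff by blast
 have m: "f \<in> borel_measurable borel" by (rule borel_measurable_continuous_onI[OF f])
 show ?thesis
 proof (rule sq_int_bound[OF sq_int_cmult[OF sq_int_interval[of a b], of "\<bar>B\<bar>"]])
  show "AE t in lborel. norm (indicator {a<..<b} t * f t) <= norm (\<bar>B\<bar> * indicator {a<..<b} t)"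
  proof (rule AE_I2)
   fix t show "norm (indicator {a<..<b} t * f t) <= norm (\<bar>B\<bar> * indicator {a<..<b} t)"
    using B[of t] by (cases "t \<in> {a<..<b}") auto
  qed
 qed (use m in simp)
qed

text \<open>The multiplier \<open>exp (-t) a\<close>, where \<open>a\<close> is the velocity: the Lagrangian
 energy \<open>(|G|\<^sup>2 - a\<^sup>2) / 2\<close> enters as a boundary term that has a sign by the
 conditions at \<open>0\<close> and \<open>T\<close>, and the derivative of the weight leaves the positive
 energy \<open>(|G|\<^sup>2 + a\<^sup>2) / 2\<close>.\<close>

lemma weighted_energy_1d:
 fixes G G' :: "real => 'a::euclidean_space" and a a' :: "real => real"
 assumes T: "0 < T"
  and G: "!!t. (G has_vector_derivative G' t) (at t)" "continuous_on UNIV G" "continuous_on UNIV G'" "G 0 = 0"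
  and a: "!!t. (a has_vector_derivative a' t) (at t)" "continuous_on UNIV a" "continuous_on UNIV a'" "a T = 0"
 shows "exp (- T) / 2 * (LBINT t. indicator {0<..<T} t * ((norm (G t))\<^sup>2 + (a t)\<^sup>2))
   <= (LBINT t. indicator {0<..<T} t * (exp (- t) * (G t \<bullet> G' t) - a t * (exp (- t) * (a' t - a t))))"
proof -
 \<comment> \<open>The integrand is \<open>E' + H\<close>, and \<open>E T - E 0\<close> is a sum of squares.\<close>
 define E where "E t = exp (- t) / 2 * (G t \<bullet> G t - a t * a t)" for t
 define E' where "E' t = - exp (- t) / 2 * (G t \<bullet> G t - a t * a t) + exp (- t) * (G t \<bullet> G' t - a t * a' t)" for t
 define H where "H t = exp (- t) / 2 * ((norm (G t))\<^sup>2 + (a t)\<^sup>2)" for t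
 have dE: "(E has_real_derivative E' t) (at t)" for t
 proof -
  have dG: "((\<lambda>t. G t \<bullet> G t) has_real_derivative (G t \<bullet> G' t + G' t \<bullet> G t)) (at t)"
   unfolding has_real_derivative_iff_has_vector_derivative
   by (rule bounded_bilinear.has_vector_derivative[OF bounded_bilinear_inner G(1) G(1)])
  have da: "(a has_real_derivative a' t) (at t)"
   unfolding has_real_derivative_iff_has_vector_derivative by (rule a(1))
  have de: "((\<lambda>t. exp (- t) / 2) has_real_derivative - exp (- t) / 2) (at t)"
   by (auto intro!: derivative_eq_intros)
  show ?thesis
   unfolding E_def[abs_def] E'_def
   by (rule DERIV_cong[OF DERIV_mult[OF de DERIV_diff[OF dG DERIV_mult[OF da da]]]])
     (simp add: inner_commute[of "G' t"] field_simps)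
 qed
 have cE: "continuous_on UNIV E'" unfolding E'_def[abs_def] by (intro continuous_intros G a) simp_all
 have cH: "continuous_on UNIV H" unfolding H_def[abs_def] by (intro continuous_intros G a) simp_all
 have cN: "continuous_on UNIV (\<lambda>t. (norm (G t))\<^sup>2 + (a t)\<^sup>2)" by (intro continuous_intros G a)
 have T0: "0 <= T" using T by simp
 note iE = interval_continuous_integrable[OF cE T0] and iH = interval_continuous_integrable[OF cH T0]
  and iN = interval_continuous_integrable[OF cN T0]
 have split: "exp (- t) * (G t \<bullet> G' t) - a t * (exp (- t) * (a' t - a t)) = E' t + H t" for t
  unfolding E'_def H_def power2_norm_eq_inner by (simp add: power2_eq_square field_simps)
 have "exp (- T) / 2 * (LBINT t. indicator {0<..<T} t * ((norm (G t))\<^sup>2 + (a t)\<^sup>2))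
   = (LBINT t. exp (- T) / 2 * (indicator {0<..<T} t * ((norm (G t))\<^sup>2 + (a t)\<^sup>2)))" by simp
 also have "\<dots> <= (LBINT t. indicator {0<..<T} t * H t)"
 proof (rule integral_mono)
  show "integrable lborel (\<lambda>t. exp (- T) / 2 * (indicator {0<..<T} t * ((norm (G t))\<^sup>2 + (a t)\<^sup>2)))"
   using iN by (rule integrable_mult_right)
  show "exp (- T) / 2 * (indicator {0<..<T} t * ((norm (G t))\<^sup>2 + (a t)\<^sup>2)) <= indicator {0<..<T} t * H t" for t
  proof (cases "t \<in> {0<..<T}")
   case True
   then have "exp (- T) / 2 <= exp (- t) / 2" by simp
   then show ?thesis using True unfolding H_def by (simp add: mult_right_mono)
  qed simp
 qed (rule iH)
 also have "\<dots> <= (LBINT t. indicator {0<..<T} t * E' t) + (LBINT t. indicator {0<..<T} t * H t)"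
 proof -
  have "(LBINT t. indicator {0<..<T} t * E' t) = E T - E 0"
   by (rule integral_FTC_open(1)[OF T0 dE cE])
  also have "\<dots> \<ge> 0" by (simp add: E_def G a)
  finally show ?thesis by simp
 qed
 also have "\<dots> = (LBINT t. indicator {0<..<T} t * E' t + indicator {0<..<T} t * H t)"
  by (rule Bochner_Integration.integral_add[OF iE iH, symmetric])
 also have "\<dots> = (LBINT t. indicator {0<..<T} t * (exp (- t) * (G t \<bullet> G' t) - a t * (exp (- t) * (a' t - a t))))"
  unfolding split by (simp add: distrib_left)
 finally show ?thesis .
qed

text \<open>The inner product of \<open>trial\<close>, which is \<open>(\<nabla>u,
 \<partial>\<^sub>tu)\<close>, with \<open>weighted_test\<close> is \<open>\<nabla>u \<bullet>
 \<nabla>\<phi> - \<partial>\<^sub>tu \<partial>\<^sub>t\<phi>\<close> for \<open>\<phi> = exp (-t)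
 \<partial>\<^sub>tv\<close>: the weak form of the wave equation, tested with the weighted velocity.\<close>

definition trial :: "'a::euclidean_space set => real => ('a \<times> real => real) => ('a \<times> real => 'a) => 'a \<times> real => 'a \<times> real" where
 "trial \<Omega> T vt g z = indicator (cylinder \<Omega> T) z *\<^sub>R (g z, vt z)"

definition weighted_test :: "'a::euclidean_space set => real => ('a \<times> real => real) => ('a \<times> real => real) => ('a \<times> real => 'a)
  => 'a \<times> real => 'a \<times> real" where
 "weighted_test \<Omega> T vt vtt gt z =
   indicator (cylinder \<Omega> T) z *\<^sub>R (exp (- snd z) *\<^sub>R gt z, - (exp (- snd z) * (vtt z - vt z)))"

definition weighted_load :: "'a::euclidean_space set => real => ('a \<times> real => real) => 'a \<times> real => real" where
 "weighted_load \<Omega> T vt z = indicator (cylinder \<Omega> T) z *\<^sub>R (exp (- snd z) * vt z)"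

lemma ansatzD:
 assumes "ansatz \<Omega> T v vt vtt g gt"
 shows "continuous_on UNIV v" "continuous_on UNIV vt" "continuous_on UNIV vtt" "continuous_on UNIV g" "continuous_on UNIV gt"
  "!!x t. ((\<lambda>t. v (x, t)) has_vector_derivative vt (x, t)) (at t)"
  "!!x t. ((\<lambda>t. vt (x, t)) has_vector_derivative vtt (x, t)) (at t)"
  "!!x t. ((\<lambda>t. g (x, t)) has_vector_derivative gt (x, t)) (at t)"
  "!!x. v (x, 0) = 0" "!!x. g (x, 0) = 0" "!!x. vt (x, T) = 0"
  "!!t. (\<lambda>x. v (x, t)) \<in> test_functions \<Omega>" "!!b t x. b \<in> Basis ==> pderiv_dir b (\<lambda>x. v (x, t)) x = g (x, t) \<bullet> b"
 using assms unfolding ansatz_def by blast+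

lemma ansatz_support:
 assumes "ansatz \<Omega> T v vt vtt g gt"
 obtains K where "compact K" "K \<subseteq> \<Omega>"
  "!!x t. x \<notin> K ==> v (x, t) = 0 & vt (x, t) = 0 & vtt (x, t) = 0 & g (x, t) = 0 & gt (x, t) = 0"
 using assms unfolding ansatz_def by blast

lemma ansatz_sq_int:
 assumes \<Omega>: "open \<Omega>" and A: "ansatz \<Omega> T v vt vtt g gt"
 shows "sq_int lborel (trial \<Omega> T vt g)" "sq_int lborel (weighted_test \<Omega> T vt vtt gt)" "sq_int lborel (weighted_load \<Omega> T vt)"
proof -
 obtain K where K: "compact K" "K \<subseteq> \<Omega>"
  "!!x t. x \<notin> K ==> v (x, t) = 0 & vt (x, t) = 0 & vtt (x, t) = 0 & g (x, t) = 0 & gt (x, t) = 0"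
  using ansatz_support[OF A] by blast
 note c = ansatzD(2-5)[OF A]
 show "sq_int lborel (trial \<Omega> T vt g)"
  unfolding trial_def[abs_def]
  by (rule restricted_continuous_sq_int[OF \<Omega> _ K(1,2)]) (use K(3) in "auto intro!: continuous_intros c simp: zero_prod_def")
 show "sq_int lborel (weighted_test \<Omega> T vt vtt gt)"
  unfolding weighted_test_def[abs_def]
  by (rule restricted_continuous_sq_int[OF \<Omega> _ K(1,2)]) (use K(3) in "auto intro!: continuous_intros c simp: zero_prod_def")
 show "sq_int lborel (weighted_load \<Omega> T vt)"
  unfolding weighted_load_def[abs_def]
  by (rule restricted_continuous_sq_int[OF \<Omega> _ K(1,2)]) (use K(3) in "auto intro!: continuous_intros c")
qed

lemma ansatz_coercive:
 fixes \<Omega> :: "'a::euclidean_space set"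
 assumes \<Omega>: "open \<Omega>" and T: "0 < T" and A: "ansatz \<Omega> T v vt vtt g gt"
 shows "exp (- T) / 2 * (l2n lborel (trial \<Omega> T vt g))\<^sup>2 <= (LBINT z. trial \<Omega> T vt g z \<bullet> weighted_test \<Omega> T vt vtt gt z)"
proof -
 obtain K where K: "compact K" "K \<subseteq> \<Omega>"
  "!!x t. x \<notin> K ==> v (x, t) = 0 & vt (x, t) = 0 & vtt (x, t) = 0 & g (x, t) = 0 & gt (x, t) = 0"
  using ansatz_support[OF A] by blast
 note c = ansatzD(2-5)[OF A]
 note S = ansatz_sq_int[OF \<Omega> A]
 have sl: "continuous_on UNIV (\<lambda>t. F (x, t))" if "continuous_on UNIV F" for F :: "'a \<times> real => 'c::topological_space" and x
  by (intro continuous_on_compose2[OF that] continuous_intros) auto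
 have e1: "(norm (trial \<Omega> T vt g (x, t)))\<^sup>2 = indicator {0<..<T} t * ((norm (g (x, t)))\<^sup>2 + (vt (x, t))\<^sup>2)" for x t
 proof (cases "x \<in> \<Omega>")
  case False
  then have "x \<notin> K" using K(2) by blast
  with False show ?thesis using K(3)[of x t] by (simp add: trial_def zero_prod_def[symmetric])
 qed (cases "t \<in> {0<..<T}"; auto simp: trial_def norm_Pair zero_prod_def[symmetric])
 have e2: "trial \<Omega> T vt g (x, t) \<bullet> weighted_test \<Omega> T vt vtt gt (x, t)
   = indicator {0<..<T} t * (exp (- t) * (g (x, t) \<bullet> gt (x, t)) - vt (x, t) * (exp (- t) * (vtt (x, t) - vt (x, t))))" for x t
 proof (cases "x \<in> \<Omega>")
  case False
  then have "x \<notin> K" using K(2) by blast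
  with False show ?thesis using K(3)[of x t] by (simp add: trial_def zero_prod_def[symmetric])
 qed (cases "t \<in> {0<..<T}"; auto simp: trial_def weighted_test_def)
 have i1: "integrable lborel (\<lambda>z. (norm (trial \<Omega> T vt g z))\<^sup>2)" by (rule sq_int_integrable[OF S(1)])
 have i2: "integrable lborel (\<lambda>z. trial \<Omega> T vt g z \<bullet> weighted_test \<Omega> T vt vtt gt z)" by (rule sq_int_inner[OF S(1,2)])
 have "exp (- T) / 2 * (l2n lborel (trial \<Omega> T vt g))\<^sup>2
   = (LBINT x. exp (- T) / 2 * (LBINT t. (norm (trial \<Omega> T vt g (x, t)))\<^sup>2))"
  unfolding l2n_power2 Fubini_xt(5)[OF i1, symmetric] by simp
 also have "\<dots> <= (LBINT x. (LBINT t. trial \<Omega> T vt g (x, t) \<bullet> weighted_test \<Omega> T vt vtt gt (x, t)))"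
 proof (rule integral_mono)
  show "integrable lborel (\<lambda>x. exp (- T) / 2 * (LBINT t. (norm (trial \<Omega> T vt g (x, t)))\<^sup>2))"
   by (rule integrable_mult_right) (rule Fubini_xt(3)[OF i1])
  show "integrable lborel (\<lambda>x. (LBINT t. trial \<Omega> T vt g (x, t) \<bullet> weighted_test \<Omega> T vt vtt gt (x, t)))"
   by (rule Fubini_xt(3)[OF i2])
  fix x :: 'a
  show "exp (- T) / 2 * (LBINT t. (norm (trial \<Omega> T vt g (x, t)))\<^sup>2)
    <= (LBINT t. trial \<Omega> T vt g (x, t) \<bullet> weighted_test \<Omega> T vt vtt gt (x, t))"
   unfolding e1 e2
   by (rule weighted_energy_1d[OF T ansatzD(8)[OF A] sl[OF c(3)] sl[OF c(4)] ansatzD(10)[OF A]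
      ansatzD(7)[OF A] sl[OF c(1)] sl[OF c(2)] ansatzD(11)[OF A]])
 qed
 also have "\<dots> = (LBINT z. trial \<Omega> T vt g z \<bullet> weighted_test \<Omega> T vt vtt gt z)"
  by (rule Fubini_xt(5)[OF i2])
 finally show ?thesis .
qed

lemma weighted_load_bound:
 fixes \<Omega> :: "'a::euclidean_space set"
 assumes \<Omega>: "open \<Omega>" and A: "ansatz \<Omega> T v vt vtt g gt" and f: "sq_int lborel f"
 shows "\<bar>(LBINT z. f z * weighted_load \<Omega> T vt z)\<bar> <= l2n lborel f * l2n lborel (trial \<Omega> T vt g)"
proof -
 note S = ansatz_sq_int[OF \<Omega> A]
 have "\<bar>(LBINT z. f z \<bullet> weighted_load \<Omega> T vt z)\<bar> <= l2n lborel f * l2n lborel (weighted_load \<Omega> T vt)"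
  by (rule l2_Cauchy_Schwarz[OF f S(3)])
 also have "l2n lborel (weighted_load \<Omega> T vt) <= l2n lborel (trial \<Omega> T vt g)"
 proof (rule l2n_mono[OF S(1)])
  show "weighted_load \<Omega> T vt \<in> borel_measurable lborel" using S(3) by auto
  show "AE z in lborel. norm (weighted_load \<Omega> T vt z) <= norm (trial \<Omega> T vt g z)"
  proof (rule AE_I2)
   fix z :: "'a \<times> real"
   have "\<bar>exp (- snd z) * vt z\<bar> <= norm (g z, vt z)" if "0 < snd z"
   proof -
    have "\<bar>exp (- snd z) * vt z\<bar> <= 1 * \<bar>vt z\<bar>" unfolding abs_mult using that by (intro mult_right_mono) auto
    also have "\<dots> <= norm (g z, vt z)" using norm_snd_le[of "vt z" "g z"] by simp
    finally show ?thesis .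
   qed
   then show "norm (weighted_load \<Omega> T vt z) <= norm (trial \<Omega> T vt g z)"
    by (cases "z \<in> cylinder \<Omega> T") (auto simp: weighted_load_def trial_def)
  qed
 qed
 finally show ?thesis by (simp add: mult_left_mono)
qed

text \<open>What the theorem of Lions delivers, with \<open>U\<close> in place of \<open>(\<nabla>u,
 \<partial>\<^sub>tu)\<close>: the approximability by ansatz functions carries the boundary and initial
 condition on \<open>u\<close>, while the equation carries the load and the initial condition on
 \<open>\<partial>\<^sub>tu\<close>.\<close>

definition limit_solution :: "'a::euclidean_space set => real => ('a \<times> real => real) => ('a \<times> real => 'a \<times> real) => bool" where
 "limit_solution \<Omega> T f U \<longleftrightarrow> sq_int lborel U \<and>
   (\<exists>v vt vtt g gt. (\<forall>k::nat. ansatz \<Omega> T (v k) (vt k) (vtt k) (g k) (gt k)) \<and>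
    (\<lambda>k. l2n lborel (\<lambda>z. trial \<Omega> T (vt k) (g k) z - U z)) \<longlonglongrightarrow> 0) \<and>
   (\<forall>v vt vtt g gt. ansatz \<Omega> T v vt vtt g gt -->
    (LBINT z. U z \<bullet> weighted_test \<Omega> T vt vtt gt z) = (LBINT z. f z * weighted_load \<Omega> T vt z))"

text \<open>An instance of \<open>Lions_projection\<close>, with coercivity constant \<open>exp (-T) /
 2\<close>.\<close>

theorem limit_solution_exists:
 fixes \<Omega> :: "'a::euclidean_space set"
 assumes \<Omega>: "open \<Omega>" and T: "0 < T" and f: "sq_int lborel f"
 shows "\<exists>U. limit_solution \<Omega> T f U"
proof -
 define G where "G = {(abs_l2 (trial \<Omega> T vt g), abs_l2 (weighted_test \<Omega> T vt vtt gt), (LBINT z. f z * weighted_load \<Omega> T vt z)) |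
  v vt vtt g gt. ansatz \<Omega> T v vt vtt g gt}"
 have GI: "(abs_l2 (trial \<Omega> T vt g), abs_l2 (weighted_test \<Omega> T vt vtt gt), (LBINT z. f z * weighted_load \<Omega> T vt z)) \<in> G"
  if "ansatz \<Omega> T v vt vtt g gt" for v vt vtt g gt unfolding G_def using that by blast
 have GE: "\<exists>v vt vtt g gt. a = abs_l2 (trial \<Omega> T vt g) & m = abs_l2 (weighted_test \<Omega> T vt vtt gt) \<and>
   l = (LBINT z. f z * weighted_load \<Omega> T vt z) & ansatz \<Omega> T v vt vtt g gt" if "(a, m, l) \<in> G" for a m l
  using that unfolding G_def by blast
 have add: "(a + a', m + m', l + l') \<in> G" if "(a, m, l) \<in> G" "(a', m', l') \<in> G" for a m l a' m' l'
 proof -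
  obtain v vt vtt g gt where 1: "a = abs_l2 (trial \<Omega> T vt g)" "m = abs_l2 (weighted_test \<Omega> T vt vtt gt)"
   "l = (LBINT z. f z * weighted_load \<Omega> T vt z)" "ansatz \<Omega> T v vt vtt g gt" using GE[OF \<open>(a, m, l) \<in> G\<close>] by blast
  obtain v' vt' vtt' g' gt' where 2: "a' = abs_l2 (trial \<Omega> T vt' g')" "m' = abs_l2 (weighted_test \<Omega> T vt' vtt' gt')"
   "l' = (LBINT z. f z * weighted_load \<Omega> T vt' z)" "ansatz \<Omega> T v' vt' vtt' g' gt'" using GE[OF \<open>(a', m', l') \<in> G\<close>] by blast
  note S = ansatz_sq_int[OF \<Omega> 1(4)] and S' = ansatz_sq_int[OF \<Omega> 2(4)]
  have "a + a' = abs_l2 (trial \<Omega> T (\<lambda>z. vt z + vt' z) (\<lambda>z. g z + g' z))"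
  proof -
   have "(\<lambda>z. trial \<Omega> T vt g z + trial \<Omega> T vt' g' z) = trial \<Omega> T (\<lambda>z. vt z + vt' z) (\<lambda>z. g z + g' z)"
    by (rule ext) (simp add: trial_def scaleR_add_right distrib_left)
   then show ?thesis unfolding 1 2 abs_l2_add[OF S(1) S'(1)] by simp
  qed
  moreover have "m + m' = abs_l2 (weighted_test \<Omega> T (\<lambda>z. vt z + vt' z) (\<lambda>z. vtt z + vtt' z) (\<lambda>z. gt z + gt' z))"
  proof -
   have "(\<lambda>z. weighted_test \<Omega> T vt vtt gt z + weighted_test \<Omega> T vt' vtt' gt' z)
     = weighted_test \<Omega> T (\<lambda>z. vt z + vt' z) (\<lambda>z. vtt z + vtt' z) (\<lambda>z. gt z + gt' z)"
    by (rule ext) (simp add: weighted_test_def algebra_simps)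
   then show ?thesis unfolding 1 2 abs_l2_add[OF S(2) S'(2)] by simp
  qed
  moreover have "l + l' = (LBINT z. f z * weighted_load \<Omega> T (\<lambda>z. vt z + vt' z) z)"
  proof -
   have "l + l' = (LBINT z. f z * weighted_load \<Omega> T vt z + f z * weighted_load \<Omega> T vt' z)"
    unfolding 1 2 by (rule Bochner_Integration.integral_add[OF sq_int_mult[OF f S(3)] sq_int_mult[OF f S'(3)], symmetric])
   then show ?thesis by (simp add: weighted_load_def algebra_simps)
  qed
  ultimately show ?thesis using GI[OF ansatz_add[OF 1(4) 2(4)]] by simp
 qed
 have scale: "(c *\<^sub>R a, c *\<^sub>R m, c * l) \<in> G" if "(a, m, l) \<in> G" for c a m l
 proof -
  obtain v vt vtt g gt where 1: "a = abs_l2 (trial \<Omega> T vt g)" "m = abs_l2 (weighted_test \<Omega> T vt vtt gt)"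
   "l = (LBINT z. f z * weighted_load \<Omega> T vt z)" "ansatz \<Omega> T v vt vtt g gt" using GE[OF \<open>(a, m, l) \<in> G\<close>] by blast
  note S = ansatz_sq_int[OF \<Omega> 1(4)]
  have "c *\<^sub>R a = abs_l2 (trial \<Omega> T (\<lambda>z. c * vt z) (\<lambda>z. c *\<^sub>R g z))"
  proof -
   have "(\<lambda>z. c *\<^sub>R trial \<Omega> T vt g z) = trial \<Omega> T (\<lambda>z. c * vt z) (\<lambda>z. c *\<^sub>R g z)"
    by (rule ext) (simp add: trial_def)
   then show ?thesis unfolding 1 abs_l2_scaleR[OF S(1)] by simp
  qed
  moreover have "c *\<^sub>R m = abs_l2 (weighted_test \<Omega> T (\<lambda>z. c * vt z) (\<lambda>z. c * vtt z) (\<lambda>z. c *\<^sub>R gt z))"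
  proof -
   have "(\<lambda>z. c *\<^sub>R weighted_test \<Omega> T vt vtt gt z) = weighted_test \<Omega> T (\<lambda>z. c * vt z) (\<lambda>z. c * vtt z) (\<lambda>z. c *\<^sub>R gt z)"
    by (rule ext) (simp add: weighted_test_def algebra_simps)
   then show ?thesis unfolding 1 abs_l2_scaleR[OF S(2)] by simp
  qed
  moreover have "c * l = (LBINT z. f z * weighted_load \<Omega> T (\<lambda>z. c * vt z) z)"
  proof -
   have "(\<lambda>z. f z * weighted_load \<Omega> T (\<lambda>z. c * vt z) z) = (\<lambda>z. c * (f z * weighted_load \<Omega> T vt z))"
    by (rule ext) (simp add: weighted_load_def algebra_simps)
   then show ?thesis unfolding 1 by simp
  qed
  ultimately show ?thesis using GI[OF ansatz_scale[OF 1(4)]] by simp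
 qed
 have az: "ansatz \<Omega> T (\<lambda>z. 0) (\<lambda>z. 0) (\<lambda>z. 0) (\<lambda>z. 0) (\<lambda>z. 0)"
  unfolding ansatz_def
 proof (intro conjI allI ballI)
  show "pderiv_dir b (\<lambda>x. 0) x = 0 \<bullet> b" for b x :: 'a by (subst pderiv_dir_eq[of _ "\<lambda>b. 0"]) auto
 qed (auto intro!: exI[of _ "{}"])
 have sub: "subspace G"
 proof (rule subspaceI)
  obtain a m l where "(a, m, l) \<in> G" using GI[OF az] by blast
  from scale[OF this, of 0] show "0 \<in> G" by (simp add: zero_prod_def)
  show "x + y \<in> G" if "x \<in> G" "y \<in> G" for x y using add that by (cases x; cases y) auto
  show "c *\<^sub>R x \<in> G" if "x \<in> G" for c x using scale that by (cases x) auto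
 qed
 have coer_bd: "exp (- T) / 2 * (norm a)\<^sup>2 <= inner a m" "\<bar>l\<bar> <= l2n lborel f * norm a" if aml: "(a, m, l) \<in> G" for a m l
 proof -
  obtain v vt vtt g gt where 1: "a = abs_l2 (trial \<Omega> T vt g)" "m = abs_l2 (weighted_test \<Omega> T vt vtt gt)"
   "l = (LBINT z. f z * weighted_load \<Omega> T vt z)" "ansatz \<Omega> T v vt vtt g gt" using GE[OF aml] by blast
  note S = ansatz_sq_int[OF \<Omega> 1(4)]
  show "exp (- T) / 2 * (norm a)\<^sup>2 <= inner a m"
   unfolding 1 norm_abs_l2[OF S(1)] inner_abs_l2[OF S(1,2)] by (rule ansatz_coercive[OF \<Omega> T 1(4)])
  show "\<bar>l\<bar> <= l2n lborel f * norm a"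
   unfolding 1 norm_abs_l2[OF S(1)] by (rule weighted_load_bound[OF \<Omega> 1(4) f])
 qed
 obtain V where V: "V \<in> closure (fst ` G)" "!!a m l. (a, m, l) \<in> G ==> inner V m = l"
  using Lions_projection[OF sub, of "exp (- T) / 2" "l2n lborel f"] coer_bd by auto
 obtain U where U: "V = abs_l2 U" "sq_int lborel U" by (rule l2_cases)
 obtain s where s: "!!k. s k \<in> fst ` G" "s \<longlonglongrightarrow> V" using V(1) unfolding closure_sequential by blast
 have "\<exists>v vt vtt g gt. s k = abs_l2 (trial \<Omega> T vt g) & ansatz \<Omega> T v vt vtt g gt" for k
 proof -
  obtain a m l where "(a, m, l) \<in> G" "s k = a" using s(1)[of k] by auto
  then show ?thesis using GE by blast
 qed
 then obtain v vt vtt g gt where k: "!!k. s k = abs_l2 (trial \<Omega> T (vt k) (g k))" "!!k. ansatz \<Omega> T (v k) (vt k) (vtt k) (g k) (gt k)"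
  by metis
 have "(\<lambda>k. dist (s k) V) \<longlonglongrightarrow> 0" using s(2) by (simp only: tendsto_dist_iff[symmetric])
 then have "(\<lambda>k. l2n lborel (\<lambda>z. trial \<Omega> T (vt k) (g k) z - U z)) \<longlonglongrightarrow> 0"
  unfolding k(1) U(1) dist_abs_l2[OF ansatz_sq_int(1)[OF \<Omega> k(2)] U(2)] .
 moreover have "(LBINT z. U z \<bullet> weighted_test \<Omega> T vt vtt gt z) = (LBINT z. f z * weighted_load \<Omega> T vt z)"
  if A: "ansatz \<Omega> T v vt vtt g gt" for v vt vtt g gt
  using V(2)[OF GI[OF A]] unfolding U(1) inner_abs_l2[OF U(2) ansatz_sq_int(2)[OF \<Omega> A]] .
 ultimately have "limit_solution \<Omega> T f U" unfolding limit_solution_def using U(2) k(2) by blast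
 then show ?thesis by blast
qed

section \<open>The limit solves the wave equation\<close>

text \<open>The weighted velocity of the displacement \<open>q(t) \<xi>(x)\<close> is exactly
 \<open>\<eta>(t) \<xi>(x)\<close>, since \<open>q' = exp t \<eta>\<close>.\<close>

lemma product_ansatz:
 fixes \<xi> :: "'a::euclidean_space => real" and p \<eta> q :: "real => real"
 assumes \<xi>: "\<xi> \<in> test_functions \<Omega>" and p: "continuous_on UNIV p"
  and \<eta>: "!!t. (\<eta> has_real_derivative - p t) (at t)" "\<eta> T = 0"
  and q: "!!t. (q has_real_derivative exp t * \<eta> t) (at t)" "q 0 = 0"
 shows "ansatz \<Omega> T (\<lambda>z. q (snd z) * \<xi> (fst z)) (\<lambda>z. exp (snd z) * \<eta> (snd z) * \<xi> (fst z))
   (\<lambda>z. exp (snd z) * (\<eta> (snd z) - p (snd z)) * \<xi> (fst z))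
   (\<lambda>z. q (snd z) *\<^sub>R grad \<xi> (fst z)) (\<lambda>z. (exp (snd z) * \<eta> (snd z)) *\<^sub>R grad \<xi> (fst z))"
proof -
 have s: "smooth \<xi>" by (rule test_smooth[OF \<xi>])
 have c\<eta>: "continuous_on UNIV \<eta>" and cq: "continuous_on UNIV q"
  using \<eta>(1) q(1) by (meson DERIV_isCont continuous_at_imp_continuous_on)+
 have c\<xi>: "continuous_on UNIV \<xi>" "continuous_on UNIV (grad \<xi>)" by (rule smooth_continuous[OF s], rule grad_continuous[OF s])
 have c1: "continuous_on UNIV (\<lambda>z. F (fst z))" if "continuous_on UNIV F" for F :: "'a => 'c::topological_space"
  by (intro continuous_on_compose2[OF that] continuous_intros) auto
 have c2: "continuous_on UNIV (\<lambda>z. F (snd z))" if "continuous_on UNIV F" for F :: "real => 'c::topological_space"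
  by (intro continuous_on_compose2[OF that] continuous_intros) auto
 obtain K where K: "compact K" "K \<subseteq> \<Omega>" "!!x. x \<notin> K ==> \<xi> x = 0" "!!b x. x \<notin> K ==> pderiv_dir b \<xi> x = 0"
  using test_functionsD[OF \<xi>] by blast
 have K': "grad \<xi> x = 0" if "x \<notin> K" for x using K(4)[OF that] by (simp add: grad_def)
 have de: "((\<lambda>t. exp t * \<eta> t) has_real_derivative exp t * (\<eta> t - p t)) (at t)" for t
  by (rule DERIV_cong[OF DERIV_mult[OF DERIV_exp \<eta>(1)]]) (simp add: algebra_simps)
 show ?thesis
  unfolding ansatz_def
 proof (intro conjI allI ballI)
  show "\<exists>K. compact K & K \<subseteq> \<Omega> & (\<forall>x t. x \<notin> K --> q (snd (x, t)) * \<xi> (fst (x, t)) = 0 & exp (snd (x, t)) * \<eta> (snd (x, t)) * \<xi> (fst (x, t)) = 0 \<and>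
    exp (snd (x, t)) * (\<eta> (snd (x, t)) - p (snd (x, t))) * \<xi> (fst (x, t)) = 0 & q (snd (x, t)) *\<^sub>R grad \<xi> (fst (x, t)) = 0 \<and>
    (exp (snd (x, t)) * \<eta> (snd (x, t))) *\<^sub>R grad \<xi> (fst (x, t)) = 0)"
   by (rule exI[of _ K]) (use K K' in simp)
  fix x :: 'a and t :: real
  show "((\<lambda>t. q (snd (x, t)) * \<xi> (fst (x, t))) has_vector_derivative exp (snd (x, t)) * \<eta> (snd (x, t)) * \<xi> (fst (x, t))) (at t)"
   unfolding has_real_derivative_iff_has_vector_derivative[symmetric] fst_conv snd_conv by (rule DERIV_cmult_right[OF q(1)])
  show "((\<lambda>t. exp (snd (x, t)) * \<eta> (snd (x, t)) * \<xi> (fst (x, t))) has_vector_derivative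
    exp (snd (x, t)) * (\<eta> (snd (x, t)) - p (snd (x, t))) * \<xi> (fst (x, t))) (at t)"
   unfolding has_real_derivative_iff_has_vector_derivative[symmetric] fst_conv snd_conv by (rule DERIV_cmult_right[OF de])
  show "((\<lambda>t. q (snd (x, t)) *\<^sub>R grad \<xi> (fst (x, t))) has_vector_derivative (exp (snd (x, t)) * \<eta> (snd (x, t))) *\<^sub>R grad \<xi> (fst (x, t))) (at t)"
   unfolding fst_conv snd_conv
   by (rule bounded_linear.has_vector_derivative[OF bounded_linear_scaleR_left q(1)[unfolded has_real_derivative_iff_has_vector_derivative]])
  show "(\<lambda>x. q (snd (x, t)) * \<xi> (fst (x, t))) \<in> test_functions \<Omega>" using test_cmult[OF \<xi>, of "q t"] by simp
  show "pderiv_dir b (\<lambda>x. q (snd (x, t)) * \<xi> (fst (x, t))) x = q (snd (x, t)) *\<^sub>R grad \<xi> (fst (x, t)) \<bullet> b" if "b \<in> Basis" for b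
   using pderiv_dir_cmult[OF s, of b "q t" x] that by (simp add: grad_component)
 qed (auto simp: \<eta> q intro!: continuous_intros c1 c2 c\<xi> c\<eta> cq p)
qed

definition velocity :: "'a::euclidean_space set => real => ('a \<times> real => 'a \<times> real) => 'a \<times> real => real" where
 "velocity \<Omega> T U z = indicator (cylinder \<Omega> T) z * snd (U z)"

definition slope :: "'a::euclidean_space set => real => ('a \<times> real => 'a \<times> real) => 'a => 'a \<times> real => real" where
 "slope \<Omega> T U b z = indicator (cylinder \<Omega> T) z * (fst (U z) \<bullet> b)"

lemma velocity_slope_cyl:
 assumes \<Omega>: "open \<Omega>" and U: "sq_int lborel U"
 shows "velocity \<Omega> T U \<in> cyl \<Omega> T" "slope \<Omega> T U b \<in> cyl \<Omega> T"
proof -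
 have m: "U \<in> borel_measurable borel" using sq_int_measurable[OF U] by simp
 have "sq_int lborel (\<lambda>z. snd (U z))"
 proof (rule sq_int_bound[OF U])
  show "(\<lambda>z. snd (U z)) \<in> borel_measurable lborel"
   using measurable_compose[OF m borel_measurable_continuous_onI[OF continuous_on_snd[OF continuous_on_id]]] by simp
  show "AE z in lborel. norm (snd (U z)) <= norm (U z)"
   by (intro AE_I2) (metis norm_snd_le prod.collapse)
 qed
 moreover have "sq_int lborel (\<lambda>z. fst (U z))"
 proof (rule sq_int_bound[OF U])
  show "(\<lambda>z. fst (U z)) \<in> borel_measurable lborel"
   using measurable_compose[OF m borel_measurable_continuous_onI[OF continuous_on_fst[OF continuous_on_id]]] by simp
  show "AE z in lborel. norm (fst (U z)) <= norm (U z)"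
   by (intro AE_I2) (metis norm_fst_le prod.collapse)
 qed
 ultimately show "velocity \<Omega> T U \<in> cyl \<Omega> T" "slope \<Omega> T U b \<in> cyl \<Omega> T"
  unfolding velocity_def[abs_def] slope_def[abs_def] by (auto intro!: cyl_restrict \<Omega> borel_open)
qed

lemma interval_prim_sq_int:
 assumes k: "sq_int lborel k" "integrable lborel k"
 shows "sq_int lborel (\<lambda>t. indicator {0<..<T} t * prim k t)"
proof (rule sq_int_bound[OF sq_int_cmult[OF sq_int_interval[of 0 T], of "(LBINT s. \<bar>k s\<bar>)"]])
 have [measurable]: "k \<in> borel_measurable borel" using sq_int_measurable[OF k(1)] by simp
 show "(\<lambda>t. indicator {0<..<T} t * prim k t) \<in> borel_measurable lborel" by simp
 show "AE t in lborel. norm (indicator {0<..<T} t * prim k t) <= norm ((LBINT s. \<bar>k s\<bar>) * indicator {0<..<T} t)"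
  using prim_abs_le[OF k(2)] by (intro AE_I2) (auto simp: indicator_def)
qed

locale limit_equation =
 fixes \<Omega> :: "'a::euclidean_space set" and T :: real and f :: "'a \<times> real => real" and U :: "'a \<times> real => 'a \<times> real"
 assumes \<Omega>: "open \<Omega>" "bounded \<Omega>" and T: "0 < T" and f: "f \<in> cyl \<Omega> T" and U: "limit_solution \<Omega> T f U"
begin

abbreviation "wU \<equiv> velocity \<Omega> T U"
abbreviation "gU \<equiv> slope \<Omega> T U"

lemma wU_cyl: "wU \<in> cyl \<Omega> T" and gU_cyl: "gU b \<in> cyl \<Omega> T"
 using velocity_slope_cyl[OF \<Omega>(1)] U unfolding limit_solution_def by blast+

lemma U_sq_int: "sq_int lborel U"
 using U unfolding limit_solution_def by blast

lemma Omega_borel: "\<Omega> \<in> sets borel" and Q_borel: "cylinder \<Omega> T \<in> sets borel" and I_borel: "{0<..<T} \<in> sets borel"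
 using borel_open[OF \<Omega>(1)] cylinder_borel[OF \<Omega>(1)] by auto

end

text \<open>Inserting products \<open>q(t) \<xi>(x)\<close> as trial functions tests the limit equation against
 \<open>\<eta>(t) \<xi>(x)\<close> for every smooth \<open>\<eta>\<close> with \<open>\<eta>(T) = 0\<close>; integrating by parts in time moves the
 derivative off \<open>\<eta>\<close> and leaves the wave equation integrated once in time.\<close>

lemma (in limit_equation) limit_solution_tested:
 assumes \<xi>: "\<xi> \<in> test_functions \<Omega>"
 shows "AE t in lborel. t \<in> {0<..<T} --> (LBINT x. wU (x, t) * \<xi> x)
  = (LBINT x. tprim f (x, t) * \<xi> x) - (\<Sum>b\<in>Basis. (LBINT x. tprim (gU b) (x, t) * pderiv_dir b \<xi> x))"
proof -
 let ?I = "indicator {0<..<T} :: real => real"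
 have \<xi>s: "sq_int lborel \<xi>" by (rule test_sq_int[OF \<xi>])
 have \<xi>b: "sq_int lborel (pderiv_dir b \<xi>)" if "b \<in> Basis" for b by (rule test_sq_int(1)[OF test_pderiv[OF \<xi> that]])
 define kw where "kw t = (LBINT x. wU (x, t) * \<xi> x)" for t
 define kf where "kf t = (LBINT x. f (x, t) * \<xi> x)" for t
 define kg where "kg b t = (LBINT x. gU b (x, t) * pderiv_dir b \<xi> x)" for b t
 note W = slice_inner[OF wU_cyl \<xi>s, folded kw_def] and F = slice_inner[OF f \<xi>s, folded kf_def]
 have G: "integrable lborel (kg b)" "sq_int lborel (kg b)" "!!t. t \<notin> {0<..<T} ==> kg b t = 0"
  "!!t. (LBINT x. tprim (gU b) (x, t) * pderiv_dir b \<xi> x) = prim (kg b) t" if "b \<in> Basis" for b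
  using slice_inner[OF gU_cyl[of b] \<xi>b[OF that]] unfolding kg_def[abs_def] by blast+
 define h where "h t = kw t + (\<Sum>b\<in>Basis. ?I t * prim (kg b) t) - ?I t * prim kf t" for t
 have pg: "sq_int lborel (\<lambda>t. ?I t * prim (kg b) t)" if "b \<in> Basis" for b by (rule interval_prim_sq_int[OF G(2,1)[OF that]])
 have pf: "sq_int lborel (\<lambda>t. ?I t * prim kf t)" by (rule interval_prim_sq_int[OF F(2,1)])
 have hs: "sq_int lborel h" unfolding h_def[abs_def] by (intro sq_int_diff sq_int_add sq_int_sum W(2) pg pf)
 have "AE t in lborel. t \<in> {0<..<T} --> h t = 0"
 proof (rule fundamental_lemma_lborel[OF _ hs])
  fix p :: "real => real" assume p: "p \<in> test_functions {0<..<T}"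
  have ps: "sq_int lborel p" by (rule test_sq_int[OF p])
  have pc: "continuous_on UNIV p" by (rule smooth_continuous[OF test_smooth[OF p]])
  have pI: "?I t * p t = p t" for t using test_outside[OF p, of t] by (cases "t \<in> {0<..<T}") auto
  obtain P where P: "!!t. (P has_real_derivative p t) (at t)" using primitive_of_continuous[OF pc] by blast
  \<comment> \<open>The primitive of \<open>-p\<close> that vanishes at \<open>T\<close>; the weight is absorbed into \<open>q\<close>.\<close>
  define \<eta> where "\<eta> t = P T - P t" for t
  have d\<eta>: "(\<eta> has_real_derivative - p t) (at t)" for t
   unfolding \<eta>_def[abs_def] using DERIV_diff[OF DERIV_const P, of "P T" t] by simp
  have \<eta>T: "\<eta> T = 0" by (simp add: \<eta>_def)
  have c\<eta>: "continuous_on UNIV \<eta>" using d\<eta> by (meson DERIV_isCont continuous_at_imp_continuous_on)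
  have "continuous_on UNIV (\<lambda>t. exp t * \<eta> t)" by (intro continuous_intros c\<eta>)
  then obtain q where q: "!!t. (q has_real_derivative exp t * \<eta> t) (at t)" "q 0 = 0"
  proof (rule primitive_of_continuous, goal_cases)
   case (1 q)
   show ?case by (rule 1(1)) (fact 1)+
  qed
  have \<eta>s: "sq_int lborel (\<lambda>t. ?I t * \<eta> t)" by (rule interval_continuous_sq_int[OF c\<eta>])
  note A = product_ansatz[OF \<xi> pc d\<eta> \<eta>T q]
  have lhs: "U z \<bullet> weighted_test \<Omega> T (\<lambda>z. exp (snd z) * \<eta> (snd z) * \<xi> (fst z))
    (\<lambda>z. exp (snd z) * (\<eta> (snd z) - p (snd z)) * \<xi> (fst z)) (\<lambda>z. (exp (snd z) * \<eta> (snd z)) *\<^sub>R grad \<xi> (fst z)) z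
   = (\<Sum>b\<in>Basis. gU b z * ((?I (snd z) * \<eta> (snd z)) * pderiv_dir b \<xi> (fst z))) + wU z * (p (snd z) * \<xi> (fst z))" (is "?l z = ?r z") for z
  proof (cases "z \<in> cylinder \<Omega> T")
   case True
   have e: "exp (- snd z) * exp (snd z) = (1::real)" by (simp add: exp_minus)
   have e1: "exp (- snd z) *\<^sub>R (exp (snd z) * \<eta> (snd z)) *\<^sub>R grad \<xi> (fst z) = \<eta> (snd z) *\<^sub>R grad \<xi> (fst z)"
    by (simp add: mult.assoc[symmetric] e)
   have e2: "- (exp (- snd z) * (exp (snd z) * (\<eta> (snd z) - p (snd z)) * \<xi> (fst z) - exp (snd z) * \<eta> (snd z) * \<xi> (fst z)))
     = (exp (- snd z) * exp (snd z)) * (p (snd z) * \<xi> (fst z))" by (simp add: algebra_simps)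
   have e3: "fst (U z) \<bullet> grad \<xi> (fst z) = (\<Sum>b\<in>Basis. (fst (U z) \<bullet> b) * pderiv_dir b \<xi> (fst z))"
    unfolding grad_def by (simp add: inner_sum_right mult.commute)
   have "?l z = \<eta> (snd z) * (fst (U z) \<bullet> grad \<xi> (fst z)) + snd (U z) * (p (snd z) * \<xi> (fst z))"
    using True by (simp add: weighted_test_def inner_prod_def e e1 e2[unfolded e])
   also have "\<dots> = ?r z" using True unfolding e3
    by (auto simp: velocity_def slope_def sum_distrib_left algebra_simps)
   finally show ?thesis .
  qed (simp add: weighted_test_def velocity_def slope_def zero_prod_def[symmetric])
  have rhs: "f z * weighted_load \<Omega> T (\<lambda>z. exp (snd z) * \<eta> (snd z) * \<xi> (fst z)) z = f z * ((?I (snd z) * \<eta> (snd z)) * \<xi> (fst z))" for z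
  proof (cases "z \<in> cylinder \<Omega> T")
   case True
   have "exp (- snd z) * (exp (snd z) * \<eta> (snd z) * \<xi> (fst z)) = \<eta> (snd z) * \<xi> (fst z)"
    by (simp add: mult.assoc[symmetric] exp_minus)
   then show ?thesis using True by (auto simp: weighted_load_def)
  qed (simp add: cylD(2)[OF f])
  have tens: "sq_int lborel (\<lambda>z. F (snd z) * X (fst z))" if "sq_int lborel F" "sq_int lborel X" for F :: "real => real" and X :: "'a => real"
   using sq_int_tensor[OF that(2,1)] by (simp add: mult.commute)
  have ig: "integrable lborel (\<lambda>z. gU b z * ((?I (snd z) * \<eta> (snd z)) * pderiv_dir b \<xi> (fst z)))" if "b \<in> Basis" for b
   by (rule sq_int_mult[OF cylD(1)[OF gU_cyl] tens[OF \<eta>s \<xi>b[OF that]]])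
  have iw: "integrable lborel (\<lambda>z. wU z * (p (snd z) * \<xi> (fst z)))" by (rule sq_int_mult[OF cylD(1)[OF wU_cyl] tens[OF ps \<xi>s]])
  have "(LBINT z. ?r z) = (LBINT z. f z * ((?I (snd z) * \<eta> (snd z)) * \<xi> (fst z)))"
   using U A unfolding limit_solution_def lhs[symmetric] rhs[symmetric] by blast
  moreover have "(LBINT z. ?r z) = (\<Sum>b\<in>Basis. (LBINT t. (?I t * \<eta> t) * kg b t)) + (LBINT t. p t * kw t)"
  proof -
   have "(LBINT z. ?r z) = (LBINT z. (\<Sum>b\<in>Basis. gU b z * ((?I (snd z) * \<eta> (snd z)) * pderiv_dir b \<xi> (fst z))))
     + (LBINT z. wU z * (p (snd z) * \<xi> (fst z)))"
    by (rule Bochner_Integration.integral_add) (use ig iw in auto)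
   also have "(LBINT z. (\<Sum>b\<in>Basis. gU b z * ((?I (snd z) * \<eta> (snd z)) * pderiv_dir b \<xi> (fst z))))
     = (\<Sum>b\<in>Basis. (LBINT z. gU b z * ((?I (snd z) * \<eta> (snd z)) * pderiv_dir b \<xi> (fst z))))"
    by (rule Bochner_Integration.integral_sum[OF ig])
   also have "\<dots> = (\<Sum>b\<in>Basis. (LBINT t. (?I t * \<eta> t) * kg b t))"
    by (rule sum.cong[OF refl]) (simp only: tensor_inner[OF gU_cyl \<xi>b \<eta>s] kg_def)
   also have "(LBINT z. wU z * (p (snd z) * \<xi> (fst z))) = (LBINT t. p t * kw t)"
    by (simp only: tensor_inner[OF wU_cyl \<xi>s ps] kw_def)
   finally show ?thesis .
  qed
  moreover have "(LBINT z. f z * ((?I (snd z) * \<eta> (snd z)) * \<xi> (fst z))) = (LBINT t. (?I t * \<eta> t) * kf t)"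
   by (simp only: tensor_inner[OF f \<xi>s \<eta>s] kf_def)
  moreover have bp: "(LBINT t. (?I t * \<eta> t) * k t) = (LBINT t. (?I t * prim k t) * p t)" if "integrable lborel k" for k
   using prim_by_parts[OF that less_imp_le[OF T] P pc] by (simp add: \<eta>_def mult.assoc mult.commute[of "p _"])
  ultimately have key: "(\<Sum>b\<in>Basis. (LBINT t. (?I t * prim (kg b) t) * p t)) + (LBINT t. kw t * p t)
    = (LBINT t. (?I t * prim kf t) * p t)"
   using bp[OF F(1)] bp[OF G(1)] by (simp add: mult.commute[of "p _"])
  have i1: "integrable lborel (\<lambda>t. kw t * p t)" by (rule sq_int_mult[OF W(2) ps])
  have i2: "integrable lborel (\<lambda>t. (?I t * prim (kg b) t) * p t)" if "b \<in> Basis" for b by (rule sq_int_mult[OF pg[OF that] ps])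
  have i3: "integrable lborel (\<lambda>t. (?I t * prim kf t) * p t)" by (rule sq_int_mult[OF pf ps])
  have "(LBINT t. h t * p t) = (LBINT t. kw t * p t + (\<Sum>b\<in>Basis. (?I t * prim (kg b) t) * p t) - (?I t * prim kf t) * p t)"
   unfolding h_def by (simp only: left_diff_distrib distrib_right sum_distrib_right)
  also have "\<dots> = (LBINT t. kw t * p t) + (\<Sum>b\<in>Basis. (LBINT t. (?I t * prim (kg b) t) * p t)) - (LBINT t. (?I t * prim kf t) * p t)"
   by (subst Bochner_Integration.integral_diff Bochner_Integration.integral_add Bochner_Integration.integral_sum; use i1 i2 i3 in auto)+
  finally show "(LBINT t. h t * p t) = 0" using key by simp
 qed simp
 then show ?thesis
 proof eventually_elim
  case (elim t)
  show ?case
  proof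
   assume t: "t \<in> {0<..<T}"
   then have "kw t = prim kf t - (\<Sum>b\<in>Basis. prim (kg b) t)" using elim unfolding h_def by simp
   moreover have "(\<Sum>b\<in>Basis. prim (kg b) t) = (\<Sum>b\<in>Basis. (LBINT x. tprim (gU b) (x, t) * pderiv_dir b \<xi> x))"
    by (rule sum.cong[OF refl]) (simp only: G(4))
   ultimately show "(LBINT x. wU (x, t) * \<xi> x)
    = (LBINT x. tprim f (x, t) * \<xi> x) - (\<Sum>b\<in>Basis. (LBINT x. tprim (gU b) (x, t) * pderiv_dir b \<xi> x))"
    unfolding F(4) kw_def by simp
  qed
 qed
qed

text \<open>The functional \<open>\<integral>\<^sub>0\<^sup>t f + div \<integral>\<^sub>0\<^sup>t g\<close>
 on \<open>H\<^sup>1\<^sub>0\<close>: the wave equation integrated once in time says that it is the velocity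
 at time \<open>t\<close>.\<close>

definition flux :: "'a::euclidean_space set => ('a \<times> real => real) => ('a => 'a \<times> real => real) => real => ('a => real) => real" where
 "flux \<Omega> f g t \<xi> = L2_inner \<Omega> (\<lambda>x. tprim f (x, t)) \<xi> - (\<Sum>b\<in>Basis. L2_inner \<Omega> (\<lambda>x. tprim (g b) (x, t)) (\<lambda>x. weak_gradient \<Omega> \<xi> x \<bullet> b))"

lemma L2_inner_tendsto_right:
 "(!!k. f k \<in> L2 S) ==> h \<in> L2 S ==> g \<in> L2 S ==> (\<lambda>k. L2_norm S (\<lambda>x. f k x - h x)) \<longlonglongrightarrow> 0 ==>
  (\<lambda>k. L2_inner S g (f k)) \<longlonglongrightarrow> L2_inner S g h"
 using L2_inner_tendsto[of f S h g] by (simp add: L2_inner_commute[of S g])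

text \<open>The exceptional null set of times in \<open>limit_solution_tested\<close> depends on \<open>\<xi>\<close>; separability of \<open>H\<^sup>1\<^sub>0(\<Omega>)\<close> makes it uniform.\<close>

lemma (in limit_equation) limit_solution_flux:
 shows "AE t in lborel. t \<in> {0<..<T} --> (\<forall>\<xi>\<in>H10 \<Omega>. L2_inner \<Omega> (\<lambda>x. wU (x, t)) \<xi> = flux \<Omega> f (gU) t \<xi>)"
proof -
 obtain C where C: "countable C" "C \<subseteq> test_functions \<Omega>"
  "!!\<xi>. \<xi> \<in> H10 \<Omega> ==> \<exists>\<phi> :: nat => 'a => real. (\<forall>k. \<phi> k \<in> C) & (\<lambda>k. L2_norm \<Omega> (\<lambda>x. \<phi> k x - \<xi> x)) \<longlonglongrightarrow> 0 \<and>
    (\<forall>b\<in>Basis. (\<lambda>k. L2_norm \<Omega> (\<lambda>x. pderiv_dir b (\<phi> k) x - weak_gradient \<Omega> \<xi> x \<bullet> b)) \<longlonglongrightarrow> 0)"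
 proof (rule H10_separable[OF \<Omega>], goal_cases)
  case (1 C)
  show ?case by (rule 1(1)) (fact 1)+
 qed
 have "AE t in lborel. \<forall>\<xi>\<in>C. t \<in> {0<..<T} --> (LBINT x. wU (x, t) * \<xi> x)
  = (LBINT x. tprim f (x, t) * \<xi> x) - (\<Sum>b\<in>Basis. (LBINT x. tprim (gU b) (x, t) * pderiv_dir b \<xi> x))"
  unfolding AE_ball_countable[OF C(1)]
 proof
  fix \<xi> assume "\<xi> \<in> C"
  then have "\<xi> \<in> test_functions \<Omega>" using C(2) by blast
  then show "AE t in lborel. t \<in> {0<..<T} --> (LBINT x. wU (x, t) * \<xi> x)
   = (LBINT x. tprim f (x, t) * \<xi> x) - (\<Sum>b\<in>Basis. (LBINT x. tprim (gU b) (x, t) * pderiv_dir b \<xi> x))"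
   by (rule limit_solution_tested)
 qed
 with cyl_slices[OF wU_cyl] show ?thesis
 proof eventually_elim
  case (elim t)
  show ?case
  proof (intro impI ballI)
   fix \<xi> assume t: "t \<in> {0<..<T}" and \<xi>: "\<xi> \<in> H10 \<Omega>"
   obtain \<phi> :: "nat => 'a => real" where \<phi>: "!!k. \<phi> k \<in> C" "(\<lambda>k. L2_norm \<Omega> (\<lambda>x. \<phi> k x - \<xi> x)) \<longlonglongrightarrow> 0"
    "!!b. b \<in> Basis ==> (\<lambda>k. L2_norm \<Omega> (\<lambda>x. pderiv_dir b (\<phi> k) x - weak_gradient \<Omega> \<xi> x \<bullet> b)) \<longlonglongrightarrow> 0"
    using C(3)[OF \<xi>] by blast
   have \<phi>t: "\<phi> k \<in> test_functions \<Omega>" for k using \<phi>(1) C(2) by blast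
   have t0: "0 <= t" using t by simp
   have wL: "(\<lambda>x. wU (x, t)) \<in> L2 \<Omega>" by (rule L2_of_sq_int[OF conjunct1[OF elim(1)] Omega_borel])
   have fL: "(\<lambda>x. tprim f (x, t)) \<in> L2 \<Omega>" and gL: "(\<lambda>x. tprim (gU b) (x, t)) \<in> L2 \<Omega>" for b
    by (rule L2_of_sq_int[OF tprim_L2(1)[OF f t0] Omega_borel], rule L2_of_sq_int[OF tprim_L2(1)[OF gU_cyl t0] Omega_borel])
   have eq: "L2_inner \<Omega> (\<lambda>x. wU (x, t)) (\<phi> k) = L2_inner \<Omega> (\<lambda>x. tprim f (x, t)) (\<phi> k)
     - (\<Sum>b\<in>Basis. L2_inner \<Omega> (\<lambda>x. tprim (gU b) (x, t)) (pderiv_dir b (\<phi> k)))" for k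
   proof -
    have r: "L2_inner \<Omega> (\<lambda>x. h (x, t)) \<psi> = (LBINT x. h (x, t) * \<psi> x)" if "h \<in> borel_measurable borel" "\<psi> \<in> test_functions \<Omega>" for h \<psi>
     by (rule L2_inner_lborel[OF Omega_borel spacetime_slice_borel(1)[OF that(1)] test_borel[OF that(2)]]) (simp add: test_outside[OF that(2)])
    have gs: "(\<Sum>b\<in>Basis. L2_inner \<Omega> (\<lambda>x. tprim (gU b) (x, t)) (pderiv_dir b (\<phi> k)))
      = (\<Sum>b\<in>Basis. (LBINT x. tprim (gU b) (x, t) * pderiv_dir b (\<phi> k) x))"
     by (rule sum.cong[OF refl]) (rule r[OF tprim_borel[OF cylD(3)[OF gU_cyl]] test_pderiv[OF \<phi>t]])
    show ?thesis unfolding gs r[OF cylD(3)[OF wU_cyl] \<phi>t] r[OF tprim_borel[OF cylD(3)[OF f]] \<phi>t]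
     by (rule mp[OF bspec[OF elim(2) \<phi>(1)] t])
   qed
   have 1: "(\<lambda>k. L2_inner \<Omega> (\<lambda>x. wU (x, t)) (\<phi> k)) \<longlonglongrightarrow> L2_inner \<Omega> (\<lambda>x. wU (x, t)) \<xi>"
    by (rule L2_inner_tendsto_right[OF test_L2[OF \<phi>t \<Omega>(1)] H10_L2[OF \<xi>] wL \<phi>(2)])
   have "(\<lambda>k. L2_inner \<Omega> (\<lambda>x. wU (x, t)) (\<phi> k)) \<longlonglongrightarrow> flux \<Omega> f gU t \<xi>"
    unfolding eq flux_def
    by (intro tendsto_diff tendsto_sum L2_inner_tendsto_right[OF test_L2[OF \<phi>t \<Omega>(1)] H10_L2[OF \<xi>] fL \<phi>(2)]
      L2_inner_tendsto_right[OF test_L2[OF test_pderiv[OF \<phi>t] \<Omega>(1)] gradient_L2[OF H10_gradient[OF \<xi>]] gL \<phi>(3)])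
   then show "L2_inner \<Omega> (\<lambda>x. wU (x, t)) \<xi> = flux \<Omega> f gU t \<xi>" by (rule LIMSEQ_unique[OF 1])
  qed
 qed
qed

section \<open>Convergence of time slices\<close>

text \<open>Uniform continuity on \<open>K \<times> [0,T]\<close>.\<close>

lemma step_approximation:
 fixes F :: "'a::euclidean_space \<times> real => 'b::real_normed_vector"
 assumes F: "continuous_on UNIV F" and K: "compact K" "!!x t. x \<notin> K ==> F (x, t) = 0" and e: "0 < e"
 shows "\<exists>m>0. \<forall>x. \<forall>t\<in>{0<..<T}. norm (F (x, of_int \<lfloor>m * t\<rfloor> / m) - F (x, t)) <= e"
proof -
 have "uniformly_continuous_on (K \<times> {0..T}) F"
  by (intro compact_uniformly_continuous continuous_on_subset[OF F] compact_Times K(1)) auto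
 then obtain d where d: "d > 0" "!!y z. y \<in> K \<times> {0..T} ==> z \<in> K \<times> {0..T} ==> dist z y < d ==> dist (F z) (F y) < e"
  unfolding uniformly_continuous_on_def using e by meson
 define m where "m = 2 / d"
 have m: "m > 0" using d(1) by (simp add: m_def)
 have "norm (F (x, of_int \<lfloor>m * t\<rfloor> / m) - F (x, t)) <= e" if t: "t \<in> {0<..<T}" for x t
 proof (cases "x \<in> K")
  case True
  define s where "s = of_int \<lfloor>m * t\<rfloor> / m"
  have ms: "m * s = of_int \<lfloor>m * t\<rfloor>" using m by (simp add: s_def)
  have "m * s <= m * t" "m * t < m * s + 1" unfolding ms by linarith+
  then have s1: "s <= t" and "m * (t - s) < 1" using m by (auto simp: algebra_simps)
  then have "t - s < 1 / m" using m by (simp add: field_simps)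
  then have s2: "t - s < d" using d(1) by (simp add: m_def)
  have "0 <= s" using t m by (simp add: s_def)
  then have "dist (F (x, s)) (F (x, t)) < e"
   using s1 s2 t True by (intro d(2)) (auto simp: dist_Pair_Pair dist_real_def)
  then show ?thesis unfolding s_def[symmetric] by (simp add: dist_norm)
 qed (use K(2) e in simp)
 then show ?thesis using m by blast
qed

lemma L2_norm_lborel:
 assumes "\<Omega> \<in> sets borel" "h \<in> borel_measurable borel" "!!x. x \<notin> \<Omega> ==> h x = 0"
 shows "L2_norm \<Omega> h = l2n lborel h"
 unfolding L2_norm_eq by (rule l2n_lborel[OF assms])

lemma continuous_slice: "continuous_on UNIV F ==> continuous_on UNIV (\<lambda>x. F (x, t))" for F :: "'a::topological_space \<times> 'b::topological_space => 'c::topological_space"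
 by (rule continuous_on_compose2[of UNIV F]) (auto intro!: continuous_intros)

lemma velocity_primitive:
 fixes \<Omega> :: "'a::euclidean_space set"
 assumes \<Omega>: "open \<Omega>" and A: "ansatz \<Omega> T v vt vtt g gt" and t: "t \<in> {0<..<T}"
 shows "tprim (velocity \<Omega> T (trial \<Omega> T vt g)) (x, t) = v (x, t)"
proof (cases "x \<in> \<Omega>")
 case True
 have "tprim (velocity \<Omega> T (trial \<Omega> T vt g)) (x, t) = (LBINT s. indicator {0<..<t} s * vt (x, s))"
  unfolding tprim_def prim_def fst_conv snd_conv
 proof (rule arg_cong[of _ _ "integral\<^sup>L lborel"], rule ext)
  fix s show "indicator {0<..<t} s * velocity \<Omega> T (trial \<Omega> T vt g) (x, s) = indicator {0<..<t} s * vt (x, s)"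
   using t True by (cases "s \<in> {0<..<t}") (auto simp: velocity_def trial_def)
 qed
 also have "\<dots> = v (x, t) - v (x, 0)"
 proof (rule integral_FTC_open(1))
  show "continuous_on UNIV (\<lambda>s. vt (x, s))"
   by (rule continuous_on_compose2[OF ansatzD(2)[OF A]]) (auto intro!: continuous_intros)
  show "((\<lambda>s. v (x, s)) has_real_derivative vt (x, s)) (at s)" for s
   unfolding has_real_derivative_iff_has_vector_derivative by (rule ansatzD(6)[OF A])
 qed (use t in simp)
 finally show ?thesis using ansatzD(9)[OF A] by simp
next
 case False
 obtain K where K: "K \<subseteq> \<Omega>" "!!x t. x \<notin> K ==> v (x, t) = 0" using ansatz_support[OF A] by metis
 then have "v (x, t) = 0" using False by blast
 then show ?thesis using tprim_outside[OF velocity_slope_cyl(1)[OF \<Omega> ansatz_sq_int(1)[OF \<Omega> A]], of x t] False by simp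
qed

text \<open>The slices converge for almost every time along a subsequence. The displacements are the
 primitives of their velocities, so they converge for every time.\<close>

lemma (in limit_equation) limit_solution_approximation:
 shows "\<exists>v vt vtt g gt. (\<forall>k::nat. ansatz \<Omega> T (v k) (vt k) (vtt k) (g k) (gt k)) \<and>
  (AE t in lborel. t \<in> {0<..<T} -->
   (\<lambda>k. L2_norm \<Omega> (\<lambda>x. v k (x, t) - tprim wU (x, t))) \<longlonglongrightarrow> 0 \<and>
   (\<forall>b\<in>Basis. (\<lambda>k. L2_norm \<Omega> (\<lambda>x. g k (x, t) \<bullet> b - gU b (x, t))) \<longlonglongrightarrow> 0) \<and>
   (\<lambda>k. L2_norm \<Omega> (\<lambda>x. vt k (x, t) - wU (x, t))) \<longlonglongrightarrow> 0)"
proof -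
 obtain v vt vtt g gt where A: "!!k::nat. ansatz \<Omega> T (v k) (vt k) (vtt k) (g k) (gt k)"
  and lim: "(\<lambda>k. l2n lborel (\<lambda>z. trial \<Omega> T (vt k) (g k) z - U z)) \<longlonglongrightarrow> 0"
  using U unfolding limit_solution_def by blast
 define S where "S k = trial \<Omega> T (vt k) (g k)" for k
 have S: "sq_int lborel (S k)" for k unfolding S_def by (rule ansatz_sq_int(1)[OF \<Omega>(1) A])
 obtain r where r: "strict_mono r" and slim: "AE t in lborel. (\<lambda>k. l2n lborel (\<lambda>x. S (r k) (x, t) - U (x, t))) \<longlonglongrightarrow> 0"
  using slices_subsequence[OF S U_sq_int lim[folded S_def]] by blast
 have lr: "(\<lambda>k. l2n lborel (\<lambda>z. S (r k) z - U z)) \<longlonglongrightarrow> 0"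
  using LIMSEQ_subseq_LIMSEQ[OF lim r] unfolding S_def o_def .
 define h where "h k = velocity \<Omega> T (S k)" for k
 have hc: "h k \<in> cyl \<Omega> T" for k unfolding h_def by (rule velocity_slope_cyl[OF \<Omega>(1) S])
 have ssq: "AE t in lborel. \<forall>k. sq_int lborel (\<lambda>x. S (r k) (x, t))" unfolding AE_all_countable using sq_int_slices(1)[OF S] by blast
 have sn: "\<bar>snd a - snd b\<bar> <= norm (a - b)" for a b :: "'a \<times> real"
  using norm_snd_le[of "snd (a - b)" "fst (a - b)"] unfolding prod.collapse by simp
 have hw: "l2n lborel (\<lambda>z. h k z - wU z) <= l2n lborel (\<lambda>z. S k z - U z)" for k
 proof (rule l2n_mono[OF sq_int_diff[OF S U_sq_int]])
  show "(\<lambda>z. h k z - wU z) \<in> borel_measurable lborel" using cylD(3)[OF hc] cylD(3)[OF wU_cyl] by simp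
  have "norm (h k z - wU z) <= norm (S k z - U z)" for z
   using sn[of "S k z" "U z"]
   by (cases "z \<in> cylinder \<Omega> T") (auto simp: h_def velocity_def)
  then show "AE z in lborel. norm (h k z - wU z) <= norm (S k z - U z)" by simp
 qed
 have "AE t in lborel. t \<in> {0<..<T} -->
   (\<lambda>k. L2_norm \<Omega> (\<lambda>x. v (r k) (x, t) - tprim wU (x, t))) \<longlonglongrightarrow> 0 \<and>
   (\<forall>b\<in>Basis. (\<lambda>k. L2_norm \<Omega> (\<lambda>x. g (r k) (x, t) \<bullet> b - gU b (x, t))) \<longlonglongrightarrow> 0) \<and>
   (\<lambda>k. L2_norm \<Omega> (\<lambda>x. vt (r k) (x, t) - wU (x, t))) \<longlonglongrightarrow> 0"
  using slim ssq sq_int_slices(1)[OF U_sq_int]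
 proof eventually_elim
  case (elim t)
  have D: "sq_int lborel (\<lambda>x. S (r k) (x, t) - U (x, t))" for k by (rule sq_int_diff[OF spec[OF elim(2)] elim(3)])
  show ?case
  proof (intro impI conjI ballI)
   assume t: "t \<in> {0<..<T}"
   have outside: "v k (x, t) = 0 & vt k (x, t) = 0 & g k (x, t) = 0" if "x \<notin> \<Omega>" for k x
   proof -
    obtain K where "K \<subseteq> \<Omega>" "!!x t. x \<notin> K ==> v k (x, t) = 0 & vt k (x, t) = 0 & g k (x, t) = 0" using ansatz_support[OF A[of k]] by metis
    then show ?thesis using that by blast
   qed
   show "(\<lambda>k. L2_norm \<Omega> (\<lambda>x. vt (r k) (x, t) - wU (x, t))) \<longlonglongrightarrow> 0"
   proof (rule squeeze_0[OF elim(1)])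
    fix k
    have m: "(\<lambda>x. vt (r k) (x, t) - wU (x, t)) \<in> borel_measurable borel"
     using borel_measurable_continuous_onI[OF continuous_slice[OF ansatzD(2)[OF A]]] cyl_slice_borel[OF wU_cyl] by simp
    have n: "norm (vt (r k) (x, t) - wU (x, t)) <= norm (S (r k) (x, t) - U (x, t))" for x
     using sn[of "S (r k) (x, t)" "U (x, t)"] t outside[of x "r k"]
     by (cases "x \<in> \<Omega>") (auto simp: S_def trial_def velocity_def)
    have "L2_norm \<Omega> (\<lambda>x. vt (r k) (x, t) - wU (x, t)) = l2n lborel (\<lambda>x. vt (r k) (x, t) - wU (x, t))"
     by (rule L2_norm_lborel[OF Omega_borel m]) (simp add: outside cyl_slice_outside[OF wU_cyl])
    also have "\<dots> <= l2n lborel (\<lambda>x. S (r k) (x, t) - U (x, t))"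
     by (rule l2n_mono[OF D]) (use m n in auto)
    finally show "L2_norm \<Omega> (\<lambda>x. vt (r k) (x, t) - wU (x, t)) <= l2n lborel (\<lambda>x. S (r k) (x, t) - U (x, t))" .
   qed simp
   show "(\<lambda>k. L2_norm \<Omega> (\<lambda>x. g (r k) (x, t) \<bullet> b - gU b (x, t))) \<longlonglongrightarrow> 0" if b: "b \<in> Basis" for b
   proof (rule squeeze_0[OF elim(1)])
    fix k
    have c: "continuous_on UNIV (\<lambda>x. g (r k) (x, t) \<bullet> b)"
     by (intro continuous_intros continuous_slice[OF ansatzD(4)[OF A]])
    have m: "(\<lambda>x. g (r k) (x, t) \<bullet> b - gU b (x, t)) \<in> borel_measurable borel"
     using borel_measurable_continuous_onI[OF c] cyl_slice_borel[OF gU_cyl] by simp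
    have n: "norm (g (r k) (x, t) \<bullet> b - gU b (x, t)) <= norm (S (r k) (x, t) - U (x, t))" for x
    proof (cases "x \<in> \<Omega>")
     case True
     have "norm (g (r k) (x, t) \<bullet> b - gU b (x, t)) = \<bar>fst (S (r k) (x, t) - U (x, t)) \<bullet> b\<bar>"
      using True t by (simp add: S_def trial_def slope_def inner_diff_left)
     also have "\<dots> <= norm (fst (S (r k) (x, t) - U (x, t)))" by (rule Basis_le_norm[OF b])
     also have "\<dots> <= norm (S (r k) (x, t) - U (x, t))" by (metis norm_fst_le prod.collapse)
     finally show ?thesis .
    qed (simp add: outside slope_def)
    have "L2_norm \<Omega> (\<lambda>x. g (r k) (x, t) \<bullet> b - gU b (x, t)) = l2n lborel (\<lambda>x. g (r k) (x, t) \<bullet> b - gU b (x, t))"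
     by (rule L2_norm_lborel[OF Omega_borel m]) (simp add: outside cyl_slice_outside[OF gU_cyl])
    also have "\<dots> <= l2n lborel (\<lambda>x. S (r k) (x, t) - U (x, t))"
     by (rule l2n_mono[OF D]) (use m n in auto)
    finally show "L2_norm \<Omega> (\<lambda>x. g (r k) (x, t) \<bullet> b - gU b (x, t)) <= l2n lborel (\<lambda>x. S (r k) (x, t) - U (x, t))" .
   qed simp
   have "(\<lambda>k. sqrt t * l2n lborel (\<lambda>z. S (r k) z - U z)) \<longlonglongrightarrow> 0" using tendsto_mult_left[OF lr, of "sqrt t"] by simp
   then show "(\<lambda>k. L2_norm \<Omega> (\<lambda>x. v (r k) (x, t) - tprim wU (x, t))) \<longlonglongrightarrow> 0"
   proof (rule squeeze_0)
    fix k
    have vh: "v (r k) (x, t) = tprim (h (r k)) (x, t)" for x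
     unfolding h_def S_def by (rule velocity_primitive[OF \<Omega>(1) A t, symmetric])
    have m: "(\<lambda>x. tprim (h (r k)) (x, t) - tprim wU (x, t)) \<in> borel_measurable borel"
     using tprim_slice_borel[OF hc] tprim_slice_borel[OF wU_cyl] by simp
    have dc: "(\<lambda>z. h (r k) z - wU z) \<in> cyl \<Omega> T" by (rule cyl_diff[OF hc wU_cyl])
    have "L2_norm \<Omega> (\<lambda>x. v (r k) (x, t) - tprim wU (x, t)) = l2n lborel (\<lambda>x. tprim (h (r k)) (x, t) - tprim wU (x, t))"
     unfolding vh by (rule L2_norm_lborel[OF Omega_borel m]) (simp add: tprim_outside[OF hc] tprim_outside[OF wU_cyl])
    also have "\<dots> = l2n lborel (\<lambda>x. tprim (\<lambda>z. h (r k) z - wU z) (x, t))"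
    proof (rule l2n_cong_AE)
     show "AE x in lborel. tprim (h (r k)) (x, t) - tprim wU (x, t) = tprim (\<lambda>z. h (r k) z - wU z) (x, t)"
      using tprim_diff_AE[OF hc[of "r k"] wU_cyl] by eventually_elim simp
    qed (use m tprim_slice_borel[OF dc] in simp_all)
    also have "\<dots> <= sqrt t * l2n lborel (\<lambda>z. h (r k) z - wU z)" using tprim_L2(2)[OF dc] t by simp
    also have "\<dots> <= sqrt t * l2n lborel (\<lambda>z. S (r k) z - U z)" using hw t by (intro mult_left_mono) auto
    finally show "L2_norm \<Omega> (\<lambda>x. v (r k) (x, t) - tprim wU (x, t)) <= sqrt t * l2n lborel (\<lambda>z. S (r k) z - U z)" .
   qed simp
  qed
 qed
 then show ?thesis using A by (intro exI[of _ "\<lambda>k. v (r k)"] exI[of _ "\<lambda>k. vt (r k)"] exI[of _ "\<lambda>k. vtt (r k)"] exI[of _ "\<lambda>k. g (r k)"]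
    exI[of _ "\<lambda>k. gt (r k)"]) simp
qed

text \<open>The approximants are continuous with compact support in space, so they may be replaced by step
 functions with an error that tends to \<open>0\<close> uniformly; these witness strong measurability in
 \<open>H\<^sup>1\<^sub>0\<close> and \<open>L\<^sup>2\<close> simultaneously.\<close>

lemma (in limit_equation) limit_solution_steps:
 shows "\<exists>\<sigma> \<rho> :: nat => real => 'a => real.
  (\<forall>k. finite (\<sigma> k ` {0<..<T}) & (\<forall>h. {t \<in> {0<..<T}. \<sigma> k t = h} \<in> sets lebesgue)) \<and>
  (\<forall>k. finite (\<rho> k ` {0<..<T}) & (\<forall>h. {t \<in> {0<..<T}. \<rho> k t = h} \<in> sets lebesgue)) \<and>
  (\<forall>k t. \<sigma> k t \<in> test_functions \<Omega> & \<rho> k t \<in> L2 \<Omega>) \<and>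
  (AE t in lborel. t \<in> {0<..<T} -->
   (\<lambda>k. L2_norm \<Omega> (\<lambda>x. \<sigma> k t x - tprim wU (x, t))) \<longlonglongrightarrow> 0 \<and>
   (\<forall>b\<in>Basis. (\<lambda>k. L2_norm \<Omega> (\<lambda>x. pderiv_dir b (\<sigma> k t) x - gU b (x, t))) \<longlonglongrightarrow> 0) \<and>
   (\<lambda>k. L2_norm \<Omega> (\<lambda>x. \<rho> k t x - wU (x, t))) \<longlonglongrightarrow> 0)"
proof -
 obtain v vt vtt g gt where A: "!!k::nat. ansatz \<Omega> T (v k) (vt k) (vtt k) (g k) (gt k)"
  and lim: "AE t in lborel. t \<in> {0<..<T} -->
   (\<lambda>k. L2_norm \<Omega> (\<lambda>x. v k (x, t) - tprim wU (x, t))) \<longlonglongrightarrow> 0 \<and>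
   (\<forall>b\<in>Basis. (\<lambda>k. L2_norm \<Omega> (\<lambda>x. g k (x, t) \<bullet> b - gU b (x, t))) \<longlonglongrightarrow> 0) \<and>
   (\<lambda>k. L2_norm \<Omega> (\<lambda>x. vt k (x, t) - wU (x, t))) \<longlonglongrightarrow> 0"
  using limit_solution_approximation by blast
 \<comment> \<open>The \<open>k\<close>-th approximant is sampled so finely that the uniform error is at most \<open>1 / (k + 1)\<close>.\<close>
 define \<epsilon> where "\<epsilon> k = inverse (real (Suc k))" for k
 have ep: "\<epsilon> k > 0" for k by (simp add: \<epsilon>_def)
 have "\<exists>m>0. \<forall>x. \<forall>t\<in>{0<..<T}. norm ((v k (x, of_int \<lfloor>m * t\<rfloor> / m), vt k (x, of_int \<lfloor>m * t\<rfloor> / m), g k (x, of_int \<lfloor>m * t\<rfloor> / m))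
   - (v k (x, t), vt k (x, t), g k (x, t))) <= \<epsilon> k" for k
 proof -
  obtain K where K: "compact K" "!!x t. x \<notin> K ==> v k (x, t) = 0 & vt k (x, t) = 0 & g k (x, t) = 0"
   using ansatz_support[OF A[of k]] by metis
  show ?thesis
   by (rule step_approximation[of "\<lambda>z. (v k z, vt k z, g k z)", OF _ K(1) _ ep])
     (use K(2) in "auto simp: zero_prod_def intro!: continuous_intros ansatzD(1,2,4)[OF A]")
 qed
 then obtain m where m: "!!k. m k > 0" "!!k x t. t \<in> {0<..<T} ==> norm ((v k (x, of_int \<lfloor>m k * t\<rfloor> / m k), vt k (x, of_int \<lfloor>m k * t\<rfloor> / m k),
   g k (x, of_int \<lfloor>m k * t\<rfloor> / m k)) - (v k (x, t), vt k (x, t), g k (x, t))) <= \<epsilon> k"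
  by metis
 define s where "s k t = of_int \<lfloor>m k * t\<rfloor> / m k" for k t
 define \<sigma> where "\<sigma> k t = (\<lambda>x. v k (x, s k t))" for k t
 define \<rho> where "\<rho> k t = (\<lambda>x. vt k (x, s k t))" for k t
 have d: "\<bar>v k (x, s k t) - v k (x, t)\<bar> <= \<epsilon> k" "\<bar>vt k (x, s k t) - vt k (x, t)\<bar> <= \<epsilon> k" "norm (g k (x, s k t) - g k (x, t)) <= \<epsilon> k"
  if t: "t \<in> {0<..<T}" for k x t
 proof -
  have n: "norm (v k (x, s k t) - v k (x, t), vt k (x, s k t) - vt k (x, t), g k (x, s k t) - g k (x, t)) <= \<epsilon> k"
   using m(2)[OF t, of k x] by (simp add: s_def)
  show "\<bar>v k (x, s k t) - v k (x, t)\<bar> <= \<epsilon> k"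
   using order_trans[OF norm_fst_le n] by simp
  have n2: "norm (vt k (x, s k t) - vt k (x, t), g k (x, s k t) - g k (x, t)) <= \<epsilon> k" using order_trans[OF norm_snd_le n] .
  show "\<bar>vt k (x, s k t) - vt k (x, t)\<bar> <= \<epsilon> k" using order_trans[OF norm_fst_le n2] by simp
  show "norm (g k (x, s k t) - g k (x, t)) <= \<epsilon> k" using order_trans[OF norm_snd_le n2] .
 qed
 define c where "c = sqrt (measure lebesgue \<Omega>)"
 have ec: "(\<lambda>k. \<epsilon> k * c) \<longlonglongrightarrow> 0"
  unfolding \<epsilon>_def using tendsto_mult_right[OF LIMSEQ_inverse_real_of_nat, of c] by simp
 have L2c: "F \<in> L2 \<Omega>" if "continuous_on UNIV F" "compact K" "!!x. x \<notin> K ==> F x = 0" for F :: "'a => real" and K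
  by (rule L2_of_sq_int[OF sq_int_continuous_compact_support(1)[OF that] Omega_borel])
 have mem: "(\<lambda>x. v k (x, t)) \<in> L2 \<Omega>" "(\<lambda>x. vt k (x, t)) \<in> L2 \<Omega>" "(\<lambda>x. g k (x, t) \<bullet> b) \<in> L2 \<Omega>" for k t b
 proof -
  obtain K where K: "compact K" "!!x t. x \<notin> K ==> v k (x, t) = 0 & vt k (x, t) = 0 & g k (x, t) = 0"
   using ansatz_support[OF A[of k]] by metis
  show "(\<lambda>x. v k (x, t)) \<in> L2 \<Omega>" "(\<lambda>x. vt k (x, t)) \<in> L2 \<Omega>" "(\<lambda>x. g k (x, t) \<bullet> b) \<in> L2 \<Omega>"
   by (rule L2c[OF _ K(1)]; use K(2) in "auto intro!: continuous_intros continuous_slice ansatzD(1,2,4)[OF A]")+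
 qed
 have close: "L2_norm \<Omega> (\<lambda>x. F' x - h x) <= \<epsilon> k * c + L2_norm \<Omega> (\<lambda>x. F x - h x)"
  if F: "F \<in> L2 \<Omega>" "F' \<in> L2 \<Omega>" "h \<in> L2 \<Omega>" and b: "(\<lambda>x. F' x - F x) \<in> borel_measurable borel" "!!x. \<bar>F' x - F x\<bar> <= \<epsilon> k" for F F' h :: "'a => real" and k
 proof -
  have "L2_norm \<Omega> (\<lambda>x. F' x - h x) <= L2_norm \<Omega> (\<lambda>x. F' x - F x) + L2_norm \<Omega> (\<lambda>x. F x - h x)"
   unfolding L2_norm_eq by (rule l2n_triangle_diff) (use F in "simp_all add: L2_iff")
  moreover have "L2_norm \<Omega> (\<lambda>x. F' x - F x) <= \<epsilon> k * c" unfolding c_def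
   by (rule L2_norm_le_sup[OF \<Omega> b(1) less_imp_le[OF ep] b(2)])
  ultimately show ?thesis by simp
 qed
 have cm: "(\<lambda>x. F' x - F x) \<in> borel_measurable borel" if "continuous_on UNIV F" "continuous_on UNIV F'" for F F' :: "'a => real"
  by (intro borel_measurable_continuous_onI continuous_intros that)
 have gsl: "AE t in lborel. \<forall>b\<in>Basis. sq_int lborel (\<lambda>x. gU b (x, t)) & (\<forall>x. x \<notin> \<Omega> --> gU b (x, t) = 0)"
  by (subst AE_ball_countable[OF countable_finite[OF finite_Basis]]) (intro ballI cyl_slices[OF gU_cyl])
 have ae: "AE t in lborel. t \<in> {0<..<T} -->
   (\<lambda>k. L2_norm \<Omega> (\<lambda>x. \<sigma> k t x - tprim wU (x, t))) \<longlonglongrightarrow> 0 \<and>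
   (\<forall>b\<in>Basis. (\<lambda>k. L2_norm \<Omega> (\<lambda>x. pderiv_dir b (\<sigma> k t) x - gU b (x, t))) \<longlonglongrightarrow> 0) \<and>
   (\<lambda>k. L2_norm \<Omega> (\<lambda>x. \<rho> k t x - wU (x, t))) \<longlonglongrightarrow> 0"
  using lim cyl_slices[OF wU_cyl] gsl
 proof eventually_elim
  case (elim t)
  show ?case
  proof (intro impI conjI ballI)
   assume t: "t \<in> {0<..<T}"
   note l = mp[OF elim(1) t]
   have wL: "(\<lambda>x. wU (x, t)) \<in> L2 \<Omega>" by (rule L2_of_sq_int[OF conjunct1[OF elim(2)] Omega_borel])
   have uL: "(\<lambda>x. tprim wU (x, t)) \<in> L2 \<Omega>" by (rule L2_of_sq_int[OF tprim_L2(1)[OF wU_cyl] Omega_borel]) (use t in simp)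
   show "(\<lambda>k. L2_norm \<Omega> (\<lambda>x. \<sigma> k t x - tprim wU (x, t))) \<longlonglongrightarrow> 0"
    by (rule squeeze_0_add[OF ec conjunct1[OF l]])
      (auto simp: \<sigma>_def intro!: close mem uL cm d(1)[OF t] continuous_slice ansatzD(1)[OF A])
   show "(\<lambda>k. L2_norm \<Omega> (\<lambda>x. \<rho> k t x - wU (x, t))) \<longlonglongrightarrow> 0"
    by (rule squeeze_0_add[OF ec conjunct2[OF conjunct2[OF l]]])
      (auto simp: \<rho>_def intro!: close mem wL cm d(2)[OF t] continuous_slice ansatzD(2)[OF A])
   fix b :: 'a assume b: "b \<in> Basis"
   have gL: "(\<lambda>x. gU b (x, t)) \<in> L2 \<Omega>" by (rule L2_of_sq_int[OF conjunct1[OF bspec[OF elim(3) b]] Omega_borel])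
   have p: "pderiv_dir b (\<sigma> k t) x = g k (x, s k t) \<bullet> b" for k x unfolding \<sigma>_def by (rule ansatzD(13)[OF A b])
   have db: "\<bar>g k (x, s k t) \<bullet> b - g k (x, t) \<bullet> b\<bar> <= \<epsilon> k" for k x
    using order_trans[OF Basis_le_norm[OF b] d(3)[OF t, of k x]] by (simp add: inner_diff_left)
   show "(\<lambda>k. L2_norm \<Omega> (\<lambda>x. pderiv_dir b (\<sigma> k t) x - gU b (x, t))) \<longlonglongrightarrow> 0"
    unfolding p
    by (rule squeeze_0_add[OF ec bspec[OF conjunct1[OF conjunct2[OF l]] b]])
      (auto intro!: close mem gL cm db continuous_slice continuous_intros ansatzD(4)[OF A])
  qed
 qed
 have fin: "finite (\<sigma> k ` {0<..<T})" "{t \<in> {0<..<T}. \<sigma> k t = h} \<in> sets lebesgue"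
  "finite (\<rho> k ` {0<..<T})" "{t \<in> {0<..<T}. \<rho> k t = h} \<in> sets lebesgue" for k h
  unfolding \<sigma>_def s_def \<rho>_def
  by (rule step_function_measurable(1)[where \<Phi> = "\<lambda>i x. v k (x, of_int i / m k)"], rule step_function_measurable(2)[where \<Phi> = "\<lambda>i x. v k (x, of_int i / m k)"],
    rule step_function_measurable(1)[where \<Phi> = "\<lambda>i x. vt k (x, of_int i / m k)"], rule step_function_measurable(2)[where \<Phi> = "\<lambda>i x. vt k (x, of_int i / m k)"])
 have val: "\<sigma> k t \<in> test_functions \<Omega>" "\<rho> k t \<in> L2 \<Omega>" for k t
  unfolding \<sigma>_def \<rho>_def by (rule ansatzD(12)[OF A], rule mem(2))
 show ?thesis by (intro exI[of _ \<sigma>] exI[of _ \<rho>] conjI allI fin val ae)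
qed

section \<open>Regularity in time of the limit\<close>

lemma integrable_lebesgue_on:
 fixes F :: "'a::euclidean_space => real"
 assumes F: "integrable lborel F" and S: "S \<in> sets borel"
 shows "integrable (lebesgue_on S) F"
proof -
 have "F \<in> borel_measurable borel" using borel_measurable_integrable[OF F] by simp
 then show ?thesis using lebesgue_on_borel(2)[OF S, of F] integrable_mult_indicator[of S lborel F] F S by simp
qed

lemma slice_norm_integrable:
 assumes \<Omega>: "\<Omega> \<in> sets borel" and h: "h \<in> cyl \<Omega> T"
 shows "integrable (lebesgue_on {0<..<T}) (\<lambda>t. (L2_norm \<Omega> (\<lambda>x. h (x, t)))\<^sup>2)"
proof -
 have "L2_norm \<Omega> (\<lambda>x. h (x, t)) = l2n lborel (\<lambda>x. h (x, t))" for t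
  by (rule L2_norm_lborel[OF \<Omega> cyl_slice_borel[OF h]]) (rule cyl_slice_outside[OF h])
 then show ?thesis using integrable_lebesgue_on[OF sq_int_slices(3)[OF cylD(1)[OF h]], of "{0<..<T}"] by simp
qed

text \<open>Slice by slice, \<open>H10_limit\<close> applies to the step functions; integrability of the
 norms is Fubini for \<open>u\<close> and its slopes.\<close>

lemma (in limit_equation) limit_solution_bochner:
 defines "u \<equiv> tprim wU"
 shows "AE t in lborel. t \<in> {0<..<T} --> time_slice u t \<in> H10 \<Omega> \<and>
   has_weak_gradient \<Omega> (time_slice u t) (\<lambda>x. \<Sum>b\<in>Basis. gU b (x, t) *\<^sub>R b)"
  and "time_slice u \<in> bochner_L2 (H10 \<Omega>) (H1_norm \<Omega>) {0<..<T}"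
  and "time_slice u \<in> bochner_L2 (L2 \<Omega>) (L2_norm \<Omega>) {0<..<T}"
  and "time_slice wU \<in> bochner_L2 (L2 \<Omega>) (L2_norm \<Omega>) {0<..<T}"
proof -
 define G where "G t = (\<lambda>x. \<Sum>b\<in>Basis. gU b (x, t) *\<^sub>R b)" for t
 have Gb: "G t x \<bullet> b = gU b (x, t)" if "b \<in> Basis" for t x b
  unfolding G_def using that by (simp add: inner_sum_left inner_Basis if_distrib cong: if_cong)
 obtain \<sigma> \<rho> :: "nat => real => 'a => real" where
  \<sigma>: "!!k. finite (\<sigma> k ` {0<..<T})" "!!k h. {t \<in> {0<..<T}. \<sigma> k t = h} \<in> sets lebesgue" "!!k t. \<sigma> k t \<in> test_functions \<Omega>" and
  \<rho>: "!!k. finite (\<rho> k ` {0<..<T})" "!!k h. {t \<in> {0<..<T}. \<rho> k t = h} \<in> sets lebesgue" "!!k t. \<rho> k t \<in> L2 \<Omega>" and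
  lim: "AE t in lborel. t \<in> {0<..<T} -->
   (\<lambda>k. L2_norm \<Omega> (\<lambda>x. \<sigma> k t x - tprim wU (x, t))) \<longlonglongrightarrow> 0 \<and>
   (\<forall>b\<in>Basis. (\<lambda>k. L2_norm \<Omega> (\<lambda>x. pderiv_dir b (\<sigma> k t) x - gU b (x, t))) \<longlonglongrightarrow> 0) \<and>
   (\<lambda>k. L2_norm \<Omega> (\<lambda>x. \<rho> k t x - wU (x, t))) \<longlonglongrightarrow> 0"
  using limit_solution_steps by blast
 have gsl: "AE t in lborel. \<forall>b\<in>Basis. sq_int lborel (\<lambda>x. gU b (x, t)) & (\<forall>x. x \<notin> \<Omega> --> gU b (x, t) = 0)"
  by (subst AE_ball_countable[OF countable_finite[OF finite_Basis]]) (intro ballI cyl_slices[OF gU_cyl])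
 have uL: "time_slice u t \<in> L2 \<Omega>" if "t \<in> {0<..<T}" for t
  unfolding u_def time_slice_def[abs_def] by (rule L2_of_sq_int[OF tprim_L2(1)[OF wU_cyl] Omega_borel]) (use that in simp)
 have main: "AE t in lborel. t \<in> {0<..<T} --> time_slice u t \<in> H10 \<Omega> & has_weak_gradient \<Omega> (time_slice u t) (G t) \<and>
   (\<lambda>k. H1_norm \<Omega> (\<lambda>x. \<sigma> k t x - time_slice u t x)) \<longlonglongrightarrow> 0"
  using lim gsl
 proof eventually_elim
  case (elim t)
  show ?case
  proof
   assume t: "t \<in> {0<..<T}"
   note l = mp[OF elim(1) t]
   have GL: "(\<lambda>x. G t x \<bullet> b) \<in> L2 \<Omega>" if "b \<in> Basis" for b
    unfolding Gb[OF that] by (rule L2_of_sq_int[OF conjunct1[OF bspec[OF elim(2) that]] Omega_borel])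
   have 1: "(\<lambda>k. L2_norm \<Omega> (\<lambda>x. \<sigma> k t x - time_slice u t x)) \<longlonglongrightarrow> 0"
    using conjunct1[OF l] unfolding u_def time_slice_def .
   have 2: "(\<lambda>k. L2_norm \<Omega> (\<lambda>x. pderiv_dir b (\<sigma> k t) x - G t x \<bullet> b)) \<longlonglongrightarrow> 0" if "b \<in> Basis" for b
    unfolding Gb[OF that] by (rule bspec[OF conjunct1[OF conjunct2[OF l]] that])
   show "time_slice u t \<in> H10 \<Omega> & has_weak_gradient \<Omega> (time_slice u t) (G t) \<and>
     (\<lambda>k. H1_norm \<Omega> (\<lambda>x. \<sigma> k t x - time_slice u t x)) \<longlonglongrightarrow> 0"
    by (intro conjI H10_limit[OF \<Omega>(1) \<sigma>(3) uL[OF t] GL 1 2])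
  qed
 qed
 then show "AE t in lborel. t \<in> {0<..<T} --> time_slice u t \<in> H10 \<Omega> \<and>
   has_weak_gradient \<Omega> (time_slice u t) (\<lambda>x. \<Sum>b\<in>Basis. gU b (x, t) *\<^sub>R b)"
  unfolding G_def by eventually_elim simp
 define u1 where "u1 z = indicator (cylinder \<Omega> T) z * u z" for z
 have u1c: "u1 \<in> cyl \<Omega> T" unfolding u1_def[abs_def] u_def using tprim_cyl[OF wU_cyl Omega_borel] T by simp
 have u1: "time_slice u t = (\<lambda>x. u1 (x, t))" if "t \<in> {0<..<T}" for t
  using that by (auto simp: fun_eq_iff time_slice_def u1_def u_def indicator_def tprim_outside[OF wU_cyl])
 have iu: "integrable (lebesgue_on {0<..<T}) (\<lambda>t. (L2_norm \<Omega> (time_slice u t))\<^sup>2)"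
  by (rule iffD1[OF Bochner_Integration.integrable_cong[OF refl] slice_norm_integrable[OF Omega_borel u1c]]) (simp add: u1)
 have iw: "integrable (lebesgue_on {0<..<T}) (\<lambda>t. (L2_norm \<Omega> (time_slice wU t))\<^sup>2)"
  unfolding time_slice_def[abs_def] by (rule slice_norm_integrable[OF Omega_borel wU_cyl])
 have ig: "integrable (lebesgue_on {0<..<T}) (\<lambda>t. (L2_norm \<Omega> (\<lambda>x. gU b (x, t)))\<^sup>2)" for b by (rule slice_norm_integrable[OF Omega_borel gU_cyl])
 define N where "N t = (L2_norm \<Omega> (time_slice u t))\<^sup>2 + (\<Sum>b\<in>Basis. (L2_norm \<Omega> (\<lambda>x. gU b (x, t)))\<^sup>2)" for t
 have iN: "integrable (lebesgue_on {0<..<T}) N"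
  unfolding N_def by (intro Bochner_Integration.integrable_add Bochner_Integration.integrable_sum iu ig)
 have Neq: "AE t in lebesgue_on {0<..<T}. (H1_norm \<Omega> (time_slice u t))\<^sup>2 = N t"
  unfolding AE_on_iff[OF I_borel] using main
 proof eventually_elim
  case (elim t)
  show ?case
  proof
   assume t: "t \<in> {0<..<T}"
   have "(\<Sum>b\<in>Basis. (L2_norm \<Omega> (\<lambda>x. G t x \<bullet> b))\<^sup>2) = (\<Sum>b\<in>Basis. (L2_norm \<Omega> (\<lambda>x. gU b (x, t)))\<^sup>2)"
    by (rule sum.cong[OF refl]) (simp only: Gb)
   then have "H1_norm \<Omega> (time_slice u t) = sqrt (N t)"
    using H1_norm_eq[OF \<Omega>(1) conjunct1[OF conjunct2[OF mp[OF elim t]]] uL[OF t]] unfolding N_def by simp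
   moreover have "0 <= N t" unfolding N_def by (intro add_nonneg_nonneg sum_nonneg) auto
   ultimately show "(H1_norm \<Omega> (time_slice u t))\<^sup>2 = N t" by simp
  qed
 qed
 have iH: "integrable (lebesgue_on {0<..<T}) (\<lambda>t. (H1_norm \<Omega> (time_slice u t))\<^sup>2)"
 proof (rule integrable_cong_AE_imp[OF iN])
  show "(\<lambda>t. (H1_norm \<Omega> (time_slice u t))\<^sup>2) \<in> borel_measurable (lebesgue_on {0<..<T})"
   by (rule measurable_lebesgue_on_AE[OF I_borel borel_measurable_integrable[OF iN] Neq])
 qed (use Neq in "eventually_elim, simp")
 show "time_slice u \<in> bochner_L2 (H10 \<Omega>) (H1_norm \<Omega>) {0<..<T}"
  unfolding bochner_L2_def strongly_measurable_into_def AE_on_iff[OF I_borel]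
 proof (intro CollectI conjI exI[of _ \<sigma>] allI)
  show "\<sigma> k ` {0<..<T} \<subseteq> H10 \<Omega>" for k using test_H10[OF \<Omega>(1) \<sigma>(3)] by blast
  show "AE t in lborel. t \<in> {0<..<T} --> time_slice u t \<in> H10 \<Omega>" using main by eventually_elim simp
  show "AE t in lborel. t \<in> {0<..<T} --> (\<lambda>k. H1_norm \<Omega> (\<lambda>x. \<sigma> k t x - time_slice u t x)) \<longlonglongrightarrow> 0"
   using main by eventually_elim simp
 qed (rule \<sigma>(1) \<sigma>(2) iH)+
 show "time_slice u \<in> bochner_L2 (L2 \<Omega>) (L2_norm \<Omega>) {0<..<T}"
  unfolding bochner_L2_def strongly_measurable_into_def AE_on_iff[OF I_borel]
 proof (intro CollectI conjI exI[of _ \<sigma>] allI)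
  show "\<sigma> k ` {0<..<T} \<subseteq> L2 \<Omega>" for k using test_L2[OF \<sigma>(3) \<Omega>(1)] by blast
  show "AE t in lborel. t \<in> {0<..<T} --> time_slice u t \<in> L2 \<Omega>" using uL by simp
  show "AE t in lborel. t \<in> {0<..<T} --> (\<lambda>k. L2_norm \<Omega> (\<lambda>x. \<sigma> k t x - time_slice u t x)) \<longlonglongrightarrow> 0"
   using lim unfolding u_def time_slice_def by eventually_elim simp
 qed (rule \<sigma>(1) \<sigma>(2) iu)+
 show "time_slice wU \<in> bochner_L2 (L2 \<Omega>) (L2_norm \<Omega>) {0<..<T}"
  unfolding bochner_L2_def strongly_measurable_into_def AE_on_iff[OF I_borel]
 proof (intro CollectI conjI exI[of _ \<rho>] allI)
  show "\<rho> k ` {0<..<T} \<subseteq> L2 \<Omega>" for k using \<rho>(3) by blast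
  show "AE t in lborel. t \<in> {0<..<T} --> time_slice wU t \<in> L2 \<Omega>"
   using cyl_slices[OF wU_cyl]
  proof eventually_elim
   case (elim t)
   show ?case unfolding time_slice_def[abs_def] using L2_of_sq_int[OF conjunct1[OF elim] Omega_borel] by simp
  qed
  show "AE t in lborel. t \<in> {0<..<T} --> (\<lambda>k. L2_norm \<Omega> (\<lambda>x. \<rho> k t x - time_slice wU t x)) \<longlonglongrightarrow> 0"
   using lim unfolding time_slice_def by eventually_elim simp
 qed (rule \<rho>(1) \<rho>(2) iw)+
qed

lemma tprim_increment:
 assumes \<Omega>: "\<Omega> \<in> sets borel" and h: "h \<in> cyl \<Omega> T" and st: "0 <= s" "0 <= t"
 shows "L2_norm \<Omega> (\<lambda>x. tprim h (x, s) - tprim h (x, t)) <= sqrt \<bar>s - t\<bar> * l2n lborel h"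
proof -
 have "L2_norm \<Omega> (\<lambda>x. tprim h (x, s) - tprim h (x, t)) = l2n lborel (\<lambda>x. tprim h (x, s) - tprim h (x, t))"
  by (rule L2_norm_lborel[OF \<Omega>]) (use tprim_slice_borel[OF h] in "simp_all add: tprim_outside[OF h]")
 also have "\<dots> <= sqrt \<bar>s - t\<bar> * l2n lborel h"
 proof (cases "s <= t")
  case True
  then show ?thesis using tprim_L2_diff(2)[OF h st(1) True] unfolding l2n_minus_commute[of _ "\<lambda>x. tprim h (x, s)"] by simp
 next
  case False
  then show ?thesis using tprim_L2_diff(2)[OF h st(2), of s] by simp
 qed
 finally show ?thesis .
qed

lemma tprim_increment_tendsto:
 assumes \<Omega>: "\<Omega> \<in> sets borel" and h: "h \<in> cyl \<Omega> T" and t: "t \<in> {0..T}"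
 shows "((\<lambda>s. L2_norm \<Omega> (\<lambda>x. tprim h (x, s) - tprim h (x, t))) \<longlongrightarrow> 0) (at t within {0..T})"
proof (rule Lim_null_comparison)
 show "\<forall>\<^sub>F s in at t within {0..T}. norm (L2_norm \<Omega> (\<lambda>x. tprim h (x, s) - tprim h (x, t))) <= sqrt \<bar>s - t\<bar> * l2n lborel h"
  unfolding eventually_at_filter by (rule always_eventually) (use tprim_increment[OF \<Omega> h] t in auto)
 have "((\<lambda>s. sqrt \<bar>s - t\<bar> * l2n lborel h) \<longlongrightarrow> sqrt \<bar>t - t\<bar> * l2n lborel h) (at t within {0..T})"
  by (intro tendsto_intros)
 then show "((\<lambda>s. sqrt \<bar>s - t\<bar> * l2n lborel h) \<longlongrightarrow> 0) (at t within {0..T})" by simp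
qed

lemma primitive_weak_time_deriv:
 fixes \<Omega> :: "'a::euclidean_space set"
 assumes \<Omega>: "open \<Omega>" and T: "0 < T" and w: "w \<in> cyl \<Omega> T" "time_slice w \<in> bochner_L2 (L2 \<Omega>) (L2_norm \<Omega>) {0<..<T}"
 shows "has_weak_time_deriv \<Omega> T (time_slice (tprim w)) (time_slice w)"
 unfolding has_weak_time_deriv_def
proof (intro conjI ballI w(2))
 fix \<phi> \<psi> assume \<phi>: "\<phi> \<in> test_functions {0<..<T}" and \<psi>: "\<psi> \<in> L2 \<Omega>"
 have Omega_borel: "\<Omega> \<in> sets borel" using \<Omega> by (rule borel_open)
 obtain \<psi>0 where \<psi>0: "sq_int lborel \<psi>0" "!!x. x \<notin> \<Omega> ==> \<psi>0 x = 0" "AE x in lebesgue_on \<Omega>. \<psi> x = \<psi>0 x" using L2_rep[OF Omega_borel \<psi>] by blast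
 have \<psi>b: "\<psi>0 \<in> borel_measurable borel" "eq_ae \<Omega> \<psi> \<psi>0" using \<psi>0 by (auto simp: eq_ae_def dest: sq_int_measurable)
 define k where "k t = (LBINT x. w (x, t) * \<psi>0 x)" for t
 note W = slice_inner[OF w(1) \<psi>0(1), folded k_def]
 have 1: "L2_inner \<Omega> (time_slice (tprim w) t) \<psi> = prim k t" for t
  unfolding W(4)[symmetric] time_slice_def[abs_def]
  by (rule L2_inner_rep[OF Omega_borel tprim_slice_borel[OF w(1)] eq_ae_refl \<psi>b]) (simp add: \<psi>0(2))
 have 2: "L2_inner \<Omega> (time_slice w t) \<psi> = k t" for t
  unfolding k_def time_slice_def[abs_def]
  by (rule L2_inner_rep[OF Omega_borel cyl_slice_borel[OF w(1)] eq_ae_refl \<psi>b]) (simp add: \<psi>0(2))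
 note s = test_smooth[OF \<phi>]
 have km: "k \<in> borel_measurable borel" using sq_int_measurable[OF W(2)] by simp
 have \<phi>m: "\<phi> \<in> borel_measurable borel" "pderiv_dir 1 \<phi> \<in> borel_measurable borel"
  by (rule test_borel[OF \<phi>], rule test_borel[OF test_pderiv[OF \<phi>]]) simp
 have "(LINT t|lebesgue_on {0<..<T}. deriv \<phi> t * prim k t) = (LBINT t. indicator {0<..<T} t *\<^sub>R (pderiv_dir 1 \<phi> t * prim k t))"
  unfolding smooth_deriv[OF s] by (rule lebesgue_on_borel(1)) (use \<phi>m km prim_borel[OF km] in auto)
 also have "\<dots> = (LBINT t. indicator {0<..<T} t * ((\<phi> T - \<phi> t) * k t))"
  using prim_by_parts[OF W(1) less_imp_le[OF T] smooth_has_real_derivative[OF s] smooth_continuous[OF smooth_pderiv[OF s]]] by simp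
 also have "\<dots> = - (LBINT t. indicator {0<..<T} t *\<^sub>R (\<phi> t * k t))" using test_outside[OF \<phi>, of T] by simp
 also have "(LBINT t. indicator {0<..<T} t *\<^sub>R (\<phi> t * k t)) = (LINT t|lebesgue_on {0<..<T}. \<phi> t * k t)"
  by (rule lebesgue_on_borel(1)[symmetric]) (use \<phi>m km in auto)
 finally show "(LINT t|lebesgue_on {0<..<T}. deriv \<phi> t * L2_inner \<Omega> (time_slice (tprim w) t) \<psi>)
   = - (LINT t|lebesgue_on {0<..<T}. \<phi> t * L2_inner \<Omega> (time_slice w t) \<psi>)"
  unfolding 1 2 .
qed

lemma primitive_H1_time_0:
 fixes \<Omega> :: "'a::euclidean_space set"
 assumes \<Omega>: "open \<Omega>" and T: "0 < T" and w: "w \<in> cyl \<Omega> T" "time_slice w \<in> bochner_L2 (L2 \<Omega>) (L2_norm \<Omega>) {0<..<T}"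
  and u: "time_slice (tprim w) \<in> bochner_L2 (L2 \<Omega>) (L2_norm \<Omega>) {0<..<T}"
 shows "time_slice (tprim w) \<in> H1_time_0 \<Omega> T"
proof -
 have Omega_borel: "\<Omega> \<in> sets borel" using \<Omega> by (rule borel_open)
 have "continuous_into (L2 \<Omega>) (L2_norm \<Omega>) {0..T} (time_slice (tprim w))"
  unfolding continuous_into_def time_slice_def[abs_def]
  by (intro ballI conjI tprim_increment_tendsto[OF Omega_borel w(1)] L2_of_sq_int[OF tprim_L2(1)[OF w(1)] Omega_borel]) auto
 moreover have "eq_ae \<Omega> (time_slice (tprim w) 0) (\<lambda>x. 0)" by (simp add: time_slice_def[abs_def])
 ultimately show ?thesis
  unfolding H1_time_0_def H1_time_def using u primitive_weak_time_deriv[OF \<Omega> T w] by fastforce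
qed

section \<open>The limit belongs to the solution space\<close>

lemma gradient_functional_bound:
 fixes \<Omega> :: "'a::euclidean_space set" and q :: "'a => 'a => real"
 assumes p: "p \<in> L2 \<Omega>" and q: "!!b. b \<in> Basis ==> q b \<in> L2 \<Omega>" and \<xi>: "\<xi> \<in> H10 \<Omega>"
 shows "\<bar>L2_inner \<Omega> p \<xi> - (\<Sum>b\<in>Basis. L2_inner \<Omega> (q b) (\<lambda>x. weak_gradient \<Omega> \<xi> x \<bullet> b))\<bar>
  <= (L2_norm \<Omega> p + (\<Sum>b\<in>Basis. L2_norm \<Omega> (q b))) * H1_norm \<Omega> \<xi>"
proof -
 have 1: "\<bar>L2_inner \<Omega> p \<xi>\<bar> <= L2_norm \<Omega> p * H1_norm \<Omega> \<xi>"
  by (rule order_trans[OF L2_Cauchy_Schwarz[OF p H10_L2[OF \<xi>]]]) (intro mult_left_mono L2_norm_le_H1_norm L2_norm_nonneg)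
 have 2: "\<bar>L2_inner \<Omega> (q b) (\<lambda>x. weak_gradient \<Omega> \<xi> x \<bullet> b)\<bar> <= L2_norm \<Omega> (q b) * H1_norm \<Omega> \<xi>" if b: "b \<in> Basis" for b
  by (rule order_trans[OF L2_Cauchy_Schwarz[OF q[OF b] gradient_L2[OF H10_gradient[OF \<xi>] b]]])
    (intro mult_left_mono weak_gradient_norm_le_H1_norm[OF b] L2_norm_nonneg)
 have "\<bar>\<Sum>b\<in>Basis. L2_inner \<Omega> (q b) (\<lambda>x. weak_gradient \<Omega> \<xi> x \<bullet> b)\<bar> <= (\<Sum>b\<in>Basis. L2_norm \<Omega> (q b) * H1_norm \<Omega> \<xi>)"
  by (rule order_trans[OF sum_abs]) (rule sum_mono[OF 2])
 with 1 show ?thesis unfolding distrib_right sum_distrib_right by linarith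
qed

lemma dual_norm_bound:
 fixes \<Omega> :: "'a::euclidean_space set"
 assumes \<Omega>: "open \<Omega>" and B: "0 <= B" "!!\<xi>. \<xi> \<in> H10 \<Omega> ==> \<bar>F \<xi>\<bar> <= B * H1_norm \<Omega> \<xi>"
 shows "\<bar>dual_norm (H10 \<Omega>) (H1_norm \<Omega>) F\<bar> <= B"
proof -
 let ?X = "{\<xi> \<in> H10 \<Omega>. H1_norm \<Omega> \<xi> <= 1}"
 have z: "(\<lambda>x. 0) \<in> ?X" using test_H10[OF \<Omega> test_zero] H1_norm_cmult_test[OF \<Omega> test_zero, of 0] by simp
 have b: "\<bar>F \<xi>\<bar> <= B" if "\<xi> \<in> ?X" for \<xi>
 proof -
  have "\<bar>F \<xi>\<bar> <= B * H1_norm \<Omega> \<xi>" using B(2) that by blast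
  also have "\<dots> <= B * 1" using that by (intro mult_left_mono B(1)) blast
  finally show ?thesis by simp
 qed
 have "dual_norm (H10 \<Omega>) (H1_norm \<Omega>) F <= B"
  unfolding dual_norm_def by (rule cSUP_least) (use z b in blast)+
 moreover have "0 <= dual_norm (H10 \<Omega>) (H1_norm \<Omega>) F"
 proof -
  have "\<bar>F (\<lambda>x. 0)\<bar> <= dual_norm (H10 \<Omega>) (H1_norm \<Omega>) F"
   unfolding dual_norm_def by (rule cSUP_upper[OF z]) (use b in "auto intro!: bdd_aboveI[of _ B]")
  then show ?thesis by (rule order_trans[OF abs_ge_zero])
 qed
 ultimately show ?thesis by simp
qed

lemma weak_gradient_inner_add:
 fixes \<Omega> :: "'a::euclidean_space set"
 assumes \<Omega>: "open \<Omega>" and p: "p \<in> L2 \<Omega>" and u: "u \<in> H10 \<Omega>" "v \<in> H10 \<Omega>" and b: "b \<in> Basis"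
 shows "L2_inner \<Omega> p (\<lambda>x. weak_gradient \<Omega> (\<lambda>x. u x + v x) x \<bullet> b)
  = L2_inner \<Omega> p (\<lambda>x. weak_gradient \<Omega> u x \<bullet> b) + L2_inner \<Omega> p (\<lambda>x. weak_gradient \<Omega> v x \<bullet> b)"
proof -
 note G = has_weak_gradient_add[OF \<Omega> H10_L2[OF u(1)] H10_L2[OF u(2)] H10_gradient[OF u(1)] H10_gradient[OF u(2)]]
 have H: "has_weak_gradient \<Omega> (\<lambda>x. u x + v x) (weak_gradient \<Omega> (\<lambda>x. u x + v x))"
  by (rule has_weak_gradient_weak_gradient[OF H1I[OF L2_add[OF H10_L2[OF u(1)] H10_L2[OF u(2)]] G]])
 note c = gradient_L2[OF H b] gradient_L2[OF G b]
  gradient_L2[OF H10_gradient[OF u(1)] b] gradient_L2[OF H10_gradient[OF u(2)] b]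
 have "L2_inner \<Omega> p (\<lambda>x. weak_gradient \<Omega> (\<lambda>x. u x + v x) x \<bullet> b) = L2_inner \<Omega> p (\<lambda>x. (weak_gradient \<Omega> u x + weak_gradient \<Omega> v x) \<bullet> b)"
  by (rule L2_inner_cong_AE) (use L2_measurable[OF p] L2_measurable[OF c(1)] L2_measurable[OF c(2)] weak_gradient_unique[OF \<Omega> H G b] in auto)
 then show ?thesis unfolding L2_inner_commute[of \<Omega> p] inner_add_left by (simp only: L2_inner_add_left[OF c(3,4) p])
qed

lemma weak_gradient_inner_cmult:
 fixes \<Omega> :: "'a::euclidean_space set"
 assumes \<Omega>: "open \<Omega>" and p: "p \<in> L2 \<Omega>" and u: "u \<in> H10 \<Omega>" and b: "b \<in> Basis"
 shows "L2_inner \<Omega> p (\<lambda>x. weak_gradient \<Omega> (\<lambda>x. c * u x) x \<bullet> b) = c * L2_inner \<Omega> p (\<lambda>x. weak_gradient \<Omega> u x \<bullet> b)"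
proof -
 note G = has_weak_gradient_cmult[OF H10_gradient[OF u], of c]
 have H: "has_weak_gradient \<Omega> (\<lambda>x. c * u x) (weak_gradient \<Omega> (\<lambda>x. c * u x))"
  by (rule has_weak_gradient_weak_gradient[OF H1I[OF L2_cmult[OF H10_L2[OF u]] G]])
 have "L2_inner \<Omega> p (\<lambda>x. weak_gradient \<Omega> (\<lambda>x. c * u x) x \<bullet> b) = L2_inner \<Omega> p (\<lambda>x. (c *\<^sub>R weak_gradient \<Omega> u x) \<bullet> b)"
  by (rule L2_inner_cong_AE) (use L2_measurable[OF p] L2_measurable[OF gradient_L2[OF H b]]
    L2_measurable[OF gradient_L2[OF G b]] weak_gradient_unique[OF \<Omega> H G b] in auto)
 then show ?thesis unfolding L2_inner_commute[of \<Omega> p] inner_scaleR_left by (simp only: L2_inner_cmult_left)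
qed

text \<open>The flux is built from primitives in time, which are continuous with values in
 \<open>L\<^sup>2\<close>.\<close>

lemma flux_continuous_into_dual:
 fixes \<Omega> :: "'a::euclidean_space set"
 assumes \<Omega>: "open \<Omega>" and f: "f \<in> cyl \<Omega> T" and g: "!!b. g b \<in> cyl \<Omega> T"
 shows "continuous_into (dual_space (H10 \<Omega>) (H1_norm \<Omega>)) (dual_norm (H10 \<Omega>) (H1_norm \<Omega>)) {0..T} (flux \<Omega> f g)"
 unfolding continuous_into_def
proof (intro ballI conjI)
 have Omega_borel: "\<Omega> \<in> sets borel" using \<Omega> by (rule borel_open)
 have L: "(\<lambda>x. tprim h (x, t)) \<in> L2 \<Omega>" if "h \<in> cyl \<Omega> T" "t \<in> {0..T}" for h t
  by (rule L2_of_sq_int[OF tprim_L2(1)[OF that(1)] Omega_borel]) (use that in simp)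
 fix t assume t: "t \<in> {0..T}"
 show "flux \<Omega> f g t \<in> dual_space (H10 \<Omega>) (H1_norm \<Omega>)"
  unfolding dual_space_def
 proof (intro CollectI conjI ballI allI exI)
  fix u v :: "'a => real" assume u: "u \<in> H10 \<Omega>" and v: "v \<in> H10 \<Omega>"
  have "(\<Sum>b\<in>Basis. L2_inner \<Omega> (\<lambda>x. tprim (g b) (x, t)) (\<lambda>x. weak_gradient \<Omega> (\<lambda>x. u x + v x) x \<bullet> b))
    = (\<Sum>b\<in>Basis. L2_inner \<Omega> (\<lambda>x. tprim (g b) (x, t)) (\<lambda>x. weak_gradient \<Omega> u x \<bullet> b))
     + (\<Sum>b\<in>Basis. L2_inner \<Omega> (\<lambda>x. tprim (g b) (x, t)) (\<lambda>x. weak_gradient \<Omega> v x \<bullet> b))"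
   unfolding sum.distrib[symmetric] by (rule sum.cong[OF refl]) (rule weak_gradient_inner_add[OF \<Omega> L[OF g t] u v])
  moreover have "L2_inner \<Omega> (\<lambda>x. tprim f (x, t)) (\<lambda>x. u x + v x) = L2_inner \<Omega> (\<lambda>x. tprim f (x, t)) u + L2_inner \<Omega> (\<lambda>x. tprim f (x, t)) v"
   unfolding L2_inner_commute[of \<Omega> "\<lambda>x. tprim f (x, t)"] by (rule L2_inner_add_left[OF H10_L2[OF u] H10_L2[OF v] L[OF f t]])
  ultimately show "flux \<Omega> f g t (\<lambda>x. u x + v x) = flux \<Omega> f g t u + flux \<Omega> f g t v" unfolding flux_def by linarith
 next
  fix c and u :: "'a => real" assume u: "u \<in> H10 \<Omega>"
  have "(\<Sum>b\<in>Basis. L2_inner \<Omega> (\<lambda>x. tprim (g b) (x, t)) (\<lambda>x. weak_gradient \<Omega> (\<lambda>x. c * u x) x \<bullet> b))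
    = c * (\<Sum>b\<in>Basis. L2_inner \<Omega> (\<lambda>x. tprim (g b) (x, t)) (\<lambda>x. weak_gradient \<Omega> u x \<bullet> b))"
   unfolding sum_distrib_left by (rule sum.cong[OF refl]) (rule weak_gradient_inner_cmult[OF \<Omega> L[OF g t] u])
  moreover have "L2_inner \<Omega> (\<lambda>x. tprim f (x, t)) (\<lambda>x. c * u x) = c * L2_inner \<Omega> (\<lambda>x. tprim f (x, t)) u"
   unfolding L2_inner_commute[of \<Omega> "\<lambda>x. tprim f (x, t)"] by (rule L2_inner_cmult_left)
  ultimately show "flux \<Omega> f g t (\<lambda>x. c * u x) = c * flux \<Omega> f g t u" unfolding flux_def by (simp add: right_diff_distrib)
 next
  fix u :: "'a => real" assume u: "u \<in> H10 \<Omega>"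
  show "\<bar>flux \<Omega> f g t u\<bar> <= (L2_norm \<Omega> (\<lambda>x. tprim f (x, t)) + (\<Sum>b\<in>Basis. L2_norm \<Omega> (\<lambda>x. tprim (g b) (x, t)))) * H1_norm \<Omega> u"
   unfolding flux_def by (rule gradient_functional_bound[OF L[OF f t] L[OF g t] u])
 qed
 define D where "D s = L2_norm \<Omega> (\<lambda>x. tprim f (x, s) - tprim f (x, t)) + (\<Sum>b\<in>Basis. L2_norm \<Omega> (\<lambda>x. tprim (g b) (x, s) - tprim (g b) (x, t)))" for s
 have D: "\<bar>flux \<Omega> f g s \<xi> - flux \<Omega> f g t \<xi>\<bar> <= D s * H1_norm \<Omega> \<xi>" if s: "s \<in> {0..T}" and \<xi>: "\<xi> \<in> H10 \<Omega>" for s \<xi>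
 proof -
  have gs: "(\<Sum>b\<in>Basis. L2_inner \<Omega> (\<lambda>x. tprim (g b) (x, s) - tprim (g b) (x, t)) (\<lambda>x. weak_gradient \<Omega> \<xi> x \<bullet> b))
    = (\<Sum>b\<in>Basis. L2_inner \<Omega> (\<lambda>x. tprim (g b) (x, s)) (\<lambda>x. weak_gradient \<Omega> \<xi> x \<bullet> b))
     - (\<Sum>b\<in>Basis. L2_inner \<Omega> (\<lambda>x. tprim (g b) (x, t)) (\<lambda>x. weak_gradient \<Omega> \<xi> x \<bullet> b))"
   unfolding sum_subtractf[symmetric]
   by (rule sum.cong[OF refl]) (rule L2_inner_diff_left[OF L[OF g s] L[OF g t] gradient_L2[OF H10_gradient[OF \<xi>]]])
  have "flux \<Omega> f g s \<xi> - flux \<Omega> f g t \<xi> = L2_inner \<Omega> (\<lambda>x. tprim f (x, s) - tprim f (x, t)) \<xi>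
    - (\<Sum>b\<in>Basis. L2_inner \<Omega> (\<lambda>x. tprim (g b) (x, s) - tprim (g b) (x, t)) (\<lambda>x. weak_gradient \<Omega> \<xi> x \<bullet> b))"
   unfolding gs L2_inner_diff_left[OF L[OF f s] L[OF f t] H10_L2[OF \<xi>]] flux_def by linarith
  then show ?thesis unfolding D_def
   using gradient_functional_bound[OF L2_diff[OF L[OF f s] L[OF f t]] L2_diff[OF L[OF g s] L[OF g t]] \<xi>] by simp
 qed
 show "((\<lambda>s. dual_norm (H10 \<Omega>) (H1_norm \<Omega>) (\<lambda>x. flux \<Omega> f g s x - flux \<Omega> f g t x)) \<longlongrightarrow> 0) (at t within {0..T})"
 proof (rule Lim_null_comparison)
  have D0: "0 <= D s" for s unfolding D_def by (intro add_nonneg_nonneg sum_nonneg L2_norm_nonneg)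
  show "\<forall>\<^sub>F s in at t within {0..T}. norm (dual_norm (H10 \<Omega>) (H1_norm \<Omega>) (\<lambda>x. flux \<Omega> f g s x - flux \<Omega> f g t x)) <= D s"
   unfolding eventually_at_filter real_norm_def by (rule always_eventually) (intro allI impI dual_norm_bound[OF \<Omega> D0 D])
  have "(D \<longlongrightarrow> 0 + (\<Sum>b\<in>(Basis :: 'a set). 0)) (at t within {0..T})"
   unfolding D_def[abs_def] by (intro tendsto_add tendsto_sum tprim_increment_tendsto[OF Omega_borel _ t] f g)
  then show "(D \<longlongrightarrow> 0) (at t within {0..T})" by simp
 qed
qed

lemma flux_test:
 fixes \<Omega> :: "'a::euclidean_space set"
 assumes \<Omega>: "open \<Omega>" and f: "f \<in> cyl \<Omega> T" and g: "!!b. g b \<in> cyl \<Omega> T" and t: "0 <= t" and \<xi>: "\<xi> \<in> test_functions \<Omega>"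
 shows "flux \<Omega> f g t \<xi> = (LBINT x. tprim f (x, t) * \<xi> x) - (\<Sum>b\<in>Basis. (LBINT x. tprim (g b) (x, t) * pderiv_dir b \<xi> x))"
proof -
 have Omega_borel: "\<Omega> \<in> sets borel" using \<Omega> by (rule borel_open)
 note G = has_weak_gradient_test[OF \<Omega> \<xi>]
 note H = H10_gradient[OF test_H10[OF \<Omega> \<xi>]]
 have r: "L2_inner \<Omega> (\<lambda>x. tprim h (x, t)) \<psi> = (LBINT x. tprim h (x, t) * \<psi> x)" if "h \<in> cyl \<Omega> T" "\<psi> \<in> test_functions \<Omega>" for h \<psi>
  by (rule L2_inner_lborel[OF Omega_borel tprim_slice_borel[OF that(1)] test_borel[OF that(2)]]) (simp add: test_outside[OF that(2)])
 have "L2_inner \<Omega> (\<lambda>x. tprim (g b) (x, t)) (\<lambda>x. weak_gradient \<Omega> \<xi> x \<bullet> b) = (LBINT x. tprim (g b) (x, t) * pderiv_dir b \<xi> x)"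
  if b: "b \<in> Basis" for b
 proof -
  have ae: "AE x in lebesgue_on \<Omega>. weak_gradient \<Omega> \<xi> x \<bullet> b = pderiv_dir b \<xi> x"
   using weak_gradient_unique[OF \<Omega> H G b] unfolding grad_component[OF b] .
  have "L2_inner \<Omega> (\<lambda>x. tprim (g b) (x, t)) (\<lambda>x. weak_gradient \<Omega> \<xi> x \<bullet> b) = L2_inner \<Omega> (\<lambda>x. tprim (g b) (x, t)) (pderiv_dir b \<xi>)"
   by (rule L2_inner_cong_AE[OF _ _ L2_measurable[OF gradient_L2[OF H b]] _ _ ae])
     (use borel_on[OF tprim_slice_borel[OF g]] borel_on[OF test_borel[OF test_pderiv[OF \<xi> b]]] in auto)
  then show ?thesis unfolding r[OF g test_pderiv[OF \<xi> b]] .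
 qed
 then show ?thesis unfolding flux_def r[OF f \<xi>] by simp
qed

text \<open>Integration by parts in time trades \<open>\<partial>\<^sub>t\<partial>\<^sub>t\<psi>\<close>
 against \<open>-\<partial>\<^sub>t\<psi>\<close> tested with the velocity, and for the velocity the flux
 may be substituted, with \<open>\<partial>\<^sub>t\<psi>\<close> at a fixed time as test function. A second
 integration by parts in time removes the primitives from the flux.\<close>

lemma (in limit_equation) limit_solution_has_box:
 shows "has_box (cylinder \<Omega> T) (tprim wU) f"
 unfolding has_box_def
proof (intro conjI ballI)
 let ?Q = "cylinder \<Omega> T"
 let ?R = "\<lambda>h z. indicator ?Q z * tprim h z"
 have Rc: "?R h \<in> cyl \<Omega> T" if "h \<in> cyl \<Omega> T" for h using tprim_cyl[OF that Omega_borel] T by simp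
 show "f \<in> L2 ?Q" by (rule L2_of_sq_int[OF cylD(1)[OF f] Q_borel])
 fix \<psi> :: "'a \<times> real => real" assume \<psi>: "\<psi> \<in> test_functions ?Q"
 have B: "(0, 1) \<in> (Basis :: ('a \<times> real) set)" "b \<in> Basis ==> (b, 0) \<in> (Basis :: ('a \<times> real) set)" for b by (auto simp: Basis_prod_def)
 define \<psi>t where "\<psi>t = pderiv_dir (0, 1) \<psi>"
 have t\<psi>t: "\<psi>t \<in> test_functions ?Q" unfolding \<psi>t_def by (rule test_pderiv[OF \<psi> B(1)])
 have t\<psi>b: "pderiv_dir (b, 0) \<psi> \<in> test_functions ?Q" if "b \<in> Basis" for b by (rule test_pderiv[OF \<psi> B(2)[OF that]])
 have byp: "(LBINT z. ?R h z * pderiv_dir (0, 1) \<theta> z) = - (LBINT z. h z * \<theta> z)"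
  if h: "h \<in> cyl \<Omega> T" and \<theta>: "\<theta> \<in> test_functions ?Q" for h \<theta>
 proof (rule tprim_by_parts[OF h Omega_borel less_imp_le[OF T]])
  note \<theta>' = test_pderiv[OF \<theta> B(1)]
  show "((\<lambda>t. \<theta> (x, t)) has_real_derivative pderiv_dir (0, 1) \<theta> (x, t)) (at t)" for x t
   by (rule time_has_real_derivative[OF test_smooth[OF \<theta>]])
  show "\<theta> (x, T) = 0" for x by (rule test_outside[OF \<theta>]) simp
  show "continuous_on UNIV (pderiv_dir (0, 1) \<theta>)" by (rule smooth_continuous[OF test_smooth[OF \<theta>']])
  show "sq_int lborel \<theta>" "sq_int lborel (pderiv_dir (0, 1) \<theta>)" by (rule test_sq_int(1)[OF \<theta>], rule test_sq_int(1)[OF \<theta>'])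
 qed
 have inn: "L2_inner ?Q (tprim wU) h = (LBINT z. ?R wU z * h z)" if "h \<in> borel_measurable borel" "!!z. z \<notin> ?Q ==> h z = 0" for h
 proof -
  have "L2_inner ?Q (tprim wU) h = (LBINT z. tprim wU z * h z)"
   by (rule L2_inner_lborel[OF Q_borel tprim_borel[OF cylD(3)[OF wU_cyl]] that(1)]) (use that(2) in blast)
  also have "\<dots> = (LBINT z. ?R wU z * h z)"
   by (rule integral_cong_pw) (use that(2) in "auto simp: indicator_def")
  finally show ?thesis .
 qed
 have I: "integrable lborel (\<lambda>z. h z * \<theta> z)" if "h \<in> cyl \<Omega> T" "\<theta> \<in> test_functions ?Q" for h \<theta>
  by (rule sq_int_mult[OF cylD(1)[OF that(1)] test_sq_int(1)[OF that(2)]])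
 \<comment> \<open>The displacement is the primitive of the velocity, and \<open>\<partial>\<^sub>t\<psi>\<close> vanishes at \<open>T\<close>.\<close>
 have A: "L2_inner ?Q (tprim wU) (dtt \<psi>) = - (LBINT z. wU z * \<psi>t z)"
 proof -
  have d: "dtt \<psi> = pderiv_dir (0, 1) \<psi>t" unfolding dtt_def \<psi>t_def ..
  have m: "dtt \<psi> \<in> test_functions ?Q" unfolding d by (rule test_pderiv[OF t\<psi>t B(1)])
  have "L2_inner ?Q (tprim wU) (dtt \<psi>) = (LBINT z. ?R wU z * dtt \<psi> z)"
   by (rule inn[OF test_borel[OF m]]) (rule test_outside[OF m])
  then show ?thesis unfolding d byp[OF wU_cyl t\<psi>t] .
 qed
 \<comment> \<open>On almost every time slice the limit \<open>gU\<close> is the weak gradient of the displacement.\<close>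
 have Bb: "(LBINT z. ?R wU z * pderiv_dir (b, 0) (pderiv_dir (b, 0) \<psi>) z) = - (LBINT z. gU b z * pderiv_dir (b, 0) \<psi> z)"
  if b: "b \<in> Basis" for b
 proof -
  let ?\<theta> = "pderiv_dir (b, 0) \<psi>"
  note \<theta> = t\<psi>b[OF b] and \<theta>' = test_pderiv[OF t\<psi>b[OF b] B(2)[OF b]]
  have "(LBINT z. ?R wU z * pderiv_dir (b, 0) ?\<theta> z) = (LBINT t. (LBINT x. ?R wU (x, t) * pderiv_dir (b, 0) ?\<theta> (x, t)))"
   by (rule Fubini_xt(6)[OF I[OF Rc[OF wU_cyl] \<theta>'], symmetric])
  also have "\<dots> = (LBINT t. - (LBINT x. gU b (x, t) * ?\<theta> (x, t)))"
  proof (rule integral_cong_AE)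
   show "(\<lambda>t. (LBINT x. ?R wU (x, t) * pderiv_dir (b, 0) ?\<theta> (x, t))) \<in> borel_measurable lborel"
    by (rule borel_measurable_integrable[OF Fubini_xt(4)[OF I[OF Rc[OF wU_cyl] \<theta>']]])
   show "(\<lambda>t. - (LBINT x. gU b (x, t) * ?\<theta> (x, t))) \<in> borel_measurable lborel"
    by (rule borel_measurable_uminus[OF borel_measurable_integrable[OF Fubini_xt(4)[OF I[OF gU_cyl \<theta>]]]])
   show "AE t in lborel. (LBINT x. ?R wU (x, t) * pderiv_dir (b, 0) ?\<theta> (x, t)) = - (LBINT x. gU b (x, t) * ?\<theta> (x, t))"
    using limit_solution_bochner(1)
   proof eventually_elim
    case (elim t)
    show ?case
    proof (cases "t \<in> {0<..<T}")
     case True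
     define \<theta>s where "\<theta>s x = ?\<theta> (x, t)" for x
     have ts: "\<theta>s \<in> test_functions \<Omega>" unfolding \<theta>s_def[abs_def] by (rule test_slice[OF \<theta>])
     have ds: "pderiv_dir b \<theta>s x = pderiv_dir (b, 0) ?\<theta> (x, t)" for x
      unfolding \<theta>s_def[abs_def] by (rule pderiv_dir_slice[OF test_smooth[OF \<theta>]])
     have gb: "(\<Sum>c\<in>Basis. gU c (x, t) *\<^sub>R c) \<bullet> b = gU b (x, t)" for x
      using b by (simp add: inner_sum_left inner_Basis if_distrib cong: if_cong)
     have "(LBINT x. ?R wU (x, t) * pderiv_dir (b, 0) ?\<theta> (x, t)) = (LBINT x. tprim wU (x, t) * pderiv_dir b \<theta>s x)"
      unfolding ds by (rule integral_cong_pw) (use True test_outside[OF \<theta>'] in "auto simp: indicator_def")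
     also have "\<dots> = L2_inner \<Omega> (time_slice (tprim wU) t) (pderiv_dir b \<theta>s)"
      unfolding time_slice_def[abs_def]
      by (rule L2_inner_lborel[OF Omega_borel tprim_slice_borel[OF wU_cyl] test_borel[OF test_pderiv[OF ts b]], symmetric])
        (simp add: test_outside[OF test_pderiv[OF ts b]])
     also have "\<dots> = - L2_inner \<Omega> (\<lambda>x. gU b (x, t)) \<theta>s"
      using weak_gradient_eq[OF conjunct2[OF mp[OF elim True]] b ts] unfolding gb .
     also have "L2_inner \<Omega> (\<lambda>x. gU b (x, t)) \<theta>s = (LBINT x. gU b (x, t) * \<theta>s x)"
      by (rule L2_inner_lborel[OF Omega_borel cyl_slice_borel[OF gU_cyl] test_borel[OF ts]]) (simp add: test_outside[OF ts])
     finally show ?thesis unfolding \<theta>s_def .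
    next
     case False
     then show ?thesis by (simp add: cylD(2)[OF gU_cyl])
    qed
   qed
  qed
  also have "\<dots> = - (LBINT t. (LBINT x. gU b (x, t) * ?\<theta> (x, t)))" by simp
  also have "\<dots> = - (LBINT z. gU b z * ?\<theta> z)" by (simp only: Fubini_xt(6)[OF I[OF gU_cyl \<theta>]])
  finally show ?thesis .
 qed
 have L: "L2_inner ?Q (tprim wU) (laplace_x \<psi>) = - (\<Sum>b\<in>Basis. (LBINT z. gU b z * pderiv_dir (b, 0) \<psi> z))"
 proof -
  have bb: "pderiv_dir (b, 0) (pderiv_dir (b, 0) \<psi>) \<in> test_functions ?Q" if "b \<in> Basis" for b
   by (rule test_pderiv[OF t\<psi>b[OF that] B(2)[OF that]])
  have "L2_inner ?Q (tprim wU) (laplace_x \<psi>) = (LBINT z. ?R wU z * laplace_x \<psi> z)"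
   unfolding laplace_x_def[abs_def] by (rule inn) (use test_borel[OF bb] test_outside[OF bb] in "auto intro!: sum.neutral borel_measurable_sum")
  also have "\<dots> = (LBINT z. (\<Sum>b\<in>Basis. ?R wU z * pderiv_dir (b, 0) (pderiv_dir (b, 0) \<psi>) z))"
   unfolding laplace_x_def sum_distrib_left ..
  also have "\<dots> = (\<Sum>b\<in>Basis. (LBINT z. ?R wU z * pderiv_dir (b, 0) (pderiv_dir (b, 0) \<psi>) z))"
   by (rule Bochner_Integration.integral_sum) (rule I[OF Rc[OF wU_cyl] bb])
  also have "\<dots> = (\<Sum>b\<in>Basis. - (LBINT z. gU b z * pderiv_dir (b, 0) \<psi> z))" by (rule sum.cong[OF refl Bb])
  finally show ?thesis by (simp add: sum_negf)
 qed
 \<comment> \<open>The flux identity with \<open>\<partial>\<^sub>t\<psi>\<close> at a fixed time as test function, then integrated over time.\<close>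
 have C: "(LBINT z. wU z * \<psi>t z) = - (LBINT z. f z * \<psi> z) + (\<Sum>b\<in>Basis. (LBINT z. gU b z * pderiv_dir (b, 0) \<psi> z))"
 proof -
  have t\<psi>bt: "pderiv_dir (b, 0) \<psi>t \<in> test_functions ?Q" if "b \<in> Basis" for b by (rule test_pderiv[OF t\<psi>t B(2)[OF that]])
  let ?J = "\<lambda>h \<theta> t. (LBINT x. h (x, t) * \<theta> (x, t))"
  note If = I[OF Rc[OF f] t\<psi>t] and Ig = I[OF Rc[OF gU_cyl] t\<psi>bt] and Iw = I[OF wU_cyl t\<psi>t]
  have "(LBINT z. wU z * \<psi>t z) = (LBINT t. ?J wU \<psi>t t)" by (rule Fubini_xt(6)[OF Iw, symmetric])
  also have "\<dots> = (LBINT t. ?J (?R f) \<psi>t t - (\<Sum>b\<in>Basis. ?J (?R (gU b)) (pderiv_dir (b, 0) \<psi>t) t))"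
  proof (rule integral_cong_AE)
   show "?J wU \<psi>t \<in> borel_measurable lborel" by (rule borel_measurable_integrable[OF Fubini_xt(4)[OF Iw]])
   show "(\<lambda>t. ?J (?R f) \<psi>t t - (\<Sum>b\<in>Basis. ?J (?R (gU b)) (pderiv_dir (b, 0) \<psi>t) t)) \<in> borel_measurable lborel"
    by (intro borel_measurable_diff borel_measurable_sum borel_measurable_integrable[OF Fubini_xt(4)] If Ig)
   show "AE t in lborel. ?J wU \<psi>t t = ?J (?R f) \<psi>t t - (\<Sum>b\<in>Basis. ?J (?R (gU b)) (pderiv_dir (b, 0) \<psi>t) t)"
    using limit_solution_flux
   proof eventually_elim
    case (elim t)
    show ?case
    proof (cases "t \<in> {0<..<T}")
     case True
     define \<xi> where "\<xi> x = \<psi>t (x, t)" for x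
     have ts: "\<xi> \<in> test_functions \<Omega>" unfolding \<xi>_def[abs_def] by (rule test_slice[OF t\<psi>t])
     have ds: "pderiv_dir b \<xi> x = pderiv_dir (b, 0) \<psi>t (x, t)" for x b
      unfolding \<xi>_def[abs_def] by (rule pderiv_dir_slice[OF test_smooth[OF t\<psi>t]])
     have t0: "0 <= t" using True by simp
     have R: "?J (?R h) \<theta> t = (LBINT x. tprim h (x, t) * \<theta> (x, t))" if "\<theta> \<in> test_functions ?Q" for h \<theta>
      by (rule integral_cong_pw) (use True test_outside[OF that] in "auto simp: indicator_def")
     have "?J wU \<psi>t t = L2_inner \<Omega> (\<lambda>x. wU (x, t)) \<xi>"
      unfolding \<xi>_def[symmetric]
      by (rule L2_inner_lborel[OF Omega_borel cyl_slice_borel[OF wU_cyl] test_borel[OF ts], symmetric]) (simp add: test_outside[OF ts])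
     also have "\<dots> = flux \<Omega> f gU t \<xi>" by (rule bspec[OF mp[OF elim True] test_H10[OF \<Omega>(1) ts]])
     also have "\<dots> = (LBINT x. tprim f (x, t) * \<psi>t (x, t)) - (\<Sum>b\<in>Basis. (LBINT x. tprim (gU b) (x, t) * pderiv_dir (b, 0) \<psi>t (x, t)))"
      unfolding flux_test[OF \<Omega>(1) f gU_cyl t0 ts] ds \<xi>_def ..
     also have "\<dots> = ?J (?R f) \<psi>t t - (\<Sum>b\<in>Basis. ?J (?R (gU b)) (pderiv_dir (b, 0) \<psi>t) t)"
      unfolding R[OF t\<psi>t] by (intro arg_cong2[of _ _ _ _ "(-)"] refl sum.cong R[OF t\<psi>bt, symmetric])
     finally show ?thesis .
    next
     case False
     then show ?thesis by (simp add: cylD(2)[OF wU_cyl])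
    qed
   qed
  qed
  also have "\<dots> = (LBINT t. ?J (?R f) \<psi>t t) - (LBINT t. (\<Sum>b\<in>Basis. ?J (?R (gU b)) (pderiv_dir (b, 0) \<psi>t) t))"
   by (rule Bochner_Integration.integral_diff[OF Fubini_xt(4)[OF If] Bochner_Integration.integrable_sum[OF Fubini_xt(4)[OF Ig]]])
  also have "(LBINT t. (\<Sum>b\<in>Basis. ?J (?R (gU b)) (pderiv_dir (b, 0) \<psi>t) t)) = (\<Sum>b\<in>Basis. (LBINT t. ?J (?R (gU b)) (pderiv_dir (b, 0) \<psi>t) t))"
   by (rule Bochner_Integration.integral_sum[OF Fubini_xt(4)[OF Ig]])
  also have "(LBINT t. ?J (?R f) \<psi>t t) = - (LBINT z. f z * \<psi> z)"
   unfolding Fubini_xt(6)[OF If] unfolding \<psi>t_def by (rule byp[OF f \<psi>])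
  also have "(\<Sum>b\<in>Basis. (LBINT t. ?J (?R (gU b)) (pderiv_dir (b, 0) \<psi>t) t)) = (\<Sum>b\<in>Basis. - (LBINT z. gU b z * pderiv_dir (b, 0) \<psi> z))"
  proof (rule sum.cong[OF refl])
   fix b :: 'a assume b: "b \<in> Basis"
   have "pderiv_dir (b, 0) \<psi>t z = pderiv_dir (0, 1) (pderiv_dir (b, 0) \<psi>) z" for z
    unfolding \<psi>t_def by (rule pderiv_dir_commute[OF test_smooth[OF \<psi>] B(1) B(2)[OF b]])
   then show "(LBINT t. ?J (?R (gU b)) (pderiv_dir (b, 0) \<psi>t) t) = - (LBINT z. gU b z * pderiv_dir (b, 0) \<psi> z)"
    unfolding Fubini_xt(6)[OF Ig[OF b]] using byp[OF gU_cyl t\<psi>b[OF b], of b] by simp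
  qed
  finally show ?thesis by (simp add: sum_negf)
 qed
 have "L2_inner ?Q f \<psi> = (LBINT z. f z * \<psi> z)"
  by (rule L2_inner_lborel[OF Q_borel cylD(3)[OF f] test_borel[OF \<psi>]]) (simp add: test_outside[OF \<psi>])
 then show "L2_inner ?Q (tprim wU) (dtt \<psi>) - L2_inner ?Q (tprim wU) (laplace_x \<psi>) = L2_inner ?Q f \<psi>"
  unfolding A L C by simp
qed

text \<open>The flux is the continuous representative of the velocity in the dual of
 \<open>H\<^sup>1\<^sub>0\<close>, and it vanishes at time \<open>0\<close>.\<close>

theorem (in limit_equation) limit_solution_wave_space:
 shows "tprim wU \<in> wave_space \<Omega> T"
proof -
 note N = limit_solution_bochner(2-4)
 have "tprim wU \<in> L2 (cylinder \<Omega> T)"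
 proof -
  have "sq_int (lebesgue_on (cylinder \<Omega> T)) (\<lambda>z. indicator (cylinder \<Omega> T) z * tprim wU z)"
   by (rule sq_int_lebesgue_on[OF cylD(1)[OF tprim_cyl[OF wU_cyl Omega_borel less_imp_le[OF T]]] Q_borel])
  then show ?thesis unfolding L2_iff
   by (rule sq_int_cong_AE) (use borel_on[OF tprim_borel[OF cylD(3)[OF wU_cyl]]] AE_on_iff[OF Q_borel] in "auto simp: indicator_def")
 qed
 then have 1: "tprim wU \<in> H11_00 \<Omega> T" unfolding H11_00_def using primitive_H1_time_0[OF \<Omega>(1) T wU_cyl N(3,2)] N(1) by blast
 have "zero_initial_velocity \<Omega> T (tprim wU)"
  unfolding zero_initial_velocity_def
 proof (intro exI conjI)
  show "has_weak_time_deriv \<Omega> T (time_slice (tprim wU)) (time_slice wU)" by (rule primitive_weak_time_deriv[OF \<Omega>(1) T wU_cyl N(3)])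
  show "continuous_into (dual_space (H10 \<Omega>) (H1_norm \<Omega>)) (dual_norm (H10 \<Omega>) (H1_norm \<Omega>)) {0..T} (flux \<Omega> f gU)"
   by (rule flux_continuous_into_dual[OF \<Omega>(1) f gU_cyl])
   show "AE t in lebesgue_on {0<..<T}. \<forall>\<psi>\<in>H10 \<Omega>. flux \<Omega> f gU t \<psi> = L2_inner \<Omega> (time_slice wU t) \<psi>"
   unfolding AE_on_iff[OF I_borel] time_slice_def[abs_def]
   using limit_solution_flux by eventually_elim simp
  show "\<forall>\<psi>\<in>H10 \<Omega>. flux \<Omega> f gU 0 \<psi> = 0" by (simp add: flux_def L2_inner_def)
 qed
 then show ?thesis using 1 limit_solution_has_box unfolding wave_space_def by blast
qed

section \<open>Existence and the inf-sup condition\<close>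

theorem wave_equation_solvable:
 fixes \<Omega> :: "'a::euclidean_space set"
 assumes \<Omega>: "open \<Omega>" "bounded \<Omega>" and T: "0 < T" and f: "f \<in> L2 (cylinder \<Omega> T)"
 shows "\<exists>u\<in>wave_space \<Omega> T. has_box (cylinder \<Omega> T) u f"
proof -
 have Qb: "cylinder \<Omega> T \<in> sets borel" by (rule cylinder_borel[OF \<Omega>(1)])
 obtain f0 where f0: "sq_int lborel f0" "!!z. z \<notin> cylinder \<Omega> T ==> f0 z = 0" "AE z in lebesgue_on (cylinder \<Omega> T). f z = f0 z"
  using L2_rep[OF Qb f] by blast
 have fc: "f0 \<in> cyl \<Omega> T" unfolding cyl_def using f0 by blast
 obtain U where U: "limit_solution \<Omega> T f0 U" using limit_solution_exists[OF \<Omega>(1) T f0(1)] by blast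
 interpret eq: limit_equation \<Omega> T f0 U by unfold_locales (fact \<Omega> T fc U)+
 have box: "has_box (cylinder \<Omega> T) (tprim (velocity \<Omega> T U)) f0" by (rule eq.limit_solution_has_box)
 have "L2_inner (cylinder \<Omega> T) f \<phi> = L2_inner (cylinder \<Omega> T) f0 \<phi>" if \<phi>: "\<phi> \<in> test_functions (cylinder \<Omega> T)" for \<phi>
  by (rule L2_inner_cong_AE) (use L2_measurable[OF f] sq_int_measurable[OF f0(1)] f0(3) test_borel[OF \<phi>] in "auto intro!: borel_on")
 then have "has_box (cylinder \<Omega> T) (tprim (velocity \<Omega> T U)) f" using box f unfolding has_box_def by simp
 then show ?thesis using eq.limit_solution_wave_space by blast
qed

lemma wave_op_AE:
 assumes Q: "open Q" and g: "has_box Q v g"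
 shows "has_box Q v (wave_op Q v)" "eq_ae Q (wave_op Q v) g"
proof -
 show w: "has_box Q v (wave_op Q v)" unfolding wave_op_def by (rule someI[of "has_box Q v", OF g])
 show "eq_ae Q (wave_op Q v) g" unfolding eq_ae_def
  by (rule L2_inner_eq_imp_AE_eq[OF Q]) (use w g in "auto simp: has_box_def")
qed

lemma L2_norm_positive:
 assumes w: "w \<in> L2 Q" "\<not> eq_ae Q w (\<lambda>z. 0)" shows "0 < L2_norm Q w"
proof -
 have "L2_norm Q w \<noteq> 0" using l2n_eq_0[of "lebesgue_on Q" w] w unfolding L2_norm_eq L2_iff eq_ae_def by blast
 then show ?thesis using L2_norm_nonneg[of Q w] by linarith
qed

lemma L2_inner_self: "L2_inner Q f f = (L2_norm Q f)\<^sup>2"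
 by (simp add: L2_norm_def L2_inner_def)

lemma nonzero_L2:
 fixes Q :: "'a::euclidean_space set"
 assumes Q: "open Q" "Q \<noteq> {}"
 obtains w where "w \<in> L2 Q" "\<not> eq_ae Q w (\<lambda>z. 0)"
proof -
 obtain p where p: "p \<in> Q" using Q(2) by blast
 obtain a c where ac: "p \<in> box a c" "cbox a c \<subseteq> Q" using open_contains_cbox[OF Q(1) p] by metis
 have "\<not> eq_ae Q (box_bump a c 0) (\<lambda>z. 0)"
 proof
  assume "eq_ae Q (box_bump a c 0) (\<lambda>z. 0)"
  then have "AE z in lborel. z \<in> Q --> box_bump a c 0 z = 0" unfolding eq_ae_def AE_on_iff[OF borel_open[OF Q(1)]] .
  then have "AE z in lborel. z \<notin> box a c"
   by eventually_elim (use box_bump_pos_iff[of a c 0] ac(2) box_subset_cbox[of a c] in blast)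
  then have "box a c \<in> null_sets lborel" by (subst AE_iff_null_sets) auto
  then show False using open_not_negligible[of "box a c"] ac(1) by (auto simp: negligible_iff_null_sets null_sets_completionI)
 qed
 then show thesis using that[OF test_L2[OF box_bump_test[OF ac(2)] Q(1)]] by blast
qed

text \<open>Cauchy-Schwarz, with equality at \<open>w = g\<close> unless \<open>g\<close> vanishes; then any
 nonzero \<open>w\<close> attains the supremum \<open>0\<close>.\<close>

lemma sup_L2_quotient:
 fixes Q :: "'a::euclidean_space set"
 assumes Q: "open Q" "Q \<noteq> {}" and g: "g \<in> L2 Q"
 shows "(SUP w\<in>{w \<in> L2 Q. \<not> eq_ae Q w (\<lambda>z. 0)}. \<bar>L2_inner Q g w\<bar> / L2_norm Q w) = L2_norm Q g"
proof (rule antisym)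
 let ?W = "{w \<in> L2 Q. \<not> eq_ae Q w (\<lambda>z. 0)}"
 obtain w where w: "w \<in> ?W" using nonzero_L2[OF Q] by blast
 have le: "\<bar>L2_inner Q g w\<bar> / L2_norm Q w <= L2_norm Q g" if "w \<in> ?W" for w
  using L2_Cauchy_Schwarz[OF g, of w] L2_norm_positive[of w Q] that by (simp add: divide_le_eq)
 show "(SUP w\<in>?W. \<bar>L2_inner Q g w\<bar> / L2_norm Q w) <= L2_norm Q g" by (rule cSUP_least) (use w le in blast)+
 have bdd: "bdd_above ((\<lambda>w. \<bar>L2_inner Q g w\<bar> / L2_norm Q w) ` ?W)" using le by (intro bdd_aboveI[of _ "L2_norm Q g"]) blast
 show "L2_norm Q g <= (SUP w\<in>?W. \<bar>L2_inner Q g w\<bar> / L2_norm Q w)"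
 proof (cases "eq_ae Q g (\<lambda>z. 0)")
  case True
  have "L2_norm Q g = L2_norm Q (\<lambda>z. 0)" unfolding L2_norm_eq
   by (rule l2n_cong_AE) (use True L2_measurable[OF g] in "auto simp: eq_ae_def")
  also have "\<dots> = 0" by (simp add: L2_norm_def L2_inner_def)
  also have "0 <= \<bar>L2_inner Q g w\<bar> / L2_norm Q w" by simp
  also have "\<dots> <= (SUP w\<in>?W. \<bar>L2_inner Q g w\<bar> / L2_norm Q w)" by (rule cSUP_upper[OF w bdd])
  finally show ?thesis .
 next
  case False
  then have gW: "g \<in> ?W" using g by blast
  have "L2_norm Q g = \<bar>L2_inner Q g g\<bar> / L2_norm Q g"
   using L2_norm_positive[OF g False] by (simp add: L2_inner_self power2_eq_square)
  also have "\<dots> <= (SUP w\<in>?W. \<bar>L2_inner Q g w\<bar> / L2_norm Q w)" by (rule cSUP_upper[OF gW bdd])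
  finally show ?thesis .
 qed
qed

theorem theorem3:
  fixes \<Omega> :: "(real ^ 'n) set" and T :: real
  assumes "CARD('n) \<in> {1, 2, 3}"
    and "bounded_lipschitz_domain \<Omega>"
    and "0 < T"
  shows
    "(\<forall>v\<in>wave_space \<Omega> T. \<forall>w\<in>L2 (cylinder \<Omega> T).
        \<bar>wave_form \<Omega> T v w\<bar>
          \<le> L2_norm (cylinder \<Omega> T) (wave_op (cylinder \<Omega> T) v) * L2_norm (cylinder \<Omega> T) w) \<and>
     (\<forall>v\<in>wave_space \<Omega> T.
        (SUP w\<in>{w \<in> L2 (cylinder \<Omega> T). \<not> eq_ae (cylinder \<Omega> T) w (\<lambda>z. 0)}.
           \<bar>wave_form \<Omega> T v w\<bar> / L2_norm (cylinder \<Omega> T) w)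
        = L2_norm (cylinder \<Omega> T) (wave_op (cylinder \<Omega> T) v)) \<and>
     (\<forall>w\<in>L2 (cylinder \<Omega> T). \<not> eq_ae (cylinder \<Omega> T) w (\<lambda>z. 0) \<longrightarrow>
        (\<exists>v\<in>wave_space \<Omega> T. wave_form \<Omega> T v w \<noteq> 0)) \<and>
     (\<forall>f\<in>L2 (cylinder \<Omega> T).
        \<exists>u. wave_solution \<Omega> T f u \<and>
            (\<forall>u'. wave_solution \<Omega> T f u' \<longrightarrow> eq_ae (cylinder \<Omega> T) u' u) \<and>
            L2_norm (cylinder \<Omega> T) (wave_op (cylinder \<Omega> T) u) = L2_norm (cylinder \<Omega> T) f)"
proof -
 let ?Q = "cylinder \<Omega> T"
 have \<Omega>: "open \<Omega>" "bounded \<Omega>" "\<Omega> \<noteq> {}" using assms(2) unfolding bounded_lipschitz_domain_def by blast+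
 note T = assms(3)
 have Q: "open ?Q" "?Q \<noteq> {}" using \<Omega>(1,3) T by (auto intro: open_Times)
 have op: "has_box ?Q v (wave_op ?Q v)" "wave_op ?Q v \<in> L2 ?Q" if "v \<in> wave_space \<Omega> T" for v
 proof -
  show "has_box ?Q v (wave_op ?Q v)" using that wave_op_AE(1)[OF Q(1)] unfolding wave_space_def by blast
  then show "wave_op ?Q v \<in> L2 ?Q" unfolding has_box_def by blast
 qed
 have form: "wave_form \<Omega> T v w = L2_inner ?Q g w" and norm: "L2_norm ?Q (wave_op ?Q v) = L2_norm ?Q g"
  if "eq_ae ?Q (wave_op ?Q v) g" "wave_op ?Q v \<in> L2 ?Q" "g \<in> L2 ?Q" "w \<in> L2 ?Q" for v g w
 proof -
  show "wave_form \<Omega> T v w = L2_inner ?Q g w" unfolding wave_form_def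
   by (rule L2_inner_cong_AE) (use that in "auto simp: eq_ae_def dest: L2_measurable")
  show "L2_norm ?Q (wave_op ?Q v) = L2_norm ?Q g" unfolding L2_norm_eq
   by (rule l2n_cong_AE) (use that in "auto simp: eq_ae_def dest: L2_measurable")
 qed
 have sol: "\<exists>u\<in>wave_space \<Omega> T. eq_ae ?Q (wave_op ?Q u) f" if f: "f \<in> L2 ?Q" for f
  using wave_equation_solvable[OF \<Omega>(1,2) T f] wave_op_AE(2)[OF Q(1)] by blast
 have 1: "\<bar>wave_form \<Omega> T v w\<bar> <= L2_norm ?Q (wave_op ?Q v) * L2_norm ?Q w" if "v \<in> wave_space \<Omega> T" "w \<in> L2 ?Q" for v w
  unfolding wave_form_def by (rule L2_Cauchy_Schwarz[OF op(2)[OF that(1)] that(2)])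
 have 2: "(SUP w\<in>{w \<in> L2 ?Q. \<not> eq_ae ?Q w (\<lambda>z. 0)}. \<bar>wave_form \<Omega> T v w\<bar> / L2_norm ?Q w) = L2_norm ?Q (wave_op ?Q v)"
  if "v \<in> wave_space \<Omega> T" for v
  unfolding wave_form_def by (rule sup_L2_quotient[OF Q op(2)[OF that]])
 have 3: "\<exists>v\<in>wave_space \<Omega> T. wave_form \<Omega> T v w \<noteq> 0" if w: "w \<in> L2 ?Q" "\<not> eq_ae ?Q w (\<lambda>z. 0)" for w
 proof -
  obtain v where v: "v \<in> wave_space \<Omega> T" "eq_ae ?Q (wave_op ?Q v) w" using sol[OF w(1)] by blast
  have "wave_form \<Omega> T v w = (L2_norm ?Q w)\<^sup>2" using form[OF v(2) op(2)[OF v(1)] w(1) w(1)] by (simp only: L2_inner_self)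
  then show ?thesis using v(1) L2_norm_positive[OF w] by (intro bexI[of _ v]) auto
 qed
 have 4: "\<exists>u. wave_solution \<Omega> T f u & (\<forall>u'. wave_solution \<Omega> T f u' --> eq_ae ?Q u' u) \<and>
   L2_norm ?Q (wave_op ?Q u) = L2_norm ?Q f" if f: "f \<in> L2 ?Q" for f
 proof -
  obtain u where u: "u \<in> wave_space \<Omega> T" "eq_ae ?Q (wave_op ?Q u) f" using sol[OF f] by blast
  have "wave_solution \<Omega> T f u" unfolding wave_solution_def using u(1) form[OF u(2) op(2)[OF u(1)] f] by blast
  moreover have "eq_ae ?Q u' u" if u': "wave_solution \<Omega> T f u'" for u'
  proof -
   have v: "u' \<in> wave_space \<Omega> T" and eq: "!!w. w \<in> L2 ?Q ==> L2_inner ?Q (wave_op ?Q u') w = L2_inner ?Q f w"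
    using u' unfolding wave_solution_def wave_form_def by blast+
   have "eq_ae ?Q (wave_op ?Q u') f" unfolding eq_ae_def
    by (rule L2_inner_eq_imp_AE_eq[OF Q(1) op(2)[OF v] f]) (rule eq[OF test_L2[OF _ Q(1)]])
   then show ?thesis using wave_space_unique[OF \<Omega>(1) T v op(1)[OF v] u(1) op(1)[OF u(1)]] u(2) eq_ae_sym eq_ae_trans by blast
  qed
  ultimately show ?thesis using norm[OF u(2) op(2)[OF u(1)] f f] by blast
 qed
 show ?thesis using 1 2 3 4 by blast
qed

end
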